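(* Let $n\ge 2$ and equip $\mathbb R^{2n}$ with coordinates $(p_1,q_1,\dots,p_n,q_n)$ and the symplectic form $\sum_{i=1}^n dp_i\wedge dq_i$. If $n\ge 3$ (respectively $n=2$), any (germ at $0$ of a) subset of $\mathbb R^{2n}$ diffeomorphic to $U_7$ is symplectically equivalent to one and only one of the normal forms $U_7^i$, $i=0,1,\dots,7$ (respectively $i=0,1,2$), listed below. The real parameters $c,c_1,c_2$ of the normal forms are moduli. - $U_7^0$: $p_1^2+p_2q_1=0,\ p_1p_2+q_1^3=0,\ q_2=c_1q_1+c_2p_1,\ p_{\ge3}=q_{\ge3}=0$; - $U_7^1$: $p_2^2\pm p_1q_1=0,\ p_1p_2\pm q_1^3=0,\ q_2=c_1p_1+\frac{c_2}{2}q_1^2,\ p_{\ge3}=q_{\ge3}=0$; - $U_7^2$: $p_1^2+q_1q_2=0,\ p_1q_1+q_2^3=0,\ p_2=c_1p_1q_2+\frac{c_2}{2}p_1^2,\ p_{\ge3}=q_{\ge3}=0$; - $U_7^3$: $p_1^2+p_2p_3=0,\ p_1p_2+p_3^3=0,\ q_1=c\,p_1p_3,\ q_2=0,\ q_3=\pm p_1p_3,\ p_{\ge4}=q_{\ge4}=0$; - $U_7^4$: $p_1^2+p_2p_3=0,\ p_1p_2+p_3^3=0,\ q_1=\frac{c}{3}p_3^3,\ q_2=0,\ q_3=-\frac12p_1^2,\ p_{\ge4}=q_{\ge4}=0$; - $U_7^5$: $p_1^2+p_2p_3=0,\ p_1p_2+p_3^3=0,\ q_1=-\frac{c}{2}p_1p_3^2,\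 q_2=0,\ q_3=-p_1p_3^2,\ p_{\ge4}=q_{\ge4}=0$; - $U_7^6$: $p_1^2+p_2p_3=0,\ p_1p_2+p_3^3=0,\ q_1=0,\ q_2=0,\ q_3=\mp\frac12p_1^2p_3,\ p_{\ge4}=q_{\ge4}=0$; - $U_7^7$: $p_1^2+p_2p_3=0,\ p_1p_2+p_3^3=0,\ q_{\ge1}=p_{\ge4}=0$.
   Context: $U_7=\{x\in\mathbb R^{2n}: x_1^2+x_2x_3=x_1x_2+x_3^3=x_{\ge4}=0\}$, $2n\ge 4$, where $x_{\ge k}=0$ means $x_j=0$ for all $j\ge k$ (similarly $p_{\ge k}$, $q_{\ge k}$). All sets are considered as germs at $0$. A germ is diffeomorphic to $U_7$ if it is the image of $U_7$ under a germ of a diffeomorphism of $\mathbb R^{2n}$. Two germs $N_1,N_2$ of subsets of a symplectic space $(\mathbb R^{2n},\omega)$ are symplectically equivalent if there is a germ of a symplectomorphism $\Phi$ (diffeomorphism with $\Phi^*\omega=\omega$) such that $\Phi(N_1)=N_2$. In each normal form, $U_7^i$ denotes the family obtained by varying the parameters and the sign; "one and only one" refers to the index $i$. Parameters are moduli in the usual sense of singularity theory: they are independent continuous invariants, i.e. no nonconstant smooth path of parameter values (within one normal form) consists of mutually equivalent members. *)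

theory Defs
  imports "HOL-Analysis.Analysis"
begin

(* For open S, iterating the requirement over all directional derivatives
   gives exactly the usual class C^k(S). *)
primrec Ck_on ::
  "nat \<Rightarrow> 'a::euclidean_space set \<Rightarrow> ('a \<Rightarrow> 'b::real_normed_vector) \<Rightarrow> bool" where
  "Ck_on 0 S f \<longleftrightarrow> continuous_on S f"
| "Ck_on (Suc k) S f \<longleftrightarrow>
     (\<forall>x\<in>S. f differentiable (at x)) \<and>
     (\<forall>v. Ck_on k S (\<lambda>x. frechet_derivative f (at x) v))"

definition smooth_on ::
  "'a::euclidean_space set \<Rightarrow> ('a \<Rightarrow> 'b::real_normed_vector) \<Rightarrow> bool" where
  "smooth_on S f \<longleftrightarrow> (\<forall>k. Ck_on k S f)"

definition same_germ :: "'a::{topological_space,zero} set \<Rightarrow> 'a set \<Rightarrow> bool" where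
  "same_germ A B \<longleftrightarrow> (\<exists>W. open W \<and> 0 \<in> W \<and> A \<inter> W = B \<inter> W)"

(* The restriction of f to U represents a diffeomorphism germ (E,0) \<rightarrow> (E,0). *)
definition diffeo_rep :: "'a::euclidean_space set \<Rightarrow> ('a \<Rightarrow> 'a) \<Rightarrow> bool" where
  "diffeo_rep U f \<longleftrightarrow> open U \<and> 0 \<in> U \<and> f 0 = 0 \<and> inj_on f U \<and> open (f ` U) \<and>
     smooth_on U f \<and> smooth_on (f ` U) (inv_into U f)"

definition diffeomorphic_germs :: "'a::euclidean_space set \<Rightarrow> 'a set \<Rightarrow> bool" where
  "diffeomorphic_germs M N \<longleftrightarrow> (\<exists>U f. diffeo_rep U f \<and> same_germ (f ` (M \<inter> U)) N)"

(* Throughout, e enumerates the 2n coordinates of the ambient space by 1,...,2n.  The linear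
   coordinates x_1,...,x_{2n} are written as (p_1,q_1,...,p_n,q_n). *)
abbreviation X :: "(nat \<Rightarrow> 'm) \<Rightarrow> real^'m \<Rightarrow> nat \<Rightarrow> real" where
  "X e v k \<equiv> v $ e k"

abbreviation P :: "(nat \<Rightarrow> 'm) \<Rightarrow> real^'m \<Rightarrow> nat \<Rightarrow> real" where
  "P e v i \<equiv> X e v (2 * i - 1)"

abbreviation Q :: "(nat \<Rightarrow> 'm) \<Rightarrow> real^'m \<Rightarrow> nat \<Rightarrow> real" where
  "Q e v i \<equiv> X e v (2 * i)"

definition omega :: "(nat \<Rightarrow> 'm) \<Rightarrow> nat \<Rightarrow> real^'m \<Rightarrow> real^'m \<Rightarrow> real" where
  "omega e n v w = (\<Sum>i=1..n. P e v i * Q e w i - Q e v i * P e w i)"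

definition symplecto_rep ::
  "(nat \<Rightarrow> 'm::finite) \<Rightarrow> nat \<Rightarrow> (real^'m) set \<Rightarrow> (real^'m \<Rightarrow> real^'m) \<Rightarrow> bool" where
  "symplecto_rep e n U f \<longleftrightarrow> diffeo_rep U f \<and>
     (\<forall>x\<in>U. \<forall>v w. omega e n (frechet_derivative f (at x) v) (frechet_derivative f (at x) w)
                    = omega e n v w)"

definition symp_equiv ::
  "(nat \<Rightarrow> 'm::finite) \<Rightarrow> nat \<Rightarrow> (real^'m) set \<Rightarrow> (real^'m) set \<Rightarrow> bool" where
  "symp_equiv e n M N \<longleftrightarrow> (\<exists>U f. symplecto_rep e n U f \<and> same_germ (f ` (M \<inter> U)) N)"

definition U7 :: "(nat \<Rightarrow> 'm::finite) \<Rightarrow> nat \<Rightarrow> (real^'m) set" where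
  "U7 e n = {v. (X e v 1)^2 + X e v 2 * X e v 3 = 0 \<and>
                X e v 1 * X e v 2 + (X e v 3)^3 = 0 \<and>
                (\<forall>j\<in>{4..2*n}. X e v j = 0)}"

definition P_vanish_from :: "(nat \<Rightarrow> 'm) \<Rightarrow> nat \<Rightarrow> nat \<Rightarrow> real^'m \<Rightarrow> bool" where
  "P_vanish_from e n k v \<longleftrightarrow> (\<forall>j\<in>{k..n}. P e v j = 0)"

definition Q_vanish_from :: "(nat \<Rightarrow> 'm) \<Rightarrow> nat \<Rightarrow> nat \<Rightarrow> real^'m \<Rightarrow> bool" where
  "Q_vanish_from e n k v \<longleftrightarrow> (\<forall>j\<in>{k..n}. Q e v j = 0)"

(* In the normal forms the argument s is the sign +1 or -1. *)

definition U7_nf0 :: "(nat \<Rightarrow> 'm::finite) \<Rightarrow> nat \<Rightarrow> real \<times> real \<Rightarrow> (real^'m) set" where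
  "U7_nf0 e n = (\<lambda>(c1, c2). {v.
     (P e v 1)^2 + P e v 2 * Q e v 1 = 0 \<and> P e v 1 * P e v 2 + (Q e v 1)^3 = 0 \<and>
     Q e v 2 = c1 * Q e v 1 + c2 * P e v 1 \<and>
     P_vanish_from e n 3 v \<and> Q_vanish_from e n 3 v})"

definition U7_nf1 :: "(nat \<Rightarrow> 'm::finite) \<Rightarrow> nat \<Rightarrow> real \<Rightarrow> real \<times> real \<Rightarrow> (real^'m) set" where
  "U7_nf1 e n s = (\<lambda>(c1, c2). {v.
     (P e v 2)^2 + s * (P e v 1 * Q e v 1) = 0 \<and> P e v 1 * P e v 2 + s * (Q e v 1)^3 = 0 \<and>
     Q e v 2 = c1 * P e v 1 + c2 / 2 * (Q e v 1)^2 \<and>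
     P_vanish_from e n 3 v \<and> Q_vanish_from e n 3 v})"

definition U7_nf2 :: "(nat \<Rightarrow> 'm::finite) \<Rightarrow> nat \<Rightarrow> real \<times> real \<Rightarrow> (real^'m) set" where
  "U7_nf2 e n = (\<lambda>(c1, c2). {v.
     (P e v 1)^2 + Q e v 1 * Q e v 2 = 0 \<and> P e v 1 * Q e v 1 + (Q e v 2)^3 = 0 \<and>
     P e v 2 = c1 * P e v 1 * Q e v 2 + c2 / 2 * (P e v 1)^2 \<and>
     P_vanish_from e n 3 v \<and> Q_vanish_from e n 3 v})"

definition U7_nf3 :: "(nat \<Rightarrow> 'm::finite) \<Rightarrow> nat \<Rightarrow> real \<Rightarrow> real \<Rightarrow> (real^'m) set" where
  "U7_nf3 e n s c = {v.
     (P e v 1)^2 + P e v 2 * P e v 3 = 0 \<and> P e v 1 * P e v 2 + (P e v 3)^3 = 0 \<and>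
     Q e v 1 = c * P e v 1 * P e v 3 \<and> Q e v 2 = 0 \<and> Q e v 3 = s * (P e v 1 * P e v 3) \<and>
     P_vanish_from e n 4 v \<and> Q_vanish_from e n 4 v}"

definition U7_nf4 :: "(nat \<Rightarrow> 'm::finite) \<Rightarrow> nat \<Rightarrow> real \<Rightarrow> (real^'m) set" where
  "U7_nf4 e n c = {v.
     (P e v 1)^2 + P e v 2 * P e v 3 = 0 \<and> P e v 1 * P e v 2 + (P e v 3)^3 = 0 \<and>
     Q e v 1 = c / 3 * (P e v 3)^3 \<and> Q e v 2 = 0 \<and> Q e v 3 = - (1 / 2) * (P e v 1)^2 \<and>
     P_vanish_from e n 4 v \<and> Q_vanish_from e n 4 v}"

definition U7_nf5 :: "(nat \<Rightarrow> 'm::finite) \<Rightarrow> nat \<Rightarrow> real \<Rightarrow> (real^'m) set" where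
  "U7_nf5 e n c = {v.
     (P e v 1)^2 + P e v 2 * P e v 3 = 0 \<and> P e v 1 * P e v 2 + (P e v 3)^3 = 0 \<and>
     Q e v 1 = - (c / 2) * P e v 1 * (P e v 3)^2 \<and> Q e v 2 = 0 \<and>
     Q e v 3 = - (P e v 1 * (P e v 3)^2) \<and>
     P_vanish_from e n 4 v \<and> Q_vanish_from e n 4 v}"

definition U7_nf6 :: "(nat \<Rightarrow> 'm::finite) \<Rightarrow> nat \<Rightarrow> real \<Rightarrow> (real^'m) set" where
  "U7_nf6 e n s = {v.
     (P e v 1)^2 + P e v 2 * P e v 3 = 0 \<and> P e v 1 * P e v 2 + (P e v 3)^3 = 0 \<and>
     Q e v 1 = 0 \<and> Q e v 2 = 0 \<and> Q e v 3 = - s * (1 / 2) * (P e v 1)^2 * P e v 3 \<and>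
     P_vanish_from e n 4 v \<and> Q_vanish_from e n 4 v}"

definition U7_nf7 :: "(nat \<Rightarrow> 'm::finite) \<Rightarrow> nat \<Rightarrow> (real^'m) set" where
  "U7_nf7 e n = {v.
     (P e v 1)^2 + P e v 2 * P e v 3 = 0 \<and> P e v 1 * P e v 2 + (P e v 3)^3 = 0 \<and>
     Q_vanish_from e n 1 v \<and> P_vanish_from e n 4 v}"

definition U7_family :: "(nat \<Rightarrow> 'm::finite) \<Rightarrow> nat \<Rightarrow> nat \<Rightarrow> (real^'m) set set" where
  "U7_family e n i =
     [range (U7_nf0 e n),
      (\<Union>s\<in>{1, -1}. range (U7_nf1 e n s)),
      range (U7_nf2 e n),
      (\<Union>s\<in>{1, -1}. range (U7_nf3 e n s)),
      range (U7_nf4 e n),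
      range (U7_nf5 e n),
      U7_nf6 e n ` {1, -1},
      {U7_nf7 e n}] ! i"

definition parameters_are_moduli ::
  "(nat \<Rightarrow> 'm::finite) \<Rightarrow> nat \<Rightarrow> ('c::euclidean_space \<Rightarrow> (real^'m) set) \<Rightarrow> bool" where
  "parameters_are_moduli e n F \<longleftrightarrow>
     (\<forall>\<gamma> :: real \<Rightarrow> 'c. smooth_on {0<..<1} \<gamma> \<longrightarrow>
        (\<forall>t\<in>{0<..<1}. \<forall>u\<in>{0<..<1}. symp_equiv e n (F (\<gamma> t)) (F (\<gamma> u))) \<longrightarrow>
        \<gamma> constant_on {0<..<1})"

end

theory Submission
  imports Defs "HOL-Library.Landau_Symbols"
begin

text \<open>
  Parametrise a germ diffeomorphic to \<open>U\<^sub>7\<close> by an immersion \<open>g\<close> of \<open>\<real>\<^sup>3\<close> restricted to the space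
  curve \<open>N\<close> given by \<open>x\<^sub>1\<^sup>2 + x\<^sub>2 x\<^sub>3 = x\<^sub>1 x\<^sub>2 + x\<^sub>3\<^sup>3 = 0\<close>, and pull back the Liouville form. Only its class modulo
  forms agreeing on \<open>N\<close> with an exact form matters: if two immersions give the same class, a
  symplectomorphism between their images is obtained from a generating function centred at the
  midpoint of the two immersions, after their differentials at \<open>0\<close> have been matched by Witt's theorem.

  The curve is quasi-homogeneous of weights \<open>4, 5, 3\<close>. Contracting with the weighted Euler field shows
  that the space of classes is spanned by seven forms, of quasi-degrees 7, 8, 9, 10, 11, 13, 14.
  The reparametrisations \<open>x \<mapsto> (\<lambda>\<^sup>4 x\<^sub>1, \<lambda>\<^sup>5 x\<^sub>2, \<lambda>\<^sup>3 x\<^sub>3)\<close> with \<open>\<lambda>\<close> a function preserve \<open>N\<close> and multiply a form of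
  quasi-degree \<open>k\<close> by \<open>\<lambda>\<^sup>k\<close>; constant \<open>\<lambda>\<close> normalises the first nonvanishing coefficient and
  \<open>\<lambda> = 1 + u m\<close> with a monomial \<open>m\<close> removes later ones.

  Conversely, comparing jets along the two branches of \<open>N\<close>, the \<open>x\<^sub>2\<close>-axis and the curve
  \<open>(t\<^sup>4, - t\<^sup>5, t\<^sup>3)\<close>, shows that every diffeomorphism preserving \<open>N\<close> has linear part
  \<open>diag (l\<^sup>4, l\<^sup>5, l\<^sup>3)\<close>, and that a symplectic equivalence of two normal forms
  multiplies their leading coefficient and parameters of quasi-degree \<open>k\<close> by \<open>l\<^sup>k\<close>. Hence the index is
  unique, and along a continuous path of equivalent normal forms the parameters are constant.
\<close>

section \<open>Calculus of smooth maps\<close>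

text \<open>The moduli come from a gap in the weights: nonconstant monomials have quasi-degrees 3,
  4, 5, ..., so a coefficient whose degree exceeds the leading one by 1 or 2 cannot be removed and
  becomes a parameter. Signs occur for the leading degrees 8, 10, 14, because an even power of a
  real scalar cannot change the sign of a coefficient. If the coefficients of degrees 7, 8, 9
  vanish, the tangent 3-space at 0 is isotropic, which needs 2n \<ge> 6; hence only three families
  occur for n = 2. The obstacle is that the class is known only along the curve, while a
  symplectomorphism lives on a neighbourhood. What helps is that a function vanishing on the curve
  has zero differential at 0. So the class still determines the symplectic form on the tangent
  3-space, which is what Witt's theorem needs, and afterwards the generating function has zero
  Hessian at 0, so that the maps built from it are invertible. The inverse function theorem thus
  takes the place of the flow of a vector field.\<close>

lemma Ck_on_cong:
  assumes "open S" "\<And>x. x \<in> S \<Longrightarrow> f x = g x" "Ck_on k S f"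
  shows "Ck_on k S g"
  using assms(2,3)
proof (induction k arbitrary: f g)
  case 0
  have "continuous_on S g"
    by (rule continuous_on_eq[of S f]) (use 0 in simp_all)
  then show ?case by (simp only: Ck_on.simps)
next
  case (Suc k)
  have d: "(g has_derivative frechet_derivative f (at x)) (at x)" if "x \<in> S" for x
  proof (rule has_derivative_transform_within_open[OF _ assms(1) that])
    show "(f has_derivative frechet_derivative f (at x)) (at x)"
      using Suc.prems(2) that by (simp flip: frechet_derivative_works)
  qed (use Suc.prems(1) in simp)
  have e: "frechet_derivative g (at x) = frechet_derivative f (at x)" if "x \<in> S" for x
    using frechet_derivative_at[OF d[OF that]] by simp
  have "Ck_on k S (\<lambda>x. frechet_derivative g (at x) v)" for v
    by (rule Suc.IH[of "\<lambda>x. frechet_derivative f (at x) v"]) (use e Suc.prems in simp_all)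
  then show ?case
    using d unfolding Ck_on.simps differentiable_def by blast
qed

text \<open>\<open>frechet_derivative\<close> is a choice operator; by uniqueness of derivatives an
  explicit formula may replace it. Most closure rules below rest on this.\<close>

lemma Ck_on_SucI:
  assumes "open S" "\<And>x. x \<in> S \<Longrightarrow> (f has_derivative f' x) (at x)"
    and "\<And>v. Ck_on k S (\<lambda>x. f' x v)"
  shows "Ck_on (Suc k) S f"
proof -
  have "frechet_derivative f (at x) = f' x" if "x \<in> S" for x
    using frechet_derivative_at[OF assms(2)[OF that]] by simp
  then have "Ck_on k S (\<lambda>x. frechet_derivative f (at x) v)" for v
    by (intro Ck_on_cong[OF assms(1) _ assms(3)[of v]]) auto
  then show ?thesis using assms(2) unfolding Ck_on.simps differentiable_def by blast
qed

lemma Ck_on_SucD: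
  "Ck_on (Suc k) S f \<Longrightarrow> x \<in> S \<Longrightarrow> (f has_derivative frechet_derivative f (at x)) (at x)"
  by (simp add: frechet_derivative_works)

lemma Ck_on_SucD2: "Ck_on (Suc k) S f \<Longrightarrow> Ck_on k S (\<lambda>x. frechet_derivative f (at x) v)"
  by simp

lemma Ck_on_imp_continuous: "Ck_on k S f \<Longrightarrow> continuous_on S f"
  by (cases k) (auto simp: continuous_at_imp_continuous_on differentiable_imp_continuous_within)

lemma Ck_on_down: "Ck_on (Suc k) S f \<Longrightarrow> Ck_on k S f"
proof (induction k arbitrary: f)
  case 0
  then show ?case using Ck_on_imp_continuous by (metis Ck_on.simps(1))
next
  case (Suc k)
  then show ?case by (metis Ck_on.simps(2))
qed

lemma Ck_on_subset: "Ck_on k S f \<Longrightarrow> T \<subseteq> S \<Longrightarrow> Ck_on k T f"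
  by (induction k arbitrary: f) (auto intro: continuous_on_subset)

lemma Ck_on_const: "open S \<Longrightarrow> Ck_on k S (\<lambda>x. c)"
proof (induction k arbitrary: c)
  case (Suc k)
  then show ?case by (intro Ck_on_SucI[where f'="\<lambda>x v. 0"]) auto
qed auto

lemma Ck_on_add:
  assumes "open S" shows "Ck_on k S f \<Longrightarrow> Ck_on k S g \<Longrightarrow> Ck_on k S (\<lambda>x. f x + g x)"
proof (induction k arbitrary: f g)
  case 0
  then show ?case by (auto intro: continuous_on_add)
next
  case (Suc k)
  show ?case
    by (rule Ck_on_SucI[OF assms has_derivative_add[OF Ck_on_SucD[OF Suc.prems(1)] Ck_on_SucD[OF Suc.prems(2)]]])
      (assumption | rule Suc.IH Ck_on_SucD2 Suc.prems)+
qed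

lemma Ck_on_linear:
  assumes "open S" "bounded_linear L" shows "Ck_on k S f \<Longrightarrow> Ck_on k S (\<lambda>x. L (f x))"
proof (induction k arbitrary: f)
  case 0
  then show ?case using bounded_linear.continuous_on[OF assms(2)] by auto
next
  case (Suc k)
  show ?case
    by (rule Ck_on_SucI[OF assms(1) bounded_linear.has_derivative[OF assms(2) Ck_on_SucD[OF Suc.prems]]])
      (assumption | rule Suc.IH Ck_on_SucD2 Suc.prems)+
qed

lemma Ck_on_bilinear:
  assumes "open S" "bounded_bilinear B"
  shows "Ck_on k S f \<Longrightarrow> Ck_on k S g \<Longrightarrow> Ck_on k S (\<lambda>x. B (f x) (g x))"
proof (induction k arbitrary: f g)
  case 0
  then show ?case using bounded_bilinear.continuous_on[OF assms(2)] by auto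
next
  case (Suc k)
  show ?case
    by (rule Ck_on_SucI[OF assms(1) bounded_bilinear.FDERIV[OF assms(2) Ck_on_SucD[OF Suc.prems(1)]
            Ck_on_SucD[OF Suc.prems(2)]]])
      (assumption | rule Suc.IH Ck_on_SucD2 Suc.prems Ck_on_add[OF assms(1)] Ck_on_down[OF Suc.prems(1)]
        Ck_on_down[OF Suc.prems(2)])+
qed

lemma Ck_on_sum:
  assumes "open S" "\<And>i. i \<in> I \<Longrightarrow> Ck_on k S (f i)"
  shows "Ck_on k S (\<lambda>x. \<Sum>i\<in>I. f i x)"
  using assms(2)
  by (induction I rule: infinite_finite_induct) (auto intro!: Ck_on_add Ck_on_const assms(1))

lemma Ck_on_compose:
  fixes f :: "'b::euclidean_space \<Rightarrow> 'c::real_normed_vector" and g :: "'a::euclidean_space \<Rightarrow> 'b"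
  assumes "open S" "open T"
  shows "Ck_on k T f \<Longrightarrow> Ck_on k S g \<Longrightarrow> g ` S \<subseteq> T \<Longrightarrow> Ck_on k S (\<lambda>x. f (g x))"
proof (induction k arbitrary: f g)
  case 0
  then show ?case using continuous_on_compose2[of T f S g] by auto
next
  case (Suc k)
  let ?f = "\<lambda>y. frechet_derivative f (at y)" and ?g = "\<lambda>x. frechet_derivative g (at x)"
  have lin: "linear (?f (g x))" if "x \<in> S" for x
    using Ck_on_SucD[OF Suc.prems(1)] Suc.prems(3) that
    by (intro has_derivative_linear[of f _ "at (g x)"]) auto
  \<comment> \<open>\<open>Ck_on\<close> differentiates in fixed directions, whereas the chain rule
    produces the moving direction \<open>?g x v\<close>. Expanding it in \<open>Basis\<close> leaves
    products to which the induction hypothesis applies.\<close>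
  have eq: "?f (g x) (?g x v) = (\<Sum>b\<in>Basis. (?g x v \<bullet> b) *\<^sub>R ?f (g x) b)" if "x \<in> S" for x v
    by (subst euclidean_representation[symmetric, of "?g x v"])
      (simp add: linear_sum[OF lin[OF that]] linear_cmul[OF lin[OF that]] del: euclidean_representation)
  have der: "((\<lambda>x. f (g x)) has_derivative (\<lambda>v. ?f (g x) (?g x v))) (at x)" if "x \<in> S" for x
    using Ck_on_SucD[OF Suc.prems(1)] Ck_on_SucD[OF Suc.prems(2)] Suc.prems(3) that
    by (intro has_derivative_compose[of g _ x UNIV f]) auto
  have "Ck_on k S (\<lambda>x. \<Sum>b\<in>Basis. (?g x v \<bullet> b) *\<^sub>R ?f (g x) b)" for v
  proof (rule Ck_on_sum[OF assms(1)])
    fix b :: 'b assume "b \<in> Basis"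
    show "Ck_on k S (\<lambda>x. (?g x v \<bullet> b) *\<^sub>R ?f (g x) b)"
      by (rule Ck_on_bilinear[OF assms(1) bounded_bilinear_scaleR]
          Ck_on_linear[OF assms(1) bounded_linear_inner_left] Suc.IH Ck_on_SucD2 Suc.prems Ck_on_down[OF Suc.prems(2)])+
  qed
  then show ?case
    by (intro Ck_on_SucI[OF assms(1) der]) (auto intro: Ck_on_cong[OF assms(1) eq[symmetric]])
qed

lemma Ck_on_inverse:
  fixes f :: "'a::euclidean_space \<Rightarrow> real"
  assumes "open S" "\<And>x. x \<in> S \<Longrightarrow> f x \<noteq> 0"
  shows "Ck_on k S f \<Longrightarrow> Ck_on k S (\<lambda>x. inverse (f x))"
proof (induction k)
  case 0
  then show ?case using assms by (auto intro: continuous_on_inverse)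
next
  case (Suc k)
  show ?case
    by (rule Ck_on_SucI[OF assms(1) Deriv.has_derivative_inverse[OF assms(2) Ck_on_SucD[OF Suc.prems]]])
      (assumption | rule Ck_on_linear[OF assms(1) bounded_linear_minus[OF bounded_linear_ident]]
        Ck_on_bilinear[OF assms(1) bounded_bilinear_mult] Suc.IH Ck_on_down[OF Suc.prems] Ck_on_SucD2 Suc.prems)+
qed

lemma smooth_on_cong:
  "open S \<Longrightarrow> (\<And>x. x \<in> S \<Longrightarrow> f x = g x) \<Longrightarrow> smooth_on S f \<Longrightarrow> smooth_on S g"
  unfolding smooth_on_def by (metis Ck_on_cong)

lemma smooth_on_subset: "smooth_on S f \<Longrightarrow> T \<subseteq> S \<Longrightarrow> smooth_on T f"
  unfolding smooth_on_def by (metis Ck_on_subset)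

lemma smooth_on_derivative:
  assumes "smooth_on S f"
  shows "smooth_on S (\<lambda>x. frechet_derivative f (at x) v)"
    and "x \<in> S \<Longrightarrow> (f has_derivative frechet_derivative f (at x)) (at x)"
    and "continuous_on S f"
proof -
  have "Ck_on (Suc k) S f" for k using assms unfolding smooth_on_def by blast
  then show "smooth_on S (\<lambda>x. frechet_derivative f (at x) v)"
    and "x \<in> S \<Longrightarrow> (f has_derivative frechet_derivative f (at x)) (at x)"
    and "continuous_on S f"
    unfolding smooth_on_def
    using Ck_on_SucD2 Ck_on_SucD[of 0 S f x] Ck_on_imp_continuous[of 0 S f] Ck_on_down[of 0 S f] by blast+
qed

context
  fixes S :: "'a::euclidean_space set"
  assumes S: "open S"
begin

lemma smooth_on_const [intro]: "smooth_on S (\<lambda>x. c)"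
  by (simp add: smooth_on_def Ck_on_const S)

lemma smooth_on_add [intro]: "smooth_on S f \<Longrightarrow> smooth_on S g \<Longrightarrow> smooth_on S (\<lambda>x. f x + g x)"
  by (simp add: smooth_on_def Ck_on_add S)

lemma smooth_on_linear: "bounded_linear L \<Longrightarrow> smooth_on S f \<Longrightarrow> smooth_on S (\<lambda>x. L (f x))"
  by (simp add: smooth_on_def Ck_on_linear S)

lemma smooth_on_bilinear:
  "bounded_bilinear B \<Longrightarrow> smooth_on S f \<Longrightarrow> smooth_on S g \<Longrightarrow> smooth_on S (\<lambda>x. B (f x) (g x))"
  by (simp add: smooth_on_def Ck_on_bilinear S)

lemma smooth_on_sum: "(\<And>i. i \<in> I \<Longrightarrow> smooth_on S (f i)) \<Longrightarrow> smooth_on S (\<lambda>x. \<Sum>i\<in>I. f i x)"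
  by (simp add: smooth_on_def Ck_on_sum S)

lemma smooth_on_compose:
  "open T \<Longrightarrow> smooth_on T f \<Longrightarrow> smooth_on S g \<Longrightarrow> g ` S \<subseteq> T \<Longrightarrow> smooth_on S (\<lambda>x. f (g x))"
  for f :: "'b::euclidean_space \<Rightarrow> 'c::real_normed_vector"
  unfolding smooth_on_def using Ck_on_compose[OF S] by blast

lemma smooth_on_ident_linear: "bounded_linear L \<Longrightarrow> smooth_on S L"
  unfolding smooth_on_def
proof
  fix k assume L: "bounded_linear L"
  show "Ck_on k S L"
  proof (cases k)
    case 0
    then show ?thesis using linear_continuous_on L by simp
  next
    case (Suc m)
    have "Ck_on (Suc m) S L"
      by (rule Ck_on_SucI[OF S bounded_linear_imp_has_derivative[OF L] Ck_on_const[OF S]])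
    then show ?thesis using Suc by simp
  qed
qed

end

section \<open>Symmetry of second derivatives\<close>

lemma has_derivative_line:
  fixes f :: "'a::real_normed_vector \<Rightarrow> real"
  assumes "(f has_derivative f') (at (a + s *\<^sub>R u))"
  shows "((\<lambda>s. f (a + s *\<^sub>R u)) has_real_derivative f' u) (at s)"
proof -
  have "((\<lambda>s. f (a + s *\<^sub>R u)) has_derivative (\<lambda>h. f' (h *\<^sub>R u))) (at s)"
    by (rule has_derivative_compose[of "\<lambda>s. a + s *\<^sub>R u" "\<lambda>h. h *\<^sub>R u" s UNIV f])
      (use assms in \<open>auto intro!: derivative_eq_intros\<close>)
  moreover have "(\<lambda>h. f' (h *\<^sub>R u)) = (*) (f' u)"
    using linear_cmul[OF has_derivative_linear[OF assms]] by (auto simp: mult.commute)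
  ultimately show ?thesis by (simp add: has_field_derivative_def)
qed

text \<open>The mean value theorem is used twice: for the increment in direction \<open>v\<close> as
  a function of the displacement along \<open>u\<close>, then for the \<open>u\<close>-derivative
  along \<open>v\<close>. The left-hand side is symmetric in \<open>u\<close> and \<open>v\<close>,
  which yields the symmetry of second derivatives.\<close>

lemma second_difference:
  fixes f :: "'a::euclidean_space \<Rightarrow> real"
  assumes "smooth_on S f" "t > 0"
    and "\<And>a b. 0 \<le> a \<Longrightarrow> a \<le> t \<Longrightarrow> 0 \<le> b \<Longrightarrow> b \<le> t \<Longrightarrow> x + a *\<^sub>R u + b *\<^sub>R v \<in> S"
  obtains a b where "0 < a" "a < t" "0 < b" "b < t"
    "f (x + t *\<^sub>R u + t *\<^sub>R v) - f (x + t *\<^sub>R u) - f (x + t *\<^sub>R v) + f x =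
     t^2 * frechet_derivative (\<lambda>y. frechet_derivative f (at y) u) (at (x + a *\<^sub>R u + b *\<^sub>R v)) v"
proof -
  let ?D = "\<lambda>y. frechet_derivative f (at y) u"
  have "((\<lambda>s. f ((x + t *\<^sub>R v) + s *\<^sub>R u) - f (x + s *\<^sub>R u)) has_real_derivative
     ?D (x + t *\<^sub>R v + s *\<^sub>R u) - ?D (x + s *\<^sub>R u)) (at s)" if "0 \<le> s" "s \<le> t" for s
    by (intro DERIV_diff has_derivative_line smooth_on_derivative(2)[OF assms(1)])
      (use assms(3)[of s 0] assms(3)[of s t] that assms(2) in \<open>auto simp: ac_simps\<close>)
  from MVT2[OF assms(2) this] obtain a where a: "0 < a" "a < t"
    "f ((x + t *\<^sub>R v) + t *\<^sub>R u) - f (x + t *\<^sub>R u) - (f (x + t *\<^sub>R v) - f x) =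
      t * (?D (x + t *\<^sub>R v + a *\<^sub>R u) - ?D (x + a *\<^sub>R u))"
    by auto
  have "((\<lambda>s. ?D ((x + a *\<^sub>R u) + s *\<^sub>R v)) has_real_derivative
      frechet_derivative ?D (at (x + a *\<^sub>R u + s *\<^sub>R v)) v) (at s)" if "0 \<le> s" "s \<le> t" for s
    by (intro has_derivative_line smooth_on_derivative(2)[OF smooth_on_derivative(1)[OF assms(1)]])
      (use assms(3)[of a s] that a in auto)
  from MVT2[OF assms(2) this] obtain b where b: "0 < b" "b < t"
    "?D (x + a *\<^sub>R u + t *\<^sub>R v) - ?D (x + a *\<^sub>R u) =
       t * frechet_derivative ?D (at (x + a *\<^sub>R u + b *\<^sub>R v)) v"
    by auto
  have "f (x + t *\<^sub>R u + t *\<^sub>R v) - f (x + t *\<^sub>R u) - f (x + t *\<^sub>R v) + f x =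
     t^2 * frechet_derivative ?D (at (x + a *\<^sub>R u + b *\<^sub>R v)) v"
    using a(3) b(3) by (simp add: algebra_simps power2_eq_square)
  with a b show ?thesis by (intro that)
qed

lemma derivative_commute_real:
  fixes f :: "'a::euclidean_space \<Rightarrow> real"
  assumes "open S" "smooth_on S f" "x \<in> S"
  shows "frechet_derivative (\<lambda>y. frechet_derivative f (at y) u) (at x) v =
         frechet_derivative (\<lambda>y. frechet_derivative f (at y) v) (at x) u"
proof -
  define A where "A = (\<lambda>y. frechet_derivative (\<lambda>y. frechet_derivative f (at y) u) (at y) v)"
  define B where "B = (\<lambda>y. frechet_derivative (\<lambda>y. frechet_derivative f (at y) v) (at y) u)"
  have "\<bar>A x - B x\<bar> \<le> e" if "e > 0" for e
  proof -
    have c: "continuous_on S A" "continuous_on S B"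
      unfolding A_def B_def by (intro smooth_on_derivative assms)+
    have ev: "\<forall>\<^sub>F y in nhds x. \<bar>h y - h x\<bar> < e / 2" if "continuous_on S h" for h :: "'a \<Rightarrow> real"
    proof -
      have "isCont h x" using that assms by (simp add: continuous_on_eq_continuous_at)
      then have "(h \<longlongrightarrow> h x) (nhds x)" by (simp add: isCont_def tendsto_at_iff_tendsto_nhds)
      from tendstoD[OF this, of "e / 2"] show ?thesis using \<open>e > 0\<close> by (simp add: dist_real_def)
    qed
    have "\<forall>\<^sub>F y in nhds x. (\<bar>A y - A x\<bar> < e / 2 \<and> \<bar>B y - B x\<bar> < e / 2) \<and> y \<in> S"
      by (intro eventually_conj ev c eventually_nhds_in_open assms)
    then obtain d where d: "d > 0"
      and near': "\<forall>y. dist y x < d \<longrightarrow> (\<bar>A y - A x\<bar> < e / 2 \<and> \<bar>B y - B x\<bar> < e / 2) \<and> y \<in> S"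
      unfolding eventually_nhds_metric by (elim exE conjE)
    then have near: "\<bar>A y - A x\<bar> < e / 2 \<and> \<bar>B y - B x\<bar> < e / 2 \<and> y \<in> S" if "dist y x < d" for y
      using that by simp
    \<comment> \<open>With this \<open>t\<close> the parallelogram at \<open>x\<close> stays within
      d/2 of \<open>x\<close>; the summand 1 keeps the denominator positive.\<close>
    define t where "t = d / (2 * (norm u + norm v + 1))"
    have t: "t > 0" using d unfolding t_def by (simp add: add_nonneg_pos)
    have n: "dist (x + a *\<^sub>R u + b *\<^sub>R v) x < d" if "0 \<le> a" "a \<le> t" "0 \<le> b" "b \<le> t" for a b
    proof -
      have "dist (x + a *\<^sub>R u + b *\<^sub>R v) x = norm (a *\<^sub>R u + b *\<^sub>R v)"
        by (simp add: dist_norm add.assoc)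
      also have "\<dots> \<le> a * norm u + b * norm v"
        using norm_triangle_ineq[of "a *\<^sub>R u" "b *\<^sub>R v"] that by simp
      also have "\<dots> \<le> t * norm u + t * norm v" using that by (intro add_mono mult_right_mono) auto
      also have "\<dots> \<le> t * (norm u + norm v + 1)" using t by (simp add: algebra_simps)
      also have "\<dots> = d / 2"
        unfolding t_def using add_nonneg_pos[of "norm u + norm v" 1] by (simp add: field_simps)
      also have "\<dots> < d" using d by simp
      finally show ?thesis .
    qed
    have in1: "x + a *\<^sub>R u + b *\<^sub>R v \<in> S" if "0 \<le> a" "a \<le> t" "0 \<le> b" "b \<le> t" for a b
      using near n that by blast
    have in2: "x + a *\<^sub>R v + b *\<^sub>R u \<in> S" if "0 \<le> a" "a \<le> t" "0 \<le> b" "b \<le> t" for a b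
      using in1[of b a] that by (simp add: ac_simps)
    obtain a b where ab: "0 < a" "a < t" "0 < b" "b < t"
      "f (x + t *\<^sub>R u + t *\<^sub>R v) - f (x + t *\<^sub>R u) - f (x + t *\<^sub>R v) + f x =
       t^2 * A (x + a *\<^sub>R u + b *\<^sub>R v)"
      unfolding A_def by (rule second_difference[of S f t x u v, OF assms(2) t in1])
    obtain a' b' where ab': "0 < a'" "a' < t" "0 < b'" "b' < t"
      "f (x + t *\<^sub>R v + t *\<^sub>R u) - f (x + t *\<^sub>R v) - f (x + t *\<^sub>R u) + f x =
       t^2 * B (x + a' *\<^sub>R v + b' *\<^sub>R u)"
      unfolding B_def by (rule second_difference[of S f t x v u, OF assms(2) t in2])
    have swap: "x + b *\<^sub>R v + a *\<^sub>R u = x + a *\<^sub>R u + b *\<^sub>R v" for a b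
      by simp
    have "t^2 * A (x + a *\<^sub>R u + b *\<^sub>R v) = t^2 * B (x + a' *\<^sub>R v + b' *\<^sub>R u)"
      using ab(5) ab'(5) unfolding swap[of t t] by linarith
    then have eq: "A (x + a *\<^sub>R u + b *\<^sub>R v) = B (x + b' *\<^sub>R u + a' *\<^sub>R v)"
      using t unfolding swap by simp
    have "\<bar>A (x + a *\<^sub>R u + b *\<^sub>R v) - A x\<bar> < e / 2"
      by (rule near[THEN conjunct1], rule n) (use ab in auto)
    moreover have "\<bar>B (x + b' *\<^sub>R u + a' *\<^sub>R v) - B x\<bar> < e / 2"
      by (rule near[THEN conjunct2, THEN conjunct1], rule n) (use ab' in auto)
    ultimately show ?thesis using eq by linarith
  qed
  then have "\<bar>A x - B x\<bar> \<le> 0" by (rule field_le_epsilon[of _ 0, simplified])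
  then show ?thesis by (simp add: A_def B_def)
qed

lemma frechet_derivative_linear:
  assumes "bounded_linear L" "f differentiable (at x)"
  shows "frechet_derivative (\<lambda>x. L (f x)) (at x) v = L (frechet_derivative f (at x) v)"
  using frechet_derivative_at[OF bounded_linear.has_derivative[OF assms(1) frechet_derivative_works[THEN iffD1, OF assms(2)]]]
  by metis

lemma derivative_commute:
  fixes f :: "'a::euclidean_space \<Rightarrow> 'b::euclidean_space"
  assumes "open S" "smooth_on S f" "x \<in> S"
  shows "frechet_derivative (\<lambda>y. frechet_derivative f (at y) u) (at x) v =
         frechet_derivative (\<lambda>y. frechet_derivative f (at y) v) (at x) u"
proof (rule euclidean_eqI)
  fix b :: 'b assume "b \<in> Basis"
  have eq: "frechet_derivative (\<lambda>y. frechet_derivative f (at y) u) (at x) v \<bullet> b =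
     frechet_derivative (\<lambda>y. frechet_derivative (\<lambda>z. f z \<bullet> b) (at y) u) (at x) v" for u v
  proof -
    have "frechet_derivative (\<lambda>y. frechet_derivative f (at y) u) (at x) v \<bullet> b =
       frechet_derivative (\<lambda>y. frechet_derivative f (at y) u \<bullet> b) (at x) v"
      by (subst frechet_derivative_linear[OF bounded_linear_inner_left])
        (use smooth_on_derivative(2)[OF smooth_on_derivative(1)[OF assms(2)] assms(3)]
          in \<open>auto simp: differentiable_def\<close>)
    also have "\<dots> = frechet_derivative (\<lambda>y. frechet_derivative (\<lambda>z. f z \<bullet> b) (at y) u) (at x) v"
    proof (rule fun_cong[OF frechet_derivative_at])
      have "((\<lambda>y. frechet_derivative f (at y) u \<bullet> b) has_derivative
          frechet_derivative (\<lambda>y. frechet_derivative f (at y) u \<bullet> b) (at x)) (at x)"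
        by (intro smooth_on_derivative(2)[OF smooth_on_linear[OF assms(1) bounded_linear_inner_left]]
            smooth_on_derivative(1) assms)
      then show "((\<lambda>y. frechet_derivative (\<lambda>z. f z \<bullet> b) (at y) u) has_derivative
          frechet_derivative (\<lambda>y. frechet_derivative f (at y) u \<bullet> b) (at x)) (at x)"
      proof (rule has_derivative_transform_within_open[OF _ assms(1,3)])
        fix y assume "y \<in> S"
        then show "frechet_derivative f (at y) u \<bullet> b = frechet_derivative (\<lambda>z. f z \<bullet> b) (at y) u"
          using smooth_on_derivative(2)[OF assms(2)]
          by (subst frechet_derivative_linear[OF bounded_linear_inner_left])
            (auto simp: differentiable_def)
      qed
    qed
    finally show ?thesis .
  qed
  show "frechet_derivative (\<lambda>y. frechet_derivative f (at y) u) (at x) v \<bullet> b =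
     frechet_derivative (\<lambda>y. frechet_derivative f (at y) v) (at x) u \<bullet> b"
    unfolding eq
    by (intro derivative_commute_real[OF assms(1) _ assms(3)]
        smooth_on_linear[OF assms(1) bounded_linear_inner_left] assms)
qed

section \<open>Integrals depending on a parameter\<close>

lemma parameter_integral:
  fixes G :: "real \<times> 'a::euclidean_space \<Rightarrow> real"
  assumes "open T" "smooth_on T G" "open S" "convex S"
    and sub: "\<And>t x. t \<in> {0..1} \<Longrightarrow> x \<in> S \<Longrightarrow> (t, x) \<in> T"
  shows parameter_integral_has_derivative:
    "x \<in> S \<Longrightarrow> ((\<lambda>x. integral {0..1} (\<lambda>t. G (t, x))) has_derivative
        (\<lambda>v. integral {0..1} (\<lambda>t. frechet_derivative G (at (t, x)) (0, v)))) (at x)"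
    and smooth_on_parameter_integral: "smooth_on S (\<lambda>x. integral {0..1} (\<lambda>t. G (t, x)))"
proof -
  have deriv: "((\<lambda>x. integral {0..1} (\<lambda>t. G (t, x))) has_derivative
        (\<lambda>v. integral {0..1} (\<lambda>t. frechet_derivative G (at (t, x)) (0, v)))) (at x)"
    if G: "smooth_on T G" and x: "x \<in> S" for G :: "real \<times> 'a \<Rightarrow> real" and x
  proof -
    define D where "D = (\<lambda>x t. Blinfun (\<lambda>v. frechet_derivative G (at (t, x)) (0, v)))"
    have lin: "bounded_linear (frechet_derivative G (at (t, x)))" if "t \<in> {0..1}" "x \<in> S" for t x
      using smooth_on_derivative(2)[OF G sub[OF that]] has_derivative_bounded_linear by blast
    have D: "blinfun_apply (D x t) = (\<lambda>v. frechet_derivative G (at (t, x)) (0, v))"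
      if "t \<in> {0..1}" "x \<in> S" for t x
      unfolding D_def
      by (rule bounded_linear_Blinfun_apply bounded_linear_compose[OF lin[OF that]])+
        (intro bounded_linear_Pair bounded_linear_zero bounded_linear_ident)
    have cD: "continuous_on (S \<times> cbox 0 1) (\<lambda>(x, t). D x t)"
    proof (rule continuous_on_blinfun_componentwise)
      fix i :: 'a
      have "continuous_on (S \<times> cbox 0 1) (\<lambda>p. frechet_derivative G (at (snd p, fst p)) (0, i))"
        by (rule continuous_on_compose2[OF smooth_on_derivative(3)[OF smooth_on_derivative(1)[OF G]]])
          (auto intro!: continuous_intros sub)
      then show "continuous_on (S \<times> cbox 0 1) (\<lambda>p. blinfun_apply (case p of (x, t) \<Rightarrow> D x t) i)"
        by (rule continuous_on_eq) (auto simp: D)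
    qed
    have "((\<lambda>x. integral (cbox 0 1) (\<lambda>t. G (t, x))) has_derivative integral (cbox 0 1) (D x)) (at x within S)"
    proof (rule leibniz_rule[where fx = D])
      fix x and t :: real assume xt: "x \<in> S" "t \<in> cbox 0 1"
      have "(G has_derivative frechet_derivative G (at (t, x))) (at (t, x))"
        by (rule smooth_on_derivative(2)[OF G sub]) (use xt in auto)
      then have "((\<lambda>x. G (t, x)) has_derivative (\<lambda>v. frechet_derivative G (at (t, x)) (0, v))) (at x)"
        by (intro has_derivative_compose[of "\<lambda>x. (t, x)" "\<lambda>v. (0, v)" x UNIV G])
          (auto intro!: derivative_eq_intros)
      then show "((\<lambda>x. G (t, x)) has_derivative blinfun_apply (D x t)) (at x within S)"
        using xt by (auto simp: D intro: has_derivative_at_withinI)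
    next
      fix x assume "x \<in> S"
      then show "(\<lambda>t. G (t, x)) integrable_on cbox 0 1"
        by (intro integrable_continuous continuous_on_compose2[OF smooth_on_derivative(3)[OF G]])
          (auto intro!: continuous_intros sub)
    qed (use assms x cD in auto)
    moreover have "blinfun_apply (integral (cbox 0 1) (D x)) v =
       integral {0..1} (\<lambda>t. frechet_derivative G (at (t, x)) (0, v))" for v
    proof -
      have "continuous_on (cbox 0 1) (\<lambda>t. case (x, t) of (x, t) \<Rightarrow> D x t)"
        by (rule continuous_on_compose2[OF cD]) (use x in \<open>auto intro: continuous_on_Pair\<close>)
      then have "continuous_on (cbox 0 1) (D x)" by simp
      then have "D x integrable_on cbox 0 1" by (rule integrable_continuous)
      then have "blinfun_apply (integral (cbox 0 1) (D x)) v = integral (cbox 0 1) (\<lambda>t. blinfun_apply (D x t) v)"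
        by (rule blinfun_apply_integral)
      also have "\<dots> = integral (cbox 0 1) (\<lambda>t. frechet_derivative G (at (t, x)) (0, v))"
        by (rule integral_cong) (use x in \<open>auto simp: D\<close>)
      finally show ?thesis by simp
    qed
    then have "blinfun_apply (integral {0..1} (D x)) =
       (\<lambda>v. integral {0..1} (\<lambda>t. frechet_derivative G (at (t, x)) (0, v)))" unfolding cbox_interval by blast
    ultimately show ?thesis
      unfolding at_within_open[OF x assms(3)] cbox_interval by simp
  qed
  show "x \<in> S \<Longrightarrow> ((\<lambda>x. integral {0..1} (\<lambda>t. G (t, x))) has_derivative
        (\<lambda>v. integral {0..1} (\<lambda>t. frechet_derivative G (at (t, x)) (0, v)))) (at x)"
    by (rule deriv[OF assms(2)])
  \<comment> \<open>The directional derivative of the integral is an integral of the same kind with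
    another integrand smooth on \<open>T\<close>, so the induction has to generalise over
    \<open>G\<close>.\<close>
  have "Ck_on k S (\<lambda>x. integral {0..1} (\<lambda>t. G (t, x)))" if "smooth_on T G" for k and G :: "real \<times> 'a \<Rightarrow> real"
    using that
  proof (induction k arbitrary: G)
    case 0
    show ?case
      unfolding Ck_on.simps
      by (intro continuous_at_imp_continuous_on ballI has_derivative_continuous) (rule deriv[OF 0])
  next
    case (Suc k)
    show ?case
      by (rule Ck_on_SucI[OF assms(3) deriv[OF Suc.prems]])
        (assumption, rule Suc.IH, rule smooth_on_derivative[OF Suc.prems])
  qed
  then show "smooth_on S (\<lambda>x. integral {0..1} (\<lambda>t. G (t, x)))"
    using assms(2) unfolding smooth_on_def by blast
qed

section \<open>Inverse function theorem for smooth maps\<close>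

lemma Ck_on_prod:
  fixes f :: "'i \<Rightarrow> 'a::euclidean_space \<Rightarrow> real"
  assumes "open S" "\<And>i. i \<in> I \<Longrightarrow> Ck_on k S (f i)"
  shows "Ck_on k S (\<lambda>x. \<Prod>i\<in>I. f i x)"
  using assms(2)
  by (induction I rule: infinite_finite_induct)
    (auto intro!: Ck_on_bilinear[OF assms(1) bounded_bilinear_mult] Ck_on_const assms(1))

lemma Ck_on_det:
  fixes M :: "'a::euclidean_space \<Rightarrow> real^'n^'n"
  assumes "open S" "\<And>i j. Ck_on k S (\<lambda>x. M x $ i $ j)"
  shows "Ck_on k S (\<lambda>x. det (M x))"
  unfolding det_def
  by (intro Ck_on_sum[OF assms(1)] Ck_on_bilinear[OF assms(1) bounded_bilinear_mult]
      Ck_on_const[OF assms(1)] Ck_on_prod[OF assms(1)] assms(2))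

lemma Ck_on_vec:
  fixes f :: "'a::euclidean_space \<Rightarrow> real^'n"
  assumes "open S" "\<And>i. Ck_on k S (\<lambda>x. f x $ i)"
  shows "Ck_on k S f"
proof -
  have "Ck_on k S (\<lambda>x. \<Sum>i\<in>UNIV. f x $ i *\<^sub>R axis i (1::real))"
    by (intro Ck_on_sum[OF assms(1)] Ck_on_bilinear[OF assms(1) bounded_bilinear_scaleR]
        Ck_on_const[OF assms(1)] assms(2))
  then show ?thesis
    by (rule Ck_on_cong[OF assms(1), rotated])
      (simp add: vec_eq_iff axis_def if_distrib[of "(*) _"] cong: if_cong)
qed

lemma smooth_on_vec:
  fixes f :: "'a::euclidean_space \<Rightarrow> real^'n"
  assumes "open S" "\<And>i. smooth_on S (\<lambda>x. f x $ i)"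
  shows "smooth_on S f"
  using assms Ck_on_vec unfolding smooth_on_def by blast

text \<open>The differentiable inverse \<open>h\<close> has as derivative the inverse of the
  derivative of \<open>f\<close> at \<open>h y\<close>. Cramer's rule expresses it by determinants
  whose entries are partial derivatives of \<open>f\<close> composed with \<open>h\<close>; so if
  \<open>h\<close> is C^k, its derivative is C^k and \<open>h\<close> is C^(k+1).\<close>

lemma smooth_inverse_function:
  fixes f :: "real^'n \<Rightarrow> real^'n"
  assumes "open U" "0 \<in> U" "smooth_on U f" "f 0 = 0" "inj (frechet_derivative f (at 0))"
  obtains V where "V \<subseteq> U" "diffeo_rep V f" "\<And>x. x \<in> V \<Longrightarrow> bij (frechet_derivative f (at x))"
proof -
  let ?D = "\<lambda>x. frechet_derivative f (at x)"
  define F where "F = (\<lambda>x. Blinfun (?D x))"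
  note der = smooth_on_derivative(2)[OF assms(3)]
  have F: "blinfun_apply (F x) = ?D x" if "x \<in> U" for x
    unfolding F_def using der[OF that]
    by (intro bounded_linear_Blinfun_apply) (rule has_derivative_bounded_linear)
  have cF: "continuous_on U F"
    by (rule continuous_on_blinfun_componentwise)
      (auto simp: F intro: continuous_on_eq[OF smooth_on_derivative(3)[OF smooth_on_derivative(1)[OF assms(3)]]])
  obtain g where g: "linear g" "g \<circ> ?D 0 = id"
    using linear_injective_left_inverse[OF has_derivative_linear[OF der[OF assms(2)]] assms(5)] by blast
  have inv: "Blinfun g o\<^sub>L F 0 = id_blinfun"
    using fun_cong[OF g(2)] g(1) F[OF assms(2)]
    by (intro blinfun_eqI)
      (simp add: bounded_linear_Blinfun_apply linear_conv_bounded_linear)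
  obtain V W h h' where V: "open V" "V \<subseteq> U" "0 \<in> V" "open W" "f 0 \<in> W" "homeomorphism V W f h"
    and h: "\<And>y. y \<in> W \<Longrightarrow> (h has_derivative (h' y)) (at y)"
      "\<And>y. y \<in> W \<Longrightarrow> h' y = inv (blinfun_apply (F (h y)))"
      "\<And>y. y \<in> W \<Longrightarrow> bij (blinfun_apply (F (h y)))"
    using inverse_function_theorem[of U f F 0 "Blinfun g", OF assms(1) _ cF assms(2) inv] F der
    by metis
  have fV: "f ` V = W" and hV: "\<And>y. y \<in> W \<Longrightarrow> h y \<in> V" "\<And>y. y \<in> W \<Longrightarrow> f (h y) = y"
    and hf: "\<And>x. x \<in> V \<Longrightarrow> h (f x) = x"
    using V(6) unfolding homeomorphism_def by blast+
  have hU: "h y \<in> U" if "y \<in> W" for y using hV(1)[OF that] V(2) by blast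
  have inj: "inj_on f V" using hf by (rule inj_on_inverseI)
  have bij: "bij (?D x)" if "x \<in> V" for x
    using h(3)[of "f x"] hf[OF that] fV F V(2) that by (metis image_eqI subsetD)
  define M where "M = (\<lambda>y. matrix (?D (h y)))"
  have linD: "linear (?D (h y))" if "y \<in> W" for y
    using der[OF hU[OF that]] by (rule has_derivative_linear)
  have Mv: "M y *v v = ?D (h y) v" if "y \<in> W" for y v
    unfolding M_def using linD[OF that] by (simp add: matrix_works)
  have detM: "det (M y) \<noteq> 0" if "y \<in> W" for y
  proof -
    have "inj ((*v) (M y))"
      using bij[OF hV(1)[OF that]] Mv[OF that] by (auto simp: bij_def inj_def)
    then show ?thesis
      using invertible_left_inverse[of "M y"] matrix_left_invertible_injective[of "M y"]
        invertible_det_nz[of "M y"] by (auto simp: inj_def)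
  qed
  have h'_eq: "h' y v = (\<chi> k. det (\<chi> i j. if j = k then v $ i else M y $ i $ j) / det (M y))"
    if "y \<in> W" for y v
  proof -
    have "M y *v (h' y v) = v"
      using h(2)[OF that] h(3)[OF that] Mv[OF that] F[OF hU[OF that]]
      by (simp add: bij_is_surj surj_f_inv_f)
    then show ?thesis by (simp add: cramer[OF detM[OF that]])
  qed
  have Mcomp: "M y $ i $ j = ?D (h y) (axis j 1) $ i" for y i j
    by (simp add: M_def matrix_def)
  have "Ck_on k W h" for k
  proof (induction k)
    case 0
    then show ?case using V(6) by (simp add: homeomorphism_def)
  next
    case (Suc k)
    have entry: "Ck_on k W (\<lambda>y. M y $ i $ j)" for i j
    proof -
      have "Ck_on k U (\<lambda>x. ?D x (axis j 1))"
        using smooth_on_derivative(1)[OF assms(3)] unfolding smooth_on_def by blast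
      from Ck_on_compose[OF V(4) assms(1) this Suc.IH] hU show ?thesis
        unfolding Mcomp
        by (intro Ck_on_linear[OF V(4) bounded_linear_vec_nth]) auto
    qed
    have "Ck_on k W (\<lambda>y. \<chi> k. det (\<chi> i j. if j = k then v $ i else M y $ i $ j) / det (M y))" for v
    proof (rule Ck_on_vec[OF V(4)])
      fix l
      have "Ck_on k W (\<lambda>y. det (\<chi> i j. if j = l then v $ i else M y $ i $ j) * inverse (det (M y)))"
      proof (intro Ck_on_bilinear[OF V(4) bounded_bilinear_mult] Ck_on_inverse[OF V(4)] Ck_on_det[OF V(4)] entry detM)
        fix i j
        show "Ck_on k W (\<lambda>y. (\<chi> i j. if j = l then v $ i else M y $ i $ j) $ i $ j)"
          by (cases "j = l") (auto intro: entry Ck_on_const[OF V(4)])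
      qed
      then show "Ck_on k W (\<lambda>y. (\<chi> k. det (\<chi> i j. if j = k then v $ i else M y $ i $ j) / det (M y)) $ l)"
        by (simp add: divide_inverse)
    qed
    then show ?case
      by (intro Ck_on_SucI[OF V(4) h(1)])
        (auto simp: h'_eq intro: Ck_on_cong[OF V(4) h'_eq[symmetric]])
  qed
  then have smh: "smooth_on W h" by (simp add: smooth_on_def)
  have "inv_into V f y = h y" if "y \<in> W" for y
    by (rule inv_into_f_eq[OF inj hV(1)[OF that] hV(2)[OF that]])
  from smooth_on_cong[OF V(4) this[symmetric] smh] have "smooth_on W (inv_into V f)" by simp
  then have dV: "diffeo_rep V f"
    using V inj fV assms(4) smooth_on_subset[OF assms(3)] by (simp add: diffeo_rep_def)
  show ?thesis by (rule that[OF V(2) dV bij])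
qed

section \<open>Germs at the origin\<close>

lemma smooth_on_mult:
  "open S \<Longrightarrow> smooth_on S f \<Longrightarrow> smooth_on S g \<Longrightarrow> smooth_on S (\<lambda>x. f x * g x :: real)"
  by (rule smooth_on_bilinear[OF _ bounded_bilinear_mult])

lemma smooth_on_power: "open S \<Longrightarrow> smooth_on S f \<Longrightarrow> smooth_on S (\<lambda>x. f x ^ k :: real)"
  by (induction k) (auto intro: smooth_on_mult)

lemma smooth_on_nth: "open S \<Longrightarrow> smooth_on S f \<Longrightarrow> smooth_on S (\<lambda>x. f x $ i :: real)"
  by (rule smooth_on_linear[OF _ bounded_linear_vec_nth])

text \<open>One neighbourhood serves all orders of differentiability.\<close>

definition smooth_germ :: "('a::euclidean_space \<Rightarrow> 'b::real_normed_vector) \<Rightarrow> bool" where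
  "smooth_germ f \<longleftrightarrow> (\<exists>U. open U \<and> 0 \<in> U \<and> smooth_on U f)"

text \<open>\<open>nhds\<close> includes the point itself, so an identity holding near 0 can be
  evaluated at 0.\<close>

abbreviation near0 :: "('a::euclidean_space \<Rightarrow> bool) \<Rightarrow> bool" where
  "near0 R \<equiv> eventually R (nhds 0)"

lemma smooth_germE:
  assumes "smooth_germ f" obtains r where "r > 0" "smooth_on (ball 0 r) f"
proof -
  obtain U where U: "open U" "0 \<in> U" "smooth_on U f" using assms unfolding smooth_germ_def by blast
  then obtain r where "r > 0" "ball 0 r \<subseteq> U" by (meson open_contains_ball)
  then show ?thesis using that smooth_on_subset[OF U(3)] by blast
qed

lemma smooth_germI: "r > 0 \<Longrightarrow> smooth_on (ball 0 r) f \<Longrightarrow> smooth_germ f"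
  unfolding smooth_germ_def by (metis open_ball centre_in_ball)

lemma smooth_germ_cong:
  assumes "smooth_germ f" "near0 (\<lambda>x. f x = g x)" shows "smooth_germ g"
proof -
  obtain U where U: "open U" "0 \<in> U" "smooth_on U f" using assms unfolding smooth_germ_def by blast
  obtain V where V: "open V" "0 \<in> V" "\<And>x. x \<in> V \<Longrightarrow> f x = g x"
    using assms(2) unfolding eventually_nhds by blast
  have "smooth_on (U \<inter> V) g"
    by (rule smooth_on_cong[of _ f]) (use U V smooth_on_subset[OF U(3)] in auto)
  then show ?thesis using U V unfolding smooth_germ_def by (metis IntI open_Int)
qed

lemma smooth_germ2E:
  assumes "smooth_germ f" "smooth_germ g"
  obtains U where "open U" "0 \<in> U" "smooth_on U f" "smooth_on U g"
proof -
  obtain U V where "open U" "0 \<in> U" "smooth_on U f" "open V" "0 \<in> V" "smooth_on V g"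
    using assms unfolding smooth_germ_def by blast
  then show ?thesis using that[of "U \<inter> V"] smooth_on_subset[of U f "U \<inter> V"] smooth_on_subset[of V g "U \<inter> V"] by auto
qed

lemma smooth_germ_const: "smooth_germ (\<lambda>x. c)"
  unfolding smooth_germ_def by (intro exI[of _ UNIV]) (auto intro: smooth_on_const)

lemma smooth_germ_bounded_linear: "bounded_linear L \<Longrightarrow> smooth_germ L"
  unfolding smooth_germ_def by (intro exI[of _ UNIV]) (auto intro: smooth_on_ident_linear)

lemma smooth_germ_linear: "bounded_linear L \<Longrightarrow> smooth_germ f \<Longrightarrow> smooth_germ (\<lambda>x. L (f x))"
  unfolding smooth_germ_def using smooth_on_linear by blast

lemma smooth_germ_bilinear:
  "bounded_bilinear B \<Longrightarrow> smooth_germ f \<Longrightarrow> smooth_germ g \<Longrightarrow> smooth_germ (\<lambda>x. B (f x) (g x))"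
  by (erule smooth_germ2E) (auto simp: smooth_germ_def intro: smooth_on_bilinear)

lemma smooth_germ_add: "smooth_germ f \<Longrightarrow> smooth_germ g \<Longrightarrow> smooth_germ (\<lambda>x. f x + g x)"
  by (erule smooth_germ2E) (auto simp: smooth_germ_def)

lemma smooth_germ_minus: "smooth_germ f \<Longrightarrow> smooth_germ (\<lambda>x. - f x)"
  by (rule smooth_germ_linear[OF bounded_linear_minus[OF bounded_linear_ident]])

lemma smooth_germ_diff: "smooth_germ f \<Longrightarrow> smooth_germ g \<Longrightarrow> smooth_germ (\<lambda>x. f x - g x)"
  using smooth_germ_add[OF _ smooth_germ_minus] by fastforce

lemma smooth_germ_mult: "smooth_germ f \<Longrightarrow> smooth_germ g \<Longrightarrow> smooth_germ (\<lambda>x. f x * g x :: real)"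
  by (rule smooth_germ_bilinear[OF bounded_bilinear_mult])

lemma smooth_germ_scaleR: "smooth_germ f \<Longrightarrow> smooth_germ g \<Longrightarrow> smooth_germ (\<lambda>x. f x *\<^sub>R g x)"
  by (rule smooth_germ_bilinear[OF bounded_bilinear_scaleR])

lemma smooth_germ_power: "smooth_germ f \<Longrightarrow> smooth_germ (\<lambda>x. f x ^ k :: real)"
  by (induction k) (auto intro: smooth_germ_mult smooth_germ_const)

lemma smooth_germ_sum: "(\<And>i. i \<in> I \<Longrightarrow> smooth_germ (f i)) \<Longrightarrow> smooth_germ (\<lambda>x. \<Sum>i\<in>I. f i x)"
  by (induction I rule: infinite_finite_induct) (auto intro: smooth_germ_add smooth_germ_const)

lemma smooth_germ_nth: "smooth_germ f \<Longrightarrow> smooth_germ (\<lambda>x. f x $ i :: real)"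
  by (rule smooth_germ_linear[OF bounded_linear_vec_nth])

lemma smooth_germ_coord: "smooth_germ (\<lambda>x :: real^'n. x $ i)"
  by (rule smooth_germ_bounded_linear[OF bounded_linear_vec_nth])

lemma smooth_germ_vec:
  fixes f :: "'a::euclidean_space \<Rightarrow> real^'n"
  assumes "\<And>i. smooth_germ (\<lambda>x. f x $ i)" shows "smooth_germ f"
proof -
  have "smooth_germ (\<lambda>x. \<Sum>i\<in>UNIV. f x $ i *\<^sub>R axis i (1::real))"
    by (intro smooth_germ_sum smooth_germ_scaleR assms smooth_germ_const)
  then show ?thesis
    by (rule smooth_germ_cong)
      (simp add: vec_eq_iff axis_def if_distrib[of "(*) _"] cong: if_cong)
qed

lemma smooth_germ_continuous: "smooth_germ f \<Longrightarrow> isCont f 0"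
  unfolding smooth_germ_def using smooth_on_derivative(3) continuous_on_eq_continuous_at by blast

lemma near0_compose:
  assumes "near0 R" "isCont g 0" "g 0 = 0" shows "near0 (\<lambda>x. R (g x))"
proof -
  have "filterlim g (nhds 0) (nhds 0)"
    using assms(2,3) unfolding isCont_def tendsto_at_iff_tendsto_nhds by simp
  then show ?thesis using assms(1) by (rule eventually_compose_filterlim[rotated])
qed

lemma smooth_germ_compose:
  fixes f :: "'b::euclidean_space \<Rightarrow> 'c::real_normed_vector" and g :: "'a::euclidean_space \<Rightarrow> 'b"
  assumes "smooth_germ f" "smooth_germ g" "g 0 = 0" shows "smooth_germ (\<lambda>x. f (g x))"
proof -
  obtain T where T: "open T" "0 \<in> T" "smooth_on T f" using assms(1) unfolding smooth_germ_def by blast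
  obtain U where U: "open U" "0 \<in> U" "smooth_on U g" using assms(2) unfolding smooth_germ_def by blast
  have "near0 (\<lambda>x. g x \<in> T)"
    using near0_compose[of "\<lambda>y. y \<in> T" g] eventually_nhds_in_open[OF T(1,2)]
      smooth_germ_continuous[OF assms(2)] assms(3) by blast
  then obtain V where V: "open V" "0 \<in> V" "\<And>x. x \<in> V \<Longrightarrow> g x \<in> T"
    unfolding eventually_nhds by blast
  have "smooth_on (U \<inter> V) (\<lambda>x. f (g x))"
    by (rule smooth_on_compose[OF _ T(1,3)]) (use U V smooth_on_subset[OF U(3)] in auto)
  then show ?thesis using U V unfolding smooth_germ_def by (metis IntI open_Int)
qed

lemma smooth_germ_derivative: "smooth_germ f \<Longrightarrow> smooth_germ (\<lambda>x. frechet_derivative f (at x) v)"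
  unfolding smooth_germ_def using smooth_on_derivative(1) by blast

lemma smooth_germ_has_derivative:
  assumes "smooth_germ f"
  shows "near0 (\<lambda>x. (f has_derivative frechet_derivative f (at x)) (at x))"
  using assms smooth_on_derivative(2)[of _ f] unfolding smooth_germ_def eventually_nhds by blast

lemma smooth_germ_has_derivative0:
  "smooth_germ f \<Longrightarrow> (f has_derivative frechet_derivative f (at 0)) (at 0)"
  by (rule eventually_nhds_x_imp_x[OF smooth_germ_has_derivative])

text \<open>Locally equal functions admit the same derivatives, so the choice made by
  \<open>frechet_derivative\<close> agrees even at points where none exists.\<close>

lemma frechet_derivative_near0_cong:
  fixes f g :: "'a::euclidean_space \<Rightarrow> 'b::real_normed_vector"
  assumes "near0 (\<lambda>x. f x = g x)"
  shows "near0 (\<lambda>x. frechet_derivative f (at x) = frechet_derivative g (at x))"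
proof -
  have "near0 (\<lambda>x. eventually (\<lambda>x. f x = g x) (nhds x))"
    using assms by (simp add: eventually_eventually)
  then show ?thesis
  proof (rule eventually_mono)
    fix x assume ev: "\<forall>\<^sub>F x in nhds x. f x = g x"
    obtain S where S: "open S" "x \<in> S" "\<And>y. y \<in> S \<Longrightarrow> f y = g y"
      using ev unfolding eventually_nhds by (elim exE conjE) simp
    have "(f has_derivative f') (at x) \<longleftrightarrow> (g has_derivative f') (at x)" for f'
      using has_derivative_transform_within_open[OF _ S(1,2), of f f' UNIV g]
        has_derivative_transform_within_open[OF _ S(1,2), of g f' UNIV f] S(3) by metis
    then show "frechet_derivative f (at x) = frechet_derivative g (at x)"
      unfolding frechet_derivative_def by simp
  qed
qed

lemmas smooth_germ_intros = smooth_germ_const smooth_germ_add smooth_germ_diff smooth_germ_minus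
  smooth_germ_mult smooth_germ_scaleR smooth_germ_power smooth_germ_sum smooth_germ_coord

section \<open>Partial derivatives\<close>

definition pd :: "'n \<Rightarrow> (real^'n \<Rightarrow> 'b) \<Rightarrow> real^'n \<Rightarrow> 'b::real_normed_vector" where
  "pd i f x = frechet_derivative f (at x) (axis i 1)"

lemma smooth_germ_pd: "smooth_germ f \<Longrightarrow> smooth_germ (pd i f)"
  unfolding pd_def[abs_def] by (rule smooth_germ_derivative)

lemma pd_near0_cong:
  assumes "near0 (\<lambda>x. f x = g x)" shows "near0 (\<lambda>x. pd i f x = pd i g x)"
  using frechet_derivative_near0_cong[OF assms] by eventually_elim (simp add: pd_def)

lemma pd_eqI: "(f has_derivative f') (at x) \<Longrightarrow> pd i f x = f' (axis i 1)"
  unfolding pd_def using frechet_derivative_at by metis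

lemma derivative_eq_sum_pd:
  fixes f :: "real^'n \<Rightarrow> 'b::real_normed_vector"
  assumes "(f has_derivative frechet_derivative f (at x)) (at x)"
  shows "frechet_derivative f (at x) v = (\<Sum>i\<in>UNIV. v $ i *\<^sub>R pd i f x)"
proof -
  have l: "linear (frechet_derivative f (at x))" by (rule has_derivative_linear[OF assms])
  have "frechet_derivative f (at x) (\<Sum>i\<in>UNIV. v $ i *\<^sub>R axis i 1) = (\<Sum>i\<in>UNIV. v $ i *\<^sub>R pd i f x)"
    by (simp add: linear_sum[OF l] linear_cmul[OF l] pd_def)
  moreover have "(\<Sum>i\<in>UNIV. v $ i *\<^sub>R axis i 1) = v"
    by (simp add: vec_eq_iff axis_def if_distrib[of "(*) _"] cong: if_cong)
  ultimately show ?thesis by simp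
qed

lemma pd_commute:
  fixes f :: "real^'n \<Rightarrow> 'b::euclidean_space"
  assumes "smooth_germ f"
  shows "near0 (\<lambda>x. pd i (pd j f) x = pd j (pd i f) x)"
proof -
  obtain U where U: "open U" "0 \<in> U" "smooth_on U f" using assms unfolding smooth_germ_def by blast
  have "pd i (pd j f) x = pd j (pd i f) x" if "x \<in> U" for x
    unfolding pd_def[abs_def] by (rule derivative_commute[OF U(1,3) that])
  then show ?thesis using eventually_nhds_in_open[OF U(1,2)] by (rule eventually_mono[rotated])
qed

section \<open>Weighted scalings and homotopy formulas\<close>

definition weighted :: "('n \<Rightarrow> nat) \<Rightarrow> real \<Rightarrow> real^'n \<Rightarrow> real^'n" where
  "weighted w t x = (\<chi> i. t ^ w i * x $ i)"

lemma weighted_nth [simp]: "weighted w t x $ i = t ^ w i * x $ i"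
  by (simp add: weighted_def)

lemma bounded_linear_weighted: "bounded_linear (weighted w t)"
  unfolding linear_conv_bounded_linear[symmetric]
  by (rule linearI) (simp_all add: vec_eq_iff algebra_simps)

lemma norm_weighted_le:
  assumes "0 \<le> t" "t \<le> 1" shows "norm (weighted w t x) \<le> norm x"
proof (rule norm_le_componentwise_cart)
  fix i show "norm (weighted w t x $ i) \<le> norm (x $ i)"
    using assms power_le_one[OF assms, of "w i"] by (simp add: abs_mult mult_left_le_one_le)
qed

lemma weighted_axis: "weighted w t (axis i 1) = t ^ w i *\<^sub>R axis i (1::real)"
  by (simp add: vec_eq_iff axis_def)

lemma smooth_on_weighted: "smooth_on UNIV (\<lambda>(t, x). weighted w t x)"
proof (rule smooth_on_vec)
  fix i
  have "smooth_on UNIV (\<lambda>p :: real \<times> (real^'a). fst p ^ w i * snd p $ i)"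
    by (intro smooth_on_mult smooth_on_power smooth_on_nth open_UNIV
        smooth_on_ident_linear bounded_linear_fst bounded_linear_snd)
  then show "smooth_on UNIV (\<lambda>p. (case p of (t, x) \<Rightarrow> weighted w t x) $ i)"
    by (simp add: case_prod_unfold)
qed simp

text \<open>Scalings with 0 \<le> t \<le> 1 do not increase the norm, so this open set contains
  [0,1] times the ball, as differentiation under the integral sign requires.\<close>

lemma smooth_on_weighted_compose:
  fixes f :: "real^'n \<Rightarrow> real"
  assumes "smooth_on (ball 0 r) f"
  shows "open {(t, x). weighted w t x \<in> ball 0 r}"
    and "smooth_on {(t, x). weighted w t x \<in> ball 0 r} (\<lambda>(t, x). f (weighted w t x))"
proof -
  let ?T = "{(t, x). weighted w t x \<in> ball 0 r}"
  have T: "?T = (\<lambda>(t, x). weighted w t x) -` ball 0 r" by auto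
  show o: "open ?T"
    unfolding T by (rule open_vimage[OF open_ball smooth_on_derivative(3)[OF smooth_on_weighted]])
  have "smooth_on ?T (\<lambda>p. f ((\<lambda>(t, x). weighted w t x) p))"
    by (rule smooth_on_compose[OF o open_ball assms smooth_on_subset[OF smooth_on_weighted]]) auto
  then show "smooth_on ?T (\<lambda>(t, x). f (weighted w t x))" by (simp add: case_prod_unfold)
qed

text \<open>The relative Poincare homotopy along the orbits of the weighted scaling: up to an exact form,
  a one-form is the contraction of a two-form with the weighted Euler field.\<close>

lemma weighted_homotopy:
  fixes a :: "'n \<Rightarrow> real^'n \<Rightarrow> real"
  assumes "\<And>i. smooth_germ (a i)" and w: "\<And>i. w i > 0"
  obtains \<phi> \<mu> where "smooth_germ \<phi>" "\<And>i j. smooth_germ (\<mu> i j)" "\<And>i j x. \<mu> j i x = - \<mu> i j x"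
    "near0 (\<lambda>x. \<forall>i. a i x = pd i \<phi> x + (\<Sum>j\<in>UNIV. real (w j) * x $ j * \<mu> i j x))"
    "near0 (\<lambda>x. \<forall>i j. pd j (a i) x = pd i (a j) x) \<Longrightarrow> near0 (\<lambda>x. \<forall>i. a i x = pd i \<phi> x)"
proof -
  have "\<exists>r>0. smooth_on (ball 0 r) (a i)" for i
    using smooth_germE[OF assms(1)] by blast
  then obtain R where R: "\<And>i. R i > 0" "\<And>i. smooth_on (ball 0 (R i)) (a i)" by metis
  define r where "r = Min (range R)"
  have r: "r > 0" using R(1) unfolding r_def by (subst Min_gr_iff) auto
  have sm: "smooth_on (ball 0 r) (a i)" for i
    by (rule smooth_on_subset[OF R(2)[of i]]) (auto simp: r_def intro!: subset_ball Min_le)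
  have smd: "smooth_on (ball 0 r) (pd j (a i))" for i j
    unfolding pd_def[abs_def] by (rule smooth_on_derivative[OF sm])
  define T where "T = {(t, x). weighted w t (x::real^'n) \<in> ball 0 r}"
  note oT = smooth_on_weighted_compose(1)[OF sm, of w, folded T_def]
  have inT: "(t, x) \<in> T" if "t \<in> {0..1}" "x \<in> ball 0 r" for t x
    using norm_weighted_le[of t w x] that by (auto simp: T_def)
  have smf: "smooth_on T (\<lambda>p. f (weighted w (fst p) (snd p)))" if "smooth_on (ball 0 r) f" for f :: "real^'n \<Rightarrow> real"
    using smooth_on_weighted_compose(2)[OF that, of w, folded T_def] by (simp add: case_prod_unfold)
  \<comment> \<open>The integrand of the potential: the one-form at the scaled point, applied to the
    velocity of the scaling orbit.\<close>
  define G where "G = (\<lambda>p. \<Sum>j\<in>UNIV. real (w j) * fst p ^ (w j - 1) * (snd p $ j * a j (weighted w (fst p) (snd p))))"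
  have smG: "smooth_on T G"
    unfolding G_def
    by (intro smooth_on_sum smooth_on_mult smooth_on_power smooth_on_nth oT smf sm smooth_on_const
        smooth_on_ident_linear bounded_linear_fst bounded_linear_snd)
  \<comment> \<open>Coefficients of the differential pulled back by the scaling, divided by t
    because the velocity corresponds to the Euler field divided by t. The exponent is a true
    subtraction since the weights are positive.\<close>
  define M where "M = (\<lambda>i j p. fst p ^ (w i + w j - 1) *
      (pd j (a i) (weighted w (fst p) (snd p)) + (- 1) * pd i (a j) (weighted w (fst p) (snd p))))"
  have smM: "smooth_on T (M i j)" for i j
    unfolding M_def
    by (intro smooth_on_add smooth_on_mult smooth_on_power oT smf smd smooth_on_const
        smooth_on_ident_linear bounded_linear_fst bounded_linear_snd)
  define \<phi> where "\<phi> = (\<lambda>x. integral {0..1} (\<lambda>t. G (t, x)))"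
  define \<mu> where "\<mu> = (\<lambda>i j x. integral {0..1} (\<lambda>t. M i j (t, x)))"
  have cont: "continuous_on {0..1} (\<lambda>t. f (weighted w t x))"
    if "smooth_on (ball 0 r) f" "x \<in> ball 0 r" for f :: "real^'n \<Rightarrow> real" and x
  proof -
    have "continuous_on {0..1} (\<lambda>t. f (weighted w (fst (t, x)) (snd (t, x))))"
      by (rule continuous_on_compose2[OF smooth_on_derivative(3)[OF smf[OF that(1)]]])
        (use inT that in \<open>auto intro!: continuous_intros\<close>)
    then show ?thesis by simp
  qed
  have der: "(a i has_derivative frechet_derivative (a i) (at (weighted w t x))) (at (weighted w t x))"
    if "t \<in> {0..1}" "x \<in> ball 0 r" for t x i
    by (rule smooth_on_derivative(2)[OF sm]) (use inT[OF that] in \<open>auto simp: T_def\<close>)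
  have main: "a i x = pd i \<phi> x + (\<Sum>j\<in>UNIV. real (w j) * x $ j * \<mu> i j x)" if x: "x \<in> ball 0 r" for x i
  proof -
    define p where "p = (\<lambda>t. real (w i) * t ^ (w i - 1) * a i (weighted w t x))"
    define q where "q = (\<lambda>j t. t ^ w i * (real (w j) * t ^ (w j - 1) * x $ j) * pd j (a i) (weighted w t x))"
    define q' where "q' = (\<lambda>j t. t ^ w i * (real (w j) * t ^ (w j - 1) * x $ j) * pd i (a j) (weighted w t x))"
    have ip: "p integrable_on {0..1}" and iq: "\<And>j. q j integrable_on {0..1}" "\<And>j. q' j integrable_on {0..1}"
      unfolding p_def q_def q'_def
      by (intro integrable_continuous_interval continuous_intros cont sm smd x)+
    \<comment> \<open>The i-th coefficient of the pulled back form runs from 0 at t = 0, because w i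
      > 0, to \<open>a i x\<close> at t = 1.\<close>
    have 1: "((\<lambda>t. p t + (\<Sum>j\<in>UNIV. q j t)) has_integral (1 ^ w i * a i (weighted w 1 x) - 0 ^ w i * a i (weighted w 0 x))) {0..1}"
    proof (rule fundamental_theorem_of_calculus)
      fix t :: real assume t: "t \<in> {0..1}"
      have "((\<lambda>t. \<Sum>j\<in>UNIV. t ^ w j *\<^sub>R x $ j *\<^sub>R axis j (1::real)) has_derivative
          (\<lambda>h. \<Sum>j\<in>UNIV. (h * (real (w j) * t ^ (w j - 1))) *\<^sub>R x $ j *\<^sub>R axis j 1)) (at t)"
        by (intro has_derivative_sum has_derivative_scaleR_left)
          (auto intro!: derivative_eq_intros simp: mult.commute)
      moreover have "(\<lambda>t. \<Sum>j\<in>UNIV. t ^ w j *\<^sub>R x $ j *\<^sub>R axis j (1::real)) = (\<lambda>t. weighted w t x)"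
        by (simp add: vec_eq_iff fun_eq_iff axis_def if_distrib[of "(*) _"] cong: if_cong)
      moreover have "(\<lambda>h. \<Sum>j\<in>UNIV. (h * (real (w j) * t ^ (w j - 1))) *\<^sub>R x $ j *\<^sub>R axis j (1::real)) =
          (\<lambda>h. h *\<^sub>R (\<chi> j. real (w j) * t ^ (w j - 1) * x $ j))"
        by (simp add: vec_eq_iff fun_eq_iff axis_def if_distrib[of "(*) _"] cong: if_cong)
      ultimately have dw: "((\<lambda>t. weighted w t x) has_derivative
          (\<lambda>h. h *\<^sub>R (\<chi> j. real (w j) * t ^ (w j - 1) * x $ j))) (at t)"
        by simp
      have "((\<lambda>t. a i (weighted w t x)) has_derivative
          (\<lambda>h. frechet_derivative (a i) (at (weighted w t x)) (h *\<^sub>R (\<chi> j. real (w j) * t ^ (w j - 1) * x $ j)))) (at t)"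
        by (rule has_derivative_compose[OF dw der[OF t x]])
      then have "((\<lambda>t. a i (weighted w t x)) has_real_derivative
           (\<Sum>j\<in>UNIV. real (w j) * t ^ (w j - 1) * x $ j * pd j (a i) (weighted w t x))) (at t)"
        unfolding has_field_derivative_def derivative_eq_sum_pd[OF der[OF t x]]
        by (rule has_derivative_eq_rhs) (simp add: fun_eq_iff sum_distrib_left sum_distrib_right mult_ac)
      then have "((\<lambda>t. t ^ w i * a i (weighted w t x)) has_real_derivative
          (real (w i) * t ^ (w i - 1) * a i (weighted w t x) + t ^ w i *
            (\<Sum>j\<in>UNIV. real (w j) * t ^ (w j - 1) * x $ j * pd j (a i) (weighted w t x)))) (at t)"
        by (auto intro!: derivative_eq_intros)
      then have "((\<lambda>t. t ^ w i * a i (weighted w t x)) has_real_derivative p t + (\<Sum>j\<in>UNIV. q j t)) (at t)"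
        by (simp add: p_def q_def sum_distrib_left mult.assoc)
      then show "((\<lambda>t. t ^ w i * a i (weighted w t x)) has_vector_derivative p t + (\<Sum>j\<in>UNIV. q j t)) (at t within {0..1})"
        by (meson has_real_derivative_iff_has_vector_derivative has_vector_derivative_at_within)
    qed simp
    have "weighted w 1 x = x" by (simp add: vec_eq_iff)
    then have A: "a i x = integral {0..1} p + (\<Sum>j\<in>UNIV. integral {0..1} (q j))"
      using integral_unique[OF 1] w[of i]
      by (simp add: integral_add[OF ip integrable_sum] iq integral_sum)
    have "pd i \<phi> x = integral {0..1} (\<lambda>t. frechet_derivative G (at (t, x)) (0, axis i 1))"
      unfolding \<phi>_def
      by (rule pd_eqI[OF parameter_integral_has_derivative[OF oT smG open_ball convex_ball inT x]])
    also have "\<dots> = integral {0..1} (\<lambda>t. p t + (\<Sum>j\<in>UNIV. q' j t))"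
    proof (rule integral_cong)
      fix t :: real assume t: "t \<in> {0..1}"
      have "(G has_derivative frechet_derivative G (at (t, x))) (at (t, x))"
        by (rule smooth_on_derivative(2)[OF smG inT[OF t x]])
      then have 1: "((\<lambda>x. G (t, x)) has_derivative (\<lambda>v. frechet_derivative G (at (t, x)) (0, v))) (at x)"
        by (intro has_derivative_compose[of "\<lambda>x. (t, x)" "\<lambda>v. (0, v)" x UNIV G])
          (auto intro!: derivative_eq_intros)
      have da: "((\<lambda>x. a j (weighted w t x)) has_derivative
          (\<lambda>v. frechet_derivative (a j) (at (weighted w t x)) (weighted w t v))) (at x)" for j
        by (rule has_derivative_compose[OF bounded_linear_imp_has_derivative[OF bounded_linear_weighted] der[OF t x]])
      have "((\<lambda>x. G (t, x)) has_derivative (\<lambda>v. \<Sum>j\<in>UNIV. real (w j) * t ^ (w j - 1) *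
          (x $ j * frechet_derivative (a j) (at (weighted w t x)) (weighted w t v) + v $ j * a j (weighted w t x)))) (at x)"
        unfolding G_def fst_conv snd_conv
        by (intro has_derivative_sum has_derivative_mult_right has_derivative_mult da
            bounded_linear_imp_has_derivative bounded_linear_vec_nth)
      from has_derivative_unique[OF 1 this, THEN fun_cong, of "axis i 1"]
      have "frechet_derivative G (at (t, x)) (0, axis i 1) =
         (\<Sum>j\<in>UNIV. real (w j) * t ^ (w j - 1) *
          (x $ j * (t ^ w i * pd i (a j) (weighted w t x)) + axis i 1 $ j * a j (weighted w t x)))"
        unfolding weighted_axis
        by (simp add: linear_cmul[OF has_derivative_linear[OF der[OF t x]]] pd_def)
      also have "\<dots> = (\<Sum>j\<in>UNIV. q' j t) + (\<Sum>j\<in>UNIV. if j = i then p t else 0)"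
        unfolding sum.distrib[symmetric] by (rule sum.cong) (auto simp: q'_def p_def axis_def algebra_simps)
      finally show "frechet_derivative G (at (t, x)) (0, axis i 1) = p t + (\<Sum>j\<in>UNIV. q' j t)" by simp
    qed
    finally have B: "pd i \<phi> x = integral {0..1} p + (\<Sum>j\<in>UNIV. integral {0..1} (q' j))"
      by (simp add: integral_add[OF ip integrable_sum] iq integral_sum)
    have C: "real (w j) * x $ j * \<mu> i j x = integral {0..1} (q j) - integral {0..1} (q' j)" for j
    proof -
      have "real (w j) * x $ j * \<mu> i j x = integral {0..1} (\<lambda>t. real (w j) * x $ j * M i j (t, x))"
        unfolding \<mu>_def by simp
      also have "\<dots> = integral {0..1} (\<lambda>t. q j t - q' j t)"
      proof (rule integral_cong)
        fix t :: real
        have "t ^ (w i + w j - 1) = t ^ w i * t ^ (w j - 1)"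
          using w[of j] by (simp flip: power_add)
        then show "real (w j) * x $ j * M i j (t, x) = q j t - q' j t"
          by (simp add: M_def q_def q'_def algebra_simps)
      qed
      also have "\<dots> = integral {0..1} (q j) - integral {0..1} (q' j)"
        by (rule integral_diff[OF iq])
      finally show ?thesis .
    qed
    show ?thesis unfolding A B C by (simp add: sum_subtractf)
  qed
  have ball: "near0 (\<lambda>x. x \<in> ball 0 r)" using r by (intro eventually_nhds_in_open) auto
  show ?thesis
  proof (rule that[of \<phi> \<mu>])
    show "smooth_germ \<phi>" unfolding \<phi>_def
      by (rule smooth_germI[OF r smooth_on_parameter_integral[OF oT smG open_ball convex_ball inT]])
    show "smooth_germ (\<mu> i j)" for i j unfolding \<mu>_def
      by (rule smooth_germI[OF r smooth_on_parameter_integral[OF oT smM open_ball convex_ball inT]])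
    show "\<mu> j i x = - \<mu> i j x" for i j x
      unfolding \<mu>_def integral_neg[symmetric] by (rule integral_cong) (simp add: M_def algebra_simps)
    show "near0 (\<lambda>x. \<forall>i. a i x = pd i \<phi> x + (\<Sum>j\<in>UNIV. real (w j) * x $ j * \<mu> i j x))"
      using ball by (rule eventually_mono) (use main in blast)
    \<comment> \<open>A ball around 0 is preserved by the scalings with 0 \<le> t \<le> 1, so
      closedness on it makes the integrand of \<open>\<mu>\<close> vanish for all these t.\<close>
    assume "near0 (\<lambda>x. \<forall>i j. pd j (a i) x = pd i (a j) x)"
    then obtain s where s: "s > 0" "\<And>x. dist x 0 < s \<Longrightarrow> \<forall>i j. pd j (a i) x = pd i (a j) x"
      unfolding eventually_nhds_metric by (elim exE conjE) simp
    have "near0 (\<lambda>x. x \<in> ball 0 s)" using s by (intro eventually_nhds_in_open) auto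
    then show "near0 (\<lambda>x. \<forall>i. a i x = pd i \<phi> x)"
      using ball
    proof eventually_elim
      case (elim x)
      have "\<mu> i j x = integral {0..1} (\<lambda>t::real. 0)" for i j
        unfolding \<mu>_def
      proof (rule integral_cong)
        fix t :: real assume "t \<in> {0..1}"
        then have "dist (weighted w t x) 0 < s"
          using norm_weighted_le[of t w x] elim by auto
        then show "M i j (t, x) = 0" using s(2) by (simp add: M_def)
      qed
      then show ?case using main[OF elim(2)] by simp
    qed
  qed
qed

text \<open>This is the fundamental theorem of calculus along the segment from 0 to x, which is the
  scaling orbit with all weights 1; thus the smoothness of parameter integrals applies to the
  quotients.\<close>

lemma hadamard:
  fixes f :: "real^'n \<Rightarrow> real"
  assumes "smooth_germ f"
  obtains h where "\<And>i. smooth_germ (h i)" "near0 (\<lambda>x. f x = f 0 + (\<Sum>i\<in>UNIV. x $ i * h i x))"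
proof -
  obtain r where r: "r > 0" "smooth_on (ball 0 r) f" using smooth_germE[OF assms] .
  define w where "w = (\<lambda>i::'n. 1::nat)"
  define T where "T = {(t, x). weighted w t x \<in> ball 0 r}"
  note sm = smooth_on_weighted_compose[of r _ w, folded T_def]
  have smd: "smooth_on (ball 0 r) (pd i f)" for i
    unfolding pd_def[abs_def] by (rule smooth_on_derivative[OF r(2)])
  have inT: "(t, x) \<in> T" if "t \<in> {0..1}" "x \<in> ball 0 r" for t x
    using norm_weighted_le[of t w x] that by (auto simp: T_def)
  have w: "weighted w t x = t *\<^sub>R x" for t x by (simp add: vec_eq_iff w_def)
  define h where "h = (\<lambda>i x. integral {0..1} (\<lambda>t. pd i f (weighted w t x)))"
  show ?thesis
  proof (rule that[of h])
    show "smooth_germ (h i)" for i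
    proof -
      have "smooth_on (ball 0 r) (\<lambda>x. integral {0..1} (\<lambda>t. case (t, x) of (t, x) \<Rightarrow> pd i f (weighted w t x)))"
        by (rule smooth_on_parameter_integral[OF sm[OF smd] open_ball convex_ball inT])
      then show ?thesis unfolding h_def by (intro smooth_germI[OF r(1)]) simp
    qed
    have "f x = f 0 + (\<Sum>i\<in>UNIV. x $ i * h i x)" if x: "x \<in> ball 0 r" for x
    proof -
      have cont: "continuous_on {0..1} (\<lambda>t. pd i f (weighted w t x))" for i
      proof -
        have "continuous_on {0..1} (\<lambda>t. case (t, x) of (t, x) \<Rightarrow> pd i f (weighted w t x))"
          by (rule continuous_on_compose2[OF smooth_on_derivative(3)[OF sm(2)[OF smd]]])
            (use inT x in \<open>auto intro!: continuous_intros\<close>)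
        then show ?thesis by simp
      qed
      have "((\<lambda>t. \<Sum>i\<in>UNIV. x $ i * pd i f (weighted w t x)) has_integral f (0 + 1 *\<^sub>R x) - f (0 + 0 *\<^sub>R x)) {0..1}"
      proof (rule fundamental_theorem_of_calculus)
        fix t :: real assume t: "t \<in> {0..1}"
        have d: "(f has_derivative frechet_derivative f (at (0 + t *\<^sub>R x))) (at (0 + t *\<^sub>R x))"
          by (rule smooth_on_derivative(2)[OF r(2)]) (use inT[OF t x] in \<open>simp add: T_def w\<close>)
        from has_derivative_line[OF d]
        have "((\<lambda>t. f (0 + t *\<^sub>R x)) has_real_derivative (\<Sum>i\<in>UNIV. x $ i * pd i f (weighted w t x))) (at t)"
          unfolding derivative_eq_sum_pd[OF d] by (simp add: w)
        then show "((\<lambda>t. f (0 + t *\<^sub>R x)) has_vector_derivative (\<Sum>i\<in>UNIV. x $ i * pd i f (weighted w t x))) (at t within {0..1})"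
          by (meson has_real_derivative_iff_has_vector_derivative has_vector_derivative_at_within)
      qed simp
      from integral_unique[OF this] show ?thesis
        unfolding h_def
        by (subst (asm) integral_sum)
          (auto intro!: integrable_continuous_interval continuous_intros cont)
    qed
    moreover have "near0 (\<lambda>x. x \<in> ball 0 r)" using r(1) by (intro eventually_nhds_in_open) auto
    ultimately show "near0 (\<lambda>x. f x = f 0 + (\<Sum>i\<in>UNIV. x $ i * h i x))"
      by (rule eventually_mono[rotated])
  qed
qed

section \<open>Algebraic restrictions of one-forms to the curve\<close>

definition N3 :: "(real^3) set" where
  "N3 = {x. (x$1)^2 + x$2 * x$3 = 0 \<and> x$1 * x$2 + (x$3)^3 = 0}"

text \<open>For x3 = 0 the first equation leaves the x2-axis. Otherwise t = x1/x3 is the parameter: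
  the two equations give x1^3 = x3^4, hence t^3 = x3.\<close>

lemma N3_cases:
  assumes "x \<in> N3"
  obtains "x$1 = 0" "x$3 = 0" | t where "x$1 = t^4" "x$2 = - (t^5)" "x$3 = t^3"
proof (cases "x$3 = 0")
  case True
  then show ?thesis using assms that(1) by (auto simp: N3_def)
next
  case False
  define t where "t = x$1 / x$3"
  have 1: "(x$1)^2 = - (x$2 * x$3)" "x$1 * x$2 = - ((x$3)^3)" using assms by (auto simp: N3_def)
  have "(x$1)^3 = (x$3)^4" using 1 by algebra
  then have 3: "t^3 = x$3" using False by (simp add: t_def power_divide eval_nat_numeral)
  then have 4: "t^4 = x$1"
    using False power_add[of t 3 1] by (simp add: t_def)
  have "t^5 = t^4 * t" by (simp add: eval_nat_numeral)
  also have "\<dots> = - (x$2)" unfolding 4 using 1(1) False by (simp add: t_def field_simps power2_eq_square)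
  finally show ?thesis using that(2)[of t] 3 4 by simp
qed

definition wt :: "3 \<Rightarrow> nat" where "wt i = (if i = 1 then 4 else if i = 2 then 5 else 3)"

lemma wt_simps [simp]: "wt 1 = 4" "wt 2 = 5" "wt 3 = 3"
  by (simp_all add: wt_def)

text \<open>Gradients of the two equations F1 and F2 of the curve, which have quasi-degrees 8 and
  9.\<close>

definition dF1 :: "real^3 \<Rightarrow> real^3" where "dF1 x = vector [2 * x$1, x$3, x$2]"
definition dF2 :: "real^3 \<Rightarrow> real^3" where "dF2 x = vector [x$2, x$1, 3 * (x$3)^2]"

text \<open>Contractions of the weighted Euler field with \<open>dx\<^sub>2 \<and> dx\<^sub>3\<close>, \<open>dx\<^sub>1 \<and> dx\<^sub>3\<close> and \<open>dx\<^sub>1 \<and> dx\<^sub>2\<close>.\<close>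

definition bA :: "real^3 \<Rightarrow> real^3" where "bA x = vector [0, - (3 * x$3), 5 * x$2]"
definition bB :: "real^3 \<Rightarrow> real^3" where "bB x = vector [- (3 * x$3), 0, 4 * x$1]"
definition bC :: "real^3 \<Rightarrow> real^3" where "bC x = vector [- (5 * x$2), 4 * x$1, 0]"

lemmas form_defs = dF1_def dF2_def bA_def bB_def bC_def

text \<open>A one-form has zero algebraic restriction iff it agrees with an exact form at the points of the
  curve; \<open>snull\<close> is the submodule of those forms whose potential lies in the ideal of the curve.\<close>

definition null :: "(real^3 \<Rightarrow> real^3) \<Rightarrow> bool" where
  "null a \<longleftrightarrow> (\<exists>\<phi> :: real^3 \<Rightarrow> real. smooth_germ \<phi> \<and> near0 (\<lambda>x. x \<in> N3 \<longrightarrow> (\<forall>i. a x $ i = pd i \<phi> x)))"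

definition snull :: "(real^3 \<Rightarrow> real^3) \<Rightarrow> bool" where
  "snull a \<longleftrightarrow> (\<exists>f g :: real^3 \<Rightarrow> real. smooth_germ f \<and> smooth_germ g \<and>
     near0 (\<lambda>x. x \<in> N3 \<longrightarrow> a x = f x *\<^sub>R dF1 x + g x *\<^sub>R dF2 x))"

lemma snullI:
  "smooth_germ f \<Longrightarrow> smooth_germ g \<Longrightarrow> (\<And>x. x \<in> N3 \<Longrightarrow> a x = f x *\<^sub>R dF1 x + g x *\<^sub>R dF2 x) \<Longrightarrow> snull a"
  unfolding snull_def by (intro exI[of _ f] exI[of _ g]) (simp add: always_eventually)

lemma snull_add: assumes "snull a" "snull b" shows "snull (\<lambda>x. a x + b x)"
proof -
  obtain f g f' g' where 1: "smooth_germ f" "smooth_germ g" "smooth_germ f'" "smooth_germ g'"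
    "near0 (\<lambda>x. x \<in> N3 \<longrightarrow> a x = f x *\<^sub>R dF1 x + g x *\<^sub>R dF2 x)"
    "near0 (\<lambda>x. x \<in> N3 \<longrightarrow> b x = f' x *\<^sub>R dF1 x + g' x *\<^sub>R dF2 x)"
    using assms unfolding snull_def by blast
  have "near0 (\<lambda>x. x \<in> N3 \<longrightarrow> a x + b x = (f x + f' x) *\<^sub>R dF1 x + (g x + g' x) *\<^sub>R dF2 x)"
    using 1(5,6) by eventually_elim (simp add: algebra_simps)
  then show ?thesis unfolding snull_def using 1(1-4) by (blast intro: smooth_germ_add)
qed

text \<open>This closure property is the reason to work with \<open>snull\<close>. It fails for
  \<open>null\<close>: dx1 is exact, but x3 dx1 equals - \<open>bB\<close> / 7 up to an exact form,
  and \<open>bB\<close> is one of the seven generators.\<close>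

lemma snull_mult: assumes "smooth_germ h" "snull a" shows "snull (\<lambda>x. h x *\<^sub>R a x)"
proof -
  obtain f g where 1: "smooth_germ f" "smooth_germ g"
    "near0 (\<lambda>x. x \<in> N3 \<longrightarrow> a x = f x *\<^sub>R dF1 x + g x *\<^sub>R dF2 x)"
    using assms unfolding snull_def by blast
  have "near0 (\<lambda>x. x \<in> N3 \<longrightarrow> h x *\<^sub>R a x = (h x * f x) *\<^sub>R dF1 x + (h x * g x) *\<^sub>R dF2 x)"
    using 1(3) by eventually_elim (simp add: algebra_simps)
  then show ?thesis unfolding snull_def using 1(1-2) assms(1) by (blast intro: smooth_germ_mult)
qed

lemma snull_cong:
  assumes "snull a" "near0 (\<lambda>x. a x = b x)" shows "snull b"
proof -
  obtain f g where 1: "smooth_germ f" "smooth_germ g"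
    "near0 (\<lambda>x. x \<in> N3 \<longrightarrow> a x = f x *\<^sub>R dF1 x + g x *\<^sub>R dF2 x)"
    using assms unfolding snull_def by blast
  have "near0 (\<lambda>x. x \<in> N3 \<longrightarrow> b x = f x *\<^sub>R dF1 x + g x *\<^sub>R dF2 x)"
    using 1(3) assms(2) by eventually_elim simp
  then show ?thesis unfolding snull_def using 1(1-2) by blast
qed

lemma pd_mult:
  fixes f g :: "real^'n \<Rightarrow> real"
  assumes "(f has_derivative frechet_derivative f (at x)) (at x)"
    "(g has_derivative frechet_derivative g (at x)) (at x)"
  shows "pd i (\<lambda>x. f x * g x) x = f x * pd i g x + pd i f x * g x"
  using pd_eqI[OF has_derivative_mult[OF assms]] by (simp add: pd_def)

lemma pd_add:
  assumes "(f has_derivative frechet_derivative f (at x)) (at x)"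
    "(g has_derivative frechet_derivative g (at x)) (at x)"
  shows "pd i (\<lambda>x. f x + g x) x = pd i f x + pd i g x"
  using pd_eqI[OF has_derivative_add[OF assms]] by (simp add: pd_def)

lemma pd_diff:
  assumes "(f has_derivative frechet_derivative f (at x)) (at x)"
    "(g has_derivative frechet_derivative g (at x)) (at x)"
  shows "pd i (\<lambda>x. f x - g x) x = pd i f x - pd i g x"
  using pd_eqI[OF has_derivative_diff[OF assms]] by (simp add: pd_def)

lemma pd_coord: "pd i (\<lambda>x :: real^'n. x $ j) x = (if i = j then 1 else 0)"
  by (subst pd_eqI[OF bounded_linear_imp_has_derivative[OF bounded_linear_vec_nth]]) (simp add: axis_def)

text \<open>The potential is f F1 + g F2; the terms containing df and dg drop out where F1 = F2 =
  0.\<close>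

lemma snull_imp_null:
  assumes "snull a" shows "null a"
proof -
  obtain f g where 1: "smooth_germ f" "smooth_germ g"
    "near0 (\<lambda>x. x \<in> N3 \<longrightarrow> a x = f x *\<^sub>R dF1 x + g x *\<^sub>R dF2 x)"
    using assms unfolding snull_def by blast
  let ?F1 = "\<lambda>x::real^3. (x$1)^2 + x$2 * x$3" and ?F2 = "\<lambda>x::real^3. x$1 * x$2 + (x$3)^3"
  have c: "((\<lambda>x :: real^3. x $ i) has_derivative (\<lambda>v. v $ i)) (at x)" for i x
    by (rule bounded_linear_imp_has_derivative[OF bounded_linear_vec_nth])
  have d1: "(?F1 has_derivative (\<lambda>v. dF1 x \<bullet> v)) (at x)" for x
    by (rule has_derivative_eq_rhs[OF has_derivative_add[OF has_derivative_power[OF c] has_derivative_mult[OF c c]]])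
      (simp add: fun_eq_iff inner_vec_def sum_3 dF1_def)
  have d2: "(?F2 has_derivative (\<lambda>v. dF2 x \<bullet> v)) (at x)" for x
    by (rule has_derivative_eq_rhs[OF has_derivative_add[OF has_derivative_mult[OF c c] has_derivative_power[OF c]]])
      (simp add: fun_eq_iff inner_vec_def sum_3 dF2_def)
  have "smooth_germ (\<lambda>x. f x * ?F1 x + g x * ?F2 x)"
    by (intro smooth_germ_intros 1(1,2))
  moreover have "near0 (\<lambda>x. x \<in> N3 \<longrightarrow> (\<forall>i. a x $ i = pd i (\<lambda>x. f x * ?F1 x + g x * ?F2 x) x))"
    using 1(3) smooth_germ_has_derivative[OF 1(1)] smooth_germ_has_derivative[OF 1(2)]
  proof eventually_elim
    case (elim x)
    have "pd i (\<lambda>x. f x * ?F1 x + g x * ?F2 x) x = f x * dF1 x $ i + g x * dF2 x $ i" if "x \<in> N3" for i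
      using that
      by (subst pd_eqI[OF has_derivative_add[OF has_derivative_mult[OF elim(2) d1] has_derivative_mult[OF elim(3) d2]]])
        (simp add: N3_def inner_axis)
    then show ?case using elim(1) by simp
  qed
  ultimately show ?thesis unfolding null_def by blast
qed

lemma null_diff: assumes "null a" "null b" shows "null (\<lambda>x. a x - b x)"
proof -
  obtain f g where 1: "smooth_germ f" "smooth_germ g" "near0 (\<lambda>x. x \<in> N3 \<longrightarrow> (\<forall>i. a x $ i = pd i f x))"
    "near0 (\<lambda>x. x \<in> N3 \<longrightarrow> (\<forall>i. b x $ i = pd i g x))"
    using assms unfolding null_def by blast
  have "near0 (\<lambda>x. x \<in> N3 \<longrightarrow> (\<forall>i. (a x - b x) $ i = pd i (\<lambda>x. f x - g x) x))"
    using 1(3,4) smooth_germ_has_derivative[OF 1(1)] smooth_germ_has_derivative[OF 1(2)]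
    by eventually_elim (simp add: pd_diff)
  then show ?thesis unfolding null_def using smooth_germ_diff[OF 1(1,2)] by blast
qed

lemma null_zero: "null (\<lambda>x. 0)"
proof -
  have "pd i (\<lambda>x::real^3. 0::real) x = 0" for i x by (rule pd_eqI) simp
  then show ?thesis unfolding null_def by (intro exI[of _ "\<lambda>x. 0"]) (simp add: smooth_germ_const)
qed

lemma null_cong:
  assumes "null a" "near0 (\<lambda>x. x \<in> N3 \<longrightarrow> a x = b x)" shows "null b"
proof -
  obtain f where 1: "smooth_germ f" "near0 (\<lambda>x. x \<in> N3 \<longrightarrow> (\<forall>i. a x $ i = pd i f x))"
    using assms unfolding null_def by blast
  have "near0 (\<lambda>x. x \<in> N3 \<longrightarrow> (\<forall>i. b x $ i = pd i f x))"
    using 1(2) assms(2) by eventually_elim simp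
  then show ?thesis unfolding null_def using 1(1) by blast
qed

lemma null_sym: "null (\<lambda>x. a x - b x) \<Longrightarrow> null (\<lambda>x. b x - a x)"
  using null_diff[OF null_zero, of "\<lambda>x. a x - b x"] by simp

lemma null_trans: assumes "null (\<lambda>x. a x - b x)" "null (\<lambda>x. b x - c x)" shows "null (\<lambda>x. a x - c x)"
  using null_diff[OF assms(1) null_sym[OF assms(2)]] by simp

text \<open>Contracting dFk \<and> dxi with the Euler field gives -wi xi dFk along the curve,
  because Fk is quasi-homogeneous and vanishes there. Combinations of these identities, together
  with the equations of the curve, lead to the relations; the witnesses are then checked on the two
  branches. By the first and the last three, only the multiples of \<open>bB\<close> by 1, x3, x1,
  x3^2 and x1 x3 can survive.\<close>

lemma snull_relations:
  "snull (\<lambda>x. x$2 *\<^sub>R bB x)" "snull (\<lambda>x. x$3 *\<^sub>R bC x)" "snull (\<lambda>x. x$1 *\<^sub>R bA x)"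
  "snull (\<lambda>x. x$3 *\<^sub>R bA x + (2 * x$1) *\<^sub>R bB x)"
  "snull (\<lambda>x. x$2 *\<^sub>R bA x + (6 * (x$3)^2) *\<^sub>R bB x)"
  "snull (\<lambda>x. x$1 *\<^sub>R bC x + (3 * (x$3)^2) *\<^sub>R bB x)"
  "snull (\<lambda>x. x$2 *\<^sub>R bC x + (6 * x$1 * x$3) *\<^sub>R bB x)"
  "snull (\<lambda>x. (x$1)^2 *\<^sub>R bB x)" "snull (\<lambda>x. (x$3)^3 *\<^sub>R bB x)" "snull (\<lambda>x. (x$1 * (x$3)^2) *\<^sub>R bB x)"
proof -
  show "snull (\<lambda>x. x$2 *\<^sub>R bB x)"
    by (rule snullI[of "\<lambda>x. x$1" "\<lambda>x. - x$3"], (intro smooth_germ_intros)+, erule N3_cases)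
      (auto simp: form_defs vec_eq_iff forall_3 eval_nat_numeral algebra_simps)
  show "snull (\<lambda>x. x$3 *\<^sub>R bC x)"
    by (rule snullI[of "\<lambda>x. 3 * x$1" "\<lambda>x. x$3"], (intro smooth_germ_intros)+, erule N3_cases)
      (auto simp: form_defs vec_eq_iff forall_3 eval_nat_numeral algebra_simps)
  show "snull (\<lambda>x. x$1 *\<^sub>R bA x)"
    by (rule snullI[of "\<lambda>x. - x$1" "\<lambda>x. - 2 * x$3"], (intro smooth_germ_intros)+, erule N3_cases)
      (auto simp: form_defs vec_eq_iff forall_3 eval_nat_numeral algebra_simps)
  show "snull (\<lambda>x. x$3 *\<^sub>R bA x + (2 * x$1) *\<^sub>R bB x)"
    by (rule snullI[of "\<lambda>x. - 3 * x$3" "\<lambda>x. 0"], (intro smooth_germ_intros)+, erule N3_cases)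
      (auto simp: form_defs vec_eq_iff forall_3 eval_nat_numeral algebra_simps)
  show "snull (\<lambda>x. x$2 *\<^sub>R bA x + (6 * (x$3)^2) *\<^sub>R bB x)"
    by (rule snullI[of "\<lambda>x. 5 * x$2" "\<lambda>x. 8 * x$1"], (intro smooth_germ_intros)+, erule N3_cases)
      (auto simp: form_defs vec_eq_iff forall_3 eval_nat_numeral algebra_simps)
  show "snull (\<lambda>x. x$1 *\<^sub>R bC x + (3 * (x$3)^2) *\<^sub>R bB x)"
    by (rule snullI[of "\<lambda>x. 0" "\<lambda>x. 4 * x$1"], (intro smooth_germ_intros)+, erule N3_cases)
      (auto simp: form_defs vec_eq_iff forall_3 eval_nat_numeral algebra_simps)
  show "snull (\<lambda>x. x$2 *\<^sub>R bC x + (6 * x$1 * x$3) *\<^sub>R bB x)"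
    by (rule snullI[of "\<lambda>x. - 9 * (x$3)^2" "\<lambda>x. - 5 * x$2"], (intro smooth_germ_intros)+, erule N3_cases)
      (auto simp: form_defs vec_eq_iff forall_3 eval_nat_numeral algebra_simps)
  show "snull (\<lambda>x. (x$1)^2 *\<^sub>R bB x)"
    by (rule snullI[of "\<lambda>x. - (x$1 * x$3)" "\<lambda>x. (x$3)^2"], (intro smooth_germ_intros)+, erule N3_cases)
      (auto simp: form_defs vec_eq_iff forall_3 eval_nat_numeral algebra_simps)
  show "snull (\<lambda>x. (x$3)^3 *\<^sub>R bB x)"
    by (rule snullI[of "\<lambda>x. - ((x$1)^2)" "\<lambda>x. x$1 * x$3"], (intro smooth_germ_intros)+, erule N3_cases)
      (auto simp: form_defs vec_eq_iff forall_3 eval_nat_numeral algebra_simps)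
  show "snull (\<lambda>x. (x$1 * (x$3)^2) *\<^sub>R bB x)"
    by (rule snullI[of "\<lambda>x. x$1 * x$2" "\<lambda>x. (x$1)^2"], (intro smooth_germ_intros)+, erule N3_cases)
      (auto simp: form_defs vec_eq_iff forall_3 eval_nat_numeral algebra_simps)
qed

text \<open>The coefficients are indexed by the quasi-degrees of the seven generators.\<close>

definition tform :: "(nat \<Rightarrow> real) \<Rightarrow> real^3 \<Rightarrow> real^3" where
  "tform d x = (d 7 + d 10 * x$3 + d 11 * x$1 + d 13 * (x$3)^2 + d 14 * (x$1 * x$3)) *\<^sub>R bB x +
     d 8 *\<^sub>R bA x + d 9 *\<^sub>R bC x"

text \<open>Every coefficient is expanded just far enough for the relations to apply. The integers
  come from x3 A = -2 x1 B, x2 A = -6 x3^2 B, x1 C = -3 x3^2 B and x2 C = -6 x1 x3 B modulo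
  \<open>snull\<close>, where A, B, C stand for \<open>bA\<close>, \<open>bB\<close>,
  \<open>bC\<close>. What is left in front of x3^2 B and x1 x3 B is collected in \<open>H\<close>
  and \<open>K\<close>, and only their values at 0 matter, since multiplying these two generators by
  any coordinate gives an element of \<open>snull\<close>.\<close>

lemma reduce_form:
  fixes a0 a3 c0 b0 b1 b3 :: real
    and A1 A2 A31 A32 A33 C1 C2 C3 B2 B11 B13 B33 :: "real^3 \<Rightarrow> real"
  assumes sm: "smooth_germ A1" "smooth_germ A2" "smooth_germ A31" "smooth_germ A32" "smooth_germ A33"
    "smooth_germ C1" "smooth_germ C2" "smooth_germ C3" "smooth_germ B2" "smooth_germ B11" "smooth_germ B13" "smooth_germ B33"
    and hA: "near0 (\<lambda>x. hA x = a0 + x$1 * A1 x + x$2 * A2 x + x$3 * (a3 + x$1 * A31 x + x$2 * A32 x + x$3 * A33 x))"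
    and hC: "near0 (\<lambda>x. hC x = c0 + x$1 * C1 x + x$2 * C2 x + x$3 * C3 x)"
    and hB: "near0 (\<lambda>x. hB x = b0 + b1 * x$1 + b3 * x$3 + x$2 * B2 x + (x$1)^2 * B11 x + x$1 * x$3 * B13 x + (x$3)^2 * B33 x)"
    and d: "d 7 = b0" "d 8 = a0" "d 9 = c0" "d 10 = b3" "d 11 = b1 - 2 * a3"
      "d 13 = B33 0 - 6 * A2 0 - 3 * C1 0" "d 14 = B13 0 - 2 * A33 0 - 6 * C2 0"
  shows "snull (\<lambda>x. hA x *\<^sub>R bA x + hB x *\<^sub>R bB x + hC x *\<^sub>R bC x - tform d x)"
proof -
  define H where "H = (\<lambda>x. B33 x - 6 * A2 x - 3 * C1 x)"
  define K where "K = (\<lambda>x. B13 x - 2 * A33 x - 6 * C2 x)"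
  have smH: "smooth_germ H" and smK: "smooth_germ K"
    unfolding H_def K_def by (intro smooth_germ_intros sm)+
  obtain h where h: "\<And>i. smooth_germ (h i)" "near0 (\<lambda>x. H x = H 0 + (\<Sum>i\<in>UNIV. x $ i * h i x))"
    using hadamard[OF smH] by blast
  obtain k where k: "\<And>i. smooth_germ (k i)" "near0 (\<lambda>x. K x = K 0 + (\<Sum>i\<in>UNIV. x $ i * k i x))"
    using hadamard[OF smK] by blast
  have "snull (\<lambda>x. A1 x *\<^sub>R (x$1 *\<^sub>R bA x) +
      (A2 x *\<^sub>R (x$2 *\<^sub>R bA x + (6 * (x$3)^2) *\<^sub>R bB x) +
      ((a3 + x$1 * A31 x + x$2 * A32 x + x$3 * A33 x) *\<^sub>R (x$3 *\<^sub>R bA x + (2 * x$1) *\<^sub>R bB x) +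
      ((- 2 * A31 x + x$3 * k 1 x + B11 x) *\<^sub>R ((x$1)^2 *\<^sub>R bB x) +
      ((B2 x - 2 * x$1 * A32 x + (x$3)^2 * h 2 x + x$1 * x$3 * k 2 x) *\<^sub>R (x$2 *\<^sub>R bB x) +
      (C1 x *\<^sub>R (x$1 *\<^sub>R bC x + (3 * (x$3)^2) *\<^sub>R bB x) +
      (C2 x *\<^sub>R (x$2 *\<^sub>R bC x + (6 * x$1 * x$3) *\<^sub>R bB x) +
      (C3 x *\<^sub>R (x$3 *\<^sub>R bC x) +
      ((h 1 x + k 3 x) *\<^sub>R ((x$1 * (x$3)^2) *\<^sub>R bB x) +
       h 3 x *\<^sub>R ((x$3)^3 *\<^sub>R bB x))))))))))" (is "snull ?R")
    by (intro snull_add snull_mult snull_relations smooth_germ_intros sm h(1) k(1))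
  then show ?thesis
  proof (rule snull_cong)
    show "near0 (\<lambda>x. ?R x = hA x *\<^sub>R bA x + hB x *\<^sub>R bB x + hC x *\<^sub>R bC x - tform d x)"
      using hA hB hC h(2) k(2)
    proof eventually_elim
      case (elim x)
      have B33: "B33 x = H x + 6 * A2 x + 3 * C1 x" and B13: "B13 x = K x + 2 * A33 x + 6 * C2 x"
        by (simp_all add: H_def K_def)
      have d': "d 13 = H 0" "d 14 = K 0" by (simp_all add: d H_def K_def)
      have H: "H x = H 0 + x$1 * h 1 x + x$2 * h 2 x + x$3 * h 3 x"
        and K: "K x = K 0 + x$1 * k 1 x + x$2 * k 2 x + x$3 * k 3 x"
        using elim(4,5) by (simp_all add: sum_3)
      have "?R x = (hA x - a0) *\<^sub>R bA x + (hC x - c0) *\<^sub>R bC x +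
         (hB x - (b0 + b3 * x$3 + (b1 - 2 * a3) * x$1 + H 0 * (x$3)^2 + K 0 * (x$1 * x$3))) *\<^sub>R bB x"
        unfolding elim(1-3) B33 B13 H K
        by (simp add: vec_eq_iff, simp add: algebra_simps eval_nat_numeral)
      then show ?case
        unfolding tform_def d(1-5) d' by (simp add: algebra_simps)
    qed
  qed
qed

lemma wt_homotopy:
  fixes a :: "real^3 \<Rightarrow> real^3"
  assumes "smooth_germ a"
  shows "\<exists>\<phi> \<mu>. smooth_germ \<phi> \<and> (\<forall>i j. smooth_germ (\<mu> i j)) \<and> (\<forall>i j x. \<mu> j i x = - \<mu> i j x) \<and>
    near0 (\<lambda>x. \<forall>i. a x $ i = pd i \<phi> x + (\<Sum>j\<in>UNIV. real (wt j) * x $ j * \<mu> i j x)) \<and>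
    (near0 (\<lambda>x. \<forall>i j. pd j (\<lambda>x. a x $ i) x = pd i (\<lambda>x. a x $ j) x) \<longrightarrow> near0 (\<lambda>x. \<forall>i. a x $ i = pd i \<phi> x))"
proof (rule weighted_homotopy[of "\<lambda>i x. a x $ i" wt])
  show "smooth_germ (\<lambda>x. a x $ i)" for i by (rule smooth_germ_nth[OF assms])
  show "wt i > 0" for i by (simp add: wt_def)
qed blast

lemma algebraic_restriction:
  fixes a :: "real^3 \<Rightarrow> real^3"
  assumes "smooth_germ a"
  obtains d where "null (\<lambda>x. a x - tform d x)"
proof -
  obtain \<phi> \<mu> where \<phi>: "smooth_germ \<phi>" and \<mu>: "\<And>i j. smooth_germ (\<mu> i j)" "\<And>i j x. \<mu> j i x = - \<mu> i j x"
    and eq: "near0 (\<lambda>x. \<forall>i. a x $ i = pd i \<phi> x + (\<Sum>j\<in>UNIV. real (wt j) * x $ j * \<mu> i j x))"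
    using wt_homotopy[OF assms] by blast
  \<comment> \<open>By antisymmetry three of the functions \<open>\<mu> i j\<close> remain; the
    minus signs match the orientation of \<open>bA\<close>, \<open>bB\<close> and
    \<open>bC\<close>.\<close>
  define hA hB hC where "hA = (\<lambda>x. - \<mu> 2 3 x)" and "hB = (\<lambda>x. - \<mu> 1 3 x)" and "hC = (\<lambda>x. - \<mu> 1 2 x)"
  have sm: "smooth_germ hA" "smooth_germ hB" "smooth_germ hC"
    unfolding hA_def hB_def hC_def by (intro smooth_germ_minus \<mu>)+
  have had: "\<exists>h. (\<forall>i. smooth_germ (h i)) \<and> near0 (\<lambda>x. f x = f 0 + x$1 * h 1 x + x$2 * h 2 x + x$3 * h (3::3) x)"
    if f: "smooth_germ f" for f :: "real^3 \<Rightarrow> real"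
  proof -
    obtain h where h: "\<And>i. smooth_germ (h i)" "near0 (\<lambda>x. f x = f 0 + (\<Sum>i\<in>UNIV. x $ i * h i x))"
      using hadamard[OF f] by blast
    show ?thesis
      by (intro exI[of _ h] conjI allI h eventually_mono[OF h(2)]) (simp add: sum_3)
  qed
  obtain A where A: "\<And>i. smooth_germ (A i)" "near0 (\<lambda>x. hA x = hA 0 + x$1 * A 1 x + x$2 * A 2 x + x$3 * A (3::3) x)"
    using had[OF sm(1)] by blast
  obtain A' where A': "\<And>i. smooth_germ (A' i)" "near0 (\<lambda>x. A 3 x = A 3 0 + x$1 * A' 1 x + x$2 * A' 2 x + x$3 * A' (3::3) x)"
    using had[OF A(1)] by blast
  obtain C where C: "\<And>i. smooth_germ (C i)" "near0 (\<lambda>x. hC x = hC 0 + x$1 * C 1 x + x$2 * C 2 x + x$3 * C (3::3) x)"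
    using had[OF sm(3)] by blast
  obtain B where B: "\<And>i. smooth_germ (B i)" "near0 (\<lambda>x. hB x = hB 0 + x$1 * B 1 x + x$2 * B 2 x + x$3 * B (3::3) x)"
    using had[OF sm(2)] by blast
  obtain B' where B': "\<And>i. smooth_germ (B' i)" "near0 (\<lambda>x. B 1 x = B 1 0 + x$1 * B' 1 x + x$2 * B' 2 x + x$3 * B' (3::3) x)"
    using had[OF B(1)] by blast
  obtain B'' where B'': "\<And>i. smooth_germ (B'' i)" "near0 (\<lambda>x. B 3 x = B 3 0 + x$1 * B'' 1 x + x$2 * B'' 2 x + x$3 * B'' (3::3) x)"
    using had[OF B(1)] by blast
  have eA: "near0 (\<lambda>x. hA x = hA 0 + x$1 * A 1 x + x$2 * A 2 x + x$3 * (A 3 0 + x$1 * A' 1 x + x$2 * A' 2 x + x$3 * A' 3 x))"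
    using A(2) A'(2) by eventually_elim simp
  have eB: "near0 (\<lambda>x. hB x = hB 0 + B 1 0 * x$1 + B 3 0 * x$3 + x$2 * (B 2 x + x$1 * B' 2 x + x$3 * B'' 2 x) +
      (x$1)^2 * B' 1 x + x$1 * x$3 * (B' 3 x + B'' 1 x) + (x$3)^2 * B'' 3 x)"
    using B(2) B'(2) B''(2) by eventually_elim (simp add: algebra_simps power2_eq_square)
  \<comment> \<open>The last case also catches every other index; \<open>tform\<close> reads only
    the seven quasi-degrees.\<close>
  define d where "d = (\<lambda>k::nat. if k = 7 then hB 0 else if k = 8 then hA 0 else if k = 9 then hC 0
    else if k = 10 then B 3 0 else if k = 11 then B 1 0 - 2 * A 3 0
    else if k = 13 then B'' 3 0 - 6 * A 2 0 - 3 * C 1 0 else (B' 3 0 + B'' 1 0) - 2 * A' 3 0 - 6 * C 2 0)"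
  have "snull (\<lambda>x. hA x *\<^sub>R bA x + hB x *\<^sub>R bB x + hC x *\<^sub>R bC x - tform d x)"
    by (rule reduce_form[OF A(1) A(1) A'(1) A'(1) A'(1) C(1) C(1) C(1) _ B'(1) _ B''(1) eA C(2) eB])
      (simp_all add: d_def, (intro smooth_germ_intros B(1) B'(1) B''(1))+)
  then have 1: "null (\<lambda>x. hA x *\<^sub>R bA x + hB x *\<^sub>R bB x + hC x *\<^sub>R bC x - tform d x)"
    by (rule snull_imp_null)
  have "null (\<lambda>x. a x - (hA x *\<^sub>R bA x + hB x *\<^sub>R bB x + hC x *\<^sub>R bC x))"
    unfolding null_def
  proof (intro exI[of _ \<phi>] conjI \<phi> eventually_mono[OF eq])
    fix x assume e: "\<forall>i. a x $ i = pd i \<phi> x + (\<Sum>j\<in>UNIV. real (wt j) * x $ j * \<mu> i j x)"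
    have z: "\<mu> i i x = 0" for i using \<mu>(2)[of i i x] by simp
    have "(a x - (hA x *\<^sub>R bA x + hB x *\<^sub>R bB x + hC x *\<^sub>R bC x)) $ i = pd i \<phi> x" for i
      using e[rule_format, of i] exhaust_3[of i] z \<mu>(2)[of 2 1 x] \<mu>(2)[of 3 1 x] \<mu>(2)[of 3 2 x]
      by (auto simp: sum_3 hA_def hB_def hC_def form_defs)
    then show "x \<in> N3 \<longrightarrow> (\<forall>i. (a x - (hA x *\<^sub>R bA x + hB x *\<^sub>R bB x + hC x *\<^sub>R bC x)) $ i = pd i \<phi> x)" by blast
  qed
  from null_trans[OF this 1] show ?thesis by (rule that)
qed

lemma closed_imp_null:
  fixes a :: "real^3 \<Rightarrow> real^3"
  assumes "smooth_germ a" "near0 (\<lambda>x. \<forall>i j. pd j (\<lambda>x. a x $ i) x = pd i (\<lambda>x. a x $ j) x)"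
  shows "null a"
proof -
  obtain \<phi> where "smooth_germ \<phi>" "near0 (\<lambda>x. \<forall>i. a x $ i = pd i \<phi> x)"
    using wt_homotopy[OF assms(1)] assms(2) by blast
  then show ?thesis
    unfolding null_def by (intro exI[of _ \<phi>] conjI) (auto elim: eventually_mono)
qed

section \<open>Quasi-homogeneous reparametrisations\<close>

definition pullback :: "(real^'n \<Rightarrow> real^'m) \<Rightarrow> (real^'m \<Rightarrow> real^'m) \<Rightarrow> real^'n \<Rightarrow> real^'n" where
  "pullback \<psi> a x = (\<chi> j. \<Sum>i\<in>UNIV. a (\<psi> x) $ i * pd j (\<lambda>x. \<psi> x $ i) x)"

lemma pd_nth:
  fixes \<psi> :: "real^'n \<Rightarrow> real^'m"
  assumes "(\<psi> has_derivative frechet_derivative \<psi> (at x)) (at x)"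
  shows "pd j (\<lambda>x. \<psi> x $ i) x = pd j \<psi> x $ i"
  using pd_eqI[OF bounded_linear.has_derivative[OF bounded_linear_vec_nth assms]] by (simp add: pd_def)

lemma pd_compose:
  fixes \<psi> :: "real^'n \<Rightarrow> real^'m" and f :: "real^'m \<Rightarrow> 'c::real_normed_vector"
  assumes \<psi>: "(\<psi> has_derivative frechet_derivative \<psi> (at x)) (at x)"
    and f: "(f has_derivative frechet_derivative f (at (\<psi> x))) (at (\<psi> x))"
  shows "pd j (\<lambda>x. f (\<psi> x)) x = (\<Sum>i\<in>UNIV. pd j (\<lambda>x. \<psi> x $ i) x *\<^sub>R pd i f (\<psi> x))"
proof -
  have "pd j (\<lambda>x. f (\<psi> x)) x = frechet_derivative f (at (\<psi> x)) (frechet_derivative \<psi> (at x) (axis j 1))"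
    by (rule pd_eqI[OF has_derivative_compose[OF \<psi> f]])
  then show ?thesis
    unfolding derivative_eq_sum_pd[OF f] pd_nth[OF \<psi>] by (simp add: pd_def[of j \<psi>])
qed

lemma near0_smooth_compose:
  assumes "near0 R" "smooth_germ g" "g 0 = 0" shows "near0 (\<lambda>x. R (g x))"
  by (rule near0_compose[OF assms(1) smooth_germ_continuous[OF assms(2)] assms(3)])

lemma null_pullback:
  assumes "null a" and \<psi>: "smooth_germ \<psi>" "\<psi> 0 = 0" and N: "near0 (\<lambda>x. x \<in> N3 \<longrightarrow> \<psi> x \<in> N3)"
  shows "null (pullback \<psi> a)"
proof -
  obtain f where f: "smooth_germ f" "near0 (\<lambda>x. x \<in> N3 \<longrightarrow> (\<forall>i. a x $ i = pd i f x))"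
    using assms(1) unfolding null_def by blast
  have "near0 (\<lambda>x. x \<in> N3 \<longrightarrow> (\<forall>i. pullback \<psi> a x $ i = pd i (\<lambda>x. f (\<psi> x)) x))"
    using N near0_smooth_compose[OF f(2) \<psi>] smooth_germ_has_derivative[OF \<psi>(1)]
      near0_smooth_compose[OF smooth_germ_has_derivative[OF f(1)] \<psi>]
    by eventually_elim (simp add: pullback_def pd_compose mult.commute)
  then show ?thesis unfolding null_def using smooth_germ_compose[OF f(1) \<psi>] by blast
qed

definition quasi :: "(real^3 \<Rightarrow> real) \<Rightarrow> real^3 \<Rightarrow> real^3" where
  "quasi l x = weighted wt (l x) x"

lemma quasi_nth: "quasi l x $ i = l x ^ wt i * x $ i"
  by (simp add: quasi_def)

lemma quasi_0 [simp]: "quasi l 0 = 0"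
  by (simp add: vec_eq_iff quasi_nth)

lemma smooth_germ_quasi: "smooth_germ l \<Longrightarrow> smooth_germ (quasi l)"
  by (rule smooth_germ_vec) (auto simp: quasi_nth intro: smooth_germ_intros)

lemma weighted_N3_iff:
  assumes "t \<noteq> 0" shows "weighted wt t x \<in> N3 \<longleftrightarrow> x \<in> N3"
proof -
  have "(t ^ 4 * x$1)^2 + (t ^ 5 * x$2) * (t ^ 3 * x$3) = t^8 * ((x$1)^2 + x$2 * x$3)"
    "(t ^ 4 * x$1) * (t ^ 5 * x$2) + (t ^ 3 * x$3)^3 = t^9 * (x$1 * x$2 + (x$3)^3)"
    by (simp_all add: eval_nat_numeral algebra_simps)
  then show ?thesis using assms by (simp add: N3_def)
qed

lemma near0_nonzero: "smooth_germ l \<Longrightarrow> l 0 \<noteq> 0 \<Longrightarrow> near0 (\<lambda>x. l x \<noteq> (0::real))"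
  using smooth_germ_continuous unfolding isCont_def tendsto_at_iff_tendsto_nhds
  by (blast intro: tendsto_imp_eventually_ne)

definition stform :: "(real^3 \<Rightarrow> real) \<Rightarrow> (nat \<Rightarrow> real) \<Rightarrow> real^3 \<Rightarrow> real^3" where
  "stform l d x = (d 8 * l x ^ 8) *\<^sub>R bA x +
     (d 7 * l x ^ 7 + d 10 * l x ^ 10 * x$3 + d 11 * l x ^ 11 * x$1 + d 13 * l x ^ 13 * (x$3)^2 +
      d 14 * l x ^ 14 * (x$1 * x$3)) *\<^sub>R bB x + (d 9 * l x ^ 9) *\<^sub>R bC x"

text \<open>The differential of \<open>l\<close> drops out: it enters the pullback of a form only
  through the value of the form on the Euler field, and the generators, being contractions with that
  field, vanish on it by antisymmetry. Hence each generator is multiplied by a power of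
  \<open>l\<close>.\<close>

lemma pullback_quasi_tform:
  assumes "smooth_germ l" shows "near0 (\<lambda>x. pullback (quasi l) (tform d) x = stform l d x)"
  using smooth_germ_has_derivative[OF assms]
proof eventually_elim
  case (elim x)
  have p: "pd j (\<lambda>x. quasi l x $ i) x =
      real (wt i) * l x ^ (wt i - 1) * pd j l x * x $ i + l x ^ wt i * (if j = i then 1 else 0)" for i j
    unfolding quasi_nth
    by (subst pd_eqI[OF has_derivative_mult[OF has_derivative_power[OF elim]
          bounded_linear_imp_has_derivative[OF bounded_linear_vec_nth]]])
      (simp add: axis_def pd_def)
  define q L where "q = quasi l x" and "L = l x"
  have q: "q $ i = L ^ wt i * x $ i" for i by (simp add: q_def L_def quasi_nth)
  have p: "pd j (\<lambda>x. quasi l x $ i) x =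
      real (wt i) * L ^ (wt i - 1) * pd j l x * x $ i + L ^ wt i * (if j = i then 1 else 0)" for i j
    by (simp add: p L_def)
  define s where "s = d 7 + d 10 * q$3 + d 11 * q$1 + d 13 * (q$3)^2 + d 14 * (q$1 * q$3)"
  have "pullback (quasi l) (tform d) x $ j = stform l d x $ j" for j
  proof -
    have b: "(\<Sum>i\<in>UNIV. bA q $ i * pd j (\<lambda>x. quasi l x $ i) x) = L^8 * bA x $ j \<and>
      (\<Sum>i\<in>UNIV. bB q $ i * pd j (\<lambda>x. quasi l x $ i) x) = L^7 * bB x $ j \<and>
      (\<Sum>i\<in>UNIV. bC q $ i * pd j (\<lambda>x. quasi l x $ i) x) = L^9 * bC x $ j"
      using exhaust_3[of j]
      by (elim disjE; simp add: form_defs p q sum_3 eval_nat_numeral; simp add: algebra_simps)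
    have "pullback (quasi l) (tform d) x $ j = (\<Sum>i\<in>UNIV. tform d q $ i * pd j (\<lambda>x. quasi l x $ i) x)"
      by (simp add: pullback_def q_def)
    also have "\<dots> = s * (\<Sum>i\<in>UNIV. bB q $ i * pd j (\<lambda>x. quasi l x $ i) x) +
      d 8 * (\<Sum>i\<in>UNIV. bA q $ i * pd j (\<lambda>x. quasi l x $ i) x) +
      d 9 * (\<Sum>i\<in>UNIV. bC q $ i * pd j (\<lambda>x. quasi l x $ i) x)"
      unfolding tform_def s_def[symmetric]
      by (simp add: sum.distrib sum_distrib_left distrib_right mult.assoc)
    also have "\<dots> = s * (L^7 * bB x $ j) + d 8 * (L^8 * bA x $ j) + d 9 * (L^9 * bC x $ j)"
      using b by simp
    also have "s * L^7 = d 7 * L ^ 7 + d 10 * L ^ 10 * x$3 + d 11 * L ^ 11 * x$1 + d 13 * L ^ 13 * (x$3)^2 +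
      d 14 * L ^ 14 * (x$1 * x$3)"
      by (simp add: s_def q, simp add: eval_nat_numeral algebra_simps)
    then have "s * (L^7 * bB x $ j) = (d 7 * L ^ 7 + d 10 * L ^ 10 * x$3 + d 11 * L ^ 11 * x$1 +
      d 13 * L ^ 13 * (x$3)^2 + d 14 * L ^ 14 * (x$1 * x$3)) * bB x $ j"
      by (simp add: mult.assoc[symmetric])
    finally show ?thesis by (simp add: stform_def L_def)
  qed
  then show ?case by (simp add: vec_eq_iff)
qed

lemma pullback_diff: "pullback \<psi> (\<lambda>x. a x - b x) x = pullback \<psi> a x - pullback \<psi> b x"
  by (simp add: vec_eq_iff pullback_def sum_subtractf algebra_simps)

section \<open>Moves on the coefficient vectors\<close>

definition step :: "(nat \<Rightarrow> real) \<Rightarrow> (nat \<Rightarrow> real) \<Rightarrow> bool" where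
  "step d d' \<longleftrightarrow> (\<exists>l. smooth_germ l \<and> l 0 \<noteq> 0 \<and> snull (\<lambda>x. stform l d x - tform d' x))"

lemma step_pullback:
  assumes "step d d'" "null (\<lambda>x. a x - tform d x)"
  obtains l where "smooth_germ l" "l 0 \<noteq> 0" "null (\<lambda>x. pullback (quasi l) a x - tform d' x)"
proof -
  obtain l where l: "smooth_germ l" "l 0 \<noteq> 0" "snull (\<lambda>x. stform l d x - tform d' x)"
    using assms(1) unfolding step_def by blast
  have "near0 (\<lambda>x. x \<in> N3 \<longrightarrow> quasi l x \<in> N3)"
    using near0_nonzero[OF l(1,2)] by eventually_elim (simp add: quasi_def weighted_N3_iff)
  from null_pullback[OF assms(2) smooth_germ_quasi[OF l(1)] quasi_0 this]
  have "null (\<lambda>x. pullback (quasi l) a x - stform l d x)"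
    by (rule null_cong) (use pullback_quasi_tform[OF l(1), of d] in eventually_elim, simp add: pullback_diff)
  from null_trans[OF this snull_imp_null[OF l(3)]] l show ?thesis by (intro that)
qed

text \<open>The quotient ((1 + u y)^k - 1 - k u y) / y^2, given by a recursion that makes it visibly
  a polynomial in y.\<close>

primrec binom_rest :: "real \<Rightarrow> nat \<Rightarrow> real \<Rightarrow> real" where
  "binom_rest u 0 y = 0"
| "binom_rest u (Suc k) y = binom_rest u k y * (1 + u * y) + real k * u^2"

lemma binom_rest: "(1 + u * y) ^ k = 1 + real k * u * y + y^2 * binom_rest u k y"
  by (induction k) (simp_all add: algebra_simps power2_eq_square)

lemma smooth_germ_binom_rest:
  "smooth_germ m \<Longrightarrow> smooth_germ (\<lambda>x. binom_rest u k (m x))"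
  by (induction k) (auto intro!: smooth_germ_intros)

lemma stepI:
  assumes "smooth_germ l" "l 0 \<noteq> 0"
    and "snull (\<lambda>x. (d 8 * l x ^ 8) *\<^sub>R bA x +
     (d 7 * l x ^ 7 + d 10 * l x ^ 10 * x$3 + d 11 * l x ^ 11 * x$1 + d 13 * l x ^ 13 * (x$3)^2 +
      d 14 * l x ^ 14 * (x$1 * x$3)) *\<^sub>R bB x + (d 9 * l x ^ 9) *\<^sub>R bC x - tform d' x)"
  shows "step d d'"
  using assms unfolding step_def stform_def by blast

text \<open>Degree k is multiplied by 1 + k u x3 + ..., which feeds degree k + 3: 7 into 10, and 8
  into 11 with factor -16 = -2 * 8 since x3 \<open>bA\<close> reduces to -2 x1 \<open>bB\<close>.
  The quadratic parts of the powers carry 7 into 13 and 8 into 14, whence the two provisos.\<close>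

lemma step_x3:
  "\<exists>d'. step d d' \<and> d' 7 = d 7 \<and> d' 8 = d 8 \<and> d' 9 = d 9 \<and> d' 10 = d 10 + 7 * u * d 7 \<and>
     d' 11 = d 11 - 16 * u * d 8 \<and> (d 7 = 0 \<longrightarrow> d' 13 = d 13 + 10 * u * d 10) \<and>
     (d 8 = 0 \<longrightarrow> d' 14 = d 14 + 11 * u * d 11)"
proof -
  let ?l = "\<lambda>x::real^3. 1 + u * x$3" and ?q = "\<lambda>k (x::real^3). binom_rest u k (x$3)"
  let ?B33 = "\<lambda>x. d 7 * ?q 7 x + d 10 * (10 * u + x$3 * ?q 10 x) + d 13 * ?l x ^ 13"
  let ?B13 = "\<lambda>x. d 11 * (11 * u + x$3 * ?q 11 x) + d 14 * ?l x ^ 14"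
  let ?A33 = "\<lambda>x. d 8 * ?q 8 x"
  \<comment> \<open>Each entry keeps the shape demanded by \<open>reduce_form\<close>, zeros for
    absent terms included, so that its side conditions hold by unfolding.\<close>
  define d' where "d' = (\<lambda>k::nat. if k = 7 then d 7 else if k = 8 then d 8 else if k = 9 then d 9
    else if k = 10 then d 10 + 7 * u * d 7 else if k = 11 then d 11 - 2 * (8 * u * d 8)
    else if k = 13 then ?B33 0 - 6 * 0 - 3 * 0 else ?B13 0 - 2 * ?A33 0 - 6 * 0)"
  have "step d d'"
  proof (rule stepI[of ?l])
    show "snull (\<lambda>x. (d 8 * ?l x ^ 8) *\<^sub>R bA x + (d 7 * ?l x ^ 7 + d 10 * ?l x ^ 10 * x$3 + d 11 * ?l x ^ 11 * x$1 +
        d 13 * ?l x ^ 13 * (x$3)^2 + d 14 * ?l x ^ 14 * (x$1 * x$3)) *\<^sub>R bB x + (d 9 * ?l x ^ 9) *\<^sub>R bC x - tform d' x)"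
    proof (rule reduce_form)
      show "near0 (\<lambda>x. d 8 * ?l x ^ 8 = d 8 + x$1 * 0 + x$2 * 0 + x$3 * (8 * u * d 8 + x$1 * 0 + x$2 * 0 + x$3 * ?A33 x))"
        by (intro always_eventually allI) (simp add: binom_rest[of u _ 8], simp add: algebra_simps power2_eq_square)
      show "near0 (\<lambda>x. d 9 * ?l x ^ 9 = d 9 + x$1 * 0 + x$2 * 0 + x$3 * (d 9 * (9 * u + x$3 * ?q 9 x)))"
        by (intro always_eventually allI) (simp add: binom_rest[of u _ 9], simp add: algebra_simps power2_eq_square)
      show "near0 (\<lambda>x. d 7 * ?l x ^ 7 + d 10 * ?l x ^ 10 * x$3 + d 11 * ?l x ^ 11 * x$1 +
        d 13 * ?l x ^ 13 * (x$3)^2 + d 14 * ?l x ^ 14 * (x$1 * x$3) =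
        d 7 + d 11 * x$1 + (d 10 + 7 * u * d 7) * x$3 + x$2 * 0 + (x$1)^2 * 0 + x$1 * x$3 * ?B13 x + (x$3)^2 * ?B33 x)"
        by (intro always_eventually allI) (simp add: binom_rest[of u _ 7] binom_rest[of u _ 10] binom_rest[of u _ 11],
            simp add: algebra_simps power2_eq_square)
    qed (simp_all add: d'_def, (intro smooth_germ_intros smooth_germ_binom_rest)+)
  qed (intro smooth_germ_intros, simp)
  then show ?thesis by (intro exI[of _ d']) (simp add: d'_def)
qed

text \<open>Degree k feeds k + 4; from 9 to 13 the factor is -27 = -3 * 9, because x1
  \<open>bC\<close> reduces to -3 x3^2 \<open>bB\<close>.\<close>

lemma step_x1:
  "\<exists>d'. step d d' \<and> d' 7 = d 7 \<and> d' 8 = d 8 \<and> d' 9 = d 9 \<and> d' 10 = d 10 \<and>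
     d' 11 = d 11 + 7 * u * d 7 \<and> d' 13 = d 13 - 27 * u * d 9 \<and> d' 14 = d 14 + 10 * u * d 10"
proof -
  let ?l = "\<lambda>x::real^3. 1 + u * x$1" and ?q = "\<lambda>k (x::real^3). binom_rest u k (x$1)"
  let ?B33 = "\<lambda>x. d 13 * ?l x ^ 13"
  let ?B13 = "\<lambda>x. d 10 * (10 * u + x$1 * ?q 10 x) + d 14 * ?l x ^ 14"
  let ?B11 = "\<lambda>x. d 7 * ?q 7 x + d 11 * (11 * u + x$1 * ?q 11 x)"
  let ?C1 = "\<lambda>x. d 9 * (9 * u + x$1 * ?q 9 x)"
  define d' where "d' = (\<lambda>k::nat. if k = 7 then d 7 else if k = 8 then d 8 else if k = 9 then d 9
    else if k = 10 then d 10 else if k = 11 then d 11 + 7 * u * d 7 - 2 * 0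
    else if k = 13 then ?B33 0 - 6 * 0 - 3 * ?C1 0 else ?B13 0 - 2 * 0 - 6 * 0)"
  have "step d d'"
  proof (rule stepI[of ?l])
    show "snull (\<lambda>x. (d 8 * ?l x ^ 8) *\<^sub>R bA x + (d 7 * ?l x ^ 7 + d 10 * ?l x ^ 10 * x$3 + d 11 * ?l x ^ 11 * x$1 +
        d 13 * ?l x ^ 13 * (x$3)^2 + d 14 * ?l x ^ 14 * (x$1 * x$3)) *\<^sub>R bB x + (d 9 * ?l x ^ 9) *\<^sub>R bC x - tform d' x)"
    proof (rule reduce_form)
      show "near0 (\<lambda>x. d 8 * ?l x ^ 8 = d 8 + x$1 * (d 8 * (8 * u + x$1 * ?q 8 x)) + x$2 * 0 + x$3 * (0 + x$1 * 0 + x$2 * 0 + x$3 * 0))"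
        by (intro always_eventually allI) (simp add: binom_rest[of u _ 8], simp add: algebra_simps power2_eq_square)
      show "near0 (\<lambda>x. d 9 * ?l x ^ 9 = d 9 + x$1 * ?C1 x + x$2 * 0 + x$3 * 0)"
        by (intro always_eventually allI) (simp add: binom_rest[of u _ 9], simp add: algebra_simps power2_eq_square)
      show "near0 (\<lambda>x. d 7 * ?l x ^ 7 + d 10 * ?l x ^ 10 * x$3 + d 11 * ?l x ^ 11 * x$1 +
        d 13 * ?l x ^ 13 * (x$3)^2 + d 14 * ?l x ^ 14 * (x$1 * x$3) =
        d 7 + (d 11 + 7 * u * d 7) * x$1 + d 10 * x$3 + x$2 * 0 + (x$1)^2 * ?B11 x + x$1 * x$3 * ?B13 x + (x$3)^2 * ?B33 x)"
        by (intro always_eventually allI) (simp add: binom_rest[of u _ 7] binom_rest[of u _ 10] binom_rest[of u _ 11],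
            simp add: algebra_simps power2_eq_square)
    qed (simp_all add: d'_def, (intro smooth_germ_intros smooth_germ_binom_rest)+)
  qed (intro smooth_germ_intros, simp)
  then show ?thesis by (intro exI[of _ d']) (simp add: d'_def)
qed

text \<open>Degree k feeds k + 5: 8 into 13 with -48 = -6 * 8 and 9 into 14 with -54 = -6 * 9, by
  the reductions of x2 \<open>bA\<close> and x2 \<open>bC\<close>.\<close>

lemma step_x2:
  "\<exists>d'. step d d' \<and> d' 7 = d 7 \<and> d' 8 = d 8 \<and> d' 9 = d 9 \<and> d' 10 = d 10 \<and>
     d' 11 = d 11 \<and> d' 13 = d 13 - 48 * u * d 8 \<and> d' 14 = d 14 - 54 * u * d 9"
proof -
  let ?l = "\<lambda>x::real^3. 1 + u * x$2" and ?q = "\<lambda>k (x::real^3). binom_rest u k (x$2)"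
  let ?B33 = "\<lambda>x. d 13 * ?l x ^ 13" and ?B13 = "\<lambda>x. d 14 * ?l x ^ 14"
  let ?B2 = "\<lambda>x. d 7 * (7 * u + x$2 * ?q 7 x) + x$3 * (d 10 * (10 * u + x$2 * ?q 10 x)) +
    x$1 * (d 11 * (11 * u + x$2 * ?q 11 x))"
  let ?A2 = "\<lambda>x. d 8 * (8 * u + x$2 * ?q 8 x)" and ?C2 = "\<lambda>x. d 9 * (9 * u + x$2 * ?q 9 x)"
  define d' where "d' = (\<lambda>k::nat. if k = 7 then d 7 else if k = 8 then d 8 else if k = 9 then d 9
    else if k = 10 then d 10 else if k = 11 then d 11 - 2 * 0
    else if k = 13 then ?B33 0 - 6 * ?A2 0 - 3 * 0 else ?B13 0 - 2 * 0 - 6 * ?C2 0)"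
  have "step d d'"
  proof (rule stepI[of ?l])
    show "snull (\<lambda>x. (d 8 * ?l x ^ 8) *\<^sub>R bA x + (d 7 * ?l x ^ 7 + d 10 * ?l x ^ 10 * x$3 + d 11 * ?l x ^ 11 * x$1 +
        d 13 * ?l x ^ 13 * (x$3)^2 + d 14 * ?l x ^ 14 * (x$1 * x$3)) *\<^sub>R bB x + (d 9 * ?l x ^ 9) *\<^sub>R bC x - tform d' x)"
    proof (rule reduce_form)
      show "near0 (\<lambda>x. d 8 * ?l x ^ 8 = d 8 + x$1 * 0 + x$2 * ?A2 x + x$3 * (0 + x$1 * 0 + x$2 * 0 + x$3 * 0))"
        by (intro always_eventually allI) (simp add: binom_rest[of u _ 8], simp add: algebra_simps power2_eq_square)
      show "near0 (\<lambda>x. d 9 * ?l x ^ 9 = d 9 + x$1 * 0 + x$2 * ?C2 x + x$3 * 0)"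
        by (intro always_eventually allI) (simp add: binom_rest[of u _ 9], simp add: algebra_simps power2_eq_square)
      show "near0 (\<lambda>x. d 7 * ?l x ^ 7 + d 10 * ?l x ^ 10 * x$3 + d 11 * ?l x ^ 11 * x$1 +
        d 13 * ?l x ^ 13 * (x$3)^2 + d 14 * ?l x ^ 14 * (x$1 * x$3) =
        d 7 + d 11 * x$1 + d 10 * x$3 + x$2 * ?B2 x + (x$1)^2 * 0 + x$1 * x$3 * ?B13 x + (x$3)^2 * ?B33 x)"
        by (intro always_eventually allI) (simp add: binom_rest[of u _ 7] binom_rest[of u _ 10] binom_rest[of u _ 11],
            simp add: algebra_simps power2_eq_square)
    qed (simp_all add: d'_def, (intro smooth_germ_intros smooth_germ_binom_rest)+)
  qed (intro smooth_germ_intros, simp)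
  then show ?thesis by (intro exI[of _ d']) (simp add: d'_def)
qed

text \<open>Degree k feeds k + 6; from 8 to 14 the factor is -16, since x3^2 \<open>bA\<close>
  reduces to -2 x1 x3 \<open>bB\<close>.\<close>

lemma step_x3x3:
  "\<exists>d'. step d d' \<and> d' 7 = d 7 \<and> d' 8 = d 8 \<and> d' 9 = d 9 \<and> d' 10 = d 10 \<and>
     d' 11 = d 11 \<and> d' 13 = d 13 + 7 * u * d 7 \<and> d' 14 = d 14 - 16 * u * d 8"
proof -
  let ?m = "\<lambda>x::real^3. (x$3)^2"
  let ?l = "\<lambda>x::real^3. 1 + u * ?m x" and ?q = "\<lambda>k (x::real^3). binom_rest u k (?m x)"
  let ?B33 = "\<lambda>x. d 7 * (7 * u + ?m x * ?q 7 x) + x$3 * (d 10 * (10 * u + ?m x * ?q 10 x)) + d 13 * ?l x ^ 13"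
  let ?B13 = "\<lambda>x. x$3 * (d 11 * (11 * u + ?m x * ?q 11 x)) + d 14 * ?l x ^ 14"
  let ?A33 = "\<lambda>x. d 8 * (8 * u + ?m x * ?q 8 x)"
  define d' where "d' = (\<lambda>k::nat. if k = 7 then d 7 else if k = 8 then d 8 else if k = 9 then d 9
    else if k = 10 then d 10 else if k = 11 then d 11 - 2 * 0
    else if k = 13 then ?B33 0 - 6 * 0 - 3 * 0 else ?B13 0 - 2 * ?A33 0 - 6 * 0)"
  have "step d d'"
  proof (rule stepI[of ?l])
    show "snull (\<lambda>x. (d 8 * ?l x ^ 8) *\<^sub>R bA x + (d 7 * ?l x ^ 7 + d 10 * ?l x ^ 10 * x$3 + d 11 * ?l x ^ 11 * x$1 +
        d 13 * ?l x ^ 13 * (x$3)^2 + d 14 * ?l x ^ 14 * (x$1 * x$3)) *\<^sub>R bB x + (d 9 * ?l x ^ 9) *\<^sub>R bC x - tform d' x)"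
    proof (rule reduce_form)
      show "near0 (\<lambda>x. d 8 * ?l x ^ 8 = d 8 + x$1 * 0 + x$2 * 0 + x$3 * (0 + x$1 * 0 + x$2 * 0 + x$3 * ?A33 x))"
        by (intro always_eventually allI) (simp add: binom_rest[of u _ 8], simp add: algebra_simps power2_eq_square power4_eq_xxxx)
      show "near0 (\<lambda>x. d 9 * ?l x ^ 9 = d 9 + x$1 * 0 + x$2 * 0 + x$3 * (x$3 * (d 9 * (9 * u + ?m x * ?q 9 x))))"
        by (intro always_eventually allI) (simp add: binom_rest[of u _ 9], simp add: algebra_simps power2_eq_square power4_eq_xxxx)
      show "near0 (\<lambda>x. d 7 * ?l x ^ 7 + d 10 * ?l x ^ 10 * x$3 + d 11 * ?l x ^ 11 * x$1 +
        d 13 * ?l x ^ 13 * (x$3)^2 + d 14 * ?l x ^ 14 * (x$1 * x$3) =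
        d 7 + d 11 * x$1 + d 10 * x$3 + x$2 * 0 + (x$1)^2 * 0 + x$1 * x$3 * ?B13 x + (x$3)^2 * ?B33 x)"
        by (intro always_eventually allI) (simp add: binom_rest[of u _ 7] binom_rest[of u _ 10] binom_rest[of u _ 11],
            simp add: algebra_simps power2_eq_square power4_eq_xxxx)
    qed (simp_all add: d'_def, (intro smooth_germ_intros smooth_germ_binom_rest)+)
  qed (intro smooth_germ_intros, simp)
  then show ?thesis by (intro exI[of _ d']) (simp add: d'_def)
qed

text \<open>Degree k feeds k + 7, so among the seven degrees only 7 acts, on 14.\<close>

lemma step_x1x3:
  "\<exists>d'. step d d' \<and> d' 7 = d 7 \<and> d' 8 = d 8 \<and> d' 9 = d 9 \<and> d' 10 = d 10 \<and>
     d' 11 = d 11 \<and> d' 13 = d 13 \<and> d' 14 = d 14 + 7 * u * d 7"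
proof -
  let ?m = "\<lambda>x::real^3. x$1 * x$3"
  let ?l = "\<lambda>x::real^3. 1 + u * ?m x" and ?q = "\<lambda>k (x::real^3). binom_rest u k (?m x)"
  let ?B33 = "\<lambda>x. d 13 * ?l x ^ 13"
  let ?B13 = "\<lambda>x. d 7 * (7 * u + ?m x * ?q 7 x) + x$3 * (d 10 * (10 * u + ?m x * ?q 10 x)) +
    x$1 * (d 11 * (11 * u + ?m x * ?q 11 x)) + d 14 * ?l x ^ 14"
  let ?A1 = "\<lambda>x. x$3 * (d 8 * (8 * u + ?m x * ?q 8 x))"
  let ?C1 = "\<lambda>x. x$3 * (d 9 * (9 * u + ?m x * ?q 9 x))"
  define d' where "d' = (\<lambda>k::nat. if k = 7 then d 7 else if k = 8 then d 8 else if k = 9 then d 9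
    else if k = 10 then d 10 else if k = 11 then d 11 - 2 * 0
    else if k = 13 then ?B33 0 - 6 * 0 - 3 * ?C1 0 else ?B13 0 - 2 * 0 - 6 * 0)"
  have "step d d'"
  proof (rule stepI[of ?l])
    show "snull (\<lambda>x. (d 8 * ?l x ^ 8) *\<^sub>R bA x + (d 7 * ?l x ^ 7 + d 10 * ?l x ^ 10 * x$3 + d 11 * ?l x ^ 11 * x$1 +
        d 13 * ?l x ^ 13 * (x$3)^2 + d 14 * ?l x ^ 14 * (x$1 * x$3)) *\<^sub>R bB x + (d 9 * ?l x ^ 9) *\<^sub>R bC x - tform d' x)"
    proof (rule reduce_form)
      show "near0 (\<lambda>x. d 8 * ?l x ^ 8 = d 8 + x$1 * ?A1 x + x$2 * 0 + x$3 * (0 + x$1 * 0 + x$2 * 0 + x$3 * 0))"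
        by (intro always_eventually allI) (simp add: binom_rest[of u _ 8], simp add: algebra_simps power2_eq_square)
      show "near0 (\<lambda>x. d 9 * ?l x ^ 9 = d 9 + x$1 * ?C1 x + x$2 * 0 + x$3 * 0)"
        by (intro always_eventually allI) (simp add: binom_rest[of u _ 9], simp add: algebra_simps power2_eq_square)
      show "near0 (\<lambda>x. d 7 * ?l x ^ 7 + d 10 * ?l x ^ 10 * x$3 + d 11 * ?l x ^ 11 * x$1 +
        d 13 * ?l x ^ 13 * (x$3)^2 + d 14 * ?l x ^ 14 * (x$1 * x$3) =
        d 7 + d 11 * x$1 + d 10 * x$3 + x$2 * 0 + (x$1)^2 * 0 + x$1 * x$3 * ?B13 x + (x$3)^2 * ?B33 x)"
        by (intro always_eventually allI) (simp add: binom_rest[of u _ 7] binom_rest[of u _ 10] binom_rest[of u _ 11],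
            simp add: algebra_simps power2_eq_square)
    qed (simp_all add: d'_def, (intro smooth_germ_intros smooth_germ_binom_rest)+)
  qed (intro smooth_germ_intros, simp)
  then show ?thesis by (intro exI[of _ d']) (simp add: d'_def)
qed

lemma step_scale:
  assumes "k \<noteq> 0" shows "step d (\<lambda>i. k ^ i * d i)"
proof (rule stepI[of "\<lambda>x. k"])
  have "snull (\<lambda>x. 0)" by (rule snullI[of "\<lambda>x. 0" "\<lambda>x. 0"]) (simp_all add: smooth_germ_const)
  then show "snull (\<lambda>x. (d 8 * k ^ 8) *\<^sub>R bA x + (d 7 * k ^ 7 + d 10 * k ^ 10 * x$3 + d 11 * k ^ 11 * x$1 +
        d 13 * k ^ 13 * (x$3)^2 + d 14 * k ^ 14 * (x$1 * x$3)) *\<^sub>R bB x + (d 9 * k ^ 9) *\<^sub>R bC x -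
        tform (\<lambda>i. k ^ i * d i) x)"
    by (rule snull_cong) (simp add: tform_def algebra_simps)
qed (use assms in \<open>simp_all add: smooth_germ_const\<close>)

text \<open>The target 1/n corresponds to coefficient 1 of the two-form: contracting with the Euler
  field and differentiating multiplies degree n by n. An odd root absorbs the sign of
  \<open>d\<close>.\<close>

lemma scale_odd:
  fixes d :: real assumes "odd n" "d \<noteq> 0"
  obtains k where "k \<noteq> 0" "k ^ n * d = 1 / real n"
proof (rule that[of "root n (1 / (real n * d))"])
  show "root n (1 / (real n * d)) ^ n * d = 1 / real n"
    using assms by (simp add: odd_real_root_pow)
  show "root n (1 / (real n * d)) \<noteq> 0" using assms by (simp add: real_root_eq_0_iff odd_pos)
qed

lemma scale_even:
  fixes d :: real assumes "n > 0" "d \<noteq> 0"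
  obtains k s where "k \<noteq> 0" "s \<in> {1, -1 :: real}" "k ^ n * d = s / real n"
proof (rule that[of "root n (1 / (real n * \<bar>d\<bar>))" "sgn d"])
  show "root n (1 / (real n * \<bar>d\<bar>)) ^ n * d = sgn d / real n"
    using assms by (simp add: sgn_if abs_if)
  show "root n (1 / (real n * \<bar>d\<bar>)) \<noteq> 0" using assms by (simp add: real_root_eq_0_iff)
  show "sgn d \<in> {1, -1}" using assms by (simp add: sgn_if)
qed

text \<open>The coefficient vectors realised by the normal forms of index \<open>i\<close>; \<open>NF\<close> is unspecified for \<open>i > 7\<close>.\<close>

definition NF :: "nat \<Rightarrow> (nat \<Rightarrow> real) \<Rightarrow> bool" where
  "NF i c \<longleftrightarrow>
    [c 7 = 1 \<and> c 10 = 0 \<and> c 11 = 0 \<and> c 13 = 0 \<and> c 14 = 0,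
     c 7 = 0 \<and> c 8 \<in> {1, -1} \<and> c 11 = 0 \<and> c 13 = 0 \<and> c 14 = 0,
     c 7 = 0 \<and> c 8 = 0 \<and> c 9 = 1 \<and> c 13 = 0 \<and> c 14 = 0,
     c 7 = 0 \<and> c 8 = 0 \<and> c 9 = 0 \<and> c 10 \<in> {1, -1} \<and> c 13 = 0 \<and> c 14 = 0,
     c 7 = 0 \<and> c 8 = 0 \<and> c 9 = 0 \<and> c 10 = 0 \<and> c 11 = 1 \<and> c 14 = 0,
     c 7 = 0 \<and> c 8 = 0 \<and> c 9 = 0 \<and> c 10 = 0 \<and> c 11 = 0 \<and> c 13 = 1,
     c 7 = 0 \<and> c 8 = 0 \<and> c 9 = 0 \<and> c 10 = 0 \<and> c 11 = 0 \<and> c 13 = 0 \<and> c 14 \<in> {1, -1},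
     c 7 = 0 \<and> c 8 = 0 \<and> c 9 = 0 \<and> c 10 = 0 \<and> c 11 = 0 \<and> c 13 = 0 \<and> c 14 = 0] ! i"

lemma normalize_scale:
  assumes "step\<^sup>*\<^sup>* d e" "k \<noteq> 0" "i \<le> 7" "NF i (\<lambda>j. real j * (k ^ j * e j))"
  shows "\<exists>c i. i \<le> 7 \<and> step\<^sup>*\<^sup>* d (\<lambda>k. c k / real k) \<and> NF i c"
proof (intro exI conjI)
  obtain l where l: "smooth_germ l" "l 0 \<noteq> 0" "snull (\<lambda>x. stform l e x - tform (\<lambda>i. k ^ i * e i) x)"
    using step_scale[OF assms(2), of e] unfolding step_def by blast
  \<comment> \<open>At index 0 the quotient on the left is 0 whatever \<open>e 0\<close> is, so the
    forms agree although the coefficient functions may differ.\<close>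
  have "tform (\<lambda>j. real j * (k ^ j * e j) / real j) = tform (\<lambda>i. k ^ i * e i)"
    by (simp add: fun_eq_iff tform_def)
  then have "step e (\<lambda>j. real j * (k ^ j * e j) / real j)"
    using l unfolding step_def by metis
  then show "step\<^sup>*\<^sup>* d (\<lambda>j. real j * (k ^ j * e j) / real j)"
    using assms(1) by simp
qed (use assms in auto)

text \<open>The coefficients are cleared in increasing degree, since a move that clears one degree
  may disturb later ones but, under the vanishing already achieved, leaves the cleared ones at 0.
  The final scaling fixes the leading coefficient and preserves zeros.\<close>

lemma normalize:
  "\<exists>c i. i \<le> 7 \<and> step\<^sup>*\<^sup>* d (\<lambda>k. c k / real k) \<and> NF i c"
proof -
  consider "d 7 \<noteq> 0" | "d 7 = 0" "d 8 \<noteq> 0" | "d 7 = 0" "d 8 = 0" "d 9 \<noteq> 0"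
    | "d 7 = 0" "d 8 = 0" "d 9 = 0" "d 10 \<noteq> 0"
    | "d 7 = 0" "d 8 = 0" "d 9 = 0" "d 10 = 0" "d 11 \<noteq> 0"
    | "d 7 = 0" "d 8 = 0" "d 9 = 0" "d 10 = 0" "d 11 = 0" "d 13 \<noteq> 0"
    | "d 7 = 0" "d 8 = 0" "d 9 = 0" "d 10 = 0" "d 11 = 0" "d 13 = 0" "d 14 \<noteq> 0"
    | "d 7 = 0" "d 8 = 0" "d 9 = 0" "d 10 = 0" "d 11 = 0" "d 13 = 0" "d 14 = 0"
    by blast
  then show ?thesis
  proof cases
    case 1
    obtain e1 where e1: "step d e1" "e1 7 = d 7" "e1 10 = 0"
      using step_x3[of d "- d 10 / (7 * d 7)"] 1 by auto
    obtain e2 where e2: "step e1 e2" "e2 7 = d 7" "e2 10 = 0" "e2 11 = 0"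
      using step_x1[of e1 "- e1 11 / (7 * d 7)"] e1 1 by auto
    obtain e3 where e3: "step e2 e3" "e3 7 = d 7" "e3 10 = 0" "e3 11 = 0" "e3 13 = 0"
      using step_x3x3[of e2 "- e2 13 / (7 * d 7)"] e2 1 by auto
    obtain e4 where e4: "step e3 e4" "e4 7 = d 7" "e4 10 = 0" "e4 11 = 0" "e4 13 = 0" "e4 14 = 0"
      using step_x1x3[of e3 "- e3 14 / (7 * d 7)"] e3 1 by auto
    obtain k where k: "k \<noteq> 0" "k ^ 7 * d 7 = 1 / real 7" using scale_odd[of 7 "d 7"] 1 by auto
    have "step\<^sup>*\<^sup>* d e4" using e1 e2 e3 e4 by (meson converse_rtranclp_into_rtranclp rtranclp.rtrancl_refl)
    then show ?thesis by (rule normalize_scale[OF _ k(1), of _ _ 0]) (use e4 k in \<open>auto simp: NF_def\<close>)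
  next
    case 2
    obtain e1 where e1: "step d e1" "e1 7 = 0" "e1 8 = d 8" "e1 11 = 0"
      using step_x3[of d "d 11 / (16 * d 8)"] 2 by auto
    obtain e2 where e2: "step e1 e2" "e2 7 = 0" "e2 8 = d 8" "e2 11 = 0" "e2 13 = 0"
      using step_x2[of e1 "e1 13 / (48 * d 8)"] e1 2 by auto
    obtain e3 where e3: "step e2 e3" "e3 7 = 0" "e3 8 = d 8" "e3 11 = 0" "e3 13 = 0" "e3 14 = 0"
      using step_x3x3[of e2 "e2 14 / (16 * d 8)"] e2 2 by auto
    obtain k s where k: "k \<noteq> 0" "s \<in> {1, - 1}" "k ^ 8 * d 8 = s / real 8" using scale_even[of 8 "d 8"] 2 by auto
    have "step\<^sup>*\<^sup>* d e3" using e1 e2 e3 by (meson converse_rtranclp_into_rtranclp rtranclp.rtrancl_refl)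
    then show ?thesis by (rule normalize_scale[OF _ k(1), of _ _ 1]) (use e3 k in \<open>auto simp: NF_def\<close>)
  next
    case 3
    obtain e1 where e1: "step d e1" "e1 7 = 0" "e1 8 = 0" "e1 9 = d 9" "e1 13 = 0"
      using step_x1[of d "d 13 / (27 * d 9)"] 3 by auto
    obtain e2 where e2: "step e1 e2" "e2 7 = 0" "e2 8 = 0" "e2 9 = d 9" "e2 13 = 0" "e2 14 = 0"
      using step_x2[of e1 "e1 14 / (54 * d 9)"] e1 3 by auto
    obtain k where k: "k \<noteq> 0" "k ^ 9 * d 9 = 1 / real 9" using scale_odd[of 9 "d 9"] 3 by auto
    have "step\<^sup>*\<^sup>* d e2" using e1 e2 by (meson converse_rtranclp_into_rtranclp rtranclp.rtrancl_refl)
    then show ?thesis by (rule normalize_scale[OF _ k(1), of _ _ 2]) (use e2 k in \<open>auto simp: NF_def\<close>)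
  next
    case 4
    obtain e1 where e1: "step d e1" "e1 7 = 0" "e1 8 = 0" "e1 9 = 0" "e1 10 = d 10" "e1 13 = 0"
      using step_x3[of d "- d 13 / (10 * d 10)"] 4 by auto
    obtain e2 where e2: "step e1 e2" "e2 7 = 0" "e2 8 = 0" "e2 9 = 0" "e2 10 = d 10" "e2 13 = 0" "e2 14 = 0"
      using step_x1[of e1 "- e1 14 / (10 * d 10)"] e1 4 by auto
    obtain k s where k: "k \<noteq> 0" "s \<in> {1, - 1}" "k ^ 10 * d 10 = s / real 10" using scale_even[of 10 "d 10"] 4 by auto
    have "step\<^sup>*\<^sup>* d e2" using e1 e2 by (meson converse_rtranclp_into_rtranclp rtranclp.rtrancl_refl)
    then show ?thesis by (rule normalize_scale[OF _ k(1), of _ _ 3]) (use e2 k in \<open>auto simp: NF_def\<close>)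
  next
    case 5
    obtain e1 where e1: "step d e1" "e1 7 = 0" "e1 8 = 0" "e1 9 = 0" "e1 10 = 0" "e1 11 = d 11" "e1 14 = 0"
      using step_x3[of d "- d 14 / (11 * d 11)"] 5 by auto
    obtain k where k: "k \<noteq> 0" "k ^ 11 * d 11 = 1 / real 11" using scale_odd[of 11 "d 11"] 5 by auto
    have "step\<^sup>*\<^sup>* d e1" using e1 by (meson converse_rtranclp_into_rtranclp rtranclp.rtrancl_refl)
    then show ?thesis by (rule normalize_scale[OF _ k(1), of _ _ 4]) (use e1 k in \<open>auto simp: NF_def\<close>)
  next
    case 6
    obtain k where k: "k \<noteq> 0" "k ^ 13 * d 13 = 1 / real 13" using scale_odd[of 13 "d 13"] 6 by auto
    show ?thesis
      by (rule normalize_scale[OF rtranclp.rtrancl_refl k(1), of 5]) (use 6 k in \<open>auto simp: NF_def\<close>)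
  next
    case 7
    obtain k s where k: "k \<noteq> 0" "s \<in> {1, - 1}" "k ^ 14 * d 14 = s / real 14" using scale_even[of 14 "d 14"] 7 by auto
    show ?thesis
      by (rule normalize_scale[OF rtranclp.rtrancl_refl k(1), of 6]) (use 7 k in \<open>auto simp: NF_def\<close>)
  next
    case 8
    show ?thesis
      by (rule normalize_scale[OF rtranclp.rtrancl_refl zero_neq_one[symmetric], of 7]) (use 8 in \<open>auto simp: NF_def\<close>)
  qed
qed

section \<open>Jets along the branches\<close>

text \<open>Order three suffices: along the cusp the norm is O(t^3), so the remainder is O(t^12) and
  the coefficients up to t^11, the largest needed for rigidity, are determined.\<close>

lemma taylor3:
  fixes f :: "real^'n \<Rightarrow> real"
  assumes "smooth_germ f"
  obtains K where "near0 (\<lambda>x. \<bar>f x - (f 0 + (\<Sum>i\<in>UNIV. x$i * pd i f 0) +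
      (\<Sum>i\<in>UNIV. x$i * (\<Sum>j\<in>UNIV. x$j * pd j (pd i f) 0)) / 2 +
      (\<Sum>i\<in>UNIV. x$i * (\<Sum>j\<in>UNIV. x$j * (\<Sum>k\<in>UNIV. x$k * pd k (pd j (pd i f)) 0))) / 6)\<bar> \<le> K * norm x ^ 4)"
proof -
  obtain r where r: "r > 0" "smooth_on (ball 0 r) f" using smooth_germE[OF assms] .
  have sm: "smooth_on (ball 0 r) (pd i g)" if "smooth_on (ball 0 r) g" for i and g :: "real^'n \<Rightarrow> real"
    unfolding pd_def[abs_def] by (rule smooth_on_derivative[OF that])
  define M where "M = (\<lambda>y. \<Sum>i\<in>UNIV. \<Sum>j\<in>UNIV. \<Sum>k\<in>UNIV. \<Sum>l\<in>UNIV. \<bar>pd l (pd k (pd j (pd i f))) y\<bar>)"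
  have cM: "continuous_on (ball 0 r) M"
    unfolding M_def by (intro continuous_on_sum continuous_on_rabs smooth_on_derivative(3) sm r(2))
  have "near0 (\<lambda>y. M y < M 0 + 1)"
  proof -
    have "isCont M 0" using cM r(1) by (simp add: continuous_on_eq_continuous_at)
    then have "(M \<longlongrightarrow> M 0) (nhds 0)" by (simp add: isCont_def tendsto_at_iff_tendsto_nhds)
    then show ?thesis by (rule order_tendstoD) simp
  qed
  then obtain s where s: "s > 0" "\<And>y. dist y 0 < s \<Longrightarrow> M y < M 0 + 1"
    unfolding eventually_nhds_metric by (elim exE conjE) simp
  have main: "\<bar>f x - (f 0 + (\<Sum>i\<in>UNIV. x$i * pd i f 0) +
      (\<Sum>i\<in>UNIV. x$i * (\<Sum>j\<in>UNIV. x$j * pd j (pd i f) 0)) / 2 +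
      (\<Sum>i\<in>UNIV. x$i * (\<Sum>j\<in>UNIV. x$j * (\<Sum>k\<in>UNIV. x$k * pd k (pd j (pd i f)) 0))) / 6)\<bar> \<le> (M 0 + 1) * norm x ^ 4"
    if x: "x \<in> ball 0 (min r s)" for x
  proof -
    \<comment> \<open>\<open>D m\<close> is the m-th derivative of t \<mapsto> f (t x). The sums are
      nested so that the next derivative arises by differentiating only the innermost
      factor.\<close>
    define D where "D = (\<lambda>(m::nat) t.
       if m = 0 then f (t *\<^sub>R x)
       else if m = 1 then \<Sum>i\<in>UNIV. x$i * pd i f (t *\<^sub>R x)
       else if m = 2 then \<Sum>i\<in>UNIV. x$i * (\<Sum>j\<in>UNIV. x$j * pd j (pd i f) (t *\<^sub>R x))
       else if m = 3 then \<Sum>i\<in>UNIV. x$i * (\<Sum>j\<in>UNIV. x$j * (\<Sum>k\<in>UNIV. x$k * pd k (pd j (pd i f)) (t *\<^sub>R x)))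
       else \<Sum>i\<in>UNIV. x$i * (\<Sum>j\<in>UNIV. x$j * (\<Sum>k\<in>UNIV. x$k * (\<Sum>l\<in>UNIV. x$l * pd l (pd k (pd j (pd i f))) (t *\<^sub>R x)))))"
    have in_ball: "t *\<^sub>R x \<in> ball 0 r" "dist (t *\<^sub>R x) 0 < s" if "0 \<le> t" "t \<le> 1" for t
      using x that mult_left_le_one_le[of "norm x" t] by auto
    have line: "((\<lambda>t. g (t *\<^sub>R x)) has_real_derivative (\<Sum>i\<in>UNIV. x$i * pd i g (t *\<^sub>R x))) (at t)"
      if "smooth_on (ball 0 r) g" "0 \<le> t" "t \<le> 1" for g t
    proof -
      have d: "(g has_derivative frechet_derivative g (at (0 + t *\<^sub>R x))) (at (0 + t *\<^sub>R x))"
        by (rule smooth_on_derivative(2)[OF that(1)]) (use in_ball[OF that(2,3)] in simp)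
      from has_derivative_line[OF d] show ?thesis
        unfolding derivative_eq_sum_pd[OF d] by simp
    qed
    have "(D m has_real_derivative D (Suc m) t) (at t)" if "m < 4" "0 \<le> t" "t \<le> 1" for m t
    proof -
      consider "m = 0" | "m = 1" | "m = 2" | "m = 3" using \<open>m < 4\<close> by linarith
      then show ?thesis
        by cases (simp_all add: D_def, (intro DERIV_sum DERIV_cmult line sm r(2) that(2,3))+)
    qed
    then obtain t where t: "0 < t" "t < 1" and eq: "D 0 1 = (\<Sum>m<4. D m 0 / fact m * 1 ^ m) + D 4 t / fact 4 * 1 ^ 4"
      using Maclaurin[of 1 4 D "D 0"] by auto
    have "f x - (f 0 + (\<Sum>i\<in>UNIV. x$i * pd i f 0) +
      (\<Sum>i\<in>UNIV. x$i * (\<Sum>j\<in>UNIV. x$j * pd j (pd i f) 0)) / 2 +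
      (\<Sum>i\<in>UNIV. x$i * (\<Sum>j\<in>UNIV. x$j * (\<Sum>k\<in>UNIV. x$k * pd k (pd j (pd i f)) 0))) / 6) = D 4 t / 24"
    proof -
      have "(\<Sum>m<4. D m 0 / fact m * 1 ^ m) = D 0 0 + D 1 0 + D 2 0 / 2 + D 3 0 / 6"
        by (simp add: lessThan_nat_numeral fact_numeral)
      moreover have "fact 4 = (24::real)" by (simp add: fact_numeral)
      ultimately have "D 0 1 = D 0 0 + D 1 0 + D 2 0 / 2 + D 3 0 / 6 + D 4 t / 24" using eq by simp
      moreover have "D 0 1 = f x" "D 0 0 = f 0" "D 1 0 = (\<Sum>i\<in>UNIV. x$i * pd i f 0)"
        "D 2 0 = (\<Sum>i\<in>UNIV. x$i * (\<Sum>j\<in>UNIV. x$j * pd j (pd i f) 0))"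
        "D 3 0 = (\<Sum>i\<in>UNIV. x$i * (\<Sum>j\<in>UNIV. x$j * (\<Sum>k\<in>UNIV. x$k * pd k (pd j (pd i f)) 0)))"
        by (simp_all add: D_def)
      ultimately show ?thesis by simp
    qed
    moreover have "\<bar>D 4 t\<bar> \<le> norm x ^ 4 * M (t *\<^sub>R x)"
    proof -
      have D4: "D 4 t = (\<Sum>i\<in>UNIV. x$i * (\<Sum>j\<in>UNIV. x$j * (\<Sum>k\<in>UNIV. x$k *
          (\<Sum>l\<in>UNIV. x$l * pd l (pd k (pd j (pd i f))) (t *\<^sub>R x)))))"
        by (simp add: D_def)
      have b: "\<bar>x $ i * S\<bar> \<le> norm x * \<bar>S\<bar>" for i S
        by (simp add: abs_mult mult_right_mono component_le_norm_cart)
      have "\<bar>D 4 t\<bar> \<le> (\<Sum>i\<in>UNIV. norm x * (\<Sum>j\<in>UNIV. norm x * (\<Sum>k\<in>UNIV. norm x * (\<Sum>l\<in>UNIV. norm x * \<bar>pd l (pd k (pd j (pd i f))) (t *\<^sub>R x)\<bar>))))"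
        unfolding D4
        by (rule order_refl norm_ge_zero order.trans[OF sum_abs] sum_mono order.trans[OF b] mult_left_mono)+
      also have "\<dots> = norm x ^ 4 * M (t *\<^sub>R x)"
        by (simp add: M_def sum_distrib_left power4_eq_xxxx mult.assoc)
      finally show ?thesis .
    qed
    moreover have "norm x ^ 4 * M (t *\<^sub>R x) \<le> norm x ^ 4 * (M 0 + 1)"
      using s(2)[OF in_ball(2)[of t]] t by (intro mult_left_mono) auto
    moreover have "0 \<le> norm x ^ 4 * (M 0 + 1)"
      by (intro mult_nonneg_nonneg add_nonneg_nonneg) (auto simp: M_def intro!: sum_nonneg)
    ultimately show ?thesis by (simp add: mult.commute)
  qed
  have "near0 (\<lambda>x. x \<in> ball 0 (min r s))" using r(1) s(1) by (intro eventually_nhds_in_open) auto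
  then have "near0 (\<lambda>x. \<bar>f x - (f 0 + (\<Sum>i\<in>UNIV. x$i * pd i f 0) +
      (\<Sum>i\<in>UNIV. x$i * (\<Sum>j\<in>UNIV. x$j * pd j (pd i f) 0)) / 2 +
      (\<Sum>i\<in>UNIV. x$i * (\<Sum>j\<in>UNIV. x$j * (\<Sum>k\<in>UNIV. x$k * pd k (pd j (pd i f)) 0))) / 6)\<bar> \<le> (M 0 + 1) * norm x ^ 4)"
    by (rule eventually_mono) (rule main)
  then show ?thesis by (rule that)
qed

text \<open>Phrased by an estimate instead of derivatives of \<open>F\<close>, so that products need
  only the Cauchy product of the coefficients.\<close>

definition jet :: "nat \<Rightarrow> (nat \<Rightarrow> real) \<Rightarrow> (real \<Rightarrow> real) \<Rightarrow> bool" where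
  "jet n a F \<longleftrightarrow> (\<lambda>t. F t - (\<Sum>k<n. a k * t ^ k)) \<in> O[at 0](\<lambda>t. t ^ n)"

lemma cont_bigo_1:
  fixes F :: "real \<Rightarrow> real"
  assumes "isCont F 0" shows "F \<in> O[at 0](\<lambda>t. 1)"
  by (rule bigoI_tendsto[where c = "F 0"]) (use assms in \<open>simp_all add: isCont_def\<close>)

lemma power_bigo: assumes "m \<ge> n" shows "(\<lambda>t::real. t ^ m) \<in> O[at 0](\<lambda>t. t ^ n)"
proof -
  have "(\<lambda>t::real. t ^ n * t ^ (m - n)) \<in> O[at 0](\<lambda>t. t ^ n * 1)"
    by (intro landau_o.big.mult landau_o.big_refl cont_bigo_1 continuous_intros)
  then show ?thesis using assms by (simp flip: power_add)
qed

lemma poly_bigo_1: "(\<lambda>t. \<Sum>k<n. a k * t ^ k) \<in> O[at (0::real)](\<lambda>t. 1)"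
  by (intro cont_bigo_1 continuous_intros)

lemma jet_bigo_1: assumes "jet n a F" shows "F \<in> O[at 0](\<lambda>t. 1)"
proof -
  have "(\<lambda>t. F t - (\<Sum>k<n. a k * t ^ k)) \<in> O[at 0](\<lambda>t. 1)"
    using landau_o.big_trans[OF assms[unfolded jet_def] power_bigo[of 0 n]] by simp
  from sum_in_bigo(1)[OF this poly_bigo_1[of a n]] show ?thesis by simp
qed

lemma jet_add: assumes "jet n a F" "jet n b G" shows "jet n (\<lambda>k. a k + b k) (\<lambda>t. F t + G t)"
  using sum_in_bigo(1)[OF assms[unfolded jet_def]] unfolding jet_def
  by (simp add: algebra_simps sum.distrib)

lemma jet_mult:
  assumes "jet n a F" "jet n b G"
  shows "jet n (\<lambda>k. \<Sum>i\<le>k. a i * b (k - i)) (\<lambda>t. F t * G t)"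
proof -
  define A B T where "A = (\<lambda>t. \<Sum>k<n. a k * t ^ k)" and "B = (\<lambda>t. \<Sum>k<n. b k * t ^ k)"
    and "T = (\<lambda>t. \<Sum>k<n. (\<Sum>i\<le>k. a i * b (k - i)) * (t::real) ^ k)"
  have 1: "(\<lambda>t. (F t - A t) * G t) \<in> O[at 0](\<lambda>t. t ^ n)"
    using landau_o.big.mult[OF assms(1)[unfolded jet_def] jet_bigo_1[OF assms(2)]] by (simp add: A_def)
  have 2: "(\<lambda>t. A t * (G t - B t)) \<in> O[at 0](\<lambda>t. t ^ n)"
    using landau_o.big.mult[OF poly_bigo_1 assms(2)[unfolded jet_def]] by (simp add: A_def B_def)
  \<comment> \<open>The product of the truncations differs from the truncated Cauchy product by the
    terms with i + j \<ge> n.\<close>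
  have 3: "(\<lambda>t. A t * B t - T t) \<in> O[at 0](\<lambda>t. t ^ n)"
  proof -
    have "A t * B t - T t = (\<Sum>i<n. \<Sum>j<n. if i + j < n then 0 else a i * b j * t ^ (i + j))" for t
    proof -
      have "T t = (\<Sum>k<n. \<Sum>i\<le>k. a i * b (k - i) * t ^ (i + (k - i)))"
        unfolding T_def by (intro sum.cong refl) (simp add: sum_distrib_right)
      also have "\<dots> = (\<Sum>(i, j)\<in>{(i, j). i + j < n}. a i * b j * t ^ (i + j))"
        by (simp add: sum.triangle_reindex)
      also have "\<dots> = (\<Sum>p\<in>{..<n} \<times> {..<n}. if fst p + snd p < n then a (fst p) * b (snd p) * t ^ (fst p + snd p) else 0)"
        by (subst sum.inter_filter[symmetric]) (auto intro!: sum.cong)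
      also have "\<dots> = (\<Sum>i<n. \<Sum>j<n. if i + j < n then a i * b j * t ^ (i + j) else 0)"
        by (simp add: sum.cartesian_product case_prod_unfold)
      finally have T: "T t = \<dots>" .
      have "A t * B t = (\<Sum>i<n. \<Sum>j<n. a i * b j * t ^ (i + j))"
        unfolding A_def B_def sum_product by (intro sum.cong refl) (simp add: power_add)
      then show ?thesis
        unfolding T by (simp add: sum_subtractf[symmetric]) (intro sum.cong refl, simp)
    qed
    moreover have "(\<lambda>t. \<Sum>i<n. \<Sum>j<n. if i + j < n then 0 else a i * b j * t ^ (i + j)) \<in> O[at 0](\<lambda>t. t ^ n)"
    proof (intro big_sum_in_bigo)
      fix i j show "(\<lambda>t. if i + j < n then 0 else a i * b j * t ^ (i + j)) \<in> O[at 0](\<lambda>t. t ^ n)"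
        by (cases "i + j < n") (simp_all add: power_bigo)
    qed
    ultimately show ?thesis by simp
  qed
  have "(\<lambda>t. (F t - A t) * G t + A t * (G t - B t) + (A t * B t - T t)) \<in> O[at 0](\<lambda>t. t ^ n)"
    by (intro sum_in_bigo 1 2 3)
  then show ?thesis unfolding jet_def T_def by (simp add: algebra_simps)
qed

lemma poly_bigo_zero_const:
  assumes "(\<lambda>t::real. \<Sum>k<Suc n. a k * t ^ k) \<in> O[at 0](\<lambda>t. t ^ Suc n)"
  shows "(\<Sum>k<Suc n. a k * 0 ^ k) = (0::real)"
proof -
  have "isCont (\<lambda>t::real. t ^ Suc n) 0" by (intro continuous_intros)
  then have 1: "((\<lambda>t::real. t ^ Suc n / 1) \<longlongrightarrow> 0) (at 0)" unfolding isCont_def by simp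
  have 2: "(\<lambda>t::real. t ^ Suc n) \<in> o[at 0](\<lambda>t. 1)" by (rule smalloI_tendsto[OF 1]) simp
  have "(\<lambda>t. \<Sum>k<Suc n. a k * t ^ k) \<in> o[at 0](\<lambda>t. 1)"
    by (rule landau_o.big_small_trans[OF assms 2])
  from smalloD_tendsto[OF this] have 3: "((\<lambda>t. \<Sum>k<Suc n. a k * t ^ k) \<longlongrightarrow> 0) (at 0)"
    by (simp only: div_by_1)
  have "isCont (\<lambda>t. \<Sum>k<Suc n. a k * t ^ k) 0" by (intro continuous_intros)
  then have 4: "((\<lambda>t. \<Sum>k<Suc n. a k * t ^ k) \<longlongrightarrow> (\<Sum>k<Suc n. a k * 0 ^ k)) (at 0)" unfolding isCont_def .
  show ?thesis by (rule LIM_unique[OF 4 3])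
qed

text \<open>The constant term is the limit at 0 and hence vanishes; then a factor t is cancelled and
  the induction continues with the shifted coefficients.\<close>

lemma poly_bigo_zero:
  "(\<lambda>t::real. \<Sum>k<n. a k * t ^ k) \<in> O[at 0](\<lambda>t. t ^ n) \<Longrightarrow> k < n \<Longrightarrow> a k = 0"
proof (induction n arbitrary: a k)
  case 0
  from 0(2) show ?case by simp
next
  case (Suc n)
  have "(\<Sum>k<Suc n. a k * 0 ^ k) = 0" by (rule poly_bigo_zero_const[OF Suc.prems(1)])
  then have a0: "a 0 = 0" by (subst (asm) sum.lessThan_Suc_shift) simp
  have "(\<lambda>t. t * (\<Sum>k<n. a (Suc k) * t ^ k)) \<in> O[at (0::real)](\<lambda>t. t * t ^ n)"
    using Suc.prems(1) unfolding sum.lessThan_Suc_shift a0 sum_distrib_left power_Suc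
    by (simp only: mult_zero_left add_0_left mult.left_commute)
  then have "(\<lambda>t. \<Sum>k<n. a (Suc k) * t ^ k) \<in> O[at (0::real)](\<lambda>t. t ^ n)"
    by (subst (asm) landau_o.big.mult_cancel_left) (auto simp: eventually_at_filter)
  then have IH: "k < n \<Longrightarrow> a (Suc k) = 0" for k by (rule Suc.IH)
  show ?case using IH[of "k - 1"] Suc.prems(2) a0 by (cases "k = 0") auto
qed

lemma jet_zero:
  assumes "jet n a F" "\<forall>\<^sub>F t in at 0. F t = 0" "k < n" shows "a k = 0"
proof -
  have "(\<lambda>t. F t - (\<Sum>k<n. a k * t ^ k)) \<in> O[at 0](\<lambda>t. t ^ n) \<longleftrightarrow>
    (\<lambda>t. - (\<Sum>k<n. a k * t ^ k)) \<in> O[at 0](\<lambda>t. t ^ n)"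
    by (rule landau_o.big.in_cong) (use assms(2) in eventually_elim, simp)
  then show ?thesis using assms(1,3) poly_bigo_zero[of a n k] unfolding jet_def by simp
qed

section \<open>Jets of functions along the two branches\<close>

definition cusp :: "real \<Rightarrow> real^3" where "cusp t = vector [t^4, - (t^5), t^3]"

lemma cusp_nth [simp]: "cusp t $ 1 = t^4" "cusp t $ 2 = - (t^5)" "cusp t $ 3 = t^3"
  by (simp_all add: cusp_def)

lemma cusp_eq: "cusp = (\<lambda>t. t^4 *\<^sub>R axis 1 1 - t^5 *\<^sub>R axis 2 1 + t^3 *\<^sub>R axis 3 1)"
  by (simp add: fun_eq_iff vec_eq_iff forall_3 axis_def)

lemma isCont_cusp: "isCont cusp t"
  unfolding cusp_eq by (intro continuous_intros)

lemma cusp_N3: "cusp t \<in> N3"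
  by (simp add: N3_def eval_nat_numeral)

lemma axis_N3: "s *\<^sub>R axis 2 1 \<in> N3"
  by (simp add: N3_def axis_def)

lemma pd_sym:
  fixes f :: "real^'n \<Rightarrow> real"
  assumes "smooth_germ f"
  shows pd_sym2: "pd i (pd j f) 0 = pd j (pd i f) 0"
    and pd_sym3: "pd k (pd i (pd j f)) 0 = pd k (pd j (pd i f)) 0"
    and pd_sym3': "pd i (pd j (pd k f)) 0 = pd j (pd i (pd k f)) 0"
  using eventually_nhds_x_imp_x[OF pd_commute[OF assms]]
    eventually_nhds_x_imp_x[OF pd_near0_cong[OF pd_commute[OF assms]]]
    eventually_nhds_x_imp_x[OF pd_commute[OF smooth_germ_pd[OF assms]]] by metis+

lemma norm_bigo:
  assumes "\<And>i. (\<lambda>t. g t $ i) \<in> O[at 0](\<lambda>t. t ^ m)"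
  shows "(\<lambda>t. norm (g t :: real^'n) ^ 4) \<in> O[at 0](\<lambda>t. t ^ (4 * m))"
proof -
  have "(\<lambda>t. norm (g t)) \<in> O[at 0](\<lambda>t. \<Sum>i\<in>UNIV. \<bar>g t $ i\<bar>)"
    by (rule bigoI[of _ 1]) (simp add: norm_le_l1_cart)
  also have "(\<lambda>t. \<Sum>i\<in>UNIV. \<bar>g t $ i\<bar>) \<in> O[at 0](\<lambda>t. t ^ m)"
    by (intro big_sum_in_bigo) (use assms in simp)
  finally show ?thesis
    using landau_o.big_power[of "\<lambda>t. norm (g t)" "at 0" "\<lambda>t. t ^ m" 4] by (simp add: power_mult[symmetric] mult.commute)
qed

lemma taylor3_bigo:
  fixes f :: "real^'n \<Rightarrow> real"
  assumes "smooth_germ f" "\<And>i. (\<lambda>t. g t $ i) \<in> O[at 0](\<lambda>t. t ^ m)" "isCont g 0" "g 0 = 0"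
  shows "(\<lambda>t. f (g t) - (f 0 + (\<Sum>i\<in>UNIV. g t$i * pd i f 0) +
      (\<Sum>i\<in>UNIV. g t$i * (\<Sum>j\<in>UNIV. g t$j * pd j (pd i f) 0)) / 2 +
      (\<Sum>i\<in>UNIV. g t$i * (\<Sum>j\<in>UNIV. g t$j * (\<Sum>k\<in>UNIV. g t$k * pd k (pd j (pd i f)) 0))) / 6))
    \<in> O[at 0](\<lambda>t. t ^ (4 * m))" (is "(\<lambda>t. ?R (g t)) \<in> _")
proof -
  obtain K where K: "near0 (\<lambda>x. \<bar>?R x\<bar> \<le> K * norm x ^ 4)" using taylor3[OF assms(1)] .
  have "filterlim g (nhds 0) (at 0)" using assms(3,4) unfolding isCont_def by simp
  from eventually_compose_filterlim[OF K this]
  have "(\<lambda>t. ?R (g t)) \<in> O[at 0](\<lambda>t. norm (g t) ^ 4)"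
    by (intro bigoI[of _ K]) (auto elim: eventually_mono)
  from landau_o.big_trans[OF this norm_bigo[OF assms(2)]] show ?thesis .
qed

text \<open>Coefficient k collects the Taylor monomials of quasi-degree k, each factor x2
  contributing a sign. For instance x1^2 and x2 x3 both have degree 8, so the cusp sees only a
  combination of them.\<close>

definition cusp_coeff :: "(real^3 \<Rightarrow> real) \<Rightarrow> nat \<Rightarrow> real" where
  "cusp_coeff f k = (if k = 0 then f 0 else if k = 3 then pd 3 f 0 else if k = 4 then pd 1 f 0
    else if k = 5 then - pd 2 f 0 else if k = 6 then pd 3 (pd 3 f) 0 / 2 else if k = 7 then pd 1 (pd 3 f) 0
    else if k = 8 then pd 1 (pd 1 f) 0 / 2 - pd 2 (pd 3 f) 0
    else if k = 9 then pd 3 (pd 3 (pd 3 f)) 0 / 6 - pd 1 (pd 2 f) 0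
    else if k = 10 then pd 2 (pd 2 f) 0 / 2 + pd 1 (pd 3 (pd 3 f)) 0 / 2
    else if k = 11 then pd 1 (pd 1 (pd 3 f)) 0 / 2 - pd 2 (pd 3 (pd 3 f)) 0 / 2 else 0)"

lemma jet_cusp:
  assumes f: "smooth_germ f" shows "jet 12 (cusp_coeff f) (\<lambda>t. f (cusp t))"
proof -
  have "(\<lambda>t. cusp t $ i) \<in> O[at 0](\<lambda>t. t ^ 3)" for i
    using exhaust_3[of i] power_bigo[of 3 4] power_bigo[of 3 5] by auto
  moreover have "isCont cusp 0" by (rule isCont_cusp)
  moreover have "cusp 0 = 0" by (simp add: vec_eq_iff forall_3)
  ultimately have A: "(\<lambda>t. f (cusp t) - (f 0 + (\<Sum>i\<in>UNIV. cusp t$i * pd i f 0) +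
      (\<Sum>i\<in>UNIV. cusp t$i * (\<Sum>j\<in>UNIV. cusp t$j * pd j (pd i f) 0)) / 2 +
      (\<Sum>i\<in>UNIV. cusp t$i * (\<Sum>j\<in>UNIV. cusp t$j * (\<Sum>k\<in>UNIV. cusp t$k * pd k (pd j (pd i f)) 0))) / 6))
    \<in> O[at 0](\<lambda>t. t ^ 12)" (is "(\<lambda>t. f (cusp t) - ?T t) \<in> _")
    using taylor3_bigo[OF f, of cusp 3] by simp
  \<comment> \<open>These are the terms of the cubic Taylor polynomial of quasi-degrees 12 to
    15.\<close>
  have B: "(\<lambda>t. t ^ 12 * ((pd 1 (pd 1 (pd 1 f)) 0 / 6 - pd 1 (pd 2 (pd 3 f)) 0) +
      (pd 2 (pd 2 (pd 3 f)) 0 - pd 1 (pd 1 (pd 2 f)) 0) / 2 * t + pd 1 (pd 2 (pd 2 f)) 0 / 2 * t^2 -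
      pd 2 (pd 2 (pd 2 f)) 0 / 6 * t^3)) \<in> O[at 0](\<lambda>t. t ^ 12 * 1)" (is "?E \<in> _")
    by (intro landau_o.big.mult landau_o.big_refl cont_bigo_1 continuous_intros)
  have C: "?T t - (\<Sum>k<12. cusp_coeff f k * t ^ k) = ?E t" for t
    by (simp add: sum_3 cusp_coeff_def lessThan_nat_numeral pd_sym2[OF f, of 2 1] pd_sym2[OF f, of 3 1] pd_sym2[OF f, of 3 2]
       pd_sym3[OF f, of _ 2 1] pd_sym3[OF f, of _ 3 1] pd_sym3[OF f, of _ 3 2]
       pd_sym3'[OF f, of 2 1] pd_sym3'[OF f, of 3 1] pd_sym3'[OF f, of 3 2])
     (simp add: field_simps eval_nat_numeral)
  have "(\<lambda>t. ?T t - (\<Sum>k<12. cusp_coeff f k * t ^ k)) \<in> O[at 0](\<lambda>t. t ^ 12)"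
    using B unfolding C by simp
  from sum_in_bigo(1)[OF A this] show ?thesis unfolding jet_def by simp
qed

definition axis_coeff :: "(real^3 \<Rightarrow> real) \<Rightarrow> nat \<Rightarrow> real" where
  "axis_coeff f k = (if k = 0 then f 0 else if k = 1 then pd 2 f 0 else if k = 2 then pd 2 (pd 2 f) 0 / 2
     else if k = 3 then pd 2 (pd 2 (pd 2 f)) 0 / 6 else 0)"

lemma jet_axis:
  assumes f: "smooth_germ f" shows "jet 4 (axis_coeff f) (\<lambda>s. f (s *\<^sub>R axis 2 1))"
proof -
  have "(\<lambda>t. (t *\<^sub>R axis 2 1 :: real^3) $ i) \<in> O[at 0](\<lambda>t. t ^ 1)" for i
    using exhaust_3[of i] by (auto simp: axis_def)
  from taylor3_bigo[OF f this] show ?thesis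
    unfolding jet_def
    by (simp add: sum_3 axis_coeff_def lessThan_nat_numeral axis_def)
      (simp add: field_simps eval_nat_numeral)
qed

lemma near0_cusp: assumes "near0 R" shows "\<forall>\<^sub>F t in at 0. R (cusp t)"
proof -
  have "cusp 0 = 0" by (simp add: vec_eq_iff forall_3)
  then have "filterlim cusp (nhds 0) (at 0)" using isCont_cusp[of 0] unfolding isCont_def by simp
  from eventually_compose_filterlim[OF assms this] show ?thesis .
qed

lemma near0_axis: assumes "near0 R" shows "\<forall>\<^sub>F s in at 0. R (s *\<^sub>R axis 2 1 :: real^3)"
proof -
  have "isCont (\<lambda>s::real. s *\<^sub>R axis 2 1 :: real^3) 0" by (intro continuous_intros)
  then have "filterlim (\<lambda>s::real. s *\<^sub>R axis 2 1 :: real^3) (nhds 0) (at 0)" unfolding isCont_def by simp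
  from eventually_compose_filterlim[OF assms this] show ?thesis .
qed

text \<open>The coefficients of the two restrictions must vanish. The relations with factors 2 and 6
  are those satisfied by the second and third derivatives of F1 and F2 themselves. The absence of
  linear terms expresses that the curve spans all three dimensions at 0.\<close>

lemma vanish_jets:
  fixes f :: "real^3 \<Rightarrow> real"
  assumes f: "smooth_germ f" and v: "near0 (\<lambda>x. x \<in> N3 \<longrightarrow> f x = 0)"
  shows "f 0 = 0" "pd i f 0 = 0" "pd 3 (pd 3 f) 0 = 0" "pd 1 (pd 3 f) 0 = 0" "pd 2 (pd 2 f) 0 = 0"
    "pd 1 (pd 1 f) 0 = 2 * pd 2 (pd 3 f) 0" "pd 3 (pd 3 (pd 3 f)) 0 = 6 * pd 1 (pd 2 f) 0"
    "pd 1 (pd 3 (pd 3 f)) 0 = 0" "pd 1 (pd 1 (pd 3 f)) 0 = pd 2 (pd 3 (pd 3 f)) 0"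
proof -
  have "\<forall>\<^sub>F t in at 0. f (cusp t) = 0"
    using near0_cusp[OF v] by (simp add: cusp_N3)
  note c = jet_zero[OF jet_cusp[OF f] this]
  have "\<forall>\<^sub>F s in at 0. f (s *\<^sub>R axis 2 1) = 0"
    using near0_axis[OF v] by (simp add: axis_N3)
  note a = jet_zero[OF jet_axis[OF f] this]
  show "f 0 = 0" using c[of 0] by (simp add: cusp_coeff_def)
  have "pd 3 f 0 = 0" "pd 1 f 0 = 0" "pd 2 f 0 = 0"
    using c[of 3] c[of 4] c[of 5] by (simp_all add: cusp_coeff_def)
  then show "pd i f 0 = 0" using exhaust_3[of i] by auto
  show "pd 3 (pd 3 f) 0 = 0" using c[of 6] by (simp add: cusp_coeff_def)
  show "pd 1 (pd 3 f) 0 = 0" using c[of 7] by (simp add: cusp_coeff_def)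
  show "pd 1 (pd 1 f) 0 = 2 * pd 2 (pd 3 f) 0" using c[of 8] by (simp add: cusp_coeff_def)
  show "pd 3 (pd 3 (pd 3 f)) 0 = 6 * pd 1 (pd 2 f) 0" using c[of 9] by (simp add: cusp_coeff_def)
  \<comment> \<open>On the cusp x2^2 and x1 x3^2 share the degree 10; the axis branch separates
    them.\<close>
  show 2: "pd 2 (pd 2 f) 0 = 0" using a[of 2] by (simp add: axis_coeff_def)
  show "pd 1 (pd 3 (pd 3 f)) 0 = 0" using c[of 10] 2 by (simp add: cusp_coeff_def)
  show "pd 1 (pd 1 (pd 3 f)) 0 = pd 2 (pd 3 (pd 3 f)) 0" using c[of 11] by (simp add: cusp_coeff_def)
qed

text \<open>Here \<open>B\<^sub>k\<close>, \<open>C\<^sub>k\<close>, \<open>A\<^sub>k\<close> are the coefficients of \<open>t\<^sup>k\<close> in the first, second and third component of a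
  diffeomorphism composed with the cusp, and \<open>E\<^sub>k\<close>, \<open>G\<^sub>k\<close> state that the coefficients of \<open>t\<^sup>k\<close> in the
  two equations of the curve vanish.\<close>

lemma curve_jet_relations:
  fixes A3 A4 A6 A7 B3 B4 B6 B7 B8 C3 C4 C5 C6 C7 C8 :: real
  assumes E6: "B3^2 + C3 * A3 = 0" and G6: "B3 * C3 = 0"
    and E7: "2 * B3 * B4 + C3 * A4 + C4 * A3 = 0"
    and E8: "B4^2 + C5 * A3 + C4 * A4 = 0"
    and E9: "2 * B3 * B6 + C6 * A3 + C5 * A4 + C3 * A6 = 0"
    and G9: "B3 * C6 + B4 * C5 + B6 * C3 + A3^3 = 0"
    and E10: "2 * B4 * B6 + 2 * B3 * B7 + C7 * A3 + C6 * A4 + C4 * A6 + C3 * A7 = 0"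
    and G10: "B3 * C7 + B4 * C6 + B6 * C4 + B7 * C3 + 3 * A3^2 * A4 = 0"
    and G11: "B3 * C8 + B4 * C7 + B6 * C5 + B7 * C4 + B8 * C3 + 3 * A3 * A4^2 = 0"
    and nz: "B3 = 0 \<Longrightarrow> B4 * A3 \<noteq> 0"
  obtains l where "l \<noteq> 0" "A3 = l^3" "A4 = 0" "B3 = 0" "B4 = l^4" "B6 = 0" "C3 = 0" "C4 = 0" "C5 = - (l^5)"
    "C6 = 0" "C7 = 0"
proof -
  \<comment> \<open>Multiplying \<open>E6\<close> by \<open>B3\<close> and using \<open>G6\<close>
    gives B3^3 = 0.\<close>
  have B3: "B3 = 0" using E6 G6 by algebra
  then have n: "B4 \<noteq> 0" "A3 \<noteq> 0" using nz by auto
  have C3: "C3 = 0" using E6 B3 n by simp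
  have C4: "C4 = 0" using E7 B3 C3 n by simp
  have e8: "C5 * A3 = - (B4^2)" using E8 C4 by simp
  have e9: "C6 * A3 = - (C5 * A4)" using E9 B3 C3 by simp
  have g9: "B4 * C5 = - (A3^3)" using G9 B3 C3 by simp
  \<comment> \<open>In the expected solution \<open>B4\<close> is l^4 and \<open>A3\<close> is l^3,
    so their quotient must be l.\<close>
  define l where "l = B4 / A3"
  have l0: "l \<noteq> 0" using n by (simp add: l_def)
  have B4l: "B4 = l * A3" using n by (simp add: l_def)
  have "B4 * (C5 * A3) = - (A3^3) * A3" using g9 by (simp add: mult.assoc[symmetric])
  then have "B4^3 = A3^4" unfolding e8 by (simp add: eval_nat_numeral)
  then have "l^3 * A3^3 = A3 * A3^3" unfolding B4l by (simp add: eval_nat_numeral algebra_simps)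
  then have A3: "A3 = l^3" using n by simp
  have B4: "B4 = l^4" using B4l A3 by (simp add: eval_nat_numeral)
  have "(C5 + l^5) * l^3 = 0" using e8 A3 B4 by (simp add: eval_nat_numeral algebra_simps)
  then have C5: "C5 = - (l^5)" using l0 by (simp add: eq_neg_iff_add_eq_0)
  have "C6 * l^3 = (l^2 * A4) * l^3" using e9 A3 C5 by (simp add: eval_nat_numeral algebra_simps)
  then have C6': "C6 = l^2 * A4" using l0 by simp
  have "l^4 * C6 + 3 * (l^3)^2 * A4 = 0" using G10 B3 C3 C4 A3 B4 by simp
  then have "l^6 * (4 * A4) = 0" unfolding C6' by (simp add: eval_nat_numeral algebra_simps)
  then have A4: "A4 = 0" using l0 by simp
  then have C6: "C6 = 0" using C6' by simp
  have "(C7 + 2 * l * B6) * l^3 = 0" using E10 B3 C3 C4 C6 A3 B4 by (simp add: eval_nat_numeral algebra_simps)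
  then have C7': "C7 = - 2 * l * B6" using l0 by simp
  have "l^4 * C7 - l^5 * B6 = 0" using G11 B3 C3 C4 A4 B4 C5 by (simp add: algebra_simps)
  then have "l^5 * (- 3 * B6) = 0" unfolding C7' by (simp add: eval_nat_numeral algebra_simps)
  then have B6: "B6 = 0" using l0 by simp
  then have C7: "C7 = 0" using C7' by simp
  with l0 A3 A4 B3 B4 B6 C3 C4 C5 C6 C7 show ?thesis by (intro that)
qed

text \<open>The axis branch forces the second column of the differential onto the second axis.
  Invertibility then passes to the block of the first and third coordinates and supplies the
  nonvanishing hypothesis of \<open>curve_jet_relations\<close>. The three second derivatives enter
  the comparison of degrees 10 and 11, where coefficients of degree 8 or 9 may still be
  nonzero.\<close>

lemma psi_jets:
  fixes \<psi> :: "real^3 \<Rightarrow> real^3"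
  defines "p \<equiv> \<lambda>i x. \<psi> x $ i"
  assumes \<psi>: "smooth_germ \<psi>" "\<psi> 0 = 0" and N: "near0 (\<lambda>x. x \<in> N3 \<longrightarrow> \<psi> x \<in> N3)"
    and inj: "inj (frechet_derivative \<psi> (at 0))"
  obtains l where "l \<noteq> 0" "\<And>i j. pd j (p i) 0 = (if i = j then l ^ wt i else 0)"
    "pd 3 (pd 3 (p 1)) 0 = 0" "pd 3 (pd 3 (p 2)) 0 = 0" "pd 1 (pd 3 (p 2)) 0 = 0"
proof -
  have sm: "smooth_germ (p i)" for i unfolding p_def by (rule smooth_germ_nth[OF \<psi>(1)])
  have p0: "p i 0 = 0" for i by (simp add: p_def \<psi>)
  have ker: "v = 0" if "\<And>i. (\<Sum>j\<in>UNIV. v $ j * pd j (p i) 0) = 0" for v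
  proof -
    have d: "(\<psi> has_derivative frechet_derivative \<psi> (at 0)) (at 0)"
      by (rule smooth_germ_has_derivative0[OF \<psi>(1)])
    have "frechet_derivative \<psi> (at 0) v $ i = 0" for i
      using that[of i] by (simp add: derivative_eq_sum_pd[OF d] p_def pd_nth[OF d])
    then have "frechet_derivative \<psi> (at 0) v = frechet_derivative \<psi> (at 0) 0"
      using linear_0[OF has_derivative_linear[OF d]] by (simp add: vec_eq_iff)
    then show ?thesis using inj by (simp add: inj_def)
  qed
  have E: "near0 (\<lambda>x. x \<in> N3 \<longrightarrow> p 1 x * p 1 x + p 2 x * p 3 x = 0)"
    and G: "near0 (\<lambda>x. x \<in> N3 \<longrightarrow> p 1 x * p 2 x + p 3 x * (p 3 x * p 3 x) = 0)"
    using N by (auto elim!: eventually_mono simp: N3_def p_def power2_eq_square power3_eq_cube)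
  define a b c where "a = axis_coeff (p 3)" and "b = axis_coeff (p 1)" and "c = axis_coeff (p 2)"
  note ja = jet_axis[OF sm[of 3], folded a_def] and jb = jet_axis[OF sm[of 1], folded b_def]
    and jc = jet_axis[OF sm[of 2], folded c_def]
  have z: "a 0 = 0" "b 0 = 0" "c 0 = 0" by (simp_all add: a_def b_def c_def axis_coeff_def p0)
  have "\<forall>\<^sub>F s in at 0. p 1 (s *\<^sub>R axis 2 1) * p 1 (s *\<^sub>R axis 2 1) + p 2 (s *\<^sub>R axis 2 1) * p 3 (s *\<^sub>R axis 2 1) = 0"
    using near0_axis[OF E] by (simp add: axis_N3)
  note e = jet_zero[OF jet_add[OF jet_mult[OF jb jb] jet_mult[OF jc ja]] this]
  have "\<forall>\<^sub>F s in at 0. p 1 (s *\<^sub>R axis 2 1) * p 2 (s *\<^sub>R axis 2 1) +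
      p 3 (s *\<^sub>R axis 2 1) * (p 3 (s *\<^sub>R axis 2 1) * p 3 (s *\<^sub>R axis 2 1)) = 0"
    using near0_axis[OF G] by (simp add: axis_N3)
  note g = jet_zero[OF jet_add[OF jet_mult[OF jb jc] jet_mult[OF ja jet_mult[OF ja ja]]] this]
  have e2: "b 1 * b 1 + c 1 * a 1 = 0" using e[of 2] z by (simp add: atMost_nat_numeral)
  have g2: "b 1 * c 1 = 0" using g[of 2] z by (simp add: atMost_nat_numeral)
  have g3: "b 1 * c 2 + b 2 * c 1 + a 1 * (a 1 * a 1) = 0" using g[of 3] z
    by (simp add: atMost_nat_numeral numeral_3_eq_3 numeral_2_eq_2)
  have abc: "a 1 = pd 2 (p 3) 0" "b 1 = pd 2 (p 1) 0" "c 1 = pd 2 (p 2) 0"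
    by (simp_all add: a_def b_def c_def axis_coeff_def)
  \<comment> \<open>Otherwise the coefficients of s^2 and s^3 would make the whole second column of
    the differential vanish.\<close>
  have c1: "c 1 \<noteq> 0"
  proof
    assume c: "c 1 = 0"
    then have "b 1 = 0" using e2 by simp
    moreover have "a 1 = 0" using g3 c \<open>b 1 = 0\<close> by simp
    ultimately have "axis 2 (1::real) = (0 :: real^3)"
      using c abc exhaust_3 by (intro ker) (auto simp: sum_3 axis_def, metis exhaust_3)
    then show False by (simp add: axis_eq_0_iff)
  qed
  have b1: "b 1 = 0" using g2 c1 by simp
  have a1: "a 1 = 0" using e2 b1 c1 by simp
  define A B C where "A = cusp_coeff (p 3)" and "B = cusp_coeff (p 1)" and "C = cusp_coeff (p 2)"
  note jA = jet_cusp[OF sm[of 3], folded A_def] and jB = jet_cusp[OF sm[of 1], folded B_def]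
    and jC = jet_cusp[OF sm[of 2], folded C_def]
  have Z: "A 0 = 0" "B 0 = 0" "C 0 = 0" "A 1 = 0" "B 1 = 0" "C 1 = 0" "A 2 = 0" "B 2 = 0" "C 2 = 0"
    "A 5 = 0" "B 5 = 0"
    using a1[unfolded abc] b1[unfolded abc] by (simp_all add: A_def B_def C_def cusp_coeff_def p0)
  have Z': "A (Suc 0) = 0" "B (Suc 0) = 0" "C (Suc 0) = 0" using Z by simp_all
  have "\<forall>\<^sub>F t in at 0. p 1 (cusp t) * p 1 (cusp t) + p 2 (cusp t) * p 3 (cusp t) = 0"
    using near0_cusp[OF E] by (simp add: cusp_N3)
  note e = jet_zero[OF jet_add[OF jet_mult[OF jB jB] jet_mult[OF jC jA]] this]
  have "\<forall>\<^sub>F t in at 0. p 1 (cusp t) * p 2 (cusp t) + p 3 (cusp t) * (p 3 (cusp t) * p 3 (cusp t)) = 0"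
    using near0_cusp[OF G] by (simp add: cusp_N3)
  note g = jet_zero[OF jet_add[OF jet_mult[OF jB jC] jet_mult[OF jA jet_mult[OF jA jA]]] this]
  note s = atMost_nat_numeral Z Z' power2_eq_square power3_eq_cube
  have nz: "B 3 = 0 \<Longrightarrow> B 4 * A 3 \<noteq> 0"
  proof
    assume B3: "B 3 = 0" and BA: "B 4 * A 3 = 0"
    have D: "pd 3 (p 3) 0 = A 3" "pd 3 (p 1) 0 = B 3" "pd 3 (p 2) 0 = C 3"
      "pd 1 (p 3) 0 = A 4" "pd 1 (p 1) 0 = B 4" "pd 1 (p 2) 0 = C 4"
      by (simp_all add: A_def B_def C_def cusp_coeff_def)
    have ker': "v1 = 0 \<and> v3 = 0" if "v1 * B 4 + v3 * B 3 = 0" "v1 * A 4 + v3 * A 3 = 0" for v1 v3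
    proof -
      \<comment> \<open>The second component cancels the second row, which is possible because
        \<open>pd 2 (p 2) 0\<close> is nonzero; only the first and third rows remain as
        conditions.\<close>
      define w where "w = (vector [v1, - (v1 * C 4 + v3 * C 3) / pd 2 (p 2) 0, v3] :: real^3)"
      have "(\<Sum>j\<in>UNIV. w $ j * pd j (p i) 0) = 0" for i
        using exhaust_3[of i] that a1[unfolded abc] b1[unfolded abc] c1[unfolded abc] by (auto simp: sum_3 w_def D)
      then have "w = 0" by (rule ker)
      then show ?thesis by (simp add: w_def vec_eq_iff forall_3)
    qed
    show False
    proof (cases "A 3 = 0")
      case True
      then show False using ker'[of 0 1] B3 by simp
    next
      case False
      then show False using ker'[of 1 "- A 4 / A 3"] B3 BA by simp
    qed
  qed
  obtain l where l: "l \<noteq> 0" "A 3 = l^3" "A 4 = 0" "B 3 = 0" "B 4 = l^4" "B 6 = 0" "C 3 = 0" "C 4 = 0" "C 5 = - (l^5)"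
    "C 6 = 0" "C 7 = 0"
  proof (rule curve_jet_relations[of "B 3" "C 3" "A 3" "B 4" "A 4" "C 4" "C 5" "B 6" "C 6" "A 6" "B 7" "C 7" "A 7" "C 8" "B 8"])
    show "(B 3)^2 + C 3 * A 3 = 0" using e[of 6] by (simp add: s)
    show "B 3 * C 3 = 0" using g[of 6] by (simp add: s)
    show "2 * B 3 * B 4 + C 3 * A 4 + C 4 * A 3 = 0" using e[of 7] by (simp add: s)
    show "(B 4)^2 + C 5 * A 3 + C 4 * A 4 = 0" using e[of 8] by (simp add: s)
    show "2 * B 3 * B 6 + C 6 * A 3 + C 5 * A 4 + C 3 * A 6 = 0" using e[of 9] by (simp add: s)
    show "B 3 * C 6 + B 4 * C 5 + B 6 * C 3 + (A 3)^3 = 0" using g[of 9] by (simp add: s)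
    show "2 * B 4 * B 6 + 2 * B 3 * B 7 + C 7 * A 3 + C 6 * A 4 + C 4 * A 6 + C 3 * A 7 = 0" using e[of 10] by (simp add: s)
    show "B 3 * C 7 + B 4 * C 6 + B 6 * C 4 + B 7 * C 3 + 3 * (A 3)^2 * A 4 = 0" using g[of 10] by (simp add: s)
    show "B 3 * C 8 + B 4 * C 7 + B 6 * C 5 + B 7 * C 4 + B 8 * C 3 + 3 * A 3 * (A 4)^2 = 0" using g[of 11] by (simp add: s)
  qed (use nz in blast)+
  show ?thesis
  proof (rule that[of l])
    show "l \<noteq> 0" by (rule l)
    show "pd j (p i) 0 = (if i = j then l ^ wt i else 0)" for i j
      using exhaust_3[of i] exhaust_3[of j] l a1[unfolded abc] b1[unfolded abc]
      by (auto simp: A_def B_def C_def cusp_coeff_def)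
    show "pd 3 (pd 3 (p 1)) 0 = 0" "pd 3 (pd 3 (p 2)) 0 = 0" "pd 1 (pd 3 (p 2)) 0 = 0"
      using l by (simp_all add: B_def C_def cusp_coeff_def)
  qed
qed

section \<open>Diffeomorphism germs\<close>

lemma diffeo_repD:
  assumes "diffeo_rep U f"
  shows "open U" "0 \<in> U" "f 0 = 0" "inj_on f U" "open (f ` U)" "smooth_on U f" "smooth_on (f ` U) (inv_into U f)"
  using assms by (auto simp: diffeo_rep_def)

lemma diffeo_rep_inv:
  assumes "diffeo_rep U f" shows "diffeo_rep (f ` U) (inv_into U f)"
proof -
  note d = diffeo_repD[OF assms]
  have img: "inv_into U f ` f ` U = U" using d(4) by simp
  have inv: "inv_into (f ` U) (inv_into U f) x = f x" if "x \<in> U" for x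
    using inv_into_f_f[OF inj_on_inv_into[of "f ` U" f U], of "f x"] that d(4) by simp
  have "smooth_on U (inv_into (f ` U) (inv_into U f))"
    by (rule smooth_on_cong[OF d(1) inv[symmetric] d(6)])
  then show ?thesis
    using d img inj_on_inv_into[of "f ` U" f U] inv_into_f_f[OF d(4,2)] d(2)
    by (auto simp: diffeo_rep_def image_iff intro!: bexI[of _ 0])
qed

lemma diffeo_rep_compose:
  assumes f: "diffeo_rep U f" and g: "diffeo_rep V g" and sub: "f ` U \<subseteq> V"
  shows "diffeo_rep U (\<lambda>x. g (f x))"
proof -
  note df = diffeo_repD[OF f] and dg = diffeo_repD[OF g]
  have inj: "inj_on (\<lambda>x. g (f x)) U"
    using df(4) dg(4) sub by (auto simp: inj_on_def image_subset_iff)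
  have cont: "continuous_on (g ` V) (inv_into V g)" by (rule smooth_on_derivative(3)[OF dg(7)])
  have eq: "(\<lambda>x. g (f x)) ` U = inv_into V g -` (f ` U) \<inter> g ` V"
    using sub dg(4) by (auto simp: image_iff) (metis imageI inv_into_f_f subset_iff)+
  have op: "open ((\<lambda>x. g (f x)) ` U)"
    unfolding eq using continuous_on_open_vimage[OF dg(5)] cont df(5) by blast
  have inv: "inv_into U (\<lambda>x. g (f x)) y = inv_into U f (inv_into V g y)" if y: "y \<in> (\<lambda>x. g (f x)) ` U" for y
  proof -
    obtain x where x: "x \<in> U" "y = g (f x)" using y by blast
    then have "inv_into V g y = f x" using sub dg(4) by (auto intro: inv_into_f_f)
    then show ?thesis using x inv_into_f_f[OF inj x(1)] inv_into_f_f[OF df(4) x(1)] by simp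
  qed
  have "smooth_on ((\<lambda>x. g (f x)) ` U) (\<lambda>y. inv_into U f (inv_into V g y))"
  proof (rule smooth_on_compose[OF op df(5) df(7)])
    show "smooth_on ((\<lambda>x. g (f x)) ` U) (inv_into V g)"
      by (rule smooth_on_subset[OF dg(7)]) (use sub in auto)
    show "inv_into V g ` (\<lambda>x. g (f x)) ` U \<subseteq> f ` U" unfolding eq by auto
  qed
  then have "smooth_on ((\<lambda>x. g (f x)) ` U) (inv_into U (\<lambda>x. g (f x)))"
    by (rule smooth_on_cong[OF op inv[symmetric], rotated])
  then show ?thesis
    using df dg inj op smooth_on_compose[OF df(1) dg(1) dg(6) df(6) sub] by (simp add: diffeo_rep_def)
qed

text \<open>Restriction is composition with the identity of the smaller set, so the change of domain
  inside \<open>inv_into\<close> is already covered.\<close>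

lemma diffeo_rep_subset:
  assumes f: "diffeo_rep U f" and V: "open V" "0 \<in> V" "V \<subseteq> U"
  shows "diffeo_rep V f"
proof -
  have id: "diffeo_rep V (\<lambda>x. x)"
  proof -
    have "smooth_on V (inv_into V (\<lambda>x. x))"
      by (rule smooth_on_cong[OF V(1) _ smooth_on_ident_linear[OF V(1) bounded_linear_ident]])
        (metis inj_on_id2 inv_into_f_f)
    then show ?thesis using V smooth_on_ident_linear[OF V(1) bounded_linear_ident] by (simp add: diffeo_rep_def)
  qed
  show ?thesis using diffeo_rep_compose[OF id f] V(3) by simp
qed

lemma diffeo_rep_linear:
  fixes A :: "'a::euclidean_space \<Rightarrow> 'a"
  assumes "linear A" "inj A" shows "diffeo_rep UNIV A"
proof -
  have surj: "surj A" using linear_injective_imp_surjective[OF assms] by simp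
  obtain B where B: "linear B" "B \<circ> A = id" using linear_injective_left_inverse[OF assms] by blast
  have "inv_into UNIV A y = B y" for y
  proof -
    obtain x where "y = A x" using surj by blast
    then show ?thesis using fun_cong[OF B(2), of x] inv_f_f[OF assms(2)] by simp
  qed
  then have "inv_into UNIV A = B" by blast
  then show ?thesis
    using assms surj B(1) linear_0[OF assms(1)]
    by (auto simp: diffeo_rep_def linear_conv_bounded_linear intro: smooth_on_ident_linear)
qed

lemma diffeo_rep_inj_derivative:
  assumes "diffeo_rep U f" "x \<in> U" shows "inj (frechet_derivative f (at x))"
proof -
  note d = diffeo_repD[OF assms(1)]
  let ?g = "inv_into U f"
  have 1: "(f has_derivative frechet_derivative f (at x)) (at x)"
    by (rule smooth_on_derivative(2)[OF d(6) assms(2)])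
  have 2: "(?g has_derivative frechet_derivative ?g (at (f x))) (at (f x))"
    by (rule smooth_on_derivative(2)[OF d(7)]) (use assms(2) in blast)
  have "((\<lambda>y. ?g (f y)) has_derivative (\<lambda>v. frechet_derivative ?g (at (f x)) (frechet_derivative f (at x) v))) (at x)"
    by (rule has_derivative_compose[OF 1 2])
  then have "((\<lambda>y. y) has_derivative (\<lambda>v. frechet_derivative ?g (at (f x)) (frechet_derivative f (at x) v))) (at x)"
    by (rule has_derivative_transform_within_open[OF _ d(1) assms(2)]) (rule inv_into_f_f[OF d(4)])
  from has_derivative_unique[OF this has_derivative_ident]
  have "frechet_derivative ?g (at (f x)) (frechet_derivative f (at x) v) = v" for v by metis
  then show ?thesis by (metis injI)
qed

section \<open>Linear symplectic algebra\<close>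

text \<open>A complex structure compatible with the inner product: it encodes the symplectic form as
  \<open>K v \<bullet> w\<close> and turns gradients into Hamiltonian vector fields without
  reference to paired coordinates.\<close>

locale sympl =
  fixes K :: "real^'m \<Rightarrow> real^'m"
  assumes linear_K: "linear K" and KK: "K (K v) = - v" and K_anti: "K v \<bullet> w = - (v \<bullet> K w)"
begin

definition om :: "real^'m \<Rightarrow> real^'m \<Rightarrow> real" where "om v w = K v \<bullet> w"

lemma bounded_bilinear_om: "bounded_bilinear om"
  unfolding om_def
  by (rule bounded_bilinear.comp1[OF bounded_bilinear_inner])
    (use linear_K in \<open>simp add: linear_conv_bounded_linear\<close>)

lemmas om_simps =
  bounded_bilinear.add_left[OF bounded_bilinear_om] bounded_bilinear.add_right[OF bounded_bilinear_om]
  bounded_bilinear.diff_left[OF bounded_bilinear_om] bounded_bilinear.diff_right[OF bounded_bilinear_om]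
  bounded_bilinear.minus_left[OF bounded_bilinear_om] bounded_bilinear.minus_right[OF bounded_bilinear_om]
  bounded_bilinear.scaleR_left[OF bounded_bilinear_om] bounded_bilinear.scaleR_right[OF bounded_bilinear_om]
  bounded_bilinear.zero_left[OF bounded_bilinear_om] bounded_bilinear.zero_right[OF bounded_bilinear_om]

lemma om_swap: "om v w = - om w v"
  unfolding om_def by (metis K_anti inner_commute)

lemma om_self [simp]: "om v v = 0"
  using om_swap[of v v] by simp

lemma K_inner: "K v \<bullet> K w = v \<bullet> w"
  by (simp add: K_anti KK)

definition symp_linear :: "(real^'m \<Rightarrow> real^'m) \<Rightarrow> bool" where
  "symp_linear A \<longleftrightarrow> linear A \<and> (\<forall>v w. om (A v) (A w) = om v w)"

lemma symp_linear_compose: "symp_linear A \<Longrightarrow> symp_linear B \<Longrightarrow> symp_linear (\<lambda>x. A (B x))"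
  using linear_compose[of B A] by (simp add: symp_linear_def comp_def)

lemma symp_linear_id: "symp_linear (\<lambda>x. x)"
  by (simp add: symp_linear_def linear_ident)

lemma symp_linear_inj: assumes "symp_linear A" shows "inj A"
proof (subst linear_injective_0)
  show "linear A" using assms by (simp add: symp_linear_def)
  show "\<forall>x. A x = 0 \<longrightarrow> x = 0"
  proof (intro allI impI)
    fix x assume "A x = 0"
    then have "om x (K x) = 0" using assms by (metis symp_linear_def om_simps(9))
    then have "K x \<bullet> K x = 0" by (simp add: om_def)
    then show "x = 0" by (simp add: K_inner)
  qed
qed

lemma transvection:
  "symp_linear (\<lambda>v. v + (c * om u v) *\<^sub>R u)"
  unfolding symp_linear_def
proof (intro conjI allI linearI)
  fix v w
  show "om (v + (c * om u v) *\<^sub>R u) (w + (c * om u w) *\<^sub>R u) = om v w"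
    using om_swap[of v u] by (simp add: om_simps algebra_simps)
qed (simp_all add: om_simps algebra_simps)

text \<open>The transvection along d - c takes c to d when \<open>om c d\<close> is nonzero, and it
  fixes every vector on which \<open>om (d - c)\<close> vanishes.\<close>

lemma move_vector1:
  assumes "\<And>x. x \<in> W \<Longrightarrow> om c x = om d x" "om c d \<noteq> 0"
  obtains B where "symp_linear B" "\<And>x. x \<in> W \<Longrightarrow> B x = x" "B c = d"
proof (rule that[OF transvection[of "1 / om d c" "d - c"]])
  show "x + (1 / om d c * om (d - c) x) *\<^sub>R (d - c) = x" if "x \<in> W" for x
    using assms(1)[OF that] by (simp add: om_simps)
  have "om d c \<noteq> 0" using assms(2) om_swap[of c d] by simp
  then show "c + (1 / om d c * om (d - c) c) *\<^sub>R (d - c) = d"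
    by (simp add: om_simps)
qed

text \<open>Up to sign, \<open>y\<close> is \<open>K\<close> applied to the component of
  \<open>c\<close> orthogonal to the span of \<open>W\<close>; this makes nondegeneracy
  explicit.\<close>

lemma separate:
  assumes "c \<notin> span W" obtains y where "\<And>x. x \<in> W \<Longrightarrow> om y x = 0" "om y c \<noteq> 0"
proof -
  obtain z1 z2 where z: "z1 \<in> span W" "\<And>w. w \<in> span W \<Longrightarrow> orthogonal z2 w" "c = z1 + z2"
    using orthogonal_subspace_decomp_exists[of W c] by metis
  have "z2 \<noteq> 0" using assms z by auto
  have om: "om (- K z2) x = z2 \<bullet> x" for x
    using linear_neg[OF linear_K] by (simp add: om_def KK)
  show ?thesis
  proof (rule that[of "- K z2"])
    show "om (- K z2) x = 0" if "x \<in> W" for x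
      unfolding om using z(2)[OF span_base[OF that]] by (simp add: orthogonal_def)
    show "om (- K z2) c \<noteq> 0"
      unfolding om using z(2)[OF z(1)] \<open>z2 \<noteq> 0\<close> by (simp add: z(3) inner_add_right orthogonal_def)
  qed
qed

lemma move_vector:
  assumes W: "\<And>x. x \<in> W \<Longrightarrow> om c x = om d x" and c: "c \<notin> span W" and d: "d \<notin> span W"
  obtains B where "symp_linear B" "\<And>x. x \<in> W \<Longrightarrow> B x = x" "B c = d"
proof (cases "om c d = 0")
  case False
  then show ?thesis using move_vector1[of W c d] W that by metis
next
  case True
  obtain y1 where y1: "\<And>x. x \<in> W \<Longrightarrow> om y1 x = 0" "om y1 c \<noteq> 0" using separate[OF c] by blast
  obtain y2 where y2: "\<And>x. x \<in> W \<Longrightarrow> om y2 x = 0" "om y2 d \<noteq> 0" using separate[OF d] by blast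
  have "\<exists>y. (\<forall>x\<in>W. om y x = 0) \<and> om y c \<noteq> 0 \<and> om y d \<noteq> 0"
  proof (cases "om y1 d = 0 \<and> om y2 c = 0")
    case True
    then show ?thesis using y1 y2 by (intro exI[of _ "y1 + y2"]) (simp add: om_simps)
  next
    case False
    then show ?thesis using y1 y2 by blast
  qed
  then obtain y where y: "\<And>x. x \<in> W \<Longrightarrow> om y x = 0" "om y c \<noteq> 0" "om y d \<noteq> 0" by blast
  obtain B1 where B1: "symp_linear B1" "\<And>x. x \<in> W \<Longrightarrow> B1 x = x" "B1 c = c + y"
    by (rule move_vector1[of W c "c + y"])
      (use y om_swap[of c y] in \<open>auto simp: om_simps\<close>)
  obtain B2 where B2: "symp_linear B2" "\<And>x. x \<in> W \<Longrightarrow> B2 x = x" "B2 (c + y) = d"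
    by (rule move_vector1[of W "c + y" d])
      (use y W True in \<open>auto simp: om_simps\<close>)
  show ?thesis
    using that[OF symp_linear_compose[OF B2(1) B1(1)]] B1 B2 by simp
qed

lemma axis_not_in_span: "k \<notin> S \<Longrightarrow> axis k (1::real) \<notin> span ((\<lambda>i. axis i 1) ` S)"
proof
  assume k: "k \<notin> S" and "axis k (1::real) \<in> span ((\<lambda>i. axis i 1) ` S)"
  moreover have "span ((\<lambda>i. axis i (1::real)) ` S) \<subseteq> {v. v $ k = 0}"
    using k by (intro span_minimal) (auto simp: subspace_def axis_def)
  ultimately show False by (auto simp: axis_def)
qed

text \<open>The axis vectors are matched one at a time: each correction fixes the images already
  matched, and injectivity keeps the next vector outside their span.\<close>

lemma witt:
  fixes f g :: "real^'n \<Rightarrow> real^'m"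
  assumes f: "linear f" "inj f" and g: "linear g" "inj g"
    and om: "\<And>i j. om (f (axis i 1)) (f (axis j 1)) = om (g (axis i 1)) (g (axis j 1))"
  obtains A where "symp_linear A" "\<And>v. A (f v) = g v"
proof -
  have "\<exists>A. symp_linear A \<and> (\<forall>i\<in>S. A (f (axis i 1)) = g (axis i 1))" if "finite S" for S :: "'n set"
    using that
  proof (induction S)
    case empty
    then show ?case using symp_linear_id by blast
  next
    case (insert k S)
    then obtain A where A: "symp_linear A" "\<And>i. i \<in> S \<Longrightarrow> A (f (axis i 1)) = g (axis i 1)" by blast
    let ?E = "(\<lambda>i. axis i (1::real)) ` S"
    let ?W = "(\<lambda>i. g (axis i 1)) ` S"
    have notin: "h (axis k 1) \<notin> span ?W" if h: "linear h" "inj h" "\<And>i. i \<in> S \<Longrightarrow> h (axis i 1) = g (axis i 1)"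
      for h :: "real^'n \<Rightarrow> real^'m"
    proof
      assume "h (axis k 1) \<in> span ?W"
      moreover have "?W = h ` ?E" using h(3) by (force simp: image_iff)
      ultimately have "h (axis k 1) \<in> h ` span ?E" using linear_span_image[OF h(1)] by simp
      then have "axis k 1 \<in> span ?E" using h(2) by (auto simp: inj_def)
      then show False using axis_not_in_span[of k S] insert by blast
    qed
    have lA: "linear (\<lambda>v. A (f v))" using A(1) linear_compose[OF f(1), of A] by (simp add: symp_linear_def comp_def)
    have iA: "inj (\<lambda>v. A (f v))" using inj_compose[OF symp_linear_inj[OF A(1)] f(2)] by (simp add: comp_def)
    obtain B where B: "symp_linear B" "\<And>x. x \<in> ?W \<Longrightarrow> B x = x" "B (A (f (axis k 1))) = g (axis k 1)"
    proof (rule move_vector[of ?W "A (f (axis k 1))" "g (axis k 1)"])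
      show "om (A (f (axis k 1))) x = om (g (axis k 1)) x" if "x \<in> ?W" for x
        using that A om by (auto simp: symp_linear_def) (metis A(2))
      show "A (f (axis k 1)) \<notin> span ?W" by (rule notin[OF lA iA A(2)])
      show "g (axis k 1) \<notin> span ?W" by (rule notin[OF g refl])
    qed blast
    show ?case
      using symp_linear_compose[OF B(1) A(1)] A(2) B by (intro exI[of _ "\<lambda>x. B (A x)"]) auto
  qed
  from this[of UNIV] obtain A where A: "symp_linear A" "\<And>i. A (f (axis i 1)) = g (axis i 1)" by auto
  have "A (f v) = g v" for v
  proof -
    have l: "linear (\<lambda>v. A (f v))" using A(1) linear_compose[OF f(1), of A] by (simp add: symp_linear_def comp_def)
    have v: "v = (\<Sum>i\<in>UNIV. v $ i *\<^sub>R axis i 1)"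
      by (simp add: vec_eq_iff axis_def if_distrib[of "(*) _"] cong: if_cong)
    have "A (f (\<Sum>i\<in>UNIV. v $ i *\<^sub>R axis i 1)) = g (\<Sum>i\<in>UNIV. v $ i *\<^sub>R axis i 1)"
      by (simp add: linear_sum[OF l] linear_cmul[OF l] linear_sum[OF g(1)] linear_cmul[OF g(1)] A(2))
    then show ?thesis using v by simp
  qed
  with A(1) show ?thesis by (rule that)
qed

end

section \<open>Symplectic equivalence from equal algebraic restrictions\<close>

lemma pd_bilinear:
  fixes f :: "real^'n \<Rightarrow> 'a::real_normed_vector" and g :: "real^'n \<Rightarrow> 'b::real_normed_vector"
  assumes "bounded_bilinear B" "(f has_derivative frechet_derivative f (at x)) (at x)"
    "(g has_derivative frechet_derivative g (at x)) (at x)"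
  shows "pd i (\<lambda>x. B (f x) (g x)) x = B (f x) (pd i g x) + B (pd i f x) (g x)"
  using pd_eqI[OF bounded_bilinear.FDERIV[OF assms]] by (simp add: pd_def)

lemma pd_linear:
  assumes "bounded_linear L" "(f has_derivative frechet_derivative f (at x)) (at x)"
  shows "pd i (\<lambda>x. L (f x)) x = L (pd i f x)"
  using pd_eqI[OF bounded_linear.has_derivative[OF assms]] by (simp add: pd_def)

lemma pd_sum:
  assumes "\<And>k. k \<in> I \<Longrightarrow> (f k has_derivative frechet_derivative (f k) (at x)) (at x)"
  shows "pd i (\<lambda>x. \<Sum>k\<in>I. f k x) x = (\<Sum>k\<in>I. pd i (f k) x)"
  using pd_eqI[OF has_derivative_sum[OF assms]] by (simp add: pd_def)

lemma frechet_derivative_0_cong: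
  fixes f g :: "real^'n \<Rightarrow> 'b::real_normed_vector"
  assumes "smooth_germ f" "smooth_germ g" "\<And>i. pd i f 0 = pd i g 0"
  shows "frechet_derivative f (at 0) = frechet_derivative g (at 0)"
  by (rule ext) (simp add: derivative_eq_sum_pd smooth_germ_has_derivative0 assms)

lemma smooth_germ_ident: "smooth_germ (\<lambda>x. x)"
  by (rule smooth_germ_bounded_linear[OF bounded_linear_ident])

context sympl
begin

lemma bounded_linear_K: "bounded_linear K"
  using linear_K by (simp add: linear_conv_bounded_linear)

text \<open>The pullback by \<open>g\<close> of the Liouville form om(z, dz) / 2, whose differential
  is the symplectic form.\<close>

definition liou :: "(real^3 \<Rightarrow> real^'m) \<Rightarrow> real^3 \<Rightarrow> real^3" where
  "liou g x = (\<chi> j. om (g x) (pd j g x) / 2)"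

definition symp_rep :: "(real^'m) set \<Rightarrow> (real^'m \<Rightarrow> real^'m) \<Rightarrow> bool" where
  "symp_rep U F \<longleftrightarrow> diffeo_rep U F \<and>
     (\<forall>x\<in>U. \<forall>v w. om (frechet_derivative F (at x) v) (frechet_derivative F (at x) w) = om v w)"

lemma smooth_germ_om: "smooth_germ f \<Longrightarrow> smooth_germ g \<Longrightarrow> smooth_germ (\<lambda>x. om (f x) (g x))"
  by (rule smooth_germ_bilinear[OF bounded_bilinear_om])

text \<open>The symplectomorphism is \<open>G\<^sub>+ \<circ> G\<^sub>-\<^sup>-\<^sup>1\<close> with \<open>G\<^sub>\<plusminus> z = z \<minusplus> K (\<nabla>S z) / 2\<close>: such a map preserves \<open>om\<close> because
  the Hessian of \<open>S\<close> is symmetric. The generating function \<open>S\<close> is chosen so that \<open>G\<^sub>+\<close> and \<open>G\<^sub>-\<close> take the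
  midpoint \<open>m = (g\<^sub>1 + g\<^sub>2) / 2\<close> to \<open>g\<^sub>2\<close> and \<open>g\<^sub>1\<close> along the curve.\<close>

lemma darboux_core:
  fixes g1 g2 :: "real^3 \<Rightarrow> real^'m"
  assumes sm: "smooth_germ g1" "smooth_germ g2" and z: "g1 0 = 0" "g2 0 = 0"
    and D: "\<And>j. pd j g1 0 = pd j g2 0" and inj: "inj (frechet_derivative g1 (at 0))"
    and nul: "null (\<lambda>x. liou g2 x - liou g1 x)"
  obtains U F where "symp_rep U F" "near0 (\<lambda>x. x \<in> N3 \<longrightarrow> g1 x \<in> U \<and> F (g1 x) = g2 x)"
proof -
  note d1 = smooth_germ_has_derivative[OF sm(1)] and d2 = smooth_germ_has_derivative[OF sm(2)]
  define m h where "m = (\<lambda>x. (1/2) *\<^sub>R (g1 x + g2 x))" and "h = (\<lambda>x. g2 x - g1 x)"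
  have smm: "smooth_germ m" and smh: "smooth_germ h"
    unfolding m_def h_def by (intro smooth_germ_intros sm)+
  have m0: "m 0 = 0" and h0: "h 0 = 0" using z by (simp_all add: m_def h_def)
  have pdmh: "near0 (\<lambda>x. \<forall>j. pd j m x = (1/2) *\<^sub>R (pd j g1 x + pd j g2 x) \<and> pd j h x = pd j g2 x - pd j g1 x)"
    using d1 d2
  proof eventually_elim
    case (elim x)
    show ?case
      using pd_eqI[OF has_derivative_scaleR_right[OF has_derivative_add[OF elim]], of _ "1/2"]
        pd_eqI[OF has_derivative_diff[OF elim(2,1)]]
      by (simp add: m_def h_def pd_def)
  qed
  have pdm0: "pd j m 0 = pd j g1 0" and pdh0: "pd j h 0 = 0" for j
    using eventually_nhds_x_imp_x[OF pdmh] D by (simp_all add: scaleR_add_right[symmetric] flip: scaleR_2)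
  have Dm: "frechet_derivative m (at 0) = frechet_derivative g1 (at 0)"
    by (rule frechet_derivative_0_cong[OF smm sm(1) pdm0])

  define a where "a = (\<lambda>j x. om (h x) (pd j m x))"
  have sma: "smooth_germ (a j)" for j
    unfolding a_def by (intro smooth_germ_om smh smooth_germ_pd smm)
  obtain \<phi> :: "real^3 \<Rightarrow> real" where \<phi>: "smooth_germ \<phi>" "near0 (\<lambda>x. x \<in> N3 \<longrightarrow> (\<forall>j. a j x = pd j \<phi> x))"
  proof -
    obtain \<phi>0 where \<phi>0: "smooth_germ \<phi>0" "near0 (\<lambda>x. x \<in> N3 \<longrightarrow> (\<forall>i. (liou g2 x - liou g1 x) $ i = pd i \<phi>0 x))"
      using nul unfolding null_def by blast
    \<comment> \<open>The form om(h, dm) exceeds the difference of the Liouville forms by the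
      differential of om(g2, g1) / 2.\<close>
    define \<phi>1 where "\<phi>1 = (\<lambda>x. om (g2 x) ((1/2) *\<^sub>R g1 x))"
    have sm1: "smooth_germ \<phi>1" unfolding \<phi>1_def by (intro smooth_germ_om smooth_germ_intros sm)
    have "near0 (\<lambda>x. x \<in> N3 \<longrightarrow> (\<forall>j. a j x = pd j (\<lambda>x. \<phi>0 x + \<phi>1 x) x))"
      using \<phi>0(2) pdmh d1 d2 smooth_germ_has_derivative[OF \<phi>0(1)] smooth_germ_has_derivative[OF sm1]
    proof eventually_elim
      case (elim x)
      have p1: "pd j \<phi>1 x = om (g2 x) ((1/2) *\<^sub>R pd j g1 x) + om (pd j g2 x) ((1/2) *\<^sub>R g1 x)" for j
        using pd_eqI[OF bounded_bilinear.FDERIV[OF bounded_bilinear_om elim(4) has_derivative_scaleR_right[OF elim(3)]], of j "1/2"]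
        by (simp add: \<phi>1_def pd_def)
      show ?case
      proof (intro impI allI)
        fix j assume "x \<in> N3"
        then have "pd j (\<lambda>x. \<phi>0 x + \<phi>1 x) x = (liou g2 x - liou g1 x) $ j + pd j \<phi>1 x"
          using elim(1) by (simp add: pd_add[OF elim(5,6)])
        also have "\<dots> = a j x"
          using elim(2) om_swap[of "pd j g2 x" "g1 x"]
          by (simp add: p1 liou_def a_def h_def om_simps field_simps)
        finally show "a j x = pd j (\<lambda>x. \<phi>0 x + \<phi>1 x) x" ..
      qed
    qed
    with smooth_germ_add[OF \<phi>0(1) sm1] show ?thesis by (rule that)
  qed
  \<comment> \<open>\<open>a i\<close> has zero 1-jet because \<open>h\<close> has, and it agrees on
    the curve with \<open>pd i \<phi>\<close>, so their 1-jets at 0 coincide. This makes the maps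
    \<open>G s\<close> below tangent to the identity.\<close>
  have \<phi>flat: "pd i \<phi> 0 = 0" "pd j (pd i \<phi>) 0 = 0" for i j
  proof -
    have f: "smooth_germ (\<lambda>x. pd i \<phi> x - a i x)" by (intro smooth_germ_diff smooth_germ_pd \<phi> sma)
    have v: "near0 (\<lambda>x. x \<in> N3 \<longrightarrow> pd i \<phi> x - a i x = 0)"
      using \<phi>(2) by eventually_elim simp
    show "pd i \<phi> 0 = 0" using vanish_jets(1)[OF f v] h0 by (simp add: a_def om_simps)
    have "pd j (a i) 0 = 0"
      unfolding a_def
      by (subst pd_bilinear[OF bounded_bilinear_om])
        (simp_all add: h0 pdh0 om_simps smooth_germ_has_derivative0 smh smm smooth_germ_pd)
    then show "pd j (pd i \<phi>) 0 = 0"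
      using vanish_jets(2)[OF f v, of j]
      by (simp add: pd_diff smooth_germ_has_derivative0 smooth_germ_pd \<phi> sma)
  qed

  have linm: "linear (frechet_derivative m (at 0))"
    by (rule has_derivative_linear[OF smooth_germ_has_derivative0[OF smm]])
  obtain pr where pr: "linear pr" "pr \<circ> frechet_derivative m (at 0) = id"
    using linear_injective_left_inverse[OF linm] inj unfolding Dm by blast
  have blpr: "bounded_linear pr" using pr(1) by (simp add: linear_conv_bounded_linear)
  have pr0: "pr 0 = 0" by (rule linear_0[OF pr(1)])
  define k where "k = (\<lambda>x. pr (m x))"
  have smk: "smooth_germ k" unfolding k_def by (rule smooth_germ_linear[OF blpr smm])
  obtain V where V: "diffeo_rep V k"
  proof -
    obtain U where U: "open U" "0 \<in> U" "smooth_on U k" using smk unfolding smooth_germ_def by blast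
    have "frechet_derivative k (at 0) = id"
      using frechet_derivative_at[OF bounded_linear.has_derivative[OF blpr smooth_germ_has_derivative0[OF smm]]] pr(2)
      by (simp add: k_def comp_def)
    then show ?thesis
      using smooth_inverse_function[OF U(1-3)] that by (metis k_def m0 pr0 inj_on_id)
  qed
  note dV = diffeo_repD[OF V]
  \<comment> \<open>A smooth left inverse of \<open>m\<close>: project linearly to 3-space and
    invert the local diffeomorphism \<open>k\<close> there.\<close>
  define \<rho> where "\<rho> = (\<lambda>z. inv_into V k (pr z))"
  have \<rho>0: "\<rho> 0 = 0" using inv_into_f_f[OF dV(4,2)] dV(3) by (simp add: \<rho>_def pr0)
  have sm\<rho>: "smooth_germ \<rho>"
  proof -
    have "smooth_germ (inv_into V k)"
      unfolding smooth_germ_def using dV by (metis imageI)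
    then show ?thesis
      unfolding \<rho>_def by (rule smooth_germ_compose[OF _ smooth_germ_bounded_linear[OF blpr] pr0])
  qed
  have \<rho>m: "near0 (\<lambda>x. \<rho> (m x) = x)"
    using eventually_nhds_in_open[OF dV(1,2)]
  proof eventually_elim
    case (elim x)
    have "pr (m x) = k x" by (simp add: k_def)
    then show ?case using inv_into_f_f[OF dV(4) elim] by (simp add: \<rho>_def)
  qed

  define hr mr where "hr = (\<lambda>z. h (\<rho> z))" and "mr = (\<lambda>z. m (\<rho> z))"
  have smhr: "smooth_germ hr" and smmr: "smooth_germ mr"
    unfolding hr_def mr_def by (intro smooth_germ_compose[OF _ sm\<rho> \<rho>0] smh smm)+
  have hr0: "hr 0 = 0" and mr0: "mr 0 = 0" by (simp_all add: hr_def mr_def \<rho>0 h0 m0)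
  \<comment> \<open>At m x with x on the curve, the differential of the first term sends v to om(h,
    dm(d\<rho> v)) and that of the second to om(h, v - dm(d\<rho> v)). They add up to om(h, v), so
    the gradient of \<open>S\<close> there is K h.\<close>
  define S where "S = (\<lambda>z. \<phi> (\<rho> z) + om (hr z) (z - mr z))"
  have smS: "smooth_germ S"
    unfolding S_def
    by (intro smooth_germ_add smooth_germ_compose[OF \<phi>(1) sm\<rho> \<rho>0] smooth_germ_om smhr smooth_germ_diff smmr smooth_germ_ident)
  note d\<rho> = smooth_germ_has_derivative[OF sm\<rho>]
  have comp: "near0 (\<lambda>z. \<forall>l. pd l (\<lambda>z. f (\<rho> z)) z = (\<Sum>i\<in>UNIV. pd l (\<lambda>z. \<rho> z $ i) z *\<^sub>R pd i f (\<rho> z)))"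
    if "smooth_germ f" for f :: "real^3 \<Rightarrow> 'c::real_normed_vector"
    using d\<rho> near0_smooth_compose[OF smooth_germ_has_derivative[OF that] sm\<rho> \<rho>0]
    by eventually_elim (simp add: pd_compose)
  have E1: "near0 (\<lambda>z. \<forall>l. pd l S z = (\<Sum>i\<in>UNIV. pd l (\<lambda>z. \<rho> z $ i) z * pd i \<phi> (\<rho> z)) +
      (om (pd l hr z) (z - mr z) + om (hr z) (axis l 1 - pd l mr z)))"
    using comp[OF \<phi>(1)] smooth_germ_has_derivative[OF smhr] smooth_germ_has_derivative[OF smmr]
      smooth_germ_has_derivative[OF smooth_germ_compose[OF \<phi>(1) sm\<rho> \<rho>0]]
      smooth_germ_has_derivative[OF smooth_germ_om[OF smhr smooth_germ_diff[OF smooth_germ_ident smmr]]]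
      smooth_germ_has_derivative[OF smooth_germ_diff[OF smooth_germ_ident smmr]]
  proof eventually_elim
    case (elim z)
    have "pd l (\<lambda>z. z - mr z) z = axis l 1 - pd l mr z" for l
      using pd_eqI[OF has_derivative_diff[OF has_derivative_ident elim(3)]] by (simp add: pd_def)
    then show ?case
      unfolding S_def pd_add[OF elim(4,5)] pd_bilinear[OF bounded_bilinear_om elim(2,6)] using elim(1) by simp
  qed
  define Gr where "Gr = (\<lambda>z. \<chi> l. pd l S z)"
  have smGr: "smooth_germ Gr" unfolding Gr_def by (rule smooth_germ_vec) (simp add: smooth_germ_pd[OF smS])
  have GrN: "near0 (\<lambda>x. x \<in> N3 \<longrightarrow> Gr (m x) = K (h x))"
    using near0_smooth_compose[OF E1 smm m0] \<rho>m \<phi>(2) near0_smooth_compose[OF comp[OF smm] smm m0]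
  proof eventually_elim
    case (elim x)
    show ?case
    proof
      assume x: "x \<in> N3"
      have "pd l S (m x) = K (h x) $ l" for l
      proof -
        have "pd l S (m x) = (\<Sum>i\<in>UNIV. pd l (\<lambda>z. \<rho> z $ i) (m x) * a i x) + om (h x) (axis l 1 - pd l mr (m x))"
          using elim(1)[rule_format, of l] x elim(2,3) by (simp add: hr_def mr_def om_simps)
        also have "pd l mr (m x) = (\<Sum>i\<in>UNIV. pd l (\<lambda>z. \<rho> z $ i) (m x) *\<^sub>R pd i m x)"
          using elim(4)[rule_format, of l] elim(2) by (simp add: mr_def[symmetric])
        finally show ?thesis
          by (simp add: om_simps bounded_bilinear.sum_right[OF bounded_bilinear_om] a_def)
            (simp add: om_def inner_axis)
      qed
      then show "Gr (m x) = K (h x)" by (simp add: Gr_def vec_eq_iff)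
    qed
  qed
  have pdhr0: "pd l hr 0 = 0" for l
    using eventually_nhds_x_imp_x[OF comp[OF smh]] by (simp add: hr_def \<rho>0 pdh0)
  have flat: "pd q (pd l S) 0 = 0" for q l
  proof -
    have t1: "pd q (\<lambda>z. pd l (\<lambda>z. \<rho> z $ i) z * pd i \<phi> (\<rho> z)) 0 = 0" for i
    proof (subst pd_mult)
      show "((\<lambda>z. pd i \<phi> (\<rho> z)) has_derivative frechet_derivative (\<lambda>z. pd i \<phi> (\<rho> z)) (at 0)) (at 0)"
        by (intro smooth_germ_has_derivative0 smooth_germ_compose[OF _ sm\<rho> \<rho>0] smooth_germ_pd \<phi>)
      have "pd q (\<lambda>z. pd i \<phi> (\<rho> z)) 0 = 0"
        using eventually_nhds_x_imp_x[OF comp[OF smooth_germ_pd[OF \<phi>(1)]]] by (simp add: \<rho>0 \<phi>flat)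
      then show "pd l (\<lambda>z. \<rho> z $ i) 0 * pd q (\<lambda>z. pd i \<phi> (\<rho> z)) 0 + pd q (pd l (\<lambda>z. \<rho> z $ i)) 0 * pd i \<phi> (\<rho> 0) = 0"
        by (simp add: \<rho>0 \<phi>flat)
    qed (intro smooth_germ_has_derivative0 smooth_germ_pd smooth_germ_nth sm\<rho>)
    have s1: "smooth_germ (\<lambda>z. pd l (\<lambda>z. \<rho> z $ i) z * pd i \<phi> (\<rho> z))" for i
      by (intro smooth_germ_mult smooth_germ_pd smooth_germ_nth sm\<rho> smooth_germ_compose[OF _ sm\<rho> \<rho>0] \<phi>)
    have s2: "smooth_germ (\<lambda>z. om (pd l hr z) (z - mr z))"
      by (intro smooth_germ_om smooth_germ_pd smhr smooth_germ_diff smmr smooth_germ_ident)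
    have s3: "smooth_germ (\<lambda>z. om (hr z) (axis l 1 - pd l mr z))"
      by (intro smooth_germ_om smooth_germ_pd smhr smooth_germ_diff smmr smooth_germ_const)
    have t2: "pd q (\<lambda>z. om (pd l hr z) (z - mr z)) 0 = 0"
      by (subst pd_bilinear[OF bounded_bilinear_om])
        (auto intro!: smooth_germ_has_derivative0 smooth_germ_pd smhr smooth_germ_diff smmr smooth_germ_ident
          simp: pdhr0 mr0 om_simps)
    have t3: "pd q (\<lambda>z. om (hr z) (axis l 1 - pd l mr z)) 0 = 0"
      by (subst pd_bilinear[OF bounded_bilinear_om])
        (auto intro!: smooth_germ_has_derivative0 smooth_germ_pd smhr smooth_germ_diff smmr smooth_germ_const
          simp: pdhr0 hr0 om_simps)
    have "pd q (pd l S) 0 = pd q (\<lambda>z. (\<Sum>i\<in>UNIV. pd l (\<lambda>z. \<rho> z $ i) z * pd i \<phi> (\<rho> z)) +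
      (om (pd l hr z) (z - mr z) + om (hr z) (axis l 1 - pd l mr z))) 0"
      by (rule eventually_nhds_x_imp_x[OF pd_near0_cong]) (use E1 in eventually_elim, blast)
    also have "\<dots> = 0"
      by (subst pd_add pd_sum, (intro smooth_germ_has_derivative0 smooth_germ_sum smooth_germ_add s1 s2 s3)+)+
        (simp add: t1 t2 t3)
    finally show ?thesis .
  qed

  \<comment> \<open>The Hamiltonian vector field of \<open>S\<close>. On the image of the curve it
    equals h because K K = -1, so moving m by -X/2 and X/2 gives g1 and g2.\<close>
  define X where "X = (\<lambda>z. - K (Gr z))"
  obtain W where W: "open W" "0 \<in> W" "smooth_on W S" using smS unfolding smooth_germ_def by blast
  have smGrW: "smooth_on W Gr"
    unfolding Gr_def
    by (rule smooth_on_vec[OF W(1)]) (simp add: pd_def smooth_on_derivative(1)[OF W(3)])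
  have smX: "smooth_on W X"
    unfolding X_def by (intro smooth_on_linear[OF W(1) bounded_linear_minus[OF bounded_linear_ident]]
        smooth_on_linear[OF W(1) bounded_linear_K] smGrW)
  have Gr0: "Gr 0 = 0"
    using eventually_nhds_x_imp_x[OF GrN] m0 h0 linear_0[OF linear_K] by (simp add: N3_def)
  have X0: "X 0 = 0" using Gr0 linear_0[OF linear_K] by (simp add: X_def)
  define Y where "Y = (\<lambda>z v. - K (frechet_derivative Gr (at z) v))"
  have dX: "(X has_derivative Y z) (at z)" if "z \<in> W" for z
    unfolding X_def Y_def
    by (intro has_derivative_minus bounded_linear.has_derivative[OF bounded_linear_K] smooth_on_derivative(2)[OF smGrW that])
  have Y0: "Y 0 v = 0" for v
  proof -
    have "pd i Gr 0 = 0" for i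
      using flat pd_nth[OF smooth_germ_has_derivative0[OF smGr]] by (simp add: vec_eq_iff Gr_def)
    then have "frechet_derivative Gr (at 0) v = 0"
      by (simp add: derivative_eq_sum_pd[OF smooth_germ_has_derivative0[OF smGr]])
    then show ?thesis using linear_0[OF linear_K] by (simp add: Y_def)
  qed
  \<comment> \<open>Symmetry of the Hessian of \<open>S\<close> says that \<open>Y z\<close> is
    infinitesimally symplectic.\<close>
  have Yanti: "om (Y z u) v + om u (Y z v) = 0" if z: "z \<in> W" for z u v
  proof -
    have sym: "frechet_derivative Gr (at z) u \<bullet> v = frechet_derivative Gr (at z) v \<bullet> u" for u v
    proof -
      have G: "Gr y \<bullet> v = frechet_derivative S (at y) v" if "y \<in> W" for y v
        unfolding derivative_eq_sum_pd[OF smooth_on_derivative(2)[OF W(3) that]]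
        by (simp add: Gr_def inner_vec_def mult.commute)
      have "frechet_derivative Gr (at z) u \<bullet> v = frechet_derivative (\<lambda>y. frechet_derivative S (at y) v) (at z) u" for u v
      proof -
        have "((\<lambda>y. Gr y \<bullet> v) has_derivative (\<lambda>u. frechet_derivative Gr (at z) u \<bullet> v)) (at z)"
          by (intro has_derivative_inner_left smooth_on_derivative(2)[OF smGrW z])
        then have "((\<lambda>y. frechet_derivative S (at y) v) has_derivative (\<lambda>u. frechet_derivative Gr (at z) u \<bullet> v)) (at z)"
          by (rule has_derivative_transform_within_open[OF _ W(1) z G])
        from frechet_derivative_at[OF this] show ?thesis by metis
      qed
      then show ?thesis using derivative_commute_real[OF W(1,3) z] by simp
    qed
    have "om (Y z u) v = frechet_derivative Gr (at z) u \<bullet> v" for u v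
      by (simp add: om_def Y_def linear_neg[OF linear_K] KK)
    then show ?thesis using om_swap[of u "Y z v"] sym[of u v] by simp
  qed
  define G where "G = (\<lambda>s z. z + s *\<^sub>R X z)"
  have smG: "smooth_on W (G s)" for s
    unfolding G_def
    by (intro smooth_on_add smooth_on_bilinear[OF W(1) bounded_bilinear_scaleR] smooth_on_const smX W(1)
        smooth_on_ident_linear bounded_linear_ident)
  have dG: "(G s has_derivative (\<lambda>v. v + s *\<^sub>R Y z v)) (at z)" if "z \<in> W" for s z
    unfolding G_def by (intro has_derivative_add has_derivative_ident has_derivative_scaleR_right dX that)
  have fG: "frechet_derivative (G s) (at z) = (\<lambda>v. v + s *\<^sub>R Y z v)" if "z \<in> W" for s z
    using frechet_derivative_at[OF dG[OF that]] by simp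
  have G0: "G s 0 = 0" for s by (simp add: G_def X0)
  have injG: "inj (frechet_derivative (G s) (at 0))" for s
    unfolding fG[OF W(2)] by (simp add: Y0 inj_def)
  obtain V1 where V1: "V1 \<subseteq> W" "diffeo_rep V1 (G (- 1/2))" "\<And>x. x \<in> V1 \<Longrightarrow> bij (frechet_derivative (G (- 1/2)) (at x))"
    using smooth_inverse_function[OF W(1,2) smG G0 injG] by metis
  obtain V2 where V2: "V2 \<subseteq> W" "diffeo_rep V2 (G (1/2))"
    using smooth_inverse_function[OF W(1,2) smG G0 injG] by metis
  define V' where "V' = V1 \<inter> V2"
  have V': "open V'" "0 \<in> V'" "V' \<subseteq> V1" "V' \<subseteq> V2"
    using diffeo_repD(1,2)[OF V1(2)] diffeo_repD(1,2)[OF V2(2)] by (auto simp: V'_def)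
  have dm: "diffeo_rep V' (G (- 1/2))" and dp: "diffeo_rep V' (G (1/2))"
    using diffeo_rep_subset[OF V1(2) V'(1-3)] diffeo_rep_subset[OF V2(2) V'(1,2,4)] .
  define U where "U = G (- 1/2) ` V'"
  define F where "F = (\<lambda>y. G (1/2) (inv_into V' (G (- 1/2)) y))"
  have dF: "diffeo_rep U F"
    unfolding U_def F_def
    by (rule diffeo_rep_compose[OF diffeo_rep_inv[OF dm] dp]) (auto intro: inv_into_into)
  have FG: "F (G (- 1/2) z) = G (1/2) z" if "z \<in> V'" for z
    by (simp only: F_def inv_into_f_f[OF diffeo_repD(4)[OF dm] that])
  \<comment> \<open>The derivative of \<open>F\<close> is the Cayley transform (1 + Y/2)(1 -
    Y/2)^(-1). In both factors the terms of om linear in Y cancel, and the same quadratic term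
    remains.\<close>
  have symp: "om (frechet_derivative F (at x) v) (frechet_derivative F (at x) w) = om v w" if "x \<in> U" for x v w
  proof -
    obtain z where z: "z \<in> V'" "x = G (- 1/2) z" using \<open>x \<in> U\<close> unfolding U_def by blast
    have zW: "z \<in> W" using z(1) V' V1(1) by blast
    have "(F has_derivative frechet_derivative F (at x)) (at x)"
      by (rule smooth_on_derivative(2)[OF diffeo_repD(6)[OF dF] that])
    then have "((\<lambda>z. F (G (- 1/2) z)) has_derivative (\<lambda>v. frechet_derivative F (at x) (v + (- 1/2) *\<^sub>R Y z v))) (at z)"
      unfolding z(2) by (rule has_derivative_compose[OF dG[OF zW]])
    then have "(G (1/2) has_derivative (\<lambda>v. frechet_derivative F (at x) (v + (- 1/2) *\<^sub>R Y z v))) (at z)"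
      by (rule has_derivative_transform_within_open[OF _ V'(1) z(1) FG])
    from has_derivative_unique[OF this dG[OF zW]]
    have DF: "frechet_derivative F (at x) (v + (- 1/2) *\<^sub>R Y z v) = v + (1/2) *\<^sub>R Y z v" for v by metis
    have "surj (\<lambda>v. v + (- 1/2) *\<^sub>R Y z v)"
      using V1(3)[of z] z(1) V'(3) fG[OF zW] by (auto simp: bij_def)
    then obtain v' w' where v': "v = v' + (- 1/2) *\<^sub>R Y z v'" and w': "w = w' + (- 1/2) *\<^sub>R Y z w'"
      by (meson surjD)
    show ?thesis
      unfolding v' w' DF using Yanti[OF zW, of v' w'] by (simp add: om_simps algebra_simps)
  qed
  have "near0 (\<lambda>x. x \<in> N3 \<longrightarrow> g1 x \<in> U \<and> F (g1 x) = g2 x)"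
    using GrN near0_smooth_compose[OF eventually_nhds_in_open[OF V'(1,2)] smm m0]
  proof eventually_elim
    case (elim x)
    show ?case
    proof
      assume "x \<in> N3"
      then have X: "X (m x) = h x" using elim(1) by (simp add: X_def KK)
      have "G (- 1/2) (m x) = g1 x" "G (1/2) (m x) = g2 x"
        unfolding G_def X by (simp_all add: m_def h_def algebra_simps flip: scaleR_add_left)
      then show "g1 x \<in> U \<and> F (g1 x) = g2 x"
        using FG[OF elim(2)] elim(2) by (metis U_def imageI)
    qed
  qed
  with dF symp show ?thesis by (intro that) (auto simp: symp_rep_def)
qed

end

section \<open>Liouville forms and classes of immersions\<close>

context sympl
begin

lemma pd_liou:
  assumes "smooth_germ g"
  shows "near0 (\<lambda>x. \<forall>i j. pd i (\<lambda>x. liou g x $ j) x = (om (g x) (pd i (pd j g) x) + om (pd i g x) (pd j g x)) / 2)"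
proof -
  have "near0 (\<lambda>x. \<forall>j. (pd j g has_derivative frechet_derivative (pd j g) (at x)) (at x))"
    by (intro eventually_all_finite smooth_germ_has_derivative smooth_germ_pd assms)
  with smooth_germ_has_derivative[OF assms] show ?thesis
  proof eventually_elim
    case (elim x)
    show ?case
    proof (intro allI)
      fix i j
      have "pd i (\<lambda>x. om (g x) (pd j g x)) x = om (g x) (pd i (pd j g) x) + om (pd i g x) (pd j g x)"
        by (rule pd_bilinear[OF bounded_bilinear_om elim(1)]) (use elim(2) in blast)
      moreover have "((\<lambda>x. om (g x) (pd j g x)) has_derivative frechet_derivative (\<lambda>x. om (g x) (pd j g x)) (at x)) (at x)"
        using bounded_bilinear.FDERIV[OF bounded_bilinear_om elim(1) elim(2)[rule_format, of j]]
        by (meson differentiable_def frechet_derivative_works)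
      from pd_linear[OF bounded_linear_divide[of 2] this, of i]
      have "pd i (\<lambda>x. liou g x $ j) x = pd i (\<lambda>x. om (g x) (pd j g x)) x / 2"
        by (simp add: liou_def)
      ultimately show "pd i (\<lambda>x. liou g x $ j) x = (om (g x) (pd i (pd j g) x) + om (pd i g x) (pd j g x)) / 2"
        by simp
    qed
  qed
qed

lemma smooth_germ_liou: assumes "smooth_germ g" shows "smooth_germ (liou g)"
proof (rule smooth_germ_vec)
  fix j
  have "smooth_germ (\<lambda>x. om (g x) ((1/2) *\<^sub>R pd j g x))"
    by (intro smooth_germ_om smooth_germ_scaleR smooth_germ_const smooth_germ_pd assms)
  then show "smooth_germ (\<lambda>x. liou g x $ j)" by (simp add: liou_def om_simps)
qed

text \<open>A function vanishing on the curve has zero differential at 0, so the 1-jets of the two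
  Liouville forms differ by a Hessian. Being symmetric, it does not affect the antisymmetric part,
  which is the pulled back form at 0.\<close>

lemma null_liou_imp_form_eq:
  fixes g1 g2 :: "real^3 \<Rightarrow> real^'m"
  assumes sm: "smooth_germ g1" "smooth_germ g2" and z: "g1 0 = 0" "g2 0 = 0"
    and nul: "null (\<lambda>x. liou g2 x - liou g1 x)"
  shows "om (pd i g1 0) (pd j g1 0) = om (pd i g2 0) (pd j g2 0)"
proof -
  obtain \<phi> where \<phi>: "smooth_germ \<phi>" "near0 (\<lambda>x. x \<in> N3 \<longrightarrow> (\<forall>i. (liou g2 x - liou g1 x) $ i = pd i \<phi> x))"
    using nul unfolding null_def by blast
  have l: "pd i (\<lambda>x. liou g x $ j) 0 = om (pd i g 0) (pd j g 0) / 2" if "smooth_germ g" "g 0 = 0" for g i j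
    using eventually_nhds_x_imp_x[OF pd_liou[OF that(1)]] that(2) by (simp add: om_simps)
  have e: "pd i (pd j \<phi>) 0 = om (pd i g2 0) (pd j g2 0) / 2 - om (pd i g1 0) (pd j g1 0) / 2" for i j
  proof -
    have sml: "smooth_germ (\<lambda>x. liou g x $ j)" if "smooth_germ g" for g
      by (rule smooth_germ_nth[OF smooth_germ_liou[OF that]])
    have f: "smooth_germ (\<lambda>x. (liou g2 x $ j - liou g1 x $ j) - pd j \<phi> x)"
      by (intro smooth_germ_diff sml sm smooth_germ_pd \<phi>)
    have v: "near0 (\<lambda>x. x \<in> N3 \<longrightarrow> (liou g2 x $ j - liou g1 x $ j) - pd j \<phi> x = 0)"
      using \<phi>(2) by eventually_elim simp
    have "pd i (\<lambda>x. (liou g2 x $ j - liou g1 x $ j) - pd j \<phi> x) 0 =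
        pd i (\<lambda>x. liou g2 x $ j) 0 - pd i (\<lambda>x. liou g1 x $ j) 0 - pd i (pd j \<phi>) 0"
      by (subst pd_diff pd_diff, (intro smooth_germ_has_derivative0 smooth_germ_diff sml sm smooth_germ_pd \<phi>)+)+ simp
    with vanish_jets(2)[OF f v, of i] show ?thesis by (simp add: l sm z)
  qed
  show ?thesis
    using e[of i j] e[of j i] pd_sym2[OF \<phi>(1), of i j]
      om_swap[of "pd i g1 0" "pd j g1 0"] om_swap[of "pd i g2 0" "pd j g2 0"] by simp
qed

lemma darboux:
  fixes g1 g2 :: "real^3 \<Rightarrow> real^'m"
  assumes sm: "smooth_germ g1" "smooth_germ g2" and z: "g1 0 = 0" "g2 0 = 0"
    and inj: "inj (frechet_derivative g1 (at 0))" "inj (frechet_derivative g2 (at 0))"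
    and nul: "null (\<lambda>x. liou g2 x - liou g1 x)"
  obtains U F where "symp_rep U F" "near0 (\<lambda>x. x \<in> N3 \<longrightarrow> g1 x \<in> U \<and> F (g1 x) = g2 x)"
proof -
  note d1 = smooth_germ_has_derivative0[OF sm(1)] and d2 = smooth_germ_has_derivative0[OF sm(2)]
  obtain A where A: "symp_linear A" "\<And>v. A (frechet_derivative g1 (at 0) v) = frechet_derivative g2 (at 0) v"
    using witt[OF has_derivative_linear[OF d1] inj(1) has_derivative_linear[OF d2] inj(2)]
      null_liou_imp_form_eq[OF sm z nul] by (auto simp: pd_def)
  have linA: "linear A" and omA: "om (A v) (A w) = om v w" for v w using A(1) by (auto simp: symp_linear_def)
  have blA: "bounded_linear A" using linA by (simp add: linear_conv_bounded_linear)
  define g where "g = (\<lambda>x. A (g1 x))"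
  have smg: "smooth_germ g" unfolding g_def by (rule smooth_germ_linear[OF blA sm(1)])
  have g0: "g 0 = 0" by (simp add: g_def z linear_0[OF linA])
  have pdg: "near0 (\<lambda>x. \<forall>j. pd j g x = A (pd j g1 x))"
    using smooth_germ_has_derivative[OF sm(1)]
    by eventually_elim (simp add: g_def pd_linear[OF blA])
  have pd0: "pd j g 0 = pd j g2 0" for j
    using eventually_nhds_x_imp_x[OF pdg] A(2) by (simp add: pd_def)
  \<comment> \<open>Linear symplectic maps preserve the Liouville form, so replacing g1 by A g1 does
    not change the class.\<close>
  have "null (\<lambda>x. liou g2 x - liou g x)"
    by (rule null_cong[OF nul]) (use pdg in eventually_elim, simp add: liou_def g_def omA)
  moreover have "inj (frechet_derivative g (at 0))"
    using frechet_derivative_0_cong[OF smg sm(2) pd0] inj(2) by simp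
  ultimately obtain U F where UF: "symp_rep U F" "near0 (\<lambda>x. x \<in> N3 \<longrightarrow> g x \<in> U \<and> F (g x) = g2 x)"
    using darboux_core[OF smg sm(2) g0 z(2) pd0] by blast
  have dF: "diffeo_rep U F" using UF(1) by (simp add: symp_rep_def)
  define U' where "U' = A -` U"
  have U': "open U'" "0 \<in> U'"
    using diffeo_repD(1,2)[OF dF] linear_0[OF linA] open_vimage[OF diffeo_repD(1)[OF dF] linear_continuous_on[OF blA]]
    by (auto simp: U'_def)
  have dA: "diffeo_rep U' A"
    using diffeo_rep_subset[OF diffeo_rep_linear[OF linA symp_linear_inj[OF A(1)]] U'] by simp
  have "diffeo_rep U' (\<lambda>x. F (A x))"
    by (rule diffeo_rep_compose[OF dA dF]) (auto simp: U'_def)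
  moreover have "om (frechet_derivative (\<lambda>x. F (A x)) (at x) v) (frechet_derivative (\<lambda>x. F (A x)) (at x) w) = om v w"
    if "x \<in> U'" for x v w
  proof -
    have "(F has_derivative frechet_derivative F (at (A x))) (at (A x))"
      by (rule smooth_on_derivative(2)[OF diffeo_repD(6)[OF dF]]) (use that in \<open>simp add: U'_def\<close>)
    from has_derivative_compose[OF bounded_linear_imp_has_derivative[OF blA] this]
    have "frechet_derivative (\<lambda>x. F (A x)) (at x) = (\<lambda>v. frechet_derivative F (at (A x)) (A v))"
      using frechet_derivative_at by metis
    then show ?thesis using UF(1) that by (simp add: symp_rep_def U'_def omA)
  qed
  ultimately have "symp_rep U' (\<lambda>x. F (A x))" by (simp add: symp_rep_def)
  moreover have "near0 (\<lambda>x. x \<in> N3 \<longrightarrow> g1 x \<in> U' \<and> F (A (g1 x)) = g2 x)"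
    using UF(2) by (simp add: U'_def g_def)
  ultimately show ?thesis by (rule that)
qed

lemma liou_compose:
  fixes g :: "real^3 \<Rightarrow> real^'m"
  assumes "smooth_germ g" "smooth_germ \<psi>" "\<psi> 0 = 0"
  shows "near0 (\<lambda>x. liou (\<lambda>x. g (\<psi> x)) x = pullback \<psi> (liou g) x)"
  using smooth_germ_has_derivative[OF assms(2)]
    near0_smooth_compose[OF smooth_germ_has_derivative[OF assms(1)] assms(2,3)]
proof eventually_elim
  case (elim x)
  show ?case
    by (simp add: vec_eq_iff liou_def pullback_def pd_compose[OF elim] om_simps sum_divide_distrib mult.commute
        bounded_bilinear.sum_right[OF bounded_bilinear_om])
qed

text \<open>The division by \<open>k\<close> makes \<open>c\<close> the coefficients of the pulled back symplectic form: contracting a closed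
  two-form of quasi-degree \<open>k\<close> with the Euler field and differentiating multiplies it by \<open>k\<close>.\<close>

definition cls :: "(real^3 \<Rightarrow> real^'m) \<Rightarrow> (nat \<Rightarrow> real) \<Rightarrow> bool" where
  "cls g c \<longleftrightarrow> null (\<lambda>x. liou g x - tform (\<lambda>k. c k / real k) x)"

text \<open>Equality on a neighbourhood and not only along the curve; the normal forms satisfy it by
  direct computation. The coefficient of dx1 \<and> dx3 involves only x1 and x3, in accordance with
  closedness.\<close>

definition pulled_form :: "(real^3 \<Rightarrow> real^'m) \<Rightarrow> (nat \<Rightarrow> real) \<Rightarrow> bool" where
  "pulled_form g c \<longleftrightarrow> near0 (\<lambda>x.
     om (pd 1 g x) (pd 3 g x) = c 7 + c 10 * x$3 + c 11 * x$1 + c 13 * (x$3)^2 + c 14 * (x$1 * x$3) \<and>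
     om (pd 2 g x) (pd 3 g x) = c 8 \<and> om (pd 1 g x) (pd 2 g x) = c 9)"

lemma tform_derivative:
  defines "s' \<equiv> \<lambda>d (x::real^3) v. d 10 * v$3 + d 11 * v$1 + d 13 * (2 * x$3 * v$3) + d 14 * (x$1 * v$3 + v$1 * x$3)"
    and "s \<equiv> \<lambda>d x. d 7 + d 10 * x$3 + d 11 * x$1 + d 13 * (x$3)^2 + d 14 * (x$1 * x$3)"
  shows "((\<lambda>x. tform d x $ 1) has_derivative (\<lambda>v. - 3 * (x$3 * s' d x v + v$3 * s d x) - 5 * d 9 * v$2)) (at x)"
    "((\<lambda>x. tform d x $ 2) has_derivative (\<lambda>v. - 3 * d 8 * v$3 + 4 * d 9 * v$1)) (at x)"
    "((\<lambda>x. tform d x $ 3) has_derivative (\<lambda>v. 4 * (x$1 * s' d x v + v$1 * s d x) + 5 * d 8 * v$2)) (at x)"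
proof -
  have c: "((\<lambda>x :: real^3. x $ i) has_derivative (\<lambda>v. v $ i)) (at x)" for i x
    by (rule bounded_linear_imp_has_derivative[OF bounded_linear_vec_nth])
  have s: "(s d has_derivative s' d x) (at x)"
    unfolding s_def s'_def
    by (rule has_derivative_eq_rhs, (rule has_derivative_add has_derivative_const has_derivative_mult_right c
        has_derivative_power has_derivative_mult)+) (simp add: fun_eq_iff)
  have "(\<lambda>x. tform d x $ 1) = (\<lambda>x. - 3 * (x$3 * s d x) - 5 * d 9 * x$2)"
    "(\<lambda>x. tform d x $ 2) = (\<lambda>x. - 3 * d 8 * x$3 + 4 * d 9 * x$1)"
    "(\<lambda>x. tform d x $ 3) = (\<lambda>x. 4 * (x$1 * s d x) + 5 * d 8 * x$2)"
    by (simp_all add: fun_eq_iff tform_def form_defs s_def)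
  then show "((\<lambda>x. tform d x $ 1) has_derivative (\<lambda>v. - 3 * (x$3 * s' d x v + v$3 * s d x) - 5 * d 9 * v$2)) (at x)"
    "((\<lambda>x. tform d x $ 2) has_derivative (\<lambda>v. - 3 * d 8 * v$3 + 4 * d 9 * v$1)) (at x)"
    "((\<lambda>x. tform d x $ 3) has_derivative (\<lambda>v. 4 * (x$1 * s' d x v + v$1 * s d x) + 5 * d 8 * v$2)) (at x)"
    by (simp_all only:)
      (intro has_derivative_add has_derivative_diff has_derivative_mult_right has_derivative_mult c s)+
qed

lemma smooth_germ_tform: "smooth_germ (tform d)"
proof (rule smooth_germ_vec)
  fix i :: 3
  have "smooth_germ (\<lambda>x. bA x $ i)" "smooth_germ (\<lambda>x. bB x $ i)" "smooth_germ (\<lambda>x. bC x $ i)"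
    using exhaust_3[of i] by (auto simp: form_defs intro!: smooth_germ_intros)
  then show "smooth_germ (\<lambda>x. tform d x $ i)"
    by (auto simp: tform_def intro!: smooth_germ_intros)
qed

text \<open>By Cartan's formula the differential of the contraction of a closed two-form of
  quasi-degree k with the Euler field is k times the form. Hence the two one-forms have the same
  differential, and their difference is exact by the homotopy formula.\<close>

lemma pulled_form_cls:
  fixes g :: "real^3 \<Rightarrow> real^'m"
  assumes sm: "smooth_germ g" and c: "pulled_form g c"
  shows "cls g c"
  unfolding cls_def
proof (rule closed_imp_null)
  let ?t = "tform (\<lambda>k. c k / real k)"
  show "smooth_germ (\<lambda>x. liou g x - ?t x)"
    by (intro smooth_germ_diff smooth_germ_liou sm smooth_germ_tform)
  have dl: "near0 (\<lambda>x. \<forall>j. ((\<lambda>x. liou g x $ j) has_derivative frechet_derivative (\<lambda>x. liou g x $ j) (at x)) (at x))"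
    by (intro eventually_all_finite smooth_germ_has_derivative smooth_germ_nth smooth_germ_liou sm)
  have dt: "near0 (\<lambda>x. \<forall>j. ((\<lambda>x. ?t x $ j) has_derivative frechet_derivative (\<lambda>x. ?t x $ j) (at x)) (at x))"
    by (intro eventually_all_finite smooth_germ_has_derivative smooth_germ_nth smooth_germ_tform)
  have com: "near0 (\<lambda>x. \<forall>i j. pd i (pd j g) x = pd j (pd i g) x)"
    by (intro eventually_all_finite pd_commute sm)
  show "near0 (\<lambda>x. \<forall>i j. pd j (\<lambda>x. (liou g x - ?t x) $ i) x = pd i (\<lambda>x. (liou g x - ?t x) $ j) x)"
    using dl dt com pd_liou[OF sm] c[unfolded pulled_form_def]
  proof eventually_elim
    case (elim x)
    have 1: "pd j (\<lambda>x. liou g x $ i) x - pd i (\<lambda>x. liou g x $ j) x = om (pd j g x) (pd i g x)" for i j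
      using elim(3)[rule_format, of i j] elim(4)[rule_format, of i j] elim(4)[rule_format, of j i]
        om_swap[of "pd i g x" "pd j g x"] by simp
    have t: "pd j (\<lambda>x. ?t x $ i) x - pd i (\<lambda>x. ?t x $ j) x = om (pd j g x) (pd i g x)" for i j
      using exhaust_3[of i] exhaust_3[of j] elim(5) om_swap[of "pd 3 g x" "pd 1 g x"]
        om_swap[of "pd 3 g x" "pd 2 g x"] om_swap[of "pd 2 g x" "pd 1 g x"]
      by (auto simp: pd_eqI[OF tform_derivative(1)] pd_eqI[OF tform_derivative(2)] pd_eqI[OF tform_derivative(3)] axis_def;
          simp add: field_simps power2_eq_square)
    have "pd j (\<lambda>x. (liou g x - ?t x) $ i) x = pd j (\<lambda>x. liou g x $ i) x - pd j (\<lambda>x. ?t x $ i) x" for i j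
      using elim(1,2) by (simp add: pd_diff)
    moreover have "pd j (\<lambda>x. liou g x $ i) x - pd j (\<lambda>x. ?t x $ i) x = pd i (\<lambda>x. liou g x $ j) x - pd i (\<lambda>x. ?t x $ j) x" for i j
      using 1[of j i] t[of j i] by linarith
    ultimately show ?case by simp
  qed
qed

text \<open>Every step composes \<open>\<psi>\<close> with one more quasi-homogeneous map. The
  condition relating \<open>\<psi>\<close> to \<open>N3\<close> is an equivalence so that the new
  parametrisation still covers the whole germ.\<close>

lemma reparametrize:
  fixes g :: "real^3 \<Rightarrow> real^'m"
  assumes sm: "smooth_germ g"
  obtains \<psi> c i where "smooth_germ \<psi>" "\<psi> 0 = 0" "inj (frechet_derivative \<psi> (at 0))"
    "near0 (\<lambda>x. \<psi> x \<in> N3 \<longleftrightarrow> x \<in> N3)" "i \<le> 7" "NF i c" "cls (\<lambda>x. g (\<psi> x)) c"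
proof -
  obtain d where d: "null (\<lambda>x. liou g x - tform d x)"
    using algebraic_restriction[OF smooth_germ_liou[OF sm]] .
  obtain c i where ci: "i \<le> 7" "step\<^sup>*\<^sup>* d (\<lambda>k. c k / real k)" "NF i c" using normalize by blast
  have "\<exists>\<psi>. smooth_germ \<psi> \<and> \<psi> 0 = 0 \<and> inj (frechet_derivative \<psi> (at 0)) \<and> near0 (\<lambda>x. \<psi> x \<in> N3 \<longleftrightarrow> x \<in> N3) \<and>
      null (\<lambda>x. liou (\<lambda>x. g (\<psi> x)) x - tform e x)" if "step\<^sup>*\<^sup>* d e" for e
    using that
  proof (induction rule: rtranclp_induct)
    case base
    have "frechet_derivative (\<lambda>x::real^3. x) (at 0) = (\<lambda>v. v)"
      using frechet_derivative_at[OF has_derivative_ident] by metis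
    then show ?case using d by (intro exI[of _ "\<lambda>x. x"]) (simp add: smooth_germ_ident inj_def)
  next
    case (step e e')
    then obtain \<psi> where \<psi>: "smooth_germ \<psi>" "\<psi> 0 = 0" "inj (frechet_derivative \<psi> (at 0))"
      "near0 (\<lambda>x. \<psi> x \<in> N3 \<longleftrightarrow> x \<in> N3)" "null (\<lambda>x. liou (\<lambda>x. g (\<psi> x)) x - tform e x)" by blast
    obtain l where l: "smooth_germ l" "l 0 \<noteq> 0" "null (\<lambda>x. pullback (quasi l) (liou (\<lambda>x. g (\<psi> x))) x - tform e' x)"
      using step_pullback[OF step(2) \<psi>(5)] .
    note smq = smooth_germ_quasi[OF l(1)]
    define \<psi>' where "\<psi>' = (\<lambda>x. \<psi> (quasi l x))"
    have sm': "smooth_germ \<psi>'" unfolding \<psi>'_def by (rule smooth_germ_compose[OF \<psi>(1) smq quasi_0])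
    have "near0 (\<lambda>x. \<psi>' x \<in> N3 \<longleftrightarrow> x \<in> N3)"
      using near0_smooth_compose[OF \<psi>(4) smq quasi_0] near0_nonzero[OF l(1,2)]
      by eventually_elim (simp add: \<psi>'_def quasi_def weighted_N3_iff)
    moreover have "null (\<lambda>x. liou (\<lambda>x. g (\<psi>' x)) x - tform e' x)"
      by (rule null_cong[OF l(3)])
        (use liou_compose[OF smooth_germ_compose[OF sm \<psi>(1,2)] smq quasi_0] in \<open>eventually_elim, simp add: \<psi>'_def\<close>)
    moreover have "inj (frechet_derivative \<psi>' (at 0))"
    proof -
      have dq: "(quasi l has_derivative frechet_derivative (quasi l) (at 0)) (at 0)"
        by (rule smooth_germ_has_derivative0[OF smq])
      have d\<psi>: "(\<psi> has_derivative frechet_derivative \<psi> (at 0)) (at (quasi l 0))"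
        using smooth_germ_has_derivative0[OF \<psi>(1)] by simp
      have "frechet_derivative (quasi l) (at 0) v $ i = l 0 ^ wt i * v $ i" for v i
      proof -
        have "((\<lambda>x. quasi l x $ i) has_derivative (\<lambda>v. frechet_derivative (quasi l) (at 0) v $ i)) (at 0)"
          by (rule bounded_linear.has_derivative[OF bounded_linear_vec_nth dq])
        moreover have "((\<lambda>x. quasi l x $ i) has_derivative (\<lambda>v. l 0 ^ wt i * v $ i)) (at 0)"
          unfolding quasi_nth
          by (rule has_derivative_eq_rhs[OF has_derivative_mult[OF has_derivative_power[OF smooth_germ_has_derivative0[OF l(1)]]
              bounded_linear_imp_has_derivative[OF bounded_linear_vec_nth]]]) (simp add: fun_eq_iff)
        ultimately show ?thesis using has_derivative_unique by metis
      qed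
      then have "inj (frechet_derivative (quasi l) (at 0))"
        using l(2) by (auto simp: inj_def vec_eq_iff)
      moreover have "frechet_derivative \<psi>' (at 0) = (\<lambda>v. frechet_derivative \<psi> (at 0) (frechet_derivative (quasi l) (at 0) v))"
        using frechet_derivative_at[OF has_derivative_compose[OF dq d\<psi>]] by (simp add: \<psi>'_def)
      ultimately show ?thesis
        using inj_compose[OF \<psi>(3), of "frechet_derivative (quasi l) (at 0)"] by (simp only: comp_def)
    qed
    moreover have "\<psi>' 0 = 0" by (simp add: \<psi>'_def \<psi>(2))
    ultimately show ?case using sm' by blast
  qed
  from this[OF ci(2)] ci(1,3) show ?thesis unfolding cls_def[symmetric] using that by blast
qed

end

section \<open>Rigidity of the coefficients\<close>

context
  fixes f g :: "real^'n \<Rightarrow> real"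
  assumes f: "smooth_germ f" and g: "smooth_germ g"
begin

lemma pd0_add: "pd i (\<lambda>x. f x + g x) 0 = pd i f 0 + pd i g 0"
  by (rule pd_add[OF smooth_germ_has_derivative0[OF f] smooth_germ_has_derivative0[OF g]])

lemma pd0_diff: "pd i (\<lambda>x. f x - g x) 0 = pd i f 0 - pd i g 0"
  by (rule pd_diff[OF smooth_germ_has_derivative0[OF f] smooth_germ_has_derivative0[OF g]])

lemma pd0_mult: "pd i (\<lambda>x. f x * g x) 0 = f 0 * pd i g 0 + pd i f 0 * g 0"
  by (rule pd_mult[OF smooth_germ_has_derivative0[OF f] smooth_germ_has_derivative0[OF g]])

end

lemma pd0_const: "pd i (\<lambda>x::real^'n. c::real) 0 = 0"
  by (rule pd_eqI) simp

lemma pd0_cong: "near0 (\<lambda>x. f x = g x) \<Longrightarrow> pd i f 0 = pd i g 0"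
  by (rule eventually_nhds_x_imp_x[OF pd_near0_cong])

context
  fixes f g :: "real^'n \<Rightarrow> real"
  assumes f: "smooth_germ f" and g: "smooth_germ g"
begin

lemma pdd0_add: "pd i (pd j (\<lambda>x. f x + g x)) 0 = pd i (pd j f) 0 + pd i (pd j g) 0"
proof -
  have "pd i (pd j (\<lambda>x. f x + g x)) 0 = pd i (\<lambda>x. pd j f x + pd j g x) 0"
    by (rule pd0_cong) (use smooth_germ_has_derivative[OF f] smooth_germ_has_derivative[OF g] in eventually_elim, simp add: pd_add)
  then show ?thesis by (simp add: pd0_add smooth_germ_pd f g)
qed

lemma pdd0_diff: "pd i (pd j (\<lambda>x. f x - g x)) 0 = pd i (pd j f) 0 - pd i (pd j g) 0"
proof -
  have "pd i (pd j (\<lambda>x. f x - g x)) 0 = pd i (\<lambda>x. pd j f x - pd j g x) 0"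
    by (rule pd0_cong) (use smooth_germ_has_derivative[OF f] smooth_germ_has_derivative[OF g] in eventually_elim, simp add: pd_diff)
  then show ?thesis by (simp add: pd0_diff smooth_germ_pd f g)
qed

lemma pdd0_mult: "pd i (pd j (\<lambda>x. f x * g x)) 0 =
  f 0 * pd i (pd j g) 0 + pd i f 0 * pd j g 0 + (pd j f 0 * pd i g 0 + pd i (pd j f) 0 * g 0)"
proof -
  have "pd i (pd j (\<lambda>x. f x * g x)) 0 = pd i (\<lambda>x. f x * pd j g x + pd j f x * g x) 0"
    by (rule pd0_cong) (use smooth_germ_has_derivative[OF f] smooth_germ_has_derivative[OF g] in eventually_elim, simp add: pd_mult)
  then show ?thesis by (simp add: pd0_add pd0_mult smooth_germ_pd smooth_germ_mult f g)
qed

end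

lemma pdd0_const: "pd i (pd j (\<lambda>x::real^'n. c::real)) 0 = 0"
proof -
  have "pd j (\<lambda>x::real^'n. c::real) = (\<lambda>x. 0)" by (rule ext, rule pd_eqI) simp
  then show ?thesis by (simp add: pd0_const)
qed

lemma pdd0_coord: "pd i (pd j (\<lambda>x::real^'n. x $ k)) 0 = 0"
  unfolding pd_coord[abs_def] by (rule pd0_const)

lemmas jet_simps = pd0_add pd0_diff pd0_mult pd0_const pdd0_add pdd0_diff pdd0_mult pdd0_const pdd0_coord
  pd_coord smooth_germ_add smooth_germ_diff smooth_germ_mult smooth_germ_const smooth_germ_coord smooth_germ_pd

context sympl
begin

text \<open>Since \<open>F\<close> is symplectic, F \<circ> g1 induces the same form as g1, and it
  agrees with g2 \<circ> \<psi> on the curve. Hence the form of g1 and that of g2 \<circ> \<psi>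
  differ by the differential of a one-form whose coefficients vanish on the curve, and
  \<open>vanish_jets\<close> restricts the Taylor coefficients it can contribute.\<close>

lemma rigidity:
  fixes g1 g2 :: "real^3 \<Rightarrow> real^'m" and \<psi> :: "real^3 \<Rightarrow> real^3"
  assumes sm: "smooth_germ g1" "smooth_germ g2" and z: "g1 0 = 0"
    and inj: "inj (frechet_derivative g1 (at 0))"
    and c1: "pulled_form g1 c" and c2: "pulled_form g2 c'"
    and F: "symp_rep U F" and \<psi>: "smooth_germ \<psi>" "\<psi> 0 = 0"
    and eq: "near0 (\<lambda>x. x \<in> N3 \<longrightarrow> \<psi> x \<in> N3 \<and> g2 (\<psi> x) = F (g1 x))"
  obtains l where "l \<noteq> 0" "c 7 = l^7 * c' 7" "c 8 = l^8 * c' 8" "c 9 = l^9 * c' 9"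
    "c' 7 = 0 \<Longrightarrow> c 10 = l^10 * c' 10"
    "c' 7 = 0 \<Longrightarrow> c' 8 = 0 \<Longrightarrow> c 11 = l^11 * c' 11"
    "c' 7 = 0 \<Longrightarrow> c' 8 = 0 \<Longrightarrow> c' 9 = 0 \<Longrightarrow> c' 10 = 0 \<Longrightarrow> c 13 = l^13 * c' 13"
    "c' 7 = 0 \<Longrightarrow> c' 8 = 0 \<Longrightarrow> c' 9 = 0 \<Longrightarrow> c' 10 = 0 \<Longrightarrow> c' 11 = 0 \<Longrightarrow> c 14 = l^14 * c' 14"
proof -
  have dF: "diffeo_rep U F" using F by (simp add: symp_rep_def)
  note dU = diffeo_repD[OF dF]
  have smF: "smooth_germ F" unfolding smooth_germ_def using dU by blast
  define f m k where "f = (\<lambda>x. F (g1 x))" and "m = (\<lambda>x. g2 (\<psi> x))" and "k = (\<lambda>x. f x - m x)"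
  have smf: "smooth_germ f" unfolding f_def by (rule smooth_germ_compose[OF smF sm(1) z])
  have smm: "smooth_germ m" unfolding m_def by (rule smooth_germ_compose[OF sm(2) \<psi>])
  have smk: "smooth_germ k" unfolding k_def by (rule smooth_germ_diff[OF smf smm])
  have kN: "near0 (\<lambda>x. x \<in> N3 \<longrightarrow> k x = 0)"
    using eq by eventually_elim (simp add: k_def f_def m_def)
  note df = smooth_germ_has_derivative[OF smf] and dm = smooth_germ_has_derivative[OF smm]
    and dk = smooth_germ_has_derivative[OF smk]
  have pdk: "near0 (\<lambda>x. \<forall>j. pd j f x = pd j m x + pd j k x)"
    using df dm
  proof eventually_elim
    case (elim x)
    show ?case using pd_eqI[OF has_derivative_diff[OF elim]] by (simp add: k_def pd_def)
  qed
  have k0: "pd j k 0 = 0" for j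
  proof -
    have "pd j (\<lambda>x. k x $ i) 0 = 0" for i
      by (rule vanish_jets(2)[OF smooth_germ_nth[OF smk]]) (use kN in eventually_elim, simp)
    then show ?thesis by (simp add: vec_eq_iff pd_nth[OF smooth_germ_has_derivative0[OF smk]])
  qed
  have inj\<psi>: "inj (frechet_derivative \<psi> (at 0))"
  proof -
    have "frechet_derivative f (at 0) = frechet_derivative m (at 0)"
      by (rule frechet_derivative_0_cong[OF smf smm]) (use eventually_nhds_x_imp_x[OF pdk] k0 in simp)
    moreover have "frechet_derivative m (at 0) = (\<lambda>v. frechet_derivative g2 (at 0) (frechet_derivative \<psi> (at 0) v))"
      using frechet_derivative_at[OF has_derivative_compose[OF smooth_germ_has_derivative0[OF \<psi>(1)], of g2]]
        smooth_germ_has_derivative0[OF sm(2)] by (simp add: m_def \<psi>(2))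
    moreover have "frechet_derivative f (at 0) = (\<lambda>v. frechet_derivative F (at 0) (frechet_derivative g1 (at 0) v))"
      using frechet_derivative_at[OF has_derivative_compose[OF smooth_germ_has_derivative0[OF sm(1)], of F]]
        smooth_germ_has_derivative0[OF smF] by (simp add: f_def z)
    ultimately have e: "frechet_derivative g2 (at 0) (frechet_derivative \<psi> (at 0) v) =
        frechet_derivative F (at 0) (frechet_derivative g1 (at 0) v)" for v by metis
    show ?thesis
    proof (rule injI)
      fix v w assume "frechet_derivative \<psi> (at 0) v = frechet_derivative \<psi> (at 0) w"
      then have "frechet_derivative F (at 0) (frechet_derivative g1 (at 0) v) =
        frechet_derivative F (at 0) (frechet_derivative g1 (at 0) w)" using e by metis
      then show "v = w" using diffeo_rep_inj_derivative[OF dF dU(2)] inj by (metis injD)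
    qed
  qed
  define p where "p = (\<lambda>i x. \<psi> x $ i)"
  have p: "p i = (\<lambda>x. \<psi> x $ i)" for i by (simp add: p_def)
  have smp: "smooth_germ (p i)" for i unfolding p by (rule smooth_germ_nth[OF \<psi>(1)])
  have p0: "p i 0 = 0" for i by (simp add: p_def \<psi>(2))
  have N: "near0 (\<lambda>x. x \<in> N3 \<longrightarrow> \<psi> x \<in> N3)" using eq by eventually_elim simp
  obtain l where l: "l \<noteq> 0" "\<And>i j. pd j (p i) 0 = (if i = j then l ^ wt i else 0)"
    "pd 3 (pd 3 (p 1)) 0 = 0" "pd 3 (pd 3 (p 2)) 0 = 0" "pd 1 (pd 3 (p 2)) 0 = 0"
    unfolding p using psi_jets[OF \<psi> N inj\<psi>] by blast
  have l': "pd 3 (pd 1 (p 2)) 0 = 0" using l(5) pd_sym2[OF smp, of 1 3] by simp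

  \<comment> \<open>With f = m + k, the difference of the forms induced by f and m is the
    differential of om(k, dm) + om(k, dk) / 2, which vanishes wherever k does.\<close>
  define \<beta> where "\<beta> = (\<lambda>j x. om (k x) (pd j m x) + om (k x) ((1/2) *\<^sub>R pd j k x))"
  have sm\<beta>: "smooth_germ (\<beta> j)" for j
    unfolding \<beta>_def by (intro smooth_germ_add smooth_germ_om smooth_germ_scaleR smooth_germ_const smooth_germ_pd smk smm)
  have \<beta>N: "near0 (\<lambda>x. x \<in> N3 \<longrightarrow> \<beta> j x = 0)" for j
    using kN by eventually_elim (simp add: \<beta>_def om_simps)
  note v = vanish_jets[OF sm\<beta> \<beta>N]
  have d\<beta>: "near0 (\<lambda>x. \<forall>i j. pd i (\<beta> j) x - pd j (\<beta> i) x =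
      om (pd i k x) (pd j m x) + om (pd i m x) (pd j k x) + om (pd i k x) (pd j k x))"
  proof -
    have "near0 (\<lambda>x. \<forall>j. (pd j m has_derivative frechet_derivative (pd j m) (at x)) (at x))"
      "near0 (\<lambda>x. \<forall>j. (pd j k has_derivative frechet_derivative (pd j k) (at x)) (at x))"
      by (intro eventually_all_finite smooth_germ_has_derivative smooth_germ_pd smm smk)+
    moreover have "near0 (\<lambda>x. \<forall>i j. pd i (pd j m) x = pd j (pd i m) x)" "near0 (\<lambda>x. \<forall>i j. pd i (pd j k) x = pd j (pd i k) x)"
      by (intro eventually_all_finite pd_commute smm smk)+
    ultimately show ?thesis
      using dk
    proof eventually_elim
      case (elim x)
      have d1: "((\<lambda>x. om (k x) (pd j m x)) has_derivative (\<lambda>v. om (k x) (frechet_derivative (pd j m) (at x) v) +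
          om (frechet_derivative k (at x) v) (pd j m x))) (at x)" for j
        by (rule bounded_bilinear.FDERIV[OF bounded_bilinear_om elim(5) elim(1)[rule_format]])
      have d2: "((\<lambda>x. om (k x) ((1/2) *\<^sub>R pd j k x)) has_derivative (\<lambda>v. om (k x) ((1/2) *\<^sub>R frechet_derivative (pd j k) (at x) v) +
          om (frechet_derivative k (at x) v) ((1/2) *\<^sub>R pd j k x))) (at x)" for j
        by (rule bounded_bilinear.FDERIV[OF bounded_bilinear_om elim(5) has_derivative_scaleR_right[OF elim(2)[rule_format]]])
      have pb: "pd i (\<beta> j) x = om (k x) (pd i (pd j m) x) + om (pd i k x) (pd j m x) +
          (om (k x) (pd i (pd j k) x) + om (pd i k x) (pd j k x)) / 2" for i j
        unfolding \<beta>_def pd_eqI[OF has_derivative_add[OF d1 d2]] by (simp add: pd_def om_simps add_divide_distrib)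
      show ?case
      proof (intro allI)
        fix i j
        show "pd i (\<beta> j) x - pd j (\<beta> i) x =
            om (pd i k x) (pd j m x) + om (pd i m x) (pd j k x) + om (pd i k x) (pd j k x)"
          using om_swap[of "pd j k x" "pd i m x"] om_swap[of "pd j k x" "pd i k x"]
            elim(3)[rule_format, of i j] elim(4)[rule_format, of i j]
          unfolding pb by (simp add: field_simps)
      qed
    qed
  qed

  have omf: "near0 (\<lambda>x. \<forall>i j. om (pd i f x) (pd j f x) = om (pd i g1 x) (pd j g1 x))"
    using smooth_germ_has_derivative[OF sm(1)]
      near0_smooth_compose[OF eventually_nhds_in_open[OF dU(1,2)] sm(1) z]
  proof eventually_elim
    case (elim x)
    have "(F has_derivative frechet_derivative F (at (g1 x))) (at (g1 x))"
      by (rule smooth_on_derivative(2)[OF dU(6) elim(2)])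
    from pd_eqI[OF has_derivative_compose[OF elim(1) this]]
    have "pd i f x = frechet_derivative F (at (g1 x)) (pd i g1 x)" for i
      by (simp add: f_def pd_def)
    then show ?case using F elim(2) by (simp add: symp_rep_def)
  qed
  define T where "T = (\<lambda>x. c' 7 + c' 10 * p 3 x + c' 11 * p 1 x + c' 13 * (p 3 x * p 3 x) + c' 14 * (p 1 x * p 3 x))"
  \<comment> \<open>The 2 by 2 minors of the Jacobian matrix of \<open>\<psi>\<close>, that is, the
    coefficients of the pullback of dxa \<and> dxb.\<close>
  define J where "J = (\<lambda>a b i j x. pd i (p a) x * pd j (p b) x - pd i (p b) x * pd j (p a) x)"
  have pm: "near0 (\<lambda>x. \<forall>i j. om (pd i m x) (pd j m x) = T x * J 1 3 i j x + c' 8 * J 2 3 i j x + c' 9 * J 1 2 i j x)"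
    using smooth_germ_has_derivative[OF \<psi>(1)] near0_smooth_compose[OF smooth_germ_has_derivative[OF sm(2)] \<psi>]
      near0_smooth_compose[OF c2[unfolded pulled_form_def] \<psi>]
  proof eventually_elim
    case (elim x)
    have pd: "pd i m x = pd i (p 1) x *\<^sub>R pd 1 g2 (\<psi> x) + pd i (p 2) x *\<^sub>R pd 2 g2 (\<psi> x) + pd i (p 3) x *\<^sub>R pd 3 g2 (\<psi> x)" for i
      unfolding m_def pd_compose[OF elim(1,2)] by (simp add: sum_3 p)
    have T: "om (pd 1 g2 (\<psi> x)) (pd 3 g2 (\<psi> x)) = T x" using elim(3) by (simp add: T_def p power2_eq_square)
    show ?case
      using elim(3) om_swap[of "pd 3 g2 (\<psi> x)" "pd 1 g2 (\<psi> x)"] om_swap[of "pd 3 g2 (\<psi> x)" "pd 2 g2 (\<psi> x)"]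
        om_swap[of "pd 2 g2 (\<psi> x)" "pd 1 g2 (\<psi> x)"]
      unfolding pd by (simp add: om_simps T J_def) (simp add: algebra_simps)
  qed
  have main: "near0 (\<lambda>x. \<forall>i j. om (pd i g1 x) (pd j g1 x) =
      T x * J 1 3 i j x + c' 8 * J 2 3 i j x + c' 9 * J 1 2 i j x + (pd i (\<beta> j) x - pd j (\<beta> i) x))"
    using omf pdk pm d\<beta>
  proof eventually_elim
    case (elim x)
    show ?case
    proof (intro allI)
      fix i j
      have "om (pd i g1 x) (pd j g1 x) = om (pd i m x) (pd j m x) + (pd i (\<beta> j) x - pd j (\<beta> i) x)"
        using elim(1,2,4) by (simp add: om_simps flip: elim(1)[rule_format])
      then show "om (pd i g1 x) (pd j g1 x) =
          T x * J 1 3 i j x + c' 8 * J 2 3 i j x + c' 9 * J 1 2 i j x + (pd i (\<beta> j) x - pd j (\<beta> i) x)"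
        using elim(3) by simp
    qed
  qed
  have smT: "smooth_germ T" unfolding T_def by (intro smooth_germ_intros smp)
  have smJ: "smooth_germ (J a b i j)" for a b i j
    unfolding J_def by (intro smooth_germ_intros smooth_germ_pd smp)
  have E13: "near0 (\<lambda>x. c 7 + c 10 * x$3 + c 11 * x$1 + c 13 * (x$3 * x$3) + c 14 * (x$1 * x$3) =
      T x * J 1 3 1 3 x + c' 8 * J 2 3 1 3 x + c' 9 * J 1 2 1 3 x + (pd 1 (\<beta> 3) x - pd 3 (\<beta> 1) x))"
    using main c1[unfolded pulled_form_def] by eventually_elim (simp add: power2_eq_square)
  have E23: "near0 (\<lambda>x. c 8 = T x * J 1 3 2 3 x + c' 8 * J 2 3 2 3 x + c' 9 * J 1 2 2 3 x + (pd 2 (\<beta> 3) x - pd 3 (\<beta> 2) x))"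
    using main c1[unfolded pulled_form_def] by eventually_elim simp
  have E12: "near0 (\<lambda>x. c 9 = T x * J 1 3 1 2 x + c' 8 * J 2 3 1 2 x + c' 9 * J 1 2 1 2 x + (pd 1 (\<beta> 2) x - pd 2 (\<beta> 1) x))"
    using main c1[unfolded pulled_form_def] by eventually_elim simp
  note js = jet_simps smT smJ smp sm\<beta> p0 l l'
  have T0: "T 0 = c' 7" by (simp add: T_def p0)
  have T1: "pd i T 0 = c' 10 * pd i (p 3) 0 + c' 11 * pd i (p 1) 0" for i
    unfolding T_def by (simp add: jet_simps smp p0)
  have T2: "pd i (pd j T) 0 = c' 10 * pd i (pd j (p 3)) 0 + c' 11 * pd i (pd j (p 1)) 0 +
     c' 13 * (2 * pd i (p 3) 0 * pd j (p 3) 0) + c' 14 * (pd i (p 1) 0 * pd j (p 3) 0 + pd j (p 1) 0 * pd i (p 3) 0)" for i j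
    unfolding T_def by (simp add: jet_simps smp p0 algebra_simps)
  have J0: "J a b i j 0 = pd i (p a) 0 * pd j (p b) 0 - pd i (p b) 0 * pd j (p a) 0" for a b i j
    by (simp add: J_def)
  have J1: "pd q (J a b i j) 0 = pd i (p a) 0 * pd q (pd j (p b)) 0 + pd q (pd i (p a)) 0 * pd j (p b) 0 -
      (pd i (p b) 0 * pd q (pd j (p a)) 0 + pd q (pd i (p b)) 0 * pd j (p a) 0)" for q a b i j
    unfolding J_def by (simp add: jet_simps smp)
  note bs = pd_sym2[OF sm\<beta>, of 3 1] pd_sym2[OF sm\<beta>, of 3 2] pd_sym2[OF sm\<beta>, of 2 1]
    pd_sym3[OF sm\<beta>, of _ 3 1] pd_sym3[OF sm\<beta>, of _ 3 2] pd_sym3[OF sm\<beta>, of _ 2 1]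
    pd_sym3'[OF sm\<beta>, of 3 1] pd_sym3'[OF sm\<beta>, of 3 2] pd_sym3'[OF sm\<beta>, of 2 1]
  note ts = T0 T1 T2 J0 J1 l l' v bs
  have c7: "c 7 = l^7 * c' 7"
    using eventually_nhds_x_imp_x[OF E13] by (simp add: ts power_add[symmetric])
  have c8: "c 8 = l^8 * c' 8"
    using eventually_nhds_x_imp_x[OF E23] by (simp add: ts power_add[symmetric])
  have c9: "c 9 = l^9 * c' 9"
    using eventually_nhds_x_imp_x[OF E12] by (simp add: ts power_add[symmetric])
  have c10: "c 10 = l^10 * c' 10" if "c' 7 = 0"
    using pd0_cong[OF E13, of 3] that by (simp add: js ts)
  \<comment> \<open>The contribution of \<open>\<beta>\<close> is
    \<open>pd 1 (pd 1 (\<beta> 3)) 0\<close>, twice \<open>pd 2 (pd 3 (\<beta> 3)) 0\<close>. The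
    x3-derivative of \<open>E23\<close>, whose left side is constant, shows that it
    vanishes.\<close>
  have c11: "c 11 = l^11 * c' 11" if "c' 7 = 0" "c' 8 = 0"
    using pd0_cong[OF E13, of 1] pd0_cong[OF E23, of 3] that by (simp add: js ts)
  \<comment> \<open>The term \<open>pd 3 (pd 3 (pd 3 (\<beta> 1))) 0\<close> is 6 times
    \<open>pd 1 (pd 2 (\<beta> 1)) 0\<close>; \<open>E12\<close> turns the latter into
    \<open>pd 1 (pd 1 (\<beta> 2)) 0\<close>, twice a derivative that vanishes by
    \<open>E23\<close>. Degree 14 is treated by a similar elimination.\<close>
  have c13: "c 13 = l^13 * c' 13" if "c' 7 = 0" "c' 8 = 0" "c' 9 = 0" "c' 10 = 0"
    using eventually_nhds_x_imp_x[OF pd_near0_cong[OF pd_near0_cong[OF E13]], of 3 3]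
      pd0_cong[OF E23, of 2] pd0_cong[OF E12, of 1] that
    by (simp add: js ts; simp add: mult.commute mult.left_commute flip: power_add)
  have c14: "c 14 = l^14 * c' 14" if "c' 7 = 0" "c' 8 = 0" "c' 9 = 0" "c' 10 = 0" "c' 11 = 0"
    using eventually_nhds_x_imp_x[OF pd_near0_cong[OF pd_near0_cong[OF E13]], of 1 3]
      eventually_nhds_x_imp_x[OF pd_near0_cong[OF pd_near0_cong[OF E23]], of 3 3]
      pd0_cong[OF E12, of 2] that
    by (simp add: js ts; simp add: mult.commute mult.left_commute flip: power_add)
  show ?thesis by (rule that[OF l(1) c7 c8 c9 c10 c11 c13 c14])
qed

end

section \<open>Parametrised germs of sets\<close>

text \<open>The second condition makes \<open>N\<close> the image of the germ of the curve and not only of a representative.\<close>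

definition param :: "(real^3 \<Rightarrow> 'a::euclidean_space) \<Rightarrow> 'a set \<Rightarrow> bool" where
  "param g N \<longleftrightarrow> near0 (\<lambda>x. x \<in> N3 \<longrightarrow> g x \<in> N) \<and>
     (\<forall>B. open B \<and> 0 \<in> B \<longrightarrow> near0 (\<lambda>z. z \<in> N \<longrightarrow> (\<exists>x\<in>B \<inter> N3. g x = z)))"

lemma param_image:
  assumes "linear pr" "\<And>x. pr (g x) = x"
  shows "param g (g ` N3)"
  unfolding param_def
proof (intro conjI allI impI)
  show "near0 (\<lambda>x. x \<in> N3 \<longrightarrow> g x \<in> g ` N3)" by (simp add: always_eventually)
  fix B :: "(real^3) set" assume B: "open B \<and> 0 \<in> B"
  have "isCont pr 0" using assms(1) by (simp add: linear_conv_bounded_linear linear_continuous_at)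
  then have "near0 (\<lambda>z. pr z \<in> B)"
    using near0_compose[OF eventually_nhds_in_open] B linear_0[OF assms(1)] by blast
  then show "near0 (\<lambda>z. z \<in> g ` N3 \<longrightarrow> (\<exists>x\<in>B \<inter> N3. g x = z))"
    by eventually_elim (use assms(2) in auto)
qed

lemma param_diffeo:
  fixes f :: "'a::euclidean_space \<Rightarrow> 'a" and g :: "real^3 \<Rightarrow> 'a"
  assumes f: "diffeo_rep U f" and N: "same_germ (f ` (M \<inter> U)) N" and g: "param g M" and sm: "smooth_germ g" "g 0 = 0"
  shows "param (\<lambda>x. f (g x)) N"
  unfolding param_def
proof (intro conjI allI impI)
  note d = diffeo_repD[OF f]
  obtain W where W: "open W" "0 \<in> W" "f ` (M \<inter> U) \<inter> W = N \<inter> W" using N unfolding same_germ_def by blast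
  have smf: "smooth_germ f" unfolding smooth_germ_def using d by blast
  have "smooth_germ (\<lambda>x. f (g x))" by (rule smooth_germ_compose[OF smf sm])
  then have 1: "near0 (\<lambda>x. f (g x) \<in> W)"
    by (rule near0_smooth_compose[OF eventually_nhds_in_open[OF W(1,2)]]) (simp add: sm d)
  have 2: "near0 (\<lambda>x. g x \<in> U)" by (rule near0_smooth_compose[OF eventually_nhds_in_open[OF d(1,2)] sm])
  have 3: "near0 (\<lambda>x. x \<in> N3 \<longrightarrow> g x \<in> M)" using g unfolding param_def by blast
  show "near0 (\<lambda>x. x \<in> N3 \<longrightarrow> f (g x) \<in> N)"
    using 1 2 3 by eventually_elim (use W(3) in blast)
  fix B :: "(real^3) set" assume B: "open B \<and> 0 \<in> B"
  then have "near0 (\<lambda>z. z \<in> M \<longrightarrow> (\<exists>x\<in>B \<inter> N3. g x = z))" using g unfolding param_def by blast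
  then obtain T where T: "open T" "0 \<in> T" "\<And>z. z \<in> T \<Longrightarrow> z \<in> M \<Longrightarrow> \<exists>x\<in>B \<inter> N3. g x = z"
    unfolding eventually_nhds by (elim exE conjE) simp
  have dT: "diffeo_rep (U \<inter> T) f" by (rule diffeo_rep_subset[OF f]) (use d T in auto)
  have "0 \<in> f ` (U \<inter> T)" using d(2,3) T(2) by force
  then have "near0 (\<lambda>z. z \<in> f ` (U \<inter> T) \<inter> W)"
    using diffeo_repD(5)[OF dT] W by (intro eventually_nhds_in_open) auto
  then show "near0 (\<lambda>z. z \<in> N \<longrightarrow> (\<exists>x\<in>B \<inter> N3. f (g x) = z))"
  proof eventually_elim
    case (elim z)
    show ?case
    proof
      assume "z \<in> N"
      then have "z \<in> N \<inter> W" using elim by simp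
      then have "z \<in> f ` (M \<inter> U)" unfolding W(3)[symmetric] by simp
      then obtain v where v: "v \<in> M" "v \<in> U" "f v = z" by blast
      obtain v' where v': "v' \<in> U" "v' \<in> T" "f v' = z" using elim by blast
      have "v = v'" by (rule inj_onD[OF d(4)]) (use v v' in simp_all)
      then obtain x where "x \<in> B \<inter> N3" "g x = v" using T(3)[of v] v(1) v'(2) by blast
      then show "\<exists>x\<in>B \<inter> N3. f (g x) = z" using v(3) by blast
    qed
  qed
qed

lemma param_reparam:
  fixes g :: "real^3 \<Rightarrow> 'a::euclidean_space"
  assumes g: "param g N" and \<psi>: "smooth_germ \<psi>" "\<psi> 0 = 0" "inj (frechet_derivative \<psi> (at 0))"
    and N: "near0 (\<lambda>x. \<psi> x \<in> N3 \<longleftrightarrow> x \<in> N3)"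
  shows "param (\<lambda>x. g (\<psi> x)) N"
  unfolding param_def
proof (intro conjI allI impI)
  have "near0 (\<lambda>x. x \<in> N3 \<longrightarrow> g x \<in> N)" using g unfolding param_def by blast
  from near0_smooth_compose[OF this \<psi>(1,2)] N
  show "near0 (\<lambda>x. x \<in> N3 \<longrightarrow> g (\<psi> x) \<in> N)" by eventually_elim simp
  fix B :: "(real^3) set" assume B: "open B \<and> 0 \<in> B"
  obtain Z where Z: "open Z" "0 \<in> Z" "\<And>x. x \<in> Z \<Longrightarrow> \<psi> x \<in> N3 \<longleftrightarrow> x \<in> N3"
    using N unfolding eventually_nhds by (elim exE conjE) simp
  obtain U where U: "open U" "0 \<in> U" "smooth_on U \<psi>" using \<psi>(1) unfolding smooth_germ_def by blast
  \<comment> \<open>Images under \<open>\<psi>\<close> of small open sets are open, so the covering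
    condition for \<open>g\<close> can be applied to them.\<close>
  obtain V where V: "diffeo_rep V \<psi>" using smooth_inverse_function[OF U \<psi>(2,3)] by metis
  have d: "diffeo_rep (V \<inter> (B \<inter> Z)) \<psi>"
    by (rule diffeo_rep_subset[OF V]) (use B Z diffeo_repD(1,2)[OF V] in auto)
  have "0 \<in> \<psi> ` (V \<inter> (B \<inter> Z))" using diffeo_repD(2,3)[OF d] by force
  then have "near0 (\<lambda>z. z \<in> N \<longrightarrow> (\<exists>x\<in>\<psi> ` (V \<inter> (B \<inter> Z)) \<inter> N3. g x = z))"
    using g diffeo_repD(5)[OF d] unfolding param_def by blast
  then show "near0 (\<lambda>z. z \<in> N \<longrightarrow> (\<exists>x\<in>B \<inter> N3. g (\<psi> x) = z))"
    by eventually_elim (use Z(3) in blast)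
qed

context sympl
begin

definition symp_eq :: "(real^'m) set \<Rightarrow> (real^'m) set \<Rightarrow> bool" where
  "symp_eq M N \<longleftrightarrow> (\<exists>U f. symp_rep U f \<and> same_germ (f ` (M \<inter> U)) N)"

lemma symp_repD:
  assumes "symp_rep U F" "x \<in> U"
  shows "(F has_derivative frechet_derivative F (at x)) (at x)"
    "om (frechet_derivative F (at x) v) (frechet_derivative F (at x) w) = om v w"
  using assms smooth_on_derivative(2)[OF diffeo_repD(6), of U F x] by (auto simp: symp_rep_def)

lemma symp_rep_inv:
  assumes "symp_rep U F" shows "symp_rep (F ` U) (inv_into U F)"
proof -
  have dF: "diffeo_rep U F" using assms by (simp add: symp_rep_def)
  note d = diffeo_repD[OF dF]
  let ?G = "inv_into U F"
  have "om (frechet_derivative ?G (at y) v) (frechet_derivative ?G (at y) w) = om v w" if y: "y \<in> F ` U" for y v w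
  proof -
    have x: "?G y \<in> U" using y by (rule inv_into_into)
    have G: "(?G has_derivative frechet_derivative ?G (at y)) (at y)"
      by (rule smooth_on_derivative(2)[OF d(7) y])
    have "((\<lambda>y. F (?G y)) has_derivative (\<lambda>v. frechet_derivative F (at (?G y)) (frechet_derivative ?G (at y) v))) (at y)"
      by (rule has_derivative_compose[OF G symp_repD(1)[OF assms x]])
    then have "((\<lambda>y. y) has_derivative (\<lambda>v. frechet_derivative F (at (?G y)) (frechet_derivative ?G (at y) v))) (at y)"
      by (rule has_derivative_transform_within_open[OF _ d(5) y]) (rule f_inv_into_f)
    from has_derivative_unique[OF this has_derivative_ident]
    have "frechet_derivative F (at (?G y)) (frechet_derivative ?G (at y) v) = v" for v by metis
    then show ?thesis using symp_repD(2)[OF assms x] by metis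
  qed
  then show ?thesis using diffeo_rep_inv[OF dF] by (simp add: symp_rep_def)
qed

lemma symp_eq_sym: assumes "symp_eq M N" shows "symp_eq N M"
proof -
  obtain U F W where F: "symp_rep U F" and W: "open W" "0 \<in> W" "F ` (M \<inter> U) \<inter> W = N \<inter> W"
    using assms unfolding symp_eq_def same_germ_def by blast
  have dF: "diffeo_rep U F" using F by (simp add: symp_rep_def)
  note d = diffeo_repD[OF dF]
  define W' where "W' = {x \<in> U. F x \<in> W}"
  have "W' = F -` W \<inter> U" by (auto simp: W'_def)
  moreover have "open (F -` W \<inter> U)"
    using continuous_on_open_vimage[OF d(1)] smooth_on_derivative(3)[OF d(6)] W(1) by blast
  ultimately have "open W'" by simp
  moreover have "0 \<in> W'" using d(2,3) W(2) by (simp add: W'_def)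
  moreover have "inv_into U F ` (N \<inter> F ` U) \<inter> W' = M \<inter> W'"
  proof (intro equalityI subsetI)
    fix x assume x: "x \<in> inv_into U F ` (N \<inter> F ` U) \<inter> W'"
    then obtain x' where x': "x' \<in> U" "F x' \<in> N" "x = inv_into U F (F x')" by blast
    then have xx: "x = x'" using inv_into_f_f[OF d(4)] by simp
    then have "F x \<in> N \<inter> W" using x x' by (simp add: W'_def)
    then have "F x \<in> F ` (M \<inter> U)" unfolding W(3)[symmetric] by simp
    then obtain y where y: "y \<in> M" "y \<in> U" "F x = F y" by blast
    have "x = y" by (rule inj_onD[OF d(4) y(3)]) (use xx x' y in simp_all)
    then show "x \<in> M \<inter> W'" using x y by simp
  next
    fix x assume x: "x \<in> M \<inter> W'"
    then have xU: "x \<in> U" "F x \<in> W" by (simp_all add: W'_def)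
    then have "F x \<in> F ` (M \<inter> U) \<inter> W" using x by blast
    then have "F x \<in> N" unfolding W(3) by simp
    moreover have "x = inv_into U F (F x)" using inv_into_f_f[OF d(4) xU(1)] by simp
    ultimately show "x \<in> inv_into U F ` (N \<inter> F ` U) \<inter> W'" using x xU(1) by blast
  qed
  ultimately show ?thesis
    using symp_rep_inv[OF F] unfolding symp_eq_def same_germ_def by blast
qed

lemma symp_eq_trans: assumes "symp_eq M N" "symp_eq N R" shows "symp_eq M R"
proof -
  obtain U F W1 where F: "symp_rep U F" and W1: "open W1" "0 \<in> W1" "F ` (M \<inter> U) \<inter> W1 = N \<inter> W1"
    using assms(1) unfolding symp_eq_def same_germ_def by blast
  obtain V G W2 where G: "symp_rep V G" and W2: "open W2" "0 \<in> W2" "G ` (N \<inter> V) \<inter> W2 = R \<inter> W2"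
    using assms(2) unfolding symp_eq_def same_germ_def by blast
  have dF: "diffeo_rep U F" and dG: "diffeo_rep V G" using F G by (simp_all add: symp_rep_def)
  note f = diffeo_repD[OF dF] and g = diffeo_repD[OF dG]
  define U' where "U' = {x \<in> U. F x \<in> V \<inter> W1}"
  have oU': "open U'"
  proof -
    have "U' = F -` (V \<inter> W1) \<inter> U" by (auto simp: U'_def)
    moreover have "open (F -` (V \<inter> W1) \<inter> U)"
      using continuous_on_open_vimage[OF f(1)] smooth_on_derivative(3)[OF f(6)] g(1) W1(1) by blast
    ultimately show ?thesis by simp
  qed
  have U'0: "0 \<in> U'" using f(2,3) g(2) W1(2) by (simp add: U'_def)
  have dF': "diffeo_rep U' F" by (rule diffeo_rep_subset[OF dF oU' U'0]) (auto simp: U'_def)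
  have dH: "diffeo_rep U' (\<lambda>x. G (F x))" by (rule diffeo_rep_compose[OF dF' dG]) (auto simp: U'_def)
  have "om (frechet_derivative (\<lambda>x. G (F x)) (at x) v) (frechet_derivative (\<lambda>x. G (F x)) (at x) w) = om v w"
    if x: "x \<in> U'" for x v w
  proof -
    have xU: "x \<in> U" "F x \<in> V" using x by (auto simp: U'_def)
    have "frechet_derivative (\<lambda>x. G (F x)) (at x) = (\<lambda>v. frechet_derivative G (at (F x)) (frechet_derivative F (at x) v))"
      using frechet_derivative_at[OF has_derivative_compose[OF symp_repD(1)[OF F xU(1)] symp_repD(1)[OF G xU(2)]]] by simp
    then show ?thesis using symp_repD(2)[OF F xU(1)] symp_repD(2)[OF G xU(2)] by simp
  qed
  then have H: "symp_rep U' (\<lambda>x. G (F x))" using dH by (simp add: symp_rep_def)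
  \<comment> \<open>\<open>W\<close> lies in the image of \<open>U'\<close>, so every point of
    \<open>R\<close> in it has a preimage at which both germ equalities apply.\<close>
  define W where "W = W2 \<inter> (\<lambda>x. G (F x)) ` U'"
  have "open W" "0 \<in> W"
    using W2(1,2) diffeo_repD(5)[OF dH] U'0 f(3) g(3) by (auto simp: W_def image_iff intro!: bexI[of _ 0])
  moreover have "(\<lambda>x. G (F x)) ` (M \<inter> U') \<inter> W = R \<inter> W"
  proof (intro equalityI subsetI)
    fix y assume y: "y \<in> (\<lambda>x. G (F x)) ` (M \<inter> U') \<inter> W"
    then obtain x where x: "x \<in> M" "x \<in> U'" "y = G (F x)" by blast
    have xU: "x \<in> U" "F x \<in> V" "F x \<in> W1" using x(2) by (simp_all add: U'_def)
    have "F x \<in> F ` (M \<inter> U) \<inter> W1" using x(1) xU by blast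
    then have "F x \<in> N" unfolding W1(3) by simp
    then have "y \<in> G ` (N \<inter> V) \<inter> W2" using x(3) xU(2) y by (auto simp: W_def)
    then have "y \<in> R" unfolding W2(3) by simp
    then show "y \<in> R \<inter> W" using y by simp
  next
    fix y assume y: "y \<in> R \<inter> W"
    then have "y \<in> R \<inter> W2" by (simp add: W_def)
    then have "y \<in> G ` (N \<inter> V)" unfolding W2(3)[symmetric] by simp
    then obtain z where z: "z \<in> N" "z \<in> V" "y = G z" by blast
    obtain x where x: "x \<in> U'" "y = G (F x)" using y unfolding W_def by blast
    have xU: "x \<in> U" "F x \<in> V" "F x \<in> W1" using x(1) by (simp_all add: U'_def)
    have "z = F x" by (rule inj_onD[OF g(4)]) (use z x xU in simp_all)
    then have "F x \<in> N \<inter> W1" using z xU by simp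
    then have "F x \<in> F ` (M \<inter> U)" unfolding W1(3)[symmetric] by simp
    then obtain x' where x': "x' \<in> M" "x' \<in> U" "F x = F x'" by blast
    have "x = x'" by (rule inj_onD[OF f(4) x'(3) xU(1) x'(2)])
    then have "x \<in> M" using x' by simp
    then show "y \<in> (\<lambda>x. G (F x)) ` (M \<inter> U') \<inter> W" using x y by blast
  qed
  ultimately show ?thesis using H unfolding symp_eq_def same_germ_def by blast
qed

text \<open>A point of either set close to 0 has a parameter so small that F (g1 x) = g2 x is
  available; this is the use of the covering condition in \<open>param\<close>, once for each
  inclusion.\<close>

lemma symp_eq_param:
  assumes F: "symp_rep U F" and eq: "near0 (\<lambda>x. x \<in> N3 \<longrightarrow> g1 x \<in> U \<and> F (g1 x) = g2 x)"
    and g1: "param g1 M1" and g2: "param g2 M2"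
  shows "symp_eq M1 M2"
proof -
  have dF: "diffeo_rep U F" using F by (simp add: symp_rep_def)
  note d = diffeo_repD[OF dF]
  have "near0 (\<lambda>x. x \<in> N3 \<longrightarrow> g1 x \<in> U \<and> F (g1 x) = g2 x \<and> g1 x \<in> M1 \<and> g2 x \<in> M2)"
    using eq g1[unfolded param_def, THEN conjunct1] g2[unfolded param_def, THEN conjunct1] by eventually_elim simp
  then obtain T where T: "open T" "0 \<in> T"
    "\<And>x. x \<in> T \<Longrightarrow> x \<in> N3 \<Longrightarrow> g1 x \<in> U \<and> F (g1 x) = g2 x \<and> g1 x \<in> M1 \<and> g2 x \<in> M2"
    unfolding eventually_nhds by (elim exE conjE) simp
  obtain W1 where W1: "open W1" "0 \<in> W1" "\<And>z. z \<in> W1 \<Longrightarrow> z \<in> M1 \<Longrightarrow> \<exists>x\<in>T \<inter> N3. g1 x = z"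
    using g1[unfolded param_def, THEN conjunct2, rule_format, OF conjI[OF T(1,2)]]
    unfolding eventually_nhds by (elim exE conjE) simp
  obtain W2 where W2: "open W2" "0 \<in> W2" "\<And>z. z \<in> W2 \<Longrightarrow> z \<in> M2 \<Longrightarrow> \<exists>x\<in>T \<inter> N3. g2 x = z"
    using g2[unfolded param_def, THEN conjunct2, rule_format, OF conjI[OF T(1,2)]]
    unfolding eventually_nhds by (elim exE conjE) simp
  have d1: "diffeo_rep (U \<inter> W1) F" by (rule diffeo_rep_subset[OF dF]) (use d W1 in auto)
  define W where "W = W2 \<inter> F ` (U \<inter> W1)"
  have "open W" "0 \<in> W"
    using diffeo_repD(5)[OF d1] W1(2) W2(1,2) d(2,3) by (auto simp: W_def image_iff intro!: bexI[of _ 0])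
  moreover have "F ` (M1 \<inter> U) \<inter> W = M2 \<inter> W"
  proof (intro equalityI subsetI)
    fix y assume y: "y \<in> F ` (M1 \<inter> U) \<inter> W"
    then obtain z where z: "z \<in> M1" "z \<in> U" "y = F z" by blast
    obtain z' where z': "z' \<in> U" "z' \<in> W1" "y = F z'" using y unfolding W_def by blast
    then have "z \<in> W1" using z inj_onD[OF d(4), of z z'] by auto
    then obtain x where x: "x \<in> T" "x \<in> N3" "g1 x = z" using W1(3)[OF _ z(1)] by blast
    then have "y \<in> M2" using T(3)[OF x(1,2)] z(3) by simp
    then show "y \<in> M2 \<inter> W" using y by simp
  next
    fix y assume y: "y \<in> M2 \<inter> W"
    then obtain x where x: "x \<in> T" "x \<in> N3" "g2 x = y" using W2(3)[of y] by (auto simp: W_def)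
    then have "y = F (g1 x)" "g1 x \<in> M1 \<inter> U" using T(3)[OF x(1,2)] by simp_all
    then show "y \<in> F ` (M1 \<inter> U) \<inter> W" using y by blast
  qed
  ultimately show ?thesis using F unfolding symp_eq_def same_germ_def by blast
qed

text \<open>The normal forms are graphs over three coordinates, hence images of the whole curve
  under a map with a linear left inverse. The left inverse makes \<open>g\<close> an immersion and
  recovers parameters from points.\<close>

definition realizes :: "(real^'m) set \<Rightarrow> (nat \<Rightarrow> real) \<Rightarrow> bool" where
  "realizes M c \<longleftrightarrow> (\<exists>g pr. smooth_germ g \<and> g 0 = 0 \<and> linear pr \<and> (\<forall>x. pr (g x) = x) \<and>
     M = g ` N3 \<and> pulled_form g c)"

lemma left_inverse_inj_derivative:
  fixes g :: "real^3 \<Rightarrow> real^'m"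
  assumes "smooth_germ g" "linear pr" "\<And>x. pr (g x) = x"
  shows "inj (frechet_derivative g (at 0))"
proof -
  have "bounded_linear pr" using assms(2) by (simp add: linear_conv_bounded_linear)
  from bounded_linear.has_derivative[OF this smooth_germ_has_derivative0[OF assms(1)]]
  have "((\<lambda>x. x) has_derivative (\<lambda>v. pr (frechet_derivative g (at 0) v))) (at 0)" by (simp only: assms(3))
  from has_derivative_unique[OF this has_derivative_ident]
  have "pr (frechet_derivative g (at 0) v) = v" for v by metis
  then show ?thesis by (metis injI)
qed

lemma realizes_rigid:
  assumes "realizes M1 c" "realizes M2 c'" "symp_eq M1 M2"
  obtains l where "l \<noteq> 0" "c 7 = l^7 * c' 7" "c 8 = l^8 * c' 8" "c 9 = l^9 * c' 9"
    "c' 7 = 0 \<Longrightarrow> c 10 = l^10 * c' 10"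
    "c' 7 = 0 \<Longrightarrow> c' 8 = 0 \<Longrightarrow> c 11 = l^11 * c' 11"
    "c' 7 = 0 \<Longrightarrow> c' 8 = 0 \<Longrightarrow> c' 9 = 0 \<Longrightarrow> c' 10 = 0 \<Longrightarrow> c 13 = l^13 * c' 13"
    "c' 7 = 0 \<Longrightarrow> c' 8 = 0 \<Longrightarrow> c' 9 = 0 \<Longrightarrow> c' 10 = 0 \<Longrightarrow> c' 11 = 0 \<Longrightarrow> c 14 = l^14 * c' 14"
proof -
  obtain g1 pr1 where g1: "smooth_germ g1" "g1 0 = 0" "linear pr1" "\<And>x. pr1 (g1 x) = x" "M1 = g1 ` N3" "pulled_form g1 c"
    using assms(1) unfolding realizes_def by blast
  obtain g2 pr2 where g2: "smooth_germ g2" "g2 0 = 0" "linear pr2" "\<And>x. pr2 (g2 x) = x" "M2 = g2 ` N3" "pulled_form g2 c'"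
    using assms(2) unfolding realizes_def by blast
  obtain U F W where F: "symp_rep U F" and W: "open W" "0 \<in> W" "F ` (M1 \<inter> U) \<inter> W = M2 \<inter> W"
    using assms(3) unfolding symp_eq_def same_germ_def by blast
  have dF: "diffeo_rep U F" using F by (simp add: symp_rep_def)
  note d = diffeo_repD[OF dF]
  have smF: "smooth_germ F" unfolding smooth_germ_def using d by blast
  have smf: "smooth_germ (\<lambda>x. F (g1 x))" by (rule smooth_germ_compose[OF smF g1(1,2)])
  \<comment> \<open>The left inverse of g2 reads off a smooth reparametrisation, which satisfies g2
    \<circ> \<psi> = F \<circ> g1 only along the curve.\<close>
  define \<psi> where "\<psi> = (\<lambda>x. pr2 (F (g1 x)))"
  have sm\<psi>: "smooth_germ \<psi>"
    unfolding \<psi>_def using g2(3) by (intro smooth_germ_linear[OF _ smf]) (simp add: linear_conv_bounded_linear)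
  have \<psi>0: "\<psi> 0 = 0" using g1(2) d(3) linear_0[OF g2(3)] by (simp add: \<psi>_def)
  have "near0 (\<lambda>x. F (g1 x) \<in> W)"
    by (rule near0_smooth_compose[OF eventually_nhds_in_open[OF W(1,2)] smf]) (simp add: g1 d)
  then have "near0 (\<lambda>x. x \<in> N3 \<longrightarrow> \<psi> x \<in> N3 \<and> g2 (\<psi> x) = F (g1 x))"
    using near0_smooth_compose[OF eventually_nhds_in_open[OF d(1,2)] g1(1,2)]
  proof eventually_elim
    case (elim x)
    show ?case
    proof
      assume "x \<in> N3"
      then have "F (g1 x) \<in> F ` (M1 \<inter> U) \<inter> W" using elim g1(5) by blast
      then have "F (g1 x) \<in> M2" unfolding W(3) by simp
      then obtain y where "y \<in> N3" "F (g1 x) = g2 y" using g2(5) by blast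
      then show "\<psi> x \<in> N3 \<and> g2 (\<psi> x) = F (g1 x)" by (simp add: \<psi>_def g2(4))
    qed
  qed
  from rigidity[OF g1(1) g2(1) g1(2) left_inverse_inj_derivative[OF g1(1,3,4)] g1(6) g2(6) F sm\<psi> \<psi>0 this] that
  show ?thesis by blast
qed

lemma realizes_equiv:
  assumes g: "smooth_germ g" "g 0 = 0" "inj (frechet_derivative g (at 0))" "param g N" "cls g c"
    and M: "realizes M c"
  shows "symp_eq N M"
proof -
  obtain g2 pr where g2: "smooth_germ g2" "g2 0 = 0" "linear pr" "\<And>x. pr (g2 x) = x" "M = g2 ` N3" "pulled_form g2 c"
    using M unfolding realizes_def by blast
  have "cls g2 c" by (rule pulled_form_cls[OF g2(1,6)])
  from null_trans[OF this[unfolded cls_def] null_sym[OF g(5)[unfolded cls_def]]]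
  have "null (\<lambda>x. liou g2 x - liou g x)" .
  then obtain U F where F: "symp_rep U F" "near0 (\<lambda>x. x \<in> N3 \<longrightarrow> g x \<in> U \<and> F (g x) = g2 x)"
    using darboux[OF g(1) g2(1) g(2) g2(2) g(3) left_inverse_inj_derivative[OF g2(1,3,4)]] by blast
  show ?thesis
    unfolding g2(5) by (rule symp_eq_param[OF F g(4) param_image[OF g2(3,4)]])
qed

text \<open>Only the generators of degrees 7, 8, 9 have a nonzero 1-jet at 0, and modulo Hessians
  the 1-jet of the Liouville form is the symplectic form on the tangent 3-space.\<close>

lemma cls_isotropic:
  fixes g :: "real^3 \<Rightarrow> real^'m"
  assumes sm: "smooth_germ g" and g0: "g 0 = 0" and c: "cls g c" and z: "c 7 = 0" "c 8 = 0" "c 9 = 0"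
  shows "om (pd i g 0) (pd j g 0) = 0"
proof -
  let ?t = "tform (\<lambda>k. c k / real k)"
  obtain \<phi> where \<phi>: "smooth_germ \<phi>" "near0 (\<lambda>x. x \<in> N3 \<longrightarrow> (\<forall>i. (liou g x - ?t x) $ i = pd i \<phi> x))"
    using c unfolding cls_def null_def by blast
  have t: "pd i (\<lambda>x. ?t x $ j) 0 = 0" for i j
    using exhaust_3[of j]
    by (auto simp: pd_eqI[OF tform_derivative(1)] pd_eqI[OF tform_derivative(2)] pd_eqI[OF tform_derivative(3)] z)
  have e: "pd i (pd j \<phi>) 0 = om (pd i g 0) (pd j g 0) / 2" for i j
  proof -
    have s1: "smooth_germ (\<lambda>x. liou g x $ j)" by (rule smooth_germ_nth[OF smooth_germ_liou[OF sm]])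
    have s2: "smooth_germ (\<lambda>x. ?t x $ j)" by (rule smooth_germ_nth[OF smooth_germ_tform])
    have f: "smooth_germ (\<lambda>x. (liou g x $ j - ?t x $ j) - pd j \<phi> x)"
      by (intro smooth_germ_diff s1 s2 smooth_germ_pd \<phi>)
    have v: "near0 (\<lambda>x. x \<in> N3 \<longrightarrow> (liou g x $ j - ?t x $ j) - pd j \<phi> x = 0)"
      using \<phi>(2) by eventually_elim simp
    have "pd i (\<lambda>x. liou g x $ j) 0 = om (pd i g 0) (pd j g 0) / 2"
      using eventually_nhds_x_imp_x[OF pd_liou[OF sm]] g0 by (simp add: om_simps)
    with vanish_jets(2)[OF f v, of i] t show ?thesis
      by (simp add: pd0_diff s1 s2 smooth_germ_diff smooth_germ_pd \<phi>)
  qed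
  show ?thesis using e[of i j] e[of j i] pd_sym2[OF \<phi>(1), of i j] om_swap[of "pd i g 0" "pd j g 0"] by simp
qed

text \<open>For isotropic range the spaces \<open>range D\<close> and \<open>K\<close> of it are
  orthogonal and both have dimension 3, which requires dimension at least 6.\<close>

lemma not_isotropic:
  fixes D :: "real^3 \<Rightarrow> real^'m"
  assumes "linear D" "inj D" "\<And>v w. om (D v) (D w) = 0" "CARD('m) < 6"
  shows False
proof -
  have lKD: "linear (\<lambda>v. K (D v))" using linear_compose[OF assms(1) linear_K] by (simp add: comp_def)
  have injK: "inj K"
  proof (rule injI)
    fix v w assume "K v = K w"
    then have "K (K v) = K (K w)" by simp
    then show "v = w" by (simp add: KK)
  qed
  have iKD: "inj (\<lambda>v. K (D v))" using inj_compose[OF injK assms(2)] by (simp add: comp_def)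
  have "dim (range D) = dim (UNIV :: (real^3) set)" "dim (range (\<lambda>v. K (D v))) = dim (UNIV :: (real^3) set)"
    by (rule dim_image_eq; use assms lKD iKD in \<open>simp add: inj_on_subset\<close>)+
  moreover have "dim (range (\<lambda>v. K (D v)) \<union> range D) = dim (range (\<lambda>v. K (D v))) + dim (range D)"
    by (rule dim_orthogonal_sum) (use assms(3) in \<open>auto simp: om_def\<close>)
  moreover have "dim (range (\<lambda>v. K (D v)) \<union> range D) \<le> CARD('m)"
    using dim_subset_UNIV[of "range (\<lambda>v. K (D v)) \<union> range D"] by simp
  ultimately show False using assms(4) by simp
qed

end

section \<open>The normal forms\<close>

context
  fixes f g :: "real^'n \<Rightarrow> real" and x
  assumes f: "f differentiable (at x)" and g: "g differentiable (at x)"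
begin

lemma pdx_add: "pd i (\<lambda>x. f x + g x) x = pd i f x + pd i g x"
  by (rule pd_add; use f g in \<open>simp flip: frechet_derivative_works\<close>)

lemma pdx_mult: "pd i (\<lambda>x. f x * g x) x = f x * pd i g x + pd i f x * g x"
  by (rule pd_mult; use f g in \<open>simp flip: frechet_derivative_works\<close>)

end

lemma pdx_divide:
  fixes f :: "real^'n \<Rightarrow> real"
  assumes "f differentiable (at x)" shows "pd i (\<lambda>x. f x / c) x = pd i f x / c"
  by (rule pd_linear[OF bounded_linear_divide]; use assms in \<open>simp flip: frechet_derivative_works\<close>)

lemma pdx_minus:
  fixes f :: "real^'n \<Rightarrow> real"
  assumes "f differentiable (at x)" shows "pd i (\<lambda>x. - f x) x = - pd i f x"
  by (rule pd_linear[OF bounded_linear_minus[OF bounded_linear_ident]]; use assms in \<open>simp flip: frechet_derivative_works\<close>)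

lemma pdx_const: "pd i (\<lambda>x::real^'n. c::real) x = 0"
  by (rule pd_eqI) simp

lemma differentiable_coord: "(\<lambda>x::real^'n. x $ i) differentiable (at x)"
  using bounded_linear_imp_has_derivative[OF bounded_linear_vec_nth] by (auto simp: differentiable_def)

lemmas pdx_simps = pdx_add pdx_divide pdx_minus pdx_mult pdx_const pd_coord differentiable_coord

lemma smooth_germ_if: "smooth_germ f \<Longrightarrow> smooth_germ g \<Longrightarrow> smooth_germ (\<lambda>x. if b then f x else g x)"
  by (cases b) simp_all

lemma sum_pairs:
  fixes F :: "nat \<Rightarrow> real"
  shows "(\<Sum>j=1..2*n. F j) = (\<Sum>i=1..n. F (2 * i - 1) + F (2 * i))"
  by (induction n) simp_all

lemma sum_3_pairs:
  fixes F :: "nat \<Rightarrow> real"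
  assumes "n \<ge> 2" "\<And>k. k > 3 \<Longrightarrow> F k = 0" "n = 2 \<Longrightarrow> F 3 = 0"
  shows "(\<Sum>k=1..n. F k) = F 1 + F 2 + F 3"
proof (cases "n = 2")
  case True
  then show ?thesis using assms(3) by (simp add: numeral_2_eq_2)
next
  case False
  then have "(\<Sum>k=1..n. F k) = (\<Sum>k\<in>{1, 2, 3}. F k)"
    using assms(1,2) by (intro sum.mono_neutral_right) auto
  then show ?thesis by simp
qed

section \<open>Paired coordinates and the standard symplectic form\<close>

locale coords =
  fixes n :: nat and e :: "nat \<Rightarrow> 'm::finite"
  assumes n2: "n \<ge> 2" and bij: "bij_betw e {1..2 * n} UNIV"
begin

definition idx :: "'m \<Rightarrow> nat" where "idx = the_inv_into {1..2 * n} e"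

lemma idx_e: "j \<in> {1..2 * n} \<Longrightarrow> idx (e j) = j"
  unfolding idx_def using bij by (intro the_inv_into_f_f) (auto simp: bij_betw_def)

lemma e_idx: "e (idx k) = k" and idx_range: "idx k \<in> {1..2 * n}"
  unfolding idx_def using bij f_the_inv_into_f[of e "{1..2 * n}" k] the_inv_into_into[of e "{1..2 * n}" k "{1..2 * n}"]
  by (auto simp: bij_betw_def)

definition emb :: "(nat \<Rightarrow> real) \<Rightarrow> real^'m" where "emb h = (\<chi> k. h (idx k))"

lemma emb_nth: "j \<in> {1..2 * n} \<Longrightarrow> emb h $ e j = h j"
  by (simp add: emb_def idx_e)

lemma vec_eq_e: "v = w \<longleftrightarrow> (\<forall>j\<in>{1..2 * n}. v $ e j = w $ e j)" for v w :: "'a^'m"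
proof
  assume *: "\<forall>j\<in>{1..2 * n}. v $ e j = w $ e j"
  have "v $ k = w $ k" for k using *[rule_format, OF idx_range[of k]] by (simp add: e_idx)
  then show "v = w" by (simp add: vec_eq_iff)
qed simp

lemma sum_e: "(\<Sum>k\<in>UNIV. F k) = (\<Sum>i=1..n. F (e (2 * i - 1)) + F (e (2 * i)))" for F :: "'m \<Rightarrow> real"
  using sum.reindex_bij_betw[OF bij, of F] sum_pairs[of "\<lambda>j. F (e j)" n] by simp

definition J :: "real^'m \<Rightarrow> real^'m" where
  "J v = emb (\<lambda>j. if even j then v $ e (j - 1) else - (v $ e (j + 1)))"

lemma J_even: "i \<in> {1..n} \<Longrightarrow> J v $ e (2 * i) = v $ e (2 * i - 1)"
  and J_odd: "i \<in> {1..n} \<Longrightarrow> J v $ e (2 * i - 1) = - (v $ e (2 * i))"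
proof -
  assume i: "i \<in> {1..n}"
  then show "J v $ e (2 * i) = v $ e (2 * i - 1)" by (simp add: J_def emb_nth)
  have "odd (2 * i - 1)" "2 * i - 1 + 1 = 2 * i" "2 * i - 1 \<in> {1..2 * n}" using i by auto
  then show "J v $ e (2 * i - 1) = - (v $ e (2 * i))" unfolding J_def by (subst emb_nth) simp_all
qed

lemma omega_J: "J v \<bullet> w = omega e n v w"
  unfolding omega_def inner_vec_def sum_e
proof (intro sum.cong refl)
  fix i assume "i \<in> {1..n}"
  from J_even[OF this, of v] J_odd[OF this, of v]
  show "J v $ e (2 * i - 1) \<bullet> w $ e (2 * i - 1) + J v $ e (2 * i) \<bullet> w $ e (2 * i) =
      v $ e (2 * i - 1) * w $ e (2 * i) - v $ e (2 * i) * w $ e (2 * i - 1)" by simp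
qed

lemma vec_eq_pairs: "v = w \<longleftrightarrow> (\<forall>i\<in>{1..n}. v $ e (2 * i - 1) = w $ e (2 * i - 1) \<and> v $ e (2 * i) = w $ e (2 * i))"
  for v w :: "'a^'m"
proof
  assume *: "\<forall>i\<in>{1..n}. v $ e (2 * i - 1) = w $ e (2 * i - 1) \<and> v $ e (2 * i) = w $ e (2 * i)"
  have "v $ e j = w $ e j" if "j \<in> {1..2 * n}" for j
  proof (cases "even j")
    case True
    then obtain i where "j = 2 * i" by blast
    then show ?thesis using * that by auto
  next
    case False
    then obtain i where "j = 2 * (i + 1) - 1" by (metis add_diff_cancel_right' distrib_left_numeral mult_2 oddE one_add_one add.assoc mult.right_neutral)
    then show ?thesis using *[rule_format, of "i + 1"] that by auto
  qed
  then show "v = w" by (simp add: vec_eq_e)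
qed simp

sublocale S: sympl J
proof (rule sympl.intro)
  show "linear J"
    by (rule linearI) (auto simp: J_def emb_def vec_eq_iff)
  show "J (J v) = - v" for v
    unfolding vec_eq_pairs using J_even J_odd by simp
  show "J v \<bullet> w = - (v \<bullet> J w)" for v w
    unfolding inner_commute[of v "J w"] omega_J omega_def
    by (simp add: sum_negf[symmetric] algebra_simps)
qed

lemma om_omega: "S.om = omega e n"
  by (simp add: fun_eq_iff S.om_def omega_J)

lemma symp_equiv_iff: "symp_equiv e n M N \<longleftrightarrow> S.symp_eq M N"
  by (simp add: symp_equiv_def S.symp_eq_def symplecto_rep_def S.symp_rep_def om_omega)

text \<open>\<open>h j\<close> is the j-th coordinate of the parametrisation. At most three
  coordinate pairs occur; for n = 2 the third pair is filled with zero functions so that one formula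
  covers all dimensions. At each use \<open>q\<close> is instantiated by reflexivity with the
  right-hand side of \<open>form\<close>, leaving three coefficients to compute.\<close>

lemma realizesI:
  fixes h :: "nat \<Rightarrow> real^3 \<Rightarrow> real"
  assumes sm: "\<And>j. smooth_germ (h j)" and h0: "\<And>j. h j 0 = 0" and hbig: "\<And>j. j > 6 \<Longrightarrow> h j = (\<lambda>x. 0)"
    and h56: "n = 2 \<Longrightarrow> h 5 = (\<lambda>x. 0) \<and> h 6 = (\<lambda>x. 0)"
    and pr: "linear pr" "\<And>x. pr (emb (\<lambda>j. h j x)) = x"
    and M: "\<And>v. v \<in> M \<longleftrightarrow> pr v \<in> N3 \<and> (\<forall>j\<in>{1..2 * n}. v $ e j = h j (pr v))"
    and form: "\<And>i j x. q i j x = (pd i (h 1) x * pd j (h 2) x - pd i (h 2) x * pd j (h 1) x) +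
      (pd i (h 3) x * pd j (h 4) x - pd i (h 4) x * pd j (h 3) x) +
      (pd i (h 5) x * pd j (h 6) x - pd i (h 6) x * pd j (h 5) x)"
    and q: "\<And>x. q 1 3 x = c 7 + c 10 * x$3 + c 11 * x$1 + c 13 * (x$3)^2 + c 14 * (x$1 * x$3)"
      "\<And>x. q 2 3 x = c 8" "\<And>x. q 1 2 x = c 9"
  shows "S.realizes M c"
proof -
  define g where "g = (\<lambda>x. emb (\<lambda>j. h j x))"
  have gk: "g x $ k = h (idx k) x" for x k by (simp add: g_def emb_def)
  have smg: "smooth_germ g" by (rule smooth_germ_vec) (simp add: gk sm)
  have "M = g ` N3"
  proof (intro equalityI subsetI)
    fix v assume "v \<in> M"
    then have "v = g (pr v)" "pr v \<in> N3" using M by (auto simp: vec_eq_e g_def emb_nth)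
    then show "v \<in> g ` N3" by blast
  next
    fix v assume "v \<in> g ` N3"
    then show "v \<in> M" using M pr(2) by (auto simp: g_def emb_nth)
  qed
  moreover have "S.pulled_form g c"
    unfolding S.pulled_form_def
    using smooth_germ_has_derivative[OF smg]
  proof eventually_elim
    case (elim x)
    have pdg: "pd i g x $ e j = pd i (h j) x" if "j \<in> {1..2 * n}" for i j
      using pd_nth[OF elim, of i "e j"] that by (simp add: gk idx_e)
    have "S.om (pd i g x) (pd j g x) = q i j x" for i j
    proof -
      have "S.om (pd i g x) (pd j g x) = (\<Sum>k=1..n. pd i (h (2 * k - 1)) x * pd j (h (2 * k)) x -
          pd i (h (2 * k)) x * pd j (h (2 * k - 1)) x)"
        unfolding om_omega omega_def
      proof (intro sum.cong refl)
        fix k assume "k \<in> {1..n}"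
        then have "2 * k - 1 \<in> {1..2 * n}" "2 * k \<in> {1..2 * n}" by auto
        then show "pd i g x $ e (2 * k - 1) * pd j g x $ e (2 * k) - pd i g x $ e (2 * k) * pd j g x $ e (2 * k - 1) =
            pd i (h (2 * k - 1)) x * pd j (h (2 * k)) x - pd i (h (2 * k)) x * pd j (h (2 * k - 1)) x"
          by (simp only: pdg)
      qed
      also have "\<dots> = q i j x"
        unfolding form
        by (subst sum_3_pairs[OF n2]) (auto simp: hbig h56 pdx_const)
      finally show ?thesis .
    qed
    then show ?case using q by simp
  qed
  moreover have "g 0 = 0" by (simp add: vec_eq_iff gk h0)
  ultimately show ?thesis
    unfolding S.realizes_def using smg pr by (intro exI[of _ g] exI[of _ pr]) (simp add: g_def)
qed

lemma PQ_vanish: "k \<ge> 1 \<Longrightarrow> P_vanish_from e n k v \<and> Q_vanish_from e n k v \<longleftrightarrow> (\<forall>j\<in>{2 * k - 1..2 * n}. v $ e j = 0)"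
  for v :: "real^'m"
proof
  assume k: "k \<ge> 1" and *: "P_vanish_from e n k v \<and> Q_vanish_from e n k v"
  show "\<forall>j\<in>{2 * k - 1..2 * n}. v $ e j = 0"
  proof
    fix j assume j: "j \<in> {2 * k - 1..2 * n}"
    show "v $ e j = 0"
    proof (cases "even j")
      case True
      then obtain i where "j = 2 * i" by blast
      then show ?thesis using * j by (auto simp: Q_vanish_from_def)
    next
      case False
      then obtain i where i: "j = 2 * i + 1" by (blast elim: oddE)
      then have "i + 1 \<in> {k..n}" using j by auto
      then have "v $ e (2 * (i + 1) - 1) = 0" using * unfolding P_vanish_from_def by blast
      then show ?thesis using i by simp
    qed
  qed
next
  assume k: "k \<ge> 1" and *: "\<forall>j\<in>{2 * k - 1..2 * n}. v $ e j = 0"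
  show "P_vanish_from e n k v \<and> Q_vanish_from e n k v"
    unfolding P_vanish_from_def Q_vanish_from_def using * k by (auto intro!: bspec[OF *])
qed

lemma all_4: "(\<forall>j\<in>{1..2 * n}. R j) \<longleftrightarrow> R 1 \<and> R 2 \<and> R 3 \<and> R 4 \<and> (\<forall>j\<in>{5..2 * n}. R j)"
proof -
  have "{1..2 * n} = {1, 2, 3, 4} \<union> {5..2 * n}" using n2 by auto
  then show ?thesis by auto
qed

lemma all_6: "n \<ge> 3 \<Longrightarrow> (\<forall>j\<in>{1..2 * n}. R j) \<longleftrightarrow> R 1 \<and> R 2 \<and> R 3 \<and> R 4 \<and> R 5 \<and> R 6 \<and> (\<forall>j\<in>{7..2 * n}. R j)"
proof -
  assume "n \<ge> 3"
  then have "{1..2 * n} = {1, 2, 3, 4, 5, 6} \<union> {7..2 * n}" by auto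
  then show ?thesis by auto
qed

section \<open>Coefficient vectors of the normal forms\<close>

definition coef :: "real \<Rightarrow> real \<Rightarrow> real \<Rightarrow> real \<Rightarrow> real \<Rightarrow> real \<Rightarrow> real \<Rightarrow> nat \<Rightarrow> real" where
  "coef c7 c8 c9 c10 c11 c13 c14 k = (if k = 7 then c7 else if k = 8 then c8 else if k = 9 then c9
    else if k = 10 then c10 else if k = 11 then c11 else if k = 13 then c13 else c14)"

lemma linear_vector3:
  assumes "linear f" "linear g" "linear h"
  shows "linear (\<lambda>v. vector [f v, g v, h v] :: real^3)"
  by (rule linearI) (simp_all add: vec_eq_iff forall_3 linear_add[OF assms(1)] linear_add[OF assms(2)]
      linear_add[OF assms(3)] linear_cmul[OF assms(1)] linear_cmul[OF assms(2)] linear_cmul[OF assms(3)])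

lemma linear_nth: "linear (\<lambda>v :: real^'m. v $ k)" and linear_nth_mult: "linear (\<lambda>v :: real^'m. r * v $ k)"
  by (auto intro!: linearI simp: algebra_simps)

lemma vec3_eq: "vector [x $ 1, x $ 2, x $ 3] = (x :: real^3)"
  by (simp add: vec_eq_iff forall_3)

lemma Q_vanish_1:
  fixes v :: "real^'m"
  assumes "n \<ge> 3"
  shows "Q_vanish_from e n 1 v \<longleftrightarrow> v $ e 2 = 0 \<and> v $ e 4 = 0 \<and> v $ e 6 = 0 \<and> Q_vanish_from e n 4 v"
proof -
  have "{1..n} = {1, 2, 3} \<union> {4..n}" using assms by auto
  then show ?thesis unfolding Q_vanish_from_def by simp
qed

text \<open>The parameters are x1 = p1, x2 = p2, x3 = q1. The second pair contributes dx2 \<and> (a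
  dx3 + b dx1), whence the sign of b in degree 9.\<close>

lemma realizes_nf0:
  shows "S.realizes (U7_nf0 e n (a, b)) (coef 1 a (- b) 0 0 0 0)"
proof -
  let ?pr = "\<lambda>v. vector [v $ e 1, v $ e 3, v $ e 2] :: real^3"
  let ?h = "\<lambda>(j::nat) (x::real^3). if j = 1 then x$1 else if j = 2 then x$3 else if j = 3 then x$2 else if j = 4 then a * x$3 + b * x$1 else 0"
  have "v \<in> U7_nf0 e n (a, b) \<longleftrightarrow> ?pr v \<in> N3 \<and> (\<forall>j\<in>{1..2 * n}. v $ e j = ?h j (?pr v))" for v
    unfolding all_4 U7_nf0_def N3_def
    using PQ_vanish[of 3 v] by (auto simp: power2_eq_square power3_eq_cube)
  then show ?thesis
    using n2
    by (intro realizesI[where pr = ?pr and h = ?h, OF _ _ _ _ _ _ _ refl])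
      (auto simp: linear_vector3 linear_nth linear_nth_mult pdx_simps emb_nth vec3_eq coef_def power2_eq_square
        intro!: smooth_germ_intros smooth_germ_if)
qed

text \<open>Here x1 = p2, x2 = p1 and x3 = s q1; since s^2 = 1, this turns the signed equations into
  those of the curve, and dp1 \<and> dq1 becomes s dx2 \<and> dx3.\<close>

lemma realizes_nf1:
  assumes "s \<in> {1, -1}"
  shows "S.realizes (U7_nf1 e n s (a, b)) (coef 0 s a b 0 0 0)"
proof -
  let ?pr = "\<lambda>v. vector [v $ e 3, v $ e 1, s * v $ e 2] :: real^3"
  let ?h = "\<lambda>(j::nat) (x::real^3). if j = 1 then x$2 else if j = 2 then s * x$3 else if j = 3 then x$1 else if j = 4 then a * x$2 + b / 2 * (x$3 * x$3) else 0"
  have "v \<in> U7_nf1 e n s (a, b) \<longleftrightarrow> ?pr v \<in> N3 \<and> (\<forall>j\<in>{1..2 * n}. v $ e j = ?h j (?pr v))" for v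
    unfolding all_4 U7_nf1_def N3_def
    using PQ_vanish[of 3 v] assms by (auto simp: power2_eq_square power3_eq_cube mult.commute[of "v $ e (Suc 0)" "v $ e 3"])
  then show ?thesis
    using assms n2
    by (intro realizesI[where pr = ?pr and h = ?h, OF _ _ _ _ _ _ _ refl])
      (auto simp: linear_vector3 linear_nth linear_nth_mult pdx_simps emb_nth vec3_eq coef_def power2_eq_square
        intro!: smooth_germ_intros smooth_germ_if)
qed

text \<open>Here x1 = p1, x2 = q1, x3 = q2; the second pair contributes (a x3 + b x1) dx1 \<and>
  dx3.\<close>

lemma realizes_nf2:
  shows "S.realizes (U7_nf2 e n (a, b)) (coef 0 0 1 a b 0 0)"
proof -
  let ?pr = "\<lambda>v. vector [v $ e 1, v $ e 2, v $ e 4] :: real^3"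
  let ?h = "\<lambda>(j::nat) (x::real^3). if j = 1 then x$1 else if j = 2 then x$2 else if j = 4 then x$3 else if j = 3 then a * (x$1 * x$3) + b / 2 * (x$1 * x$1) else 0"
  have "v \<in> U7_nf2 e n (a, b) \<longleftrightarrow> ?pr v \<in> N3 \<and> (\<forall>j\<in>{1..2 * n}. v $ e j = ?h j (?pr v))" for v
    unfolding all_4 U7_nf2_def N3_def
    using PQ_vanish[of 3 v] by (auto simp: power2_eq_square power3_eq_cube)
  then show ?thesis
    using n2
    by (intro realizesI[where pr = ?pr and h = ?h, OF _ _ _ _ _ _ _ refl])
      (auto simp: linear_vector3 linear_nth linear_nth_mult pdx_simps emb_nth vec3_eq coef_def power2_eq_square
        intro!: smooth_germ_intros smooth_germ_if)
qed

text \<open>From here on the parameters are p1, p2, p3, so the tangent space at 0 is isotropic. The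
  third pair gives s x3 dx3 \<and> dx1, hence -s in degree 10.\<close>

lemma realizes_nf3:
  assumes "n \<ge> 3"
  shows "S.realizes (U7_nf3 e n s a) (coef 0 0 0 (- s) a 0 0)"
proof -
  let ?pr = "\<lambda>v. vector [v $ e 1, v $ e 3, v $ e 5] :: real^3"
  let ?h = "\<lambda>(j::nat) (x::real^3). if j = 1 then x$1 else if j = 3 then x$2 else if j = 5 then x$3 else if j = 2 then a * (x$1 * x$3) else if j = 6 then s * (x$1 * x$3) else 0"
  have "v \<in> U7_nf3 e n s a \<longleftrightarrow> ?pr v \<in> N3 \<and> (\<forall>j\<in>{1..2 * n}. v $ e j = ?h j (?pr v))" for v
    unfolding all_6[OF assms] U7_nf3_def N3_def
    using PQ_vanish[of 4 v] by (auto simp: power2_eq_square power3_eq_cube)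
  then show ?thesis
    using assms n2
    by (intro realizesI[where pr = ?pr and h = ?h, OF _ _ _ _ _ _ _ refl])
      (auto simp: linear_vector3 linear_nth linear_nth_mult pdx_simps emb_nth vec3_eq coef_def power2_eq_square
        intro!: smooth_germ_intros smooth_germ_if)
qed

text \<open>The divisors 3 and 2 cancel the factors from differentiating p3^3 and p1^2, leaving (x1
  + a x3^2) dx1 \<and> dx3.\<close>

lemma realizes_nf4:
  assumes "n \<ge> 3"
  shows "S.realizes (U7_nf4 e n a) (coef 0 0 0 0 1 a 0)"
proof -
  let ?pr = "\<lambda>v. vector [v $ e 1, v $ e 3, v $ e 5] :: real^3"
  let ?h = "\<lambda>(j::nat) (x::real^3). if j = 1 then x$1 else if j = 3 then x$2 else if j = 5 then x$3 else if j = 2 then a / 3 * (x$3 * (x$3 * x$3)) else if j = 6 then - (1 / 2) * (x$1 * x$1) else 0"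
  have "v \<in> U7_nf4 e n a \<longleftrightarrow> ?pr v \<in> N3 \<and> (\<forall>j\<in>{1..2 * n}. v $ e j = ?h j (?pr v))" for v
    unfolding all_6[OF assms] U7_nf4_def N3_def
    using PQ_vanish[of 4 v] by (auto simp: power2_eq_square power3_eq_cube)
  then show ?thesis
    using assms n2
    by (intro realizesI[where pr = ?pr and h = ?h, OF _ _ _ _ _ _ _ refl])
      (auto simp: linear_vector3 linear_nth linear_nth_mult pdx_simps emb_nth vec3_eq coef_def power2_eq_square
        intro!: smooth_germ_intros smooth_germ_if)
qed

text \<open>The first pair contributes -a x1 x3 dx1 \<and> dx3, so the parameter appears with a
  minus sign in degree 14.\<close>

lemma realizes_nf5:
  assumes "n \<ge> 3"
  shows "S.realizes (U7_nf5 e n a) (coef 0 0 0 0 0 1 (- a))"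
proof -
  let ?pr = "\<lambda>v. vector [v $ e 1, v $ e 3, v $ e 5] :: real^3"
  let ?h = "\<lambda>(j::nat) (x::real^3). if j = 1 then x$1 else if j = 3 then x$2 else if j = 5 then x$3 else if j = 2 then - (a / 2) * (x$1 * (x$3 * x$3)) else if j = 6 then - 1 * (x$1 * (x$3 * x$3)) else 0"
  have "v \<in> U7_nf5 e n a \<longleftrightarrow> ?pr v \<in> N3 \<and> (\<forall>j\<in>{1..2 * n}. v $ e j = ?h j (?pr v))" for v
    unfolding all_6[OF assms] U7_nf5_def N3_def
    using PQ_vanish[of 4 v] by (auto simp: power2_eq_square power3_eq_cube)
  then show ?thesis
    using assms n2
    by (intro realizesI[where pr = ?pr and h = ?h, OF _ _ _ _ _ _ _ refl])
      (auto simp: linear_vector3 linear_nth linear_nth_mult pdx_simps emb_nth vec3_eq coef_def power2_eq_square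
        intro!: smooth_germ_intros smooth_germ_if)
qed

lemma realizes_nf6:
  assumes "n \<ge> 3"
  shows "S.realizes (U7_nf6 e n s) (coef 0 0 0 0 0 0 s)"
proof -
  let ?pr = "\<lambda>v. vector [v $ e 1, v $ e 3, v $ e 5] :: real^3"
  let ?h = "\<lambda>(j::nat) (x::real^3). if j = 1 then x$1 else if j = 3 then x$2 else if j = 5 then x$3 else if j = 2 then 0 else if j = 6 then - s / 2 * (x$1 * (x$1 * x$3)) else 0"
  have "v \<in> U7_nf6 e n s \<longleftrightarrow> ?pr v \<in> N3 \<and> (\<forall>j\<in>{1..2 * n}. v $ e j = ?h j (?pr v))" for v
    unfolding all_6[OF assms] U7_nf6_def N3_def
    using PQ_vanish[of 4 v] by (auto simp: power2_eq_square power3_eq_cube)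
  then show ?thesis
    using assms n2
    by (intro realizesI[where pr = ?pr and h = ?h, OF _ _ _ _ _ _ _ refl])
      (auto simp: linear_vector3 linear_nth linear_nth_mult pdx_simps emb_nth vec3_eq coef_def power2_eq_square
        intro!: smooth_germ_intros smooth_germ_if)
qed

lemma realizes_nf7:
  assumes "n \<ge> 3"
  shows "S.realizes (U7_nf7 e n) (coef 0 0 0 0 0 0 0)"
proof -
  let ?pr = "\<lambda>v. vector [v $ e 1, v $ e 3, v $ e 5] :: real^3"
  let ?h = "\<lambda>(j::nat) (x::real^3). if j = 1 then x$1 else if j = 3 then x$2 else if j = 5 then x$3 else 0"
  have "v \<in> U7_nf7 e n \<longleftrightarrow> ?pr v \<in> N3 \<and> (\<forall>j\<in>{1..2 * n}. v $ e j = ?h j (?pr v))" for v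
    unfolding all_6[OF assms] U7_nf7_def N3_def Q_vanish_1[OF assms]
    using PQ_vanish[of 4 v] by (auto simp: power2_eq_square power3_eq_cube)
  then show ?thesis
    using assms n2
    by (intro realizesI[where pr = ?pr and h = ?h, OF _ _ _ _ _ _ _ refl])
      (auto simp: linear_vector3 linear_nth linear_nth_mult pdx_simps emb_nth vec3_eq coef_def power2_eq_square
        intro!: smooth_germ_intros smooth_germ_if)
qed

end

text \<open>An even leading degree leaves the sign of the scalar l open and fixes a parameter of odd
  degree only up to sign. A continuous function of constant modulus that changed sign would have a
  zero, contradicting the modulus.\<close>

lemma constant_if_abs_constant:
  fixes f :: "real \<Rightarrow> real"
  assumes c: "continuous_on {0<..<1} f" and a: "\<And>t u. t \<in> {0<..<1} \<Longrightarrow> u \<in> {0<..<1} \<Longrightarrow> \<bar>f t\<bar> = \<bar>f u\<bar>"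
    and tu: "t \<in> {0<..<1}" "u \<in> {0<..<1}"
  shows "f t = f u"
proof (rule ccontr)
  assume ne: "f t \<noteq> f u"
  then have "f u = - f t" "f t \<noteq> 0" using a[OF tu] by (auto simp: abs_if split: if_splits)
  moreover have "connected (f ` {0<..<1})" by (rule connected_continuous_image[OF c]) simp
  moreover have "f t \<in> f ` {0<..<1}" "f u \<in> f ` {0<..<1}" using tu by blast+
  ultimately have "0 \<in> f ` {0<..<1}"
    using connectedD_interval[of "f ` {0<..<1}" "f t" "f u" 0]
      connectedD_interval[of "f ` {0<..<1}" "f u" "f t" 0] by linarith
  then obtain v where "v \<in> {0<..<1}" "f v = 0" by force
  with a[OF tu(1) this(1)] \<open>f t \<noteq> 0\<close> show False by simp
qed

lemma odd_power_eq_1: "odd k \<Longrightarrow> l ^ k = 1 \<Longrightarrow> l = (1::real)"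
  using power_eq_1_iff[of l k] by (cases "l \<ge> 0") (auto simp: abs_if odd_pos)

lemma even_power_eq_1: "k > 0 \<Longrightarrow> l ^ k = 1 \<Longrightarrow> \<bar>l\<bar> = (1::real)"
  using power_eq_1_iff[of l k] by auto

section \<open>Classification and moduli\<close>

context coords
begin

lemma realizes_cong:
  assumes "S.realizes M c" "c 7 = c' 7" "c 8 = c' 8" "c 9 = c' 9" "c 10 = c' 10" "c 11 = c' 11" "c 13 = c' 13" "c 14 = c' 14"
  shows "S.realizes M c'"
  using assms unfolding S.realizes_def S.pulled_form_def by simp

lemma le_7_cases:
  assumes "i \<le> (7::nat)"
  obtains "i = 0" | "i = 1" | "i = 2" | "i = 3" | "i = 4" | "i = 5" | "i = 6" | "i = 7"
  using assms by linarith

lemma family_realizes: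
  assumes "M \<in> U7_family e n i" "i \<le> 7" "i \<le> 2 \<or> n \<ge> 3"
  obtains c where "NF i c" "S.realizes M c"
  using assms(2)
proof (cases i rule: le_7_cases)
  case 1
  then obtain a b where "M = U7_nf0 e n (a, b)" using assms by (auto simp: U7_family_def)
  then show ?thesis using 1 that[of "coef 1 a (- b) 0 0 0 0"] realizes_nf0[of a b] by (auto simp: NF_def coef_def)
next
  case 2
  then obtain s a b where "s \<in> {1, -1}" "M = U7_nf1 e n s (a, b)" using assms by (auto simp: U7_family_def)
  then show ?thesis using 2 that[of "coef 0 s a b 0 0 0"] realizes_nf1[of s a b] by (auto simp: NF_def coef_def)
next
  case 3
  then obtain a b where "M = U7_nf2 e n (a, b)" using assms by (auto simp: U7_family_def)
  then show ?thesis using 3 that[of "coef 0 0 1 a b 0 0"] realizes_nf2[of a b] by (auto simp: NF_def coef_def)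
next
  case 4
  then obtain s a where "s \<in> {1, -1}" "M = U7_nf3 e n s a" using assms by (auto simp: U7_family_def)
  then show ?thesis using 4 assms that[of "coef 0 0 0 (- s) a 0 0"] realizes_nf3[of s a] by (auto simp: NF_def coef_def)
next
  case 5
  then obtain a where "M = U7_nf4 e n a" using assms by (auto simp: U7_family_def)
  then show ?thesis using 5 assms that[of "coef 0 0 0 0 1 a 0"] realizes_nf4[of a] by (auto simp: NF_def coef_def)
next
  case 6
  then obtain a where "M = U7_nf5 e n a" using assms by (auto simp: U7_family_def)
  then show ?thesis using 6 assms that[of "coef 0 0 0 0 0 1 (- a)"] realizes_nf5[of a] by (auto simp: NF_def coef_def)
next
  case 7
  then obtain s where "s \<in> {1, -1}" "M = U7_nf6 e n s" using assms by (auto simp: U7_family_def)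
  then show ?thesis using 7 assms that[of "coef 0 0 0 0 0 0 s"] realizes_nf6[of s] by (auto simp: NF_def coef_def)
next
  case 8
  then have "M = U7_nf7 e n" using assms by (auto simp: U7_family_def)
  then show ?thesis using 8 assms that[of "coef 0 0 0 0 0 0 0"] realizes_nf7 by (auto simp: NF_def coef_def)
qed

lemma family_exists:
  assumes "NF i c" "i \<le> 7" "i \<le> 2 \<or> n \<ge> 3"
  obtains M where "M \<in> U7_family e n i" "S.realizes M c"
  using assms(2)
proof (cases i rule: le_7_cases)
  case 1
  have "S.realizes (U7_nf0 e n (c 8, - c 9)) c"
    by (rule realizes_cong[OF realizes_nf0]) (use assms 1 in \<open>auto simp: NF_def coef_def\<close>)
  moreover have "U7_nf0 e n (c 8, - c 9) \<in> U7_family e n i" using 1 by (simp add: U7_family_def)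
  ultimately show ?thesis using that by blast
next
  case 2
  then have s: "c 8 \<in> {1, -1}" using assms by (simp add: NF_def)
  have "S.realizes (U7_nf1 e n (c 8) (c 9, c 10)) c"
    by (rule realizes_cong[OF realizes_nf1[OF s]]) (use assms 2 in \<open>auto simp: NF_def coef_def\<close>)
  moreover have "U7_nf1 e n (c 8) (c 9, c 10) \<in> U7_family e n i" using 2 s by (auto simp: U7_family_def)
  ultimately show ?thesis using that by blast
next
  case 3
  have "S.realizes (U7_nf2 e n (c 10, c 11)) c"
    by (rule realizes_cong[OF realizes_nf2]) (use assms 3 in \<open>auto simp: NF_def coef_def\<close>)
  moreover have "U7_nf2 e n (c 10, c 11) \<in> U7_family e n i" using 3 by (simp add: U7_family_def)
  ultimately show ?thesis using that by blast
next
  case 4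
  then have s: "- c 10 \<in> {1, -1}" and n: "n \<ge> 3" using assms by (auto simp: NF_def)
  have "S.realizes (U7_nf3 e n (- c 10) (c 11)) c"
    by (rule realizes_cong[OF realizes_nf3[OF n]]) (use assms 4 in \<open>auto simp: NF_def coef_def\<close>)
  moreover have "U7_nf3 e n (- c 10) (c 11) \<in> U7_family e n i" using 4 s by (auto simp: U7_family_def)
  ultimately show ?thesis using that by blast
next
  case 5
  then have n: "n \<ge> 3" using assms by auto
  have "S.realizes (U7_nf4 e n (c 13)) c"
    by (rule realizes_cong[OF realizes_nf4[OF n]]) (use assms 5 in \<open>auto simp: NF_def coef_def\<close>)
  moreover have "U7_nf4 e n (c 13) \<in> U7_family e n i" using 5 by (simp add: U7_family_def)
  ultimately show ?thesis using that by blast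
next
  case 6
  then have n: "n \<ge> 3" using assms by auto
  have "S.realizes (U7_nf5 e n (- c 14)) c"
    by (rule realizes_cong[OF realizes_nf5[OF n]]) (use assms 6 in \<open>auto simp: NF_def coef_def\<close>)
  moreover have "U7_nf5 e n (- c 14) \<in> U7_family e n i" using 6 by (simp add: U7_family_def)
  ultimately show ?thesis using that by blast
next
  case 7
  then have s: "c 14 \<in> {1, -1}" and n: "n \<ge> 3" using assms by (auto simp: NF_def)
  have "S.realizes (U7_nf6 e n (c 14)) c"
    by (rule realizes_cong[OF realizes_nf6[OF n]]) (use assms 7 in \<open>auto simp: NF_def coef_def\<close>)
  moreover have "U7_nf6 e n (c 14) \<in> U7_family e n i" using 7 s by (auto simp: U7_family_def)
  ultimately show ?thesis using that by blast
next
  case 8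
  then have n: "n \<ge> 3" using assms by auto
  have "S.realizes (U7_nf7 e n) c"
    by (rule realizes_cong[OF realizes_nf7[OF n]]) (use assms 8 in \<open>auto simp: NF_def coef_def\<close>)
  moreover have "U7_nf7 e n \<in> U7_family e n i" using 8 by (simp add: U7_family_def)
  ultimately show ?thesis using that by blast
qed

lemma NF_leading:
  assumes "NF i c" "i \<le> 7"
  shows "i = (if c 7 \<noteq> 0 then 0 else if c 8 \<noteq> 0 then 1 else if c 9 \<noteq> 0 then 2 else if c 10 \<noteq> 0 then 3
    else if c 11 \<noteq> 0 then 4 else if c 13 \<noteq> 0 then 5 else if c 14 \<noteq> 0 then 6 else 7)"
  using assms(2) by (cases i rule: le_7_cases) (use assms(1) in \<open>auto simp: NF_def\<close>)

lemma index_unique: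
  assumes "NF i c" "i \<le> 7" "S.realizes M c" "NF j c'" "j \<le> 7" "S.realizes M' c'" "S.symp_eq M M'"
  shows "i = j"
proof -
  obtain l where l: "l \<noteq> 0" "c 7 = l^7 * c' 7" "c 8 = l^8 * c' 8" "c 9 = l^9 * c' 9"
    "c' 7 = 0 \<Longrightarrow> c 10 = l^10 * c' 10"
    "c' 7 = 0 \<Longrightarrow> c' 8 = 0 \<Longrightarrow> c 11 = l^11 * c' 11"
    "c' 7 = 0 \<Longrightarrow> c' 8 = 0 \<Longrightarrow> c' 9 = 0 \<Longrightarrow> c' 10 = 0 \<Longrightarrow> c 13 = l^13 * c' 13"
    "c' 7 = 0 \<Longrightarrow> c' 8 = 0 \<Longrightarrow> c' 9 = 0 \<Longrightarrow> c' 10 = 0 \<Longrightarrow> c' 11 = 0 \<Longrightarrow> c 14 = l^14 * c' 14"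
    using S.realizes_rigid[OF assms(3,6,7)] by blast
  \<comment> \<open>Up to the first nonzero degree of \<open>c'\<close> the hypotheses of all
    relations hold, and each multiplies by a power of l \<noteq> 0; so \<open>c\<close> starts in
    the same degree.\<close>
  show ?thesis
    using NF_leading[OF assms(1,2)] NF_leading[OF assms(4,5)] l by (simp split: if_splits)
qed

definition inc :: "real^3 \<Rightarrow> real^'m" where
  "inc x = emb (\<lambda>j. if j = 1 then x$1 else if j = 2 then x$2 else if j = 3 then x$3 else 0)"

definition pr3 :: "real^'m \<Rightarrow> real^3" where "pr3 v = vector [v $ e 1, v $ e 2, v $ e 3]"

lemma linear_pr3: "linear pr3"
  unfolding pr3_def[abs_def] by (intro linear_vector3 linear_nth)

lemma pr3_inc: "pr3 (inc x) = x"
  using n2 by (simp add: pr3_def inc_def emb_nth vec3_eq)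

lemma smooth_germ_inc: "smooth_germ inc"
  by (rule smooth_germ_vec) (auto simp: inc_def emb_def intro!: smooth_germ_intros smooth_germ_if)

lemma inc_0: "inc 0 = 0"
  by (simp add: vec_eq_iff inc_def emb_def)

lemma U7_eq: "U7 e n = inc ` N3"
proof -
  have "v \<in> U7 e n \<longleftrightarrow> pr3 v \<in> N3 \<and> v = inc (pr3 v)" for v
  proof -
    have "v = inc (pr3 v) \<longleftrightarrow> (\<forall>j\<in>{4..2 * n}. v $ e j = 0)"
    proof -
      have "{1..2 * n} = {1, 2, 3} \<union> {4..2 * n}" using n2 by auto
      then show ?thesis unfolding vec_eq_e inc_def using n2 by (auto simp: emb_nth pr3_def)
    qed
    then show ?thesis by (auto simp: U7_def N3_def pr3_def)
  qed
  then show ?thesis using pr3_inc by (auto simp: image_iff) 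
qed

lemma classification:
  assumes "diffeomorphic_germs (U7 e n) N"
  obtains i c M where "i \<le> 7" "i \<le> 2 \<or> n \<ge> 3" "M \<in> U7_family e n i" "NF i c" "S.realizes M c" "S.symp_eq N M"
proof -
  obtain U f where f: "diffeo_rep U f" and N: "same_germ (f ` (U7 e n \<inter> U)) N"
    using assms unfolding diffeomorphic_germs_def by blast
  have smf: "smooth_germ f" unfolding smooth_germ_def using diffeo_repD[OF f] by blast
  have "param inc (U7 e n)" unfolding U7_eq by (rule param_image[OF linear_pr3 pr3_inc])
  from param_diffeo[OF f N this smooth_germ_inc inc_0] have g0: "param (\<lambda>x. f (inc x)) N" .
  have smg0: "smooth_germ (\<lambda>x. f (inc x))" by (rule smooth_germ_compose[OF smf smooth_germ_inc inc_0])
  have z0: "f (inc 0) = 0" using diffeo_repD(3)[OF f] inc_0 by simp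
  obtain \<psi> c i where \<psi>: "smooth_germ \<psi>" "\<psi> 0 = 0" "inj (frechet_derivative \<psi> (at 0))"
    "near0 (\<lambda>x. \<psi> x \<in> N3 \<longleftrightarrow> x \<in> N3)" "i \<le> 7" "NF i c" "S.cls (\<lambda>x. f (inc (\<psi> x))) c"
    using S.reparametrize[OF smg0] .
  define g where "g = (\<lambda>x. f (inc (\<psi> x)))"
  have smg: "smooth_germ g" unfolding g_def by (rule smooth_germ_compose[OF smg0 \<psi>(1,2)])
  have gz: "g 0 = 0" by (simp add: g_def \<psi>(2) z0)
  have pg: "param g N" unfolding g_def by (rule param_reparam[OF g0 \<psi>(1-4)])
  have clsg: "S.cls g c" using \<psi>(7) by (simp add: g_def)
  have inj: "inj (frechet_derivative g (at 0))"
  proof -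
    have d1: "(inc has_derivative frechet_derivative inc (at 0)) (at (\<psi> 0))"
      unfolding \<psi>(2) by (rule smooth_germ_has_derivative0[OF smooth_germ_inc])
    have d2: "(f has_derivative frechet_derivative f (at 0)) (at (inc (\<psi> 0)))"
      unfolding \<psi>(2) inc_0 by (rule smooth_germ_has_derivative0[OF smf])
    have "frechet_derivative g (at 0) =
        (\<lambda>v. frechet_derivative f (at 0) (frechet_derivative inc (at 0) (frechet_derivative \<psi> (at 0) v)))"
      unfolding g_def
      by (rule frechet_derivative_at[symmetric], rule has_derivative_compose[OF
          has_derivative_compose[OF smooth_germ_has_derivative0[OF \<psi>(1)] d1] d2])
    moreover have "inj (frechet_derivative f (at 0))"
      by (rule diffeo_rep_inj_derivative[OF f diffeo_repD(2)[OF f]])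
    moreover have "inj (frechet_derivative inc (at 0))"
      by (rule S.left_inverse_inj_derivative[OF smooth_germ_inc linear_pr3 pr3_inc])
    ultimately show ?thesis using \<psi>(3) unfolding inj_def by metis
  qed
  \<comment> \<open>For n = 2 a higher index would produce an isotropic 3-space in a symplectic
    space of dimension 4.\<close>
  have range: "i \<le> 2 \<or> n \<ge> 3"
  proof (rule ccontr)
    assume "\<not> (i \<le> 2 \<or> n \<ge> 3)"
    then have "n = 2" "i > 2" using n2 by auto
    have "c 7 = 0" "c 8 = 0" "c 9 = 0"
      using NF_leading[OF \<psi>(6,5)] \<open>i > 2\<close> by (auto split: if_splits)
    note iso = S.cls_isotropic[OF smg gz clsg this]
    have d: "(g has_derivative frechet_derivative g (at 0)) (at 0)" by (rule smooth_germ_has_derivative0[OF smg])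
    have "S.om (frechet_derivative g (at 0) v) (frechet_derivative g (at 0) w) = 0" for v w
      unfolding derivative_eq_sum_pd[OF d]
      by (simp add: bounded_bilinear.sum_left[OF S.bounded_bilinear_om]
          bounded_bilinear.sum_right[OF S.bounded_bilinear_om] S.om_simps iso)
    moreover have "CARD('m) = 4" using bij_betw_same_card[OF bij] \<open>n = 2\<close> by simp
    ultimately show False using S.not_isotropic[OF has_derivative_linear[OF d] inj] by simp
  qed
  obtain M where M: "M \<in> U7_family e n i" "S.realizes M c" using family_exists[OF \<psi>(6,5) range] .
  show ?thesis
    by (rule that[OF \<psi>(5) range M(1) \<psi>(6) M(2) S.realizes_equiv[OF smg gz inj pg clsg M(2)]])
qed

lemma smooth_curve_continuous: "smooth_on {0<..<1} \<gamma> \<Longrightarrow> continuous_on {0<..<1::real} \<gamma>"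
  by (rule smooth_on_derivative(3))

text \<open>The leading degree 7 is odd, so l^7 = 1 forces l = 1 and both parameters agree.\<close>

lemma moduli_nf0: "parameters_are_moduli e n (U7_nf0 e n)"
  unfolding parameters_are_moduli_def symp_equiv_iff constant_on_def
proof (intro allI impI)
  fix \<gamma> :: "real \<Rightarrow> real \<times> real"
  assume eq: "\<forall>t\<in>{0<..<1}. \<forall>u\<in>{0<..<1}. S.symp_eq (U7_nf0 e n (\<gamma> t)) (U7_nf0 e n (\<gamma> u))"
  have "\<gamma> t = \<gamma> u" if "t \<in> {0<..<1}" "u \<in> {0<..<1}" for t u
  proof -
    have "S.symp_eq (U7_nf0 e n (fst (\<gamma> t), snd (\<gamma> t))) (U7_nf0 e n (fst (\<gamma> u), snd (\<gamma> u)))"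
      using eq that by simp
    from S.realizes_rigid[OF realizes_nf0 realizes_nf0 this]
    obtain l where l: "l ^ 7 = 1" "fst (\<gamma> t) = l ^ 8 * fst (\<gamma> u)" "snd (\<gamma> t) = l ^ 9 * snd (\<gamma> u)"
      by (auto simp: coef_def)
    then show ?thesis using odd_power_eq_1[OF _ l(1)] by (simp add: prod_eq_iff)
  qed
  then show "\<exists>y. \<forall>x\<in>{0<..<1}. \<gamma> x = y" by blast
qed

text \<open>The leading degree 8 allows l = -1, which reverses the parameter of degree 9 and keeps
  that of degree 10; continuity of the path excludes the reversal.\<close>

lemma moduli_nf1: assumes s: "s \<in> {1, -1}" shows "parameters_are_moduli e n (U7_nf1 e n s)"
  unfolding parameters_are_moduli_def symp_equiv_iff constant_on_def
proof (intro allI impI)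
  fix \<gamma> :: "real \<Rightarrow> real \<times> real"
  assume sm: "smooth_on {0<..<1} \<gamma>"
    and eq: "\<forall>t\<in>{0<..<1}. \<forall>u\<in>{0<..<1}. S.symp_eq (U7_nf1 e n s (\<gamma> t)) (U7_nf1 e n s (\<gamma> u))"
  have abs: "\<bar>fst (\<gamma> t)\<bar> = \<bar>fst (\<gamma> u)\<bar> \<and> snd (\<gamma> t) = snd (\<gamma> u)" if "t \<in> {0<..<1}" "u \<in> {0<..<1}" for t u
  proof -
    have "S.symp_eq (U7_nf1 e n s (fst (\<gamma> t), snd (\<gamma> t))) (U7_nf1 e n s (fst (\<gamma> u), snd (\<gamma> u)))"
      using eq that by simp
    from S.realizes_rigid[OF realizes_nf1[OF s] realizes_nf1[OF s] this]
    obtain l where l: "s = l ^ 8 * s" "fst (\<gamma> t) = l ^ 9 * fst (\<gamma> u)" "snd (\<gamma> t) = l ^ 10 * snd (\<gamma> u)"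
      by (auto simp: coef_def)
    then have "\<bar>l\<bar> = 1" using even_power_eq_1[of 8 l] s by auto
    then have "l = 1 \<or> l = - 1" by linarith
    then show ?thesis using l by (auto simp: abs_mult)
  qed
  have "\<gamma> t = \<gamma> u" if "t \<in> {0<..<1}" "u \<in> {0<..<1}" for t u
  proof (rule prod_eqI)
    show "fst (\<gamma> t) = fst (\<gamma> u)"
      by (rule constant_if_abs_constant[OF continuous_on_fst[OF smooth_curve_continuous[OF sm]] _ that])
        (use abs in blast)
    show "snd (\<gamma> t) = snd (\<gamma> u)" using abs that by blast
  qed
  then show "\<exists>y. \<forall>x\<in>{0<..<1}. \<gamma> x = y" by blast
qed

lemma moduli_nf2: "parameters_are_moduli e n (U7_nf2 e n)"
  unfolding parameters_are_moduli_def symp_equiv_iff constant_on_def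
proof (intro allI impI)
  fix \<gamma> :: "real \<Rightarrow> real \<times> real"
  assume eq: "\<forall>t\<in>{0<..<1}. \<forall>u\<in>{0<..<1}. S.symp_eq (U7_nf2 e n (\<gamma> t)) (U7_nf2 e n (\<gamma> u))"
  have "\<gamma> t = \<gamma> u" if "t \<in> {0<..<1}" "u \<in> {0<..<1}" for t u
  proof -
    have "S.symp_eq (U7_nf2 e n (fst (\<gamma> t), snd (\<gamma> t))) (U7_nf2 e n (fst (\<gamma> u), snd (\<gamma> u)))"
      using eq that by simp
    from S.realizes_rigid[OF realizes_nf2 realizes_nf2 this]
    obtain l where l: "l ^ 9 = 1" "fst (\<gamma> t) = l ^ 10 * fst (\<gamma> u)" "snd (\<gamma> t) = l ^ 11 * snd (\<gamma> u)"
      by (auto simp: coef_def)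
    then show ?thesis using odd_power_eq_1[OF _ l(1)] by (simp add: prod_eq_iff)
  qed
  then show "\<exists>y. \<forall>x\<in>{0<..<1}. \<gamma> x = y" by blast
qed

text \<open>Here the leading degree 10 is even and the parameter has the odd degree 11, so again
  continuity decides the sign.\<close>

lemma moduli_nf3: assumes n: "n \<ge> 3" and s: "s \<in> {1, -1}" shows "parameters_are_moduli e n (U7_nf3 e n s)"
  unfolding parameters_are_moduli_def symp_equiv_iff constant_on_def
proof (intro allI impI)
  fix \<gamma> :: "real \<Rightarrow> real"
  assume sm: "smooth_on {0<..<1} \<gamma>"
    and eq: "\<forall>t\<in>{0<..<1}. \<forall>u\<in>{0<..<1}. S.symp_eq (U7_nf3 e n s (\<gamma> t)) (U7_nf3 e n s (\<gamma> u))"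
  have abs: "\<bar>\<gamma> t\<bar> = \<bar>\<gamma> u\<bar>" if "t \<in> {0<..<1}" "u \<in> {0<..<1}" for t u
  proof -
    have "S.symp_eq (U7_nf3 e n s (\<gamma> t)) (U7_nf3 e n s (\<gamma> u))" using eq that by simp
    from S.realizes_rigid[OF realizes_nf3[OF n] realizes_nf3[OF n] this]
    obtain l where l: "s = l ^ 10 * s" "\<gamma> t = l ^ 11 * \<gamma> u"
      by (auto simp: coef_def)
    then have "\<bar>l\<bar> = 1" using even_power_eq_1[of 10 l] s by auto
    then have "l = 1 \<or> l = - 1" by linarith
    then show ?thesis using l by auto
  qed
  have "\<gamma> t = \<gamma> u" if "t \<in> {0<..<1}" "u \<in> {0<..<1}" for t u
    using constant_if_abs_constant[OF smooth_curve_continuous[OF sm] abs that] .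
  then show "\<exists>y. \<forall>x\<in>{0<..<1}. \<gamma> x = y" by blast
qed

lemma moduli_nf4: assumes n: "n \<ge> 3" shows "parameters_are_moduli e n (U7_nf4 e n)"
  unfolding parameters_are_moduli_def symp_equiv_iff constant_on_def
proof (intro allI impI)
  fix \<gamma> :: "real \<Rightarrow> real"
  assume eq: "\<forall>t\<in>{0<..<1}. \<forall>u\<in>{0<..<1}. S.symp_eq (U7_nf4 e n (\<gamma> t)) (U7_nf4 e n (\<gamma> u))"
  have "\<gamma> t = \<gamma> u" if "t \<in> {0<..<1}" "u \<in> {0<..<1}" for t u
  proof -
    have "S.symp_eq (U7_nf4 e n (\<gamma> t)) (U7_nf4 e n (\<gamma> u))" using eq that by simp
    from S.realizes_rigid[OF realizes_nf4[OF n] realizes_nf4[OF n] this]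
    obtain l where l: "l ^ 11 = 1" "\<gamma> t = l ^ 13 * \<gamma> u" by (auto simp: coef_def)
    then show ?thesis using odd_power_eq_1[OF _ l(1)] by simp
  qed
  then show "\<exists>y. \<forall>x\<in>{0<..<1}. \<gamma> x = y" by blast
qed

lemma moduli_nf5: assumes n: "n \<ge> 3" shows "parameters_are_moduli e n (U7_nf5 e n)"
  unfolding parameters_are_moduli_def symp_equiv_iff constant_on_def
proof (intro allI impI)
  fix \<gamma> :: "real \<Rightarrow> real"
  assume eq: "\<forall>t\<in>{0<..<1}. \<forall>u\<in>{0<..<1}. S.symp_eq (U7_nf5 e n (\<gamma> t)) (U7_nf5 e n (\<gamma> u))"
  have "\<gamma> t = \<gamma> u" if "t \<in> {0<..<1}" "u \<in> {0<..<1}" for t u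
  proof -
    have "S.symp_eq (U7_nf5 e n (\<gamma> t)) (U7_nf5 e n (\<gamma> u))" using eq that by simp
    from S.realizes_rigid[OF realizes_nf5[OF n] realizes_nf5[OF n] this]
    obtain l where l: "l ^ 13 = 1" "\<gamma> t = l ^ 14 * \<gamma> u" by (auto simp: coef_def)
    then show ?thesis using odd_power_eq_1[OF _ l(1)] by simp
  qed
  then show "\<exists>y. \<forall>x\<in>{0<..<1}. \<gamma> x = y" by blast
qed

end

theorem theorem3p1:
  fixes n :: nat and e :: "nat \<Rightarrow> 'm::finite"
  assumes "n \<ge> 2"
    and "bij_betw e {1..2 * n} UNIV"
  shows "(\<forall>N :: (real^'m) set. diffeomorphic_germs (U7 e n) N \<longrightarrow>
            (\<exists>!i. i \<in> (if n \<ge> 3 then {0..7} else {0..2}) \<and>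
                  (\<exists>M\<in>U7_family e n i. symp_equiv e n N M))) \<and>
         parameters_are_moduli e n (U7_nf0 e n) \<and>
         (\<forall>s\<in>{1, -1}. parameters_are_moduli e n (U7_nf1 e n s)) \<and>
         parameters_are_moduli e n (U7_nf2 e n) \<and>
         (n \<ge> 3 \<longrightarrow>
            (\<forall>s\<in>{1, -1}. parameters_are_moduli e n (U7_nf3 e n s)) \<and>
            parameters_are_moduli e n (U7_nf4 e n) \<and>
            parameters_are_moduli e n (U7_nf5 e n))"
proof -
  interpret coords n e by (rule coords.intro) (fact assms)+
  have "\<exists>!i. i \<in> (if n \<ge> 3 then {0..7} else {0..2}) \<and> (\<exists>M\<in>U7_family e n i. S.symp_eq N M)"
    if N: "diffeomorphic_germs (U7 e n) N" for N :: "(real^'m) set"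
  proof -
    obtain i c M where i: "i \<le> 7" "i \<le> 2 \<or> n \<ge> 3" "M \<in> U7_family e n i" "NF i c" "S.realizes M c" "S.symp_eq N M"
      using classification[OF N] .
    show ?thesis
    proof (rule ex1I[of _ i])
      show "i \<in> (if n \<ge> 3 then {0..7} else {0..2}) \<and> (\<exists>M\<in>U7_family e n i. S.symp_eq N M)"
        using i by auto
      fix j assume j: "j \<in> (if n \<ge> 3 then {0..7} else {0..2}) \<and> (\<exists>M\<in>U7_family e n j. S.symp_eq N M)"
      then obtain M' where M': "M' \<in> U7_family e n j" "S.symp_eq N M'" by blast
      have r: "j \<le> 7" "j \<le> 2 \<or> n \<ge> 3" using j by (auto split: if_splits)
      obtain c' where c': "NF j c'" "S.realizes M' c'" using family_realizes[OF M'(1) r] .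
      \<comment> \<open>The two normal forms are equivalent to each other through N, so uniqueness
        of the index applies.\<close>
      show "j = i"
        by (rule index_unique[OF i(4,1,5) c'(1) r(1) c'(2), symmetric])
          (rule S.symp_eq_trans[OF S.symp_eq_sym[OF i(6)] M'(2)])
    qed
  qed
  then show ?thesis
    unfolding symp_equiv_iff
    using moduli_nf0 moduli_nf1 moduli_nf2 moduli_nf3 moduli_nf4 moduli_nf5 by blast
qed

end
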